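(* Let $\mathfrak g$ be a Lie algebra over a field $k$ and let $f:\mathfrak g\otimes\mathfrak g\to k$ be a $2$-cocycle. Then $U_f(\mathfrak g)$ is a $U(\mathfrak g)$-Galois extension of $k$, and $$\mathrm{HC}_*(U_f(\mathfrak g))\simeq\mathrm{HC}_*(U(\mathfrak g),U_f(\mathfrak g)),$$ where on the right $U_f(\mathfrak g)$ is the modular crossed module over $U(\mathfrak g)$ with action determined by $x\cdot a=\overline xa-a\overline x$ for $x\in\mathfrak g$, $a\in U_f(\mathfrak g)$, and with coaction the algebra map $\rho:U_f(\mathfrak g)\to U_f(\mathfrak g)\otimes U(\mathfrak g)$ determined by $\rho(\overline x)=\overline x\otimes1+1\otimes x$ for $x\in\mathfrak g$.
   Context: $\otimes=\otimes_k$. $f$ is a Lie algebra $2$-cocycle of $\mathfrak g$ with values in the trivial module $k$. $U_f(\mathfrak g)=T(\mathfrak g)/I_f(\mathfrak g)$, where $I_f(\mathfrak g)$ is the two-sided ideal of the tensor algebra $T(\mathfrak g)$ generated by the elements $x\otimes y-y\otimes x-[x,y]-f(x\otimes y)$, $x,y\in\mathfrak g$; $\overline x$ is the image of $x\in\mathfrak g$ in $U_f(\mathfrak g)$. $U(\mathfrak g)$ is the enveloping algebra, a Hopf algebra with the elements of $\mathfrak g$ primitive. $\mathrm{HC}_*(U_f(\mathfrak g))$ is the usual cyclic homology of the $k$-algebra $U_f(\mathfrak g)$. For a Hopf algebra $H$, an extension of algebras $A/B$ is $H$-Galois if $A$ is a right $H$-comodule via an algebra map $\rho:A\to A\otimes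 H$, $\rho(a)=\sum a_{\langle0\rangle}\otimes a_{\langle1\rangle}$, with $B=\{a\in A\mid\rho(a)=a\otimes1\}$ and $A\otimes_BA\to A\otimes H$, $x\otimes_By\mapsto\sum xy_{\langle0\rangle}\otimes y_{\langle1\rangle}$, bijective. A crossed module over $H$ is a left $H$-module $M$ which is also a right $H$-comodule via $\rho(m)=\sum m_{\langle0\rangle}\otimes m_{\langle1\rangle}\in M\otimes H$ such that $\rho(hm)=\sum h_{(2)}m_{\langle0\rangle}\otimes h_{(3)}m_{\langle1\rangle}S(h_{(1)})$; it is modular if $\sum m_{\langle1\rangle}m_{\langle0\rangle}=m$ for all $m$. For such $M$, $Z_*(H,M)$ is the cyclic object with $Z_n(H,M)=H^{\otimes(n+1)}\otimes_HM$, where $H^{\otimes(n+1)}$ is a right $H$-module by the diagonal action, faces $\delta_i((h^0,\ldots,h^n)\otimes_Hm)=\varepsilon(h^i)(h^0,\ldots,\widehat{h^i},\ldots,h^n)\otimes_Hm$, degeneracies $\sigma_i((h^0,\ldots,h^n)\otimes_Hm)=(h^0,\ldots,\Delta(h^i),\ldots,h^n)\otimes_Hm$, and cyclic operator $\tau_n((h^0,\ldots,h^n)\otimes_Hm)=\sum(h^nm_{\langle1\rangle},h^0,\ldots,h^{n-1})\otimes_Hm_{\langle0\rangle}$. $\mathrm{HC}_*(H,M)$ is its cyclic homology (homology of the total complex of the Tsygan double complex). *)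

theory Defs
  imports "HOL-Algebra.Algebraic_Closure_Type" "HOL-Library.Poly_Mapping"
begin

section \<open>Vector spaces and algebras over a type of class field\<close>

text \<open>
  The ground field is a type \<open>'k::field\<close>; vector spaces over it are modules in the sense of
  HOL-Algebra over the ring \<^const>\<open>ring_of_type_algebra\<close>. For records that are used only as
  vector spaces the multiplicative fields of the module record carry no meaning.
\<close>

abbreviation ground :: "'k::field ring" where
  "ground \<equiv> ring_of_type_algebra"

definition ground_algebra :: "('k::field, 'k) module" where
  "ground_algebra = ring.extend ground (module.fields (*))"

definition type_space :: "('k::field \<Rightarrow> 'v \<Rightarrow> 'v::ab_group_add) \<Rightarrow> ('k, 'v) module" where
  "type_space scale =
    \<lparr>carrier = UNIV, monoid.mult = undefined, one = undefined, zero = 0, add = (+), module.smult = scale\<rparr>"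

text \<open>Unlike the locale \<^locale>\<open>algebra\<close> of HOL-Algebra, this one does not require commutativity.\<close>

locale assoc_algebra = module ground A + ring A
  for A :: "('k::field, 'a, 'm) module_scheme" (structure) +
  assumes smult_mult_left:
      "\<lbrakk>x \<in> carrier A; y \<in> carrier A\<rbrakk> \<Longrightarrow> (c \<odot> x) \<otimes> y = c \<odot> (x \<otimes> y)"
    and smult_mult_right:
      "\<lbrakk>x \<in> carrier A; y \<in> carrier A\<rbrakk> \<Longrightarrow> x \<otimes> (c \<odot> y) = c \<odot> (x \<otimes> y)"

definition linear_maps ::
    "('k, 'a, 'm) module_scheme \<Rightarrow> ('k, 'b, 'n) module_scheme \<Rightarrow> ('a \<Rightarrow> 'b) set" where
  "linear_maps M N = {h \<in> carrier M \<rightarrow> carrier N.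
     (\<forall>x\<in>carrier M. \<forall>y\<in>carrier M. h (x \<oplus>\<^bsub>M\<^esub> y) = h x \<oplus>\<^bsub>N\<^esub> h y) \<and>
     (\<forall>c. \<forall>x\<in>carrier M. h (c \<odot>\<^bsub>M\<^esub> x) = c \<odot>\<^bsub>N\<^esub> h x)}"

definition linear_iso ::
    "('k, 'a, 'm) module_scheme \<Rightarrow> ('k, 'b, 'n) module_scheme \<Rightarrow> bool" where
  "linear_iso M N \<longleftrightarrow> (\<exists>h \<in> linear_maps M N. bij_betw h (carrier M) (carrier N))"

definition algebra_homs ::
    "('k, 'a, 'm) module_scheme \<Rightarrow> ('k, 'b, 'n) module_scheme \<Rightarrow> ('a \<Rightarrow> 'b) set" where
  "algebra_homs A B = ring_hom A B \<inter> linear_maps A B"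

text \<open>
  Quotient by a subspace, or of an algebra by a two-sided ideal. Adding \<open>W\<close> in the scalar
  multiplication makes \<open>0\<close> times a coset the coset \<open>W\<close>.
\<close>

definition quot :: "('k, 'a, 'm) module_scheme \<Rightarrow> 'a set \<Rightarrow> ('k, 'a set) module" where
  "quot M W = ring.extend (M Quot W)
     (module.fields (\<lambda>c C. W <+>\<^bsub>M\<^esub> ((\<lambda>x. c \<odot>\<^bsub>M\<^esub> x) ` C)))"

section \<open>Presented vector spaces\<close>

definition fscale :: "'k::field \<Rightarrow> ('x \<Rightarrow>\<^sub>0 'k) \<Rightarrow> ('x \<Rightarrow>\<^sub>0 'k)" where
  "fscale c = Poly_Mapping.map ((*) c)"

definition fspan :: "('x \<Rightarrow>\<^sub>0 'k::field) set \<Rightarrow> ('x \<Rightarrow>\<^sub>0 'k) set" where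
  "fspan = Modules.module.span fscale"

abbreviation fgen :: "'x \<Rightarrow> 'x \<Rightarrow>\<^sub>0 'k::field" where
  "fgen x \<equiv> Poly_Mapping.single x 1"

definition monoid_algebra :: "('x, 'm) monoid_scheme \<Rightarrow> ('k::field, 'x \<Rightarrow>\<^sub>0 'k) module" where
  "monoid_algebra G =
    \<lparr>carrier = {p. Poly_Mapping.keys p \<subseteq> carrier G},
     monoid.mult = (\<lambda>p q. \<Sum>x\<in>Poly_Mapping.keys p. \<Sum>y\<in>Poly_Mapping.keys q.
        Poly_Mapping.single (x \<otimes>\<^bsub>G\<^esub> y) (Poly_Mapping.lookup p x * Poly_Mapping.lookup q y)),
     one = fgen \<one>\<^bsub>G\<^esub>, zero = 0, add = (+), module.smult = fscale\<rparr>"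

text \<open>
  In the following two definitions \<open>Q\<close> is a quotient of a monoid algebra: \<open>cls Q x\<close> is the class
  of the basis element \<open>x\<close>, and \<open>lin_ext N F\<close> is the linear map on \<open>Q\<close> sending each \<open>cls Q x\<close> to
  \<open>F x\<close>. The latter is evaluated on an arbitrary representative, so it has this meaning whenever
  \<open>F\<close> respects the relations of \<open>Q\<close>. For \<open>t\<close> in a tensor product of two spaces,
  \<open>lin_ext N (\<lambda>(a, b). F a b) t\<close> is the sum written \<open>\<Sum> F t\<^sub>1 t\<^sub>2\<close> in Sweedler notation.
\<close>

definition cls :: "('k::field, ('x \<Rightarrow>\<^sub>0 'k) set, 'm) module_scheme \<Rightarrow> 'x \<Rightarrow> ('x \<Rightarrow>\<^sub>0 'k) set" where
  "cls Q x = (THE C. C \<in> carrier Q \<and> fgen x \<in> C)"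

definition lin_ext ::
    "('k::field, 'b, 'n) module_scheme \<Rightarrow> ('x \<Rightarrow> 'b) \<Rightarrow> ('x \<Rightarrow>\<^sub>0 'k) set \<Rightarrow> 'b" where
  "lin_ext N F C = (let p = (SOME p. p \<in> C) in
     finsum N (\<lambda>x. Poly_Mapping.lookup p x \<odot>\<^bsub>N\<^esub> F x) (Poly_Mapping.keys p))"

section \<open>Tensor products\<close>

definition bilinear_rels ::
    "('k::field, 'a, 'm) module_scheme \<Rightarrow> ('k, 'b, 'n) module_scheme \<Rightarrow> ('a \<times> 'b \<Rightarrow>\<^sub>0 'k) set" where
  "bilinear_rels M N =
     {fgen (x \<oplus>\<^bsub>M\<^esub> x', y) - fgen (x, y) - fgen (x', y) | x x' y.
        x \<in> carrier M \<and> x' \<in> carrier M \<and> y \<in> carrier N} \<union>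
     {fgen (x, y \<oplus>\<^bsub>N\<^esub> y') - fgen (x, y) - fgen (x, y') | x y y'.
        x \<in> carrier M \<and> y \<in> carrier N \<and> y' \<in> carrier N} \<union>
     {fgen (c \<odot>\<^bsub>M\<^esub> x, y) - Poly_Mapping.single (x, y) c | c x y. x \<in> carrier M \<and> y \<in> carrier N} \<union>
     {fgen (x, c \<odot>\<^bsub>N\<^esub> y) - Poly_Mapping.single (x, y) c | c x y. x \<in> carrier M \<and> y \<in> carrier N}"

text \<open>The tensor product over the ground field; for algebras \<open>M\<close> and \<open>N\<close> it is the tensor product
  algebra.\<close>

definition tensor :: "('k::field, 'a, 'm) module_scheme \<Rightarrow> ('k, 'b, 'n) module_scheme \<Rightarrow>
    ('k, ('a \<times> 'b \<Rightarrow>\<^sub>0 'k) set) module" where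
  "tensor M N = quot (monoid_algebra (M \<times>\<times> N)) (fspan (bilinear_rels M N))"

text \<open>
  The tensor product of a right module \<open>P\<close> and a left module \<open>M\<close> over a ground-field algebra with
  carrier \<open>S\<close>, as a vector space (the product of this record is not meaningful).
\<close>

definition tensor_over :: "'s set \<Rightarrow> ('p \<Rightarrow> 's \<Rightarrow> 'p) \<Rightarrow> ('s \<Rightarrow> 'a \<Rightarrow> 'a) \<Rightarrow>
    ('k::field, 'p, 'm) module_scheme \<Rightarrow> ('k, 'a, 'n) module_scheme \<Rightarrow>
    ('k, ('p \<times> 'a \<Rightarrow>\<^sub>0 'k) set) module" where
  "tensor_over S ract lact P M = quot (monoid_algebra (P \<times>\<times> M))
     (fspan (bilinear_rels P M \<union>
        {fgen (ract p s, m) - fgen (p, lact s m) | p s m.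
           p \<in> carrier P \<and> s \<in> S \<and> m \<in> carrier M}))"

definition multilinear_rels ::
    "('k::field, 'v, 'm) module_scheme \<Rightarrow> nat \<Rightarrow> ('v list \<Rightarrow>\<^sub>0 'k) set" where
  "multilinear_rels V n =
     {fgen (us @ [x \<oplus>\<^bsub>V\<^esub> y] @ vs) - fgen (us @ [x] @ vs) - fgen (us @ [y] @ vs) | us x y vs.
        us \<in> lists (carrier V) \<and> vs \<in> lists (carrier V) \<and> x \<in> carrier V \<and> y \<in> carrier V \<and>
        length us + 1 + length vs = n} \<union>
     {fgen (us @ [c \<odot>\<^bsub>V\<^esub> x] @ vs) - Poly_Mapping.single (us @ [x] @ vs) c | us c x vs.
        us \<in> lists (carrier V) \<and> vs \<in> lists (carrier V) \<and> x \<in> carrier V \<and>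
        length us + 1 + length vs = n}"

text \<open>The \<open>n\<close>-fold tensor power; its product is the componentwise one if \<open>V\<close> is an algebra.\<close>

definition tensor_power ::
    "('k::field, 'v, 'm) module_scheme \<Rightarrow> nat \<Rightarrow> ('k, ('v list \<Rightarrow>\<^sub>0 'k) set) module" where
  "tensor_power V n =
     quot (monoid_algebra \<lparr>carrier = {xs \<in> lists (carrier V). length xs = n},
             monoid.mult = map2 (monoid.mult V), one = replicate n (one V)\<rparr>)
       (fspan (multilinear_rels V n))"

text \<open>The tensor algebra: words of all lengths, multiplied by concatenation.\<close>

definition tensor_algebra ::
    "('k::field, 'v, 'm) module_scheme \<Rightarrow> ('k, ('v list \<Rightarrow>\<^sub>0 'k) set) module" where
  "tensor_algebra V =
     quot (monoid_algebra \<lparr>carrier = lists (carrier V), monoid.mult = (@), one = []\<rparr>)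
       (fspan (\<Union>n. multilinear_rels V n))"

section \<open>Hopf algebras, Galois extensions, crossed modules\<close>

record (overloaded) ('k::zero, 'h) hopf = "('k, 'h) module" +
  comult :: "'h \<Rightarrow> ('h \<times> 'h \<Rightarrow>\<^sub>0 'k) set"
  counit :: "'h \<Rightarrow> 'k"
  antipode :: "'h \<Rightarrow> 'h"

locale hopf_algebra = assoc_algebra H for H :: "('k::field, 'h, 'm) hopf_scheme" (structure) +
  assumes comult_hom: "comult H \<in> algebra_homs H (tensor H H)"
    and counit_hom: "counit H \<in> algebra_homs H ground_algebra"
    and coassoc: "h \<in> carrier H \<Longrightarrow>
      lin_ext (tensor H (tensor H H)) (\<lambda>(a, b).
        lin_ext (tensor H (tensor H H)) (\<lambda>(a1, a2).
          cls (tensor H (tensor H H)) (a1, cls (tensor H H) (a2, b))) (comult H a)) (comult H h)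
      = lin_ext (tensor H (tensor H H)) (\<lambda>(a, b).
          cls (tensor H (tensor H H)) (a, comult H b)) (comult H h)"
    and counit_left: "h \<in> carrier H \<Longrightarrow> lin_ext H (\<lambda>(a, b). counit H a \<odot> b) (comult H h) = h"
    and counit_right: "h \<in> carrier H \<Longrightarrow> lin_ext H (\<lambda>(a, b). counit H b \<odot> a) (comult H h) = h"
    and antipode_linear: "antipode H \<in> linear_maps H H"
    and antipode_left: "h \<in> carrier H \<Longrightarrow>
      lin_ext H (\<lambda>(a, b). antipode H a \<otimes> b) (comult H h) = counit H h \<odot> \<one>"
    and antipode_right: "h \<in> carrier H \<Longrightarrow>
      lin_ext H (\<lambda>(a, b). a \<otimes> antipode H b) (comult H h) = counit H h \<odot> \<one>"

locale right_comodule = hopf_algebra H + M?: module ground M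
  for H :: "('k::field, 'h, 'm) hopf_scheme" (structure)
    and M :: "('k, 'a, 'n) module_scheme" (structure)
    and \<rho> :: "'a \<Rightarrow> ('a \<times> 'h \<Rightarrow>\<^sub>0 'k) set" +
  assumes coaction_linear: "\<rho> \<in> linear_maps M (tensor M H)"
    and coaction_coassoc: "m \<in> carrier M \<Longrightarrow>
      lin_ext (tensor M (tensor H H)) (\<lambda>(a, h).
        lin_ext (tensor M (tensor H H)) (\<lambda>(a0, a1).
          cls (tensor M (tensor H H)) (a0, cls (tensor H H) (a1, h))) (\<rho> a)) (\<rho> m)
      = lin_ext (tensor M (tensor H H)) (\<lambda>(a, h).
          cls (tensor M (tensor H H)) (a, comult H h)) (\<rho> m)"
    and coaction_counit: "m \<in> carrier M \<Longrightarrow>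
      lin_ext M (\<lambda>(a, h). counit H h \<odot>\<^bsub>M\<^esub> a) (\<rho> m) = m"

locale galois_extension = right_comodule H A \<rho> + A?: assoc_algebra A
  for H :: "('k::field, 'h, 'm) hopf_scheme" (structure)
    and A :: "('k, 'a, 'n) module_scheme" (structure)
    and B :: "'a set"
    and \<rho> :: "'a \<Rightarrow> ('a \<times> 'h \<Rightarrow>\<^sub>0 'k) set" +
  assumes coaction_hom: "\<rho> \<in> algebra_homs A (tensor A H)"
    and coinvariants: "B = {a \<in> carrier A. \<rho> a = cls (tensor A H) (a, \<one>\<^bsub>H\<^esub>)}"
    and canonical_map_bij:
      "bij_betw
         (lin_ext (tensor A H) (\<lambda>(x, y).
            lin_ext (tensor A H) (\<lambda>(y0, y1). cls (tensor A H) (x \<otimes>\<^bsub>A\<^esub> y0, y1)) (\<rho> y)))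
         (carrier (tensor_over B (monoid.mult A) (monoid.mult A) A A)) (carrier (tensor A H))"

locale left_module = hopf_algebra H + M?: module ground M
  for H :: "('k::field, 'h, 'm) hopf_scheme" (structure)
    and M :: "('k, 'a, 'n) module_scheme" (structure)
    and act :: "'h \<Rightarrow> 'a \<Rightarrow> 'a" +
  assumes act_linear: "h \<in> carrier H \<Longrightarrow> act h \<in> linear_maps M M"
    and act_linear_left: "m \<in> carrier M \<Longrightarrow> (\<lambda>h. act h m) \<in> linear_maps H M"
    and act_one: "m \<in> carrier M \<Longrightarrow> act \<one>\<^bsub>H\<^esub> m = m"
    and act_mult: "\<lbrakk>h \<in> carrier H; h' \<in> carrier H; m \<in> carrier M\<rbrakk> \<Longrightarrow>
      act (h \<otimes>\<^bsub>H\<^esub> h') m = act h (act h' m)"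

locale crossed_module = left_module H M act + right_comodule H M \<rho>
  for H :: "('k::field, 'h, 'm) hopf_scheme" (structure)
    and M :: "('k, 'a, 'n) module_scheme" (structure)
    and act :: "'h \<Rightarrow> 'a \<Rightarrow> 'a"
    and \<rho> :: "'a \<Rightarrow> ('a \<times> 'h \<Rightarrow>\<^sub>0 'k) set" +
  assumes coaction_act: "\<lbrakk>h \<in> carrier H; m \<in> carrier M\<rbrakk> \<Longrightarrow>
      \<rho> (act h m) =
        lin_ext (tensor M H) (\<lambda>(h1, k).
          lin_ext (tensor M H) (\<lambda>(h2, h3).
            lin_ext (tensor M H) (\<lambda>(m0, m1).
              cls (tensor M H) (act h2 m0, h3 \<otimes>\<^bsub>H\<^esub> m1 \<otimes>\<^bsub>H\<^esub> antipode H h1)) (\<rho> m))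
            (comult H k)) (comult H h)"

locale modular_crossed_module = crossed_module +
  assumes modular: "m \<in> carrier M \<Longrightarrow> lin_ext M (\<lambda>(m0, m1). act m1 m0) (\<rho> m) = m"

section \<open>Cyclic objects and cyclic homology\<close>

text \<open>\<open>face Z n i\<close>, \<open>degen Z n i\<close> and \<open>cyc Z n\<close> are the structure maps with source \<open>obj Z n\<close>.\<close>

record ('k, 'z) cyclic_object =
  obj :: "nat \<Rightarrow> ('k, 'z) module"
  face :: "nat \<Rightarrow> nat \<Rightarrow> 'z \<Rightarrow> 'z"
  degen :: "nat \<Rightarrow> nat \<Rightarrow> 'z \<Rightarrow> 'z"
  cyc :: "nat \<Rightarrow> 'z \<Rightarrow> 'z"

definition hoch_b :: "('k::field, 'z, 'm) cyclic_object_scheme \<Rightarrow> nat \<Rightarrow> 'z \<Rightarrow> 'z" where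
  "hoch_b Z n z =
     finsum (obj Z (n - 1)) (\<lambda>i. (-1) ^ i \<odot>\<^bsub>obj Z (n - 1)\<^esub> face Z n i z) {..n}"

definition hoch_b' :: "('k::field, 'z, 'm) cyclic_object_scheme \<Rightarrow> nat \<Rightarrow> 'z \<Rightarrow> 'z" where
  "hoch_b' Z n z =
     finsum (obj Z (n - 1)) (\<lambda>i. (-1) ^ i \<odot>\<^bsub>obj Z (n - 1)\<^esub> face Z n i z) {..<n}"

definition signed_cyc :: "('k::field, 'z, 'm) cyclic_object_scheme \<Rightarrow> nat \<Rightarrow> 'z \<Rightarrow> 'z" where
  "signed_cyc Z n z = (-1) ^ n \<odot>\<^bsub>obj Z n\<^esub> cyc Z n z"

definition cyc_norm :: "('k::field, 'z, 'm) cyclic_object_scheme \<Rightarrow> nat \<Rightarrow> 'z \<Rightarrow> 'z" where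
  "cyc_norm Z n z = finsum (obj Z n) (\<lambda>i. (signed_cyc Z n ^^ i) z) {..n}"

text \<open>
  The Tsygan double complex has \<open>obj Z q\<close> in column \<open>p \<ge> 0\<close> and row \<open>q \<ge> 0\<close>, vertical
  differential \<open>b\<close> in even columns and \<open>- b'\<close> in odd ones, and horizontal differential
  \<open>1 - signed_cyc\<close> out of odd columns and \<open>cyc_norm\<close> out of positive even ones. An element of
  degree \<open>n\<close> of the total complex is a family \<open>x\<close> whose entry \<open>x q\<close> lies in column \<open>n - q\<close>.
\<close>

definition tot :: "('k::field, 'z, 'm) cyclic_object_scheme \<Rightarrow> nat \<Rightarrow> ('k, nat \<Rightarrow> 'z) module" where
  "tot Z n =
    \<lparr>carrier = (\<Pi>\<^sub>E q\<in>{..n}. carrier (obj Z q)), monoid.mult = undefined, one = undefined,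
     zero = (\<lambda>q\<in>{..n}. \<zero>\<^bsub>obj Z q\<^esub>),
     add = (\<lambda>x y. \<lambda>q\<in>{..n}. x q \<oplus>\<^bsub>obj Z q\<^esub> y q),
     module.smult = (\<lambda>c x. \<lambda>q\<in>{..n}. c \<odot>\<^bsub>obj Z q\<^esub> x q)\<rparr>"

definition tot_d :: "('k::field, 'z, 'm) cyclic_object_scheme \<Rightarrow> nat \<Rightarrow> (nat \<Rightarrow> 'z) \<Rightarrow> nat \<Rightarrow> 'z" where
  "tot_d Z n x = (\<lambda>q\<in>{..<n}.
     (if even (n - 1 - q) then hoch_b Z (q + 1) (x (q + 1))
      else \<ominus>\<^bsub>obj Z q\<^esub> hoch_b' Z (q + 1) (x (q + 1)))
     \<oplus>\<^bsub>obj Z q\<^esub>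
     (if odd (n - q) then x q \<ominus>\<^bsub>obj Z q\<^esub> signed_cyc Z q (x q) else cyc_norm Z q (x q)))"

definition cycles :: "('k::field, 'z, 'm) cyclic_object_scheme \<Rightarrow> nat \<Rightarrow> (nat \<Rightarrow> 'z) set" where
  "cycles Z n = {x \<in> carrier (tot Z n). n = 0 \<or> tot_d Z n x = \<zero>\<^bsub>tot Z (n - 1)\<^esub>}"

definition boundaries :: "('k::field, 'z, 'm) cyclic_object_scheme \<Rightarrow> nat \<Rightarrow> (nat \<Rightarrow> 'z) set" where
  "boundaries Z n = tot_d Z (n + 1) ` carrier (tot Z (n + 1))"

definition cyclic_homology ::
    "('k::field, 'z, 'm) cyclic_object_scheme \<Rightarrow> nat \<Rightarrow> ('k, (nat \<Rightarrow> 'z) set) module" where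
  "cyclic_homology Z n = quot (tot Z n\<lparr>carrier := cycles Z n\<rparr>) (boundaries Z n)"

definition algebra_cyclic_object ::
    "('k::field, 'a, 'm) module_scheme \<Rightarrow> ('k, ('a list \<Rightarrow>\<^sub>0 'k) set) cyclic_object" where
  "algebra_cyclic_object A =
    \<lparr>obj = (\<lambda>n. tensor_power A (n + 1)),
     face = (\<lambda>n i. lin_ext (tensor_power A n) (\<lambda>as. cls (tensor_power A n)
        (if i < n then take i as @ [as ! i \<otimes>\<^bsub>A\<^esub> as ! (i + 1)] @ drop (i + 2) as
         else (last as \<otimes>\<^bsub>A\<^esub> hd as) # tl (butlast as)))),
     degen = (\<lambda>n i. lin_ext (tensor_power A (n + 2)) (\<lambda>as. cls (tensor_power A (n + 2))
        (take (i + 1) as @ [\<one>\<^bsub>A\<^esub>] @ drop (i + 1) as))),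
     cyc = (\<lambda>n. lin_ext (tensor_power A (n + 1)) (\<lambda>as. cls (tensor_power A (n + 1))
        (last as # butlast as)))\<rparr>"

text \<open>The iterated comultiplication from \<open>H\<close> to its tensor power with \<open>n + 1\<close> factors.\<close>

primrec iter_comult ::
    "('k::field, 'h, 'm) hopf_scheme \<Rightarrow> nat \<Rightarrow> 'h \<Rightarrow> ('h list \<Rightarrow>\<^sub>0 'k) set" where
  "iter_comult H 0 h = cls (tensor_power H 1) [h]"
| "iter_comult H (Suc n) h =
     lin_ext (tensor_power H (n + 2)) (\<lambda>(a, b).
       lin_ext (tensor_power H (n + 2)) (\<lambda>bs. cls (tensor_power H (n + 2)) (a # bs))
         (iter_comult H n b)) (comult H h)"

definition crossed_obj :: "('k::field, 'h, 'm) hopf_scheme \<Rightarrow> ('k, 'a, 'n) module_scheme \<Rightarrow>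
    ('h \<Rightarrow> 'a \<Rightarrow> 'a) \<Rightarrow> nat \<Rightarrow> ('k, (('h list \<Rightarrow>\<^sub>0 'k) set \<times> 'a \<Rightarrow>\<^sub>0 'k) set) module" where
  "crossed_obj H M act n =
     tensor_over (carrier H) (\<lambda>u h. u \<otimes>\<^bsub>tensor_power H (n + 1)\<^esub> iter_comult H n h) act
       (tensor_power H (n + 1)) M"

text \<open>The element \<open>(h\<^sup>0, \<dots>, h\<^sup>n) \<otimes>\<^sub>H m\<close> for a list \<open>hs\<close> of length \<open>n + 1\<close>, and the extension of a map
  given on such elements.\<close>

definition crossed_gen :: "('k::field, 'h, 'm) hopf_scheme \<Rightarrow> ('k, 'a, 'n) module_scheme \<Rightarrow>
    ('h \<Rightarrow> 'a \<Rightarrow> 'a) \<Rightarrow> nat \<Rightarrow> 'h list \<Rightarrow> 'a \<Rightarrow> (('h list \<Rightarrow>\<^sub>0 'k) set \<times> 'a \<Rightarrow>\<^sub>0 'k) set" where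
  "crossed_gen H M act n hs m =
     cls (crossed_obj H M act n) (cls (tensor_power H (n + 1)) hs, m)"

definition crossed_ext :: "('k::field, 'b, 'n) module_scheme \<Rightarrow> ('h list \<Rightarrow> 'a \<Rightarrow> 'b) \<Rightarrow>
    (('h list \<Rightarrow>\<^sub>0 'k) set \<times> 'a \<Rightarrow>\<^sub>0 'k) set \<Rightarrow> 'b" where
  "crossed_ext N F = lin_ext N (\<lambda>(u, m). lin_ext N (\<lambda>hs. F hs m) u)"

definition crossed_cyclic_object :: "('k::field, 'h, 'm) hopf_scheme \<Rightarrow>
    ('k, 'a, 'n) module_scheme \<Rightarrow> ('h \<Rightarrow> 'a \<Rightarrow> 'a) \<Rightarrow> ('a \<Rightarrow> ('a \<times> 'h \<Rightarrow>\<^sub>0 'k) set) \<Rightarrow>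
    ('k, (('h list \<Rightarrow>\<^sub>0 'k) set \<times> 'a \<Rightarrow>\<^sub>0 'k) set) cyclic_object" where
  "crossed_cyclic_object H M act \<rho> =
    \<lparr>obj = crossed_obj H M act,
     face = (\<lambda>n i. crossed_ext (crossed_obj H M act (n - 1)) (\<lambda>hs m.
        counit H (hs ! i) \<odot>\<^bsub>crossed_obj H M act (n - 1)\<^esub>
          crossed_gen H M act (n - 1) (take i hs @ drop (i + 1) hs) m)),
     degen = (\<lambda>n i. crossed_ext (crossed_obj H M act (n + 1)) (\<lambda>hs m.
        lin_ext (crossed_obj H M act (n + 1)) (\<lambda>(a, b).
          crossed_gen H M act (n + 1) (take i hs @ [a, b] @ drop (i + 1) hs) m)
          (comult H (hs ! i)))),
     cyc = (\<lambda>n. crossed_ext (crossed_obj H M act n) (\<lambda>hs m.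
        lin_ext (crossed_obj H M act n) (\<lambda>(m0, m1).
          crossed_gen H M act n ((last hs \<otimes>\<^bsub>H\<^esub> m1) # butlast hs) m0) (\<rho> m)))\<rparr>"

section \<open>Lie algebras and twisted enveloping algebras\<close>

locale lie_algebra = vector_space scale
  for scale :: "'k::field \<Rightarrow> 'g::ab_group_add \<Rightarrow> 'g" +
  fixes br :: "'g \<Rightarrow> 'g \<Rightarrow> 'g"
  assumes br_linear_right: "Vector_Spaces.linear scale scale (br x)"
    and br_linear_left: "Vector_Spaces.linear scale scale (\<lambda>x. br x y)"
    and br_self: "br x x = 0"
    and jacobi: "br x (br y z) + br y (br z x) + br z (br x y) = 0"

locale lie_two_cocycle = lie_algebra +
  fixes f :: "'b \<Rightarrow> 'b \<Rightarrow> 'a"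
  assumes f_linear_right: "Vector_Spaces.linear scale (*) (f x)"
    and f_linear_left: "Vector_Spaces.linear scale (*) (\<lambda>x. f x y)"
    and f_self: "f x x = 0"
    and f_cocycle: "f (br x y) z + f (br y z) x + f (br z x) y = 0"

definition twisted_ideal :: "('k::field \<Rightarrow> 'g \<Rightarrow> 'g::ab_group_add) \<Rightarrow> ('g \<Rightarrow> 'g \<Rightarrow> 'g) \<Rightarrow>
    ('g \<Rightarrow> 'g \<Rightarrow> 'k) \<Rightarrow> ('g list \<Rightarrow>\<^sub>0 'k) set set" where
  "twisted_ideal scale br f = (let T = tensor_algebra (type_space scale) in
     Idl\<^bsub>T\<^esub> {cls T [x, y] \<ominus>\<^bsub>T\<^esub> cls T [y, x] \<ominus>\<^bsub>T\<^esub> cls T [br x y] \<ominus>\<^bsub>T\<^esub> f x y \<odot>\<^bsub>T\<^esub> \<one>\<^bsub>T\<^esub> | x y. True})"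

definition twisted_env :: "('k::field \<Rightarrow> 'g \<Rightarrow> 'g::ab_group_add) \<Rightarrow> ('g \<Rightarrow> 'g \<Rightarrow> 'g) \<Rightarrow>
    ('g \<Rightarrow> 'g \<Rightarrow> 'k) \<Rightarrow> ('k, ('g list \<Rightarrow>\<^sub>0 'k) set set) module" where
  "twisted_env scale br f = quot (tensor_algebra (type_space scale)) (twisted_ideal scale br f)"

definition twisted_incl :: "('k::field \<Rightarrow> 'g \<Rightarrow> 'g::ab_group_add) \<Rightarrow> ('g \<Rightarrow> 'g \<Rightarrow> 'g) \<Rightarrow>
    ('g \<Rightarrow> 'g \<Rightarrow> 'k) \<Rightarrow> 'g \<Rightarrow> ('g list \<Rightarrow>\<^sub>0 'k) set set" where
  "twisted_incl scale br f x = (let T = tensor_algebra (type_space scale) in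
     twisted_ideal scale br f +>\<^bsub>T\<^esub> cls T [x])"

text \<open>
  The linear map on a twisted enveloping algebra that sends the class of each word \<open>xs\<close> in
  elements of the Lie algebra to \<open>F xs\<close>, evaluated, like \<^const>\<open>lin_ext\<close>, on a representative of a representative.
\<close>

definition env_ext :: "('k::field, 'b, 'n) module_scheme \<Rightarrow> ('g list \<Rightarrow> 'b) \<Rightarrow>
    ('g list \<Rightarrow>\<^sub>0 'k) set set \<Rightarrow> 'b" where
  "env_ext N F u = lin_ext N F (SOME t. t \<in> u)"

text \<open>The enveloping algebra is the case of the zero cocycle.\<close>

abbreviation env :: "('k::field \<Rightarrow> 'g \<Rightarrow> 'g::ab_group_add) \<Rightarrow> ('g \<Rightarrow> 'g \<Rightarrow> 'g) \<Rightarrow>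
    ('k, ('g list \<Rightarrow>\<^sub>0 'k) set set) module" where
  "env scale br \<equiv> twisted_env scale br (\<lambda>_ _. 0)"

abbreviation env_incl :: "('k::field \<Rightarrow> 'g \<Rightarrow> 'g::ab_group_add) \<Rightarrow> ('g \<Rightarrow> 'g \<Rightarrow> 'g) \<Rightarrow>
    'g \<Rightarrow> ('g list \<Rightarrow>\<^sub>0 'k) set set" where
  "env_incl scale br \<equiv> twisted_incl scale br (\<lambda>_ _. 0)"

definition twisted_coaction :: "('k::field \<Rightarrow> 'g \<Rightarrow> 'g::ab_group_add) \<Rightarrow> ('g \<Rightarrow> 'g \<Rightarrow> 'g) \<Rightarrow>
    ('g \<Rightarrow> 'g \<Rightarrow> 'k) \<Rightarrow> ('g list \<Rightarrow>\<^sub>0 'k) set set \<Rightarrow>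
    (('g list \<Rightarrow>\<^sub>0 'k) set set \<times> ('g list \<Rightarrow>\<^sub>0 'k) set set \<Rightarrow>\<^sub>0 'k) set" where
  "twisted_coaction scale br f = (let A = twisted_env scale br f; U = env scale br; AU = tensor A U in
     env_ext AU (\<lambda>xs. foldr (\<lambda>x t.
       (cls AU (twisted_incl scale br f x, \<one>\<^bsub>U\<^esub>) \<oplus>\<^bsub>AU\<^esub> cls AU (\<one>\<^bsub>A\<^esub>, env_incl scale br x))
         \<otimes>\<^bsub>AU\<^esub> t) xs \<one>\<^bsub>AU\<^esub>))"

definition env_hopf :: "('k::field \<Rightarrow> 'g \<Rightarrow> 'g::ab_group_add) \<Rightarrow> ('g \<Rightarrow> 'g \<Rightarrow> 'g) \<Rightarrow>
    ('k, ('g list \<Rightarrow>\<^sub>0 'k) set set) hopf" where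
  "env_hopf scale br = (let U = env scale br; \<iota> = env_incl scale br in
     module.extend U (hopf.fields
       (twisted_coaction scale br (\<lambda>_ _. 0))
       (env_ext ground_algebra (\<lambda>xs. if xs = [] then 1 else 0))
       (env_ext U (\<lambda>xs. foldr (\<lambda>x s. s \<otimes>\<^bsub>U\<^esub> (\<ominus>\<^bsub>U\<^esub> \<iota> x)) xs \<one>\<^bsub>U\<^esub>))))"

definition twisted_action :: "('k::field \<Rightarrow> 'g \<Rightarrow> 'g::ab_group_add) \<Rightarrow> ('g \<Rightarrow> 'g \<Rightarrow> 'g) \<Rightarrow>
    ('g \<Rightarrow> 'g \<Rightarrow> 'k) \<Rightarrow> ('g list \<Rightarrow>\<^sub>0 'k) set set \<Rightarrow> ('g list \<Rightarrow>\<^sub>0 'k) set set \<Rightarrow>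
    ('g list \<Rightarrow>\<^sub>0 'k) set set" where
  "twisted_action scale br f h a = (let A = twisted_env scale br f; \<iota> = twisted_incl scale br f in
     env_ext A (\<lambda>xs. foldr (\<lambda>x b. (\<iota> x \<otimes>\<^bsub>A\<^esub> b) \<ominus>\<^bsub>A\<^esub> (b \<otimes>\<^bsub>A\<^esub> \<iota> x)) xs a) h)"

end

theory Submission
  imports Defs
begin

text \<open>
  Write \<open>A\<close> for the twisted enveloping algebra and \<open>U\<close> for the enveloping algebra.

  The theorem holds because \<open>A\<close> and \<open>U\<close> are given by generators and relations, and the cocycle
  disappears wherever left and right multiplication by a generator are subtracted. A module over
  \<open>A\<close> is a vector space with operators \<open>D x\<close> that satisfy the defining relations
  (\<open>lierep\<close>, \<open>eact\<close>), and if \<open>l\<close> and \<open>r\<close> are two maps that satisfy these relations in an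
  algebra, then \<open>t \<mapsto> l x t - t r x\<close> satisfies the relations of \<open>U\<close> (\<open>lierep_ad\<close>). All maps below are
  produced in this way, and the identities between them are checked on the unit and under
  multiplication by a generator (\<open>A_lin_eq\<close>).

  \<^item> \<open>U\<close> acts on \<open>A \<otimes> A\<close> by moving letters across the tensor sign, \<open>x\<close> taking \<open>a \<otimes> b\<close> to
    \<open>a \<otimes> x b - a x \<otimes> b\<close>. The canonical map turns this into multiplication on the second factor of
    \<open>A \<otimes> U\<close>, so its inverse sends \<open>a \<otimes> h\<close> to the result of \<open>h\<close> acting on \<open>a \<otimes> 1\<close> (\<open>can_bij\<close>).

  \<^item> That the scalars embed in \<open>A\<close> and are all the coinvariants needs a linear functional on \<open>A\<close>
    with value one at the unit, a part of the Poincare--Birkhoff--Witt theorem. The functional is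
    defined by straightening words in an ordered basis; that it respects the defining relations is
    the diamond lemma, whose overlaps are resolved by the Jacobi and cocycle identities
    (\<open>word_rel_L\<close>, \<open>A_functional\<close>).

  \<^item> The crossed module structure is adjoint action and coaction. Modularity is a case of
    \<open>coaction_conjugation\<close>, a formula that also produces the coaction in the cyclic operator.

  \<^item> In degree \<open>n\<close> of the cyclic object of \<open>A\<close>, letters can be moved across each of the \<open>n + 1\<close>
    cyclically arranged tensor signs. These operations commute, so \<open>n + 1\<close> copies of \<open>U\<close> act on the
    tensor power of \<open>A\<close>. The comparison map \<open>\<psi>\<close> sends \<open>(h\<^sup>0, \<dots>, h\<^sup>n) \<otimes> m\<close> to the result of this
    action on \<open>m \<otimes> 1 \<otimes> \<dots> \<otimes> 1\<close>. The diagonal action telescopes to the adjoint action on \<open>m\<close>, so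
    the map is defined on the tensor product over \<open>U\<close> (\<open>uact_icm\<close>). Merging two slots kills the moves
    between them, which accounts for the counit in the faces; rotating the slots permutes the moves
    (\<open>\<psi>_face\<close>, \<open>\<psi>_cyc\<close>).

  \<^item> The comparison map is onto because letters can be moved, one at a time, into slot \<open>0\<close>
    (\<open>\<psi>_surj\<close>). It is injective because every element of the balanced tensor product has a
    representative with \<open>h\<^sup>n = 1\<close>, which is recovered from its image by an explicit map into
    the algebra \<open>U\<^sup>\<otimes>\<^sup>n \<otimes> A\<close> (\<open>unwind_\<psi>_normal_form\<close>).

  An isomorphism of cyclic objects induces one of the Tsygan double complexes, and hence of cyclic
  homology (\<open>cyclic_homology_iso\<close>).
\<close>

section \<open>Vector spaces and linear maps\<close>

abbreviation vspace :: "('k::field, 'a, 'm) module_scheme \<Rightarrow> bool" where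
  "vspace M \<equiv> module ground M"

lemma ground_simps [simp]:
  "carrier ground = UNIV" "zero ground = 0" "one ground = 1"
  "add ground = (+)" "monoid.mult ground = (*)"
  by (simp_all add: ring_of_type_algebra_def)

lemma ground_minus [simp]: "\<ominus>\<^bsub>ground\<^esub> c = - (c::'k::field)"
proof -
  interpret cring "ground :: 'k ring" by (rule cring_from_type_algebra)
  show ?thesis by (rule minus_equality) auto
qed

lemma vspace_abelian_group: "vspace M \<Longrightarrow> abelian_group M"
  by (simp add: module_def)

lemma vspace_abelian_monoid: "vspace M \<Longrightarrow> abelian_monoid M"
  using abelian_group.axioms(1) vspace_abelian_group by blast

lemma vspaceI:
  fixes M :: "('k::field, 'a, 'm) module_scheme" (structure)
  assumes "\<And>x y. \<lbrakk>x \<in> carrier M; y \<in> carrier M\<rbrakk> \<Longrightarrow> x \<oplus> y \<in> carrier M"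
    and "\<zero> \<in> carrier M"
    and "\<And>x y z. \<lbrakk>x \<in> carrier M; y \<in> carrier M; z \<in> carrier M\<rbrakk> \<Longrightarrow> (x \<oplus> y) \<oplus> z = x \<oplus> (y \<oplus> z)"
    and "\<And>x y. \<lbrakk>x \<in> carrier M; y \<in> carrier M\<rbrakk> \<Longrightarrow> x \<oplus> y = y \<oplus> x"
    and "\<And>x. x \<in> carrier M \<Longrightarrow> \<zero> \<oplus> x = x"
    and "\<And>c x. x \<in> carrier M \<Longrightarrow> c \<odot> x \<in> carrier M"
    and "\<And>c d x. x \<in> carrier M \<Longrightarrow> (c + d) \<odot> x = c \<odot> x \<oplus> d \<odot> x"
    and "\<And>c x y. \<lbrakk>x \<in> carrier M; y \<in> carrier M\<rbrakk> \<Longrightarrow> c \<odot> (x \<oplus> y) = c \<odot> x \<oplus> c \<odot> y"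
    and "\<And>c d x. x \<in> carrier M \<Longrightarrow> (c * d) \<odot> x = c \<odot> (d \<odot> x)"
    and "\<And>x. x \<in> carrier M \<Longrightarrow> 1 \<odot> x = x"
    and "\<And>x. x \<in> carrier M \<Longrightarrow> 0 \<odot> x = \<zero>"
  shows "vspace M"
proof (rule moduleI)
  show "cring (ground :: 'k ring)"
    by (rule cring_from_type_algebra)
  have "\<exists>y\<in>carrier M. y \<oplus> x = \<zero>" if "x \<in> carrier M" for x
    using assms(6)[of x "-1"] assms(7)[of x "-1" 1] assms(10,11)[of x] that by (intro bexI[of _ "(-1) \<odot> x"]) auto
  then show "abelian_group M"
    using assms(1-5) by (intro abelian_groupI) auto
qed (use assms in auto)

context
  fixes M :: "('k::field, 'a, 'm) module_scheme" (structure)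
  assumes M: "vspace M"
begin

interpretation module ground M by (rule M)

lemma vs_add_closed [simp]: "\<lbrakk>x \<in> carrier M; y \<in> carrier M\<rbrakk> \<Longrightarrow> x \<oplus> y \<in> carrier M"
  and vs_zero_closed [simp]: "\<zero> \<in> carrier M"
  and vs_minus_closed [simp]: "x \<in> carrier M \<Longrightarrow> \<ominus> x \<in> carrier M"
  and vs_diff_closed [simp]: "\<lbrakk>x \<in> carrier M; y \<in> carrier M\<rbrakk> \<Longrightarrow> x \<ominus> y \<in> carrier M"
  and vs_smult_closed [simp]: "x \<in> carrier M \<Longrightarrow> c \<odot> x \<in> carrier M"
  by auto

lemma vs_assoc: "\<lbrakk>x \<in> carrier M; y \<in> carrier M; z \<in> carrier M\<rbrakk> \<Longrightarrow> (x \<oplus> y) \<oplus> z = x \<oplus> (y \<oplus> z)"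
  and vs_comm: "\<lbrakk>x \<in> carrier M; y \<in> carrier M\<rbrakk> \<Longrightarrow> x \<oplus> y = y \<oplus> x"
  and vs_lcomm: "\<lbrakk>x \<in> carrier M; y \<in> carrier M; z \<in> carrier M\<rbrakk> \<Longrightarrow> x \<oplus> (y \<oplus> z) = y \<oplus> (x \<oplus> z)"
  and vs_l_zero [simp]: "x \<in> carrier M \<Longrightarrow> \<zero> \<oplus> x = x"
  and vs_r_zero [simp]: "x \<in> carrier M \<Longrightarrow> x \<oplus> \<zero> = x"
  and vs_l_neg [simp]: "x \<in> carrier M \<Longrightarrow> \<ominus> x \<oplus> x = \<zero>"
  and vs_r_neg [simp]: "x \<in> carrier M \<Longrightarrow> x \<oplus> \<ominus> x = \<zero>"
  and vs_minus_zero [simp]: "\<ominus> \<zero> = \<zero>"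
  by (auto simp: M.a_ac M.l_neg M.r_neg)

lemma vs_r_neg1 [simp]: "\<lbrakk>x \<in> carrier M; y \<in> carrier M\<rbrakk> \<Longrightarrow> \<ominus> x \<oplus> (x \<oplus> y) = y"
  and vs_r_neg2 [simp]: "\<lbrakk>x \<in> carrier M; y \<in> carrier M\<rbrakk> \<Longrightarrow> x \<oplus> (\<ominus> x \<oplus> y) = y"
  and vs_minus_minus [simp]: "x \<in> carrier M \<Longrightarrow> \<ominus> (\<ominus> x) = x"
  and vs_minus_add: "\<lbrakk>x \<in> carrier M; y \<in> carrier M\<rbrakk> \<Longrightarrow> \<ominus> (x \<oplus> y) = \<ominus> x \<oplus> \<ominus> y"
  and vs_diff_def: "\<lbrakk>x \<in> carrier M; y \<in> carrier M\<rbrakk> \<Longrightarrow> x \<ominus> y = x \<oplus> \<ominus> y"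
  by (auto simp: M.r_neg1 M.r_neg2 M.minus_add M.minus_eq)

lemmas vs_ac = vs_assoc vs_comm vs_lcomm

lemma vs_smult_zero [simp]: "c \<odot> \<zero> = \<zero>"
  and vs_zero_smult [simp]: "x \<in> carrier M \<Longrightarrow> 0 \<odot> x = \<zero>"
  and vs_one_smult [simp]: "x \<in> carrier M \<Longrightarrow> 1 \<odot> x = x"
  and vs_smult_smult [simp]: "x \<in> carrier M \<Longrightarrow> c \<odot> (d \<odot> x) = (c * d) \<odot> x"
  and vs_smult_add_left: "x \<in> carrier M \<Longrightarrow> (c + d) \<odot> x = c \<odot> x \<oplus> d \<odot> x"
  and vs_smult_add_right: "\<lbrakk>x \<in> carrier M; y \<in> carrier M\<rbrakk> \<Longrightarrow> c \<odot> (x \<oplus> y) = c \<odot> x \<oplus> c \<odot> y"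
  using smult_r_null[of c] smult_l_null[of x] smult_one[of x] smult_assoc1[of c d x]
    smult_l_distr[of c d x] smult_r_distr[of c x y]
  by auto

lemma vs_smult_minus_left: "x \<in> carrier M \<Longrightarrow> (- c) \<odot> x = \<ominus> (c \<odot> x)"
  and vs_smult_minus_right: "x \<in> carrier M \<Longrightarrow> c \<odot> (\<ominus> x) = \<ominus> (c \<odot> x)"
  using smult_l_minus[of c x] smult_r_minus[of c x] by auto

lemma vs_minus_eq_smult: "x \<in> carrier M \<Longrightarrow> \<ominus> x = (-1) \<odot> x"
  using vs_smult_minus_left[of x 1] by simp

lemma vs_finsum_closed: "f \<in> A \<rightarrow> carrier M \<Longrightarrow> finsum M f A \<in> carrier M"
  by (rule M.finsum_closed)

end

lemma vs_diff_self [simp]: "\<lbrakk>vspace M; x \<in> carrier M\<rbrakk> \<Longrightarrow> x \<ominus>\<^bsub>M\<^esub> x = \<zero>\<^bsub>M\<^esub>"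
  by (simp add: vs_diff_def)

lemma vs_diff_eq_iff:
  assumes "vspace M" "x \<in> carrier M" "y \<in> carrier M" "z \<in> carrier M"
  shows "x \<ominus>\<^bsub>M\<^esub> y = z \<longleftrightarrow> x = z \<oplus>\<^bsub>M\<^esub> y"
proof -
  have "(x \<ominus>\<^bsub>M\<^esub> y) \<oplus>\<^bsub>M\<^esub> y = x" "(z \<oplus>\<^bsub>M\<^esub> y) \<ominus>\<^bsub>M\<^esub> y = z"
    using assms by (simp_all add: vs_diff_def vs_assoc)
  then show ?thesis by metis
qed

lemma vs_diff_zero_iff: "\<lbrakk>vspace M; x \<in> carrier M; y \<in> carrier M\<rbrakk> \<Longrightarrow> x \<ominus>\<^bsub>M\<^esub> y = \<zero>\<^bsub>M\<^esub> \<longleftrightarrow> x = y"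
  by (simp add: vs_diff_eq_iff)

lemma ground_algebra_simps [simp]:
  "carrier ground_algebra = UNIV" "zero ground_algebra = 0" "one ground_algebra = 1"
  "add ground_algebra = (+)" "monoid.mult ground_algebra = (*)" "module.smult ground_algebra = (*)"
  by (simp_all add: ground_algebra_def ring.defs module.defs ring_of_type_algebra_def)

lemma vspace_ground_algebra [simp]: "vspace ground_algebra"
  by (rule vspaceI) (auto simp: algebra_simps)

lemma type_space_simps [simp]:
  "carrier (type_space scale) = UNIV" "zero (type_space scale) = 0" "add (type_space scale) = (+)"
  "module.smult (type_space scale) = scale"
  by (simp_all add: type_space_def)

lemma linI:
  assumes "\<And>x. x \<in> carrier M \<Longrightarrow> h x \<in> carrier N"
    and "\<And>x y. \<lbrakk>x \<in> carrier M; y \<in> carrier M\<rbrakk> \<Longrightarrow> h (x \<oplus>\<^bsub>M\<^esub> y) = h x \<oplus>\<^bsub>N\<^esub> h y"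
    and "\<And>c x. x \<in> carrier M \<Longrightarrow> h (c \<odot>\<^bsub>M\<^esub> x) = c \<odot>\<^bsub>N\<^esub> h x"
  shows "h \<in> linear_maps M N"
  using assms by (auto simp: linear_maps_def)

lemma lin_closed: "\<lbrakk>h \<in> linear_maps M N; x \<in> carrier M\<rbrakk> \<Longrightarrow> h x \<in> carrier N"
  and lin_add: "\<lbrakk>h \<in> linear_maps M N; x \<in> carrier M; y \<in> carrier M\<rbrakk> \<Longrightarrow> h (x \<oplus>\<^bsub>M\<^esub> y) = h x \<oplus>\<^bsub>N\<^esub> h y"
  and lin_smult: "\<lbrakk>h \<in> linear_maps M N; x \<in> carrier M\<rbrakk> \<Longrightarrow> h (c \<odot>\<^bsub>M\<^esub> x) = c \<odot>\<^bsub>N\<^esub> h x"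
  by (auto simp: linear_maps_def)

lemma lin_zero: "\<lbrakk>h \<in> linear_maps M N; vspace M; vspace N\<rbrakk> \<Longrightarrow> h \<zero>\<^bsub>M\<^esub> = \<zero>\<^bsub>N\<^esub>"
  using lin_smult[of h M N "\<zero>\<^bsub>M\<^esub>" 0] by (simp add: lin_closed)

lemma lin_minus: "\<lbrakk>h \<in> linear_maps M N; vspace M; vspace N; x \<in> carrier M\<rbrakk> \<Longrightarrow> h (\<ominus>\<^bsub>M\<^esub> x) = \<ominus>\<^bsub>N\<^esub> h x"
  using lin_smult[of h M N x "-1"] by (simp add: lin_closed vs_minus_eq_smult)

lemma lin_diff: "\<lbrakk>h \<in> linear_maps M N; vspace M; vspace N; x \<in> carrier M; y \<in> carrier M\<rbrakk>
    \<Longrightarrow> h (x \<ominus>\<^bsub>M\<^esub> y) = h x \<ominus>\<^bsub>N\<^esub> h y"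
  by (simp add: vs_diff_def lin_closed lin_add lin_minus)

lemma lin_finsum:
  assumes h: "h \<in> linear_maps M N" and M: "vspace M" and N: "vspace N" and f: "f \<in> A \<rightarrow> carrier M"
  shows "h (finsum M f A) = finsum N (\<lambda>x. h (f x)) A"
proof (cases "finite A")
  case True
  interpret M: abelian_monoid M using M by (rule vspace_abelian_monoid)
  interpret N: abelian_monoid N using N by (rule vspace_abelian_monoid)
  show ?thesis
    using True f
  proof (induction A)
    case empty
    then show ?case using h M N by (simp add: lin_zero)
  next
    case (insert a A)
    then have *: "f \<in> A \<rightarrow> carrier M" "f a \<in> carrier M" by auto
    then have **: "(\<lambda>x. h (f x)) \<in> A \<rightarrow> carrier N" "h (f a) \<in> carrier N"
      using h by (auto intro: lin_closed)
    show ?case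
      using insert * ** h by (simp add: M.finsum_insert N.finsum_insert lin_add)
  qed
next
  case False
  interpret M: abelian_monoid M using M by (rule vspace_abelian_monoid)
  interpret N: abelian_monoid N using N by (rule vspace_abelian_monoid)
  show ?thesis
    using False h M N by (simp add: lin_zero M.finsum_infinite N.finsum_infinite)
qed

lemma lin_id: "(\<lambda>x. x) \<in> linear_maps M M"
  by (rule linI) auto

lemma lin_zero_map: "vspace N \<Longrightarrow> (\<lambda>_. \<zero>\<^bsub>N\<^esub>) \<in> linear_maps M N"
  by (rule linI) auto

lemma lin_comp: "\<lbrakk>f \<in> linear_maps N P; g \<in> linear_maps M N\<rbrakk> \<Longrightarrow> (\<lambda>x. f (g x)) \<in> linear_maps M P"
  by (rule linI) (simp_all add: lin_closed lin_add lin_smult)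

lemma lin_add_map: "\<lbrakk>vspace N; f \<in> linear_maps M N; g \<in> linear_maps M N\<rbrakk>
    \<Longrightarrow> (\<lambda>x. f x \<oplus>\<^bsub>N\<^esub> g x) \<in> linear_maps M N"
  by (rule linI) (simp_all add: lin_closed lin_add lin_smult vs_ac vs_smult_add_right)

lemma lin_smult_map: "\<lbrakk>vspace N; f \<in> linear_maps M N\<rbrakk> \<Longrightarrow> (\<lambda>x. c \<odot>\<^bsub>N\<^esub> f x) \<in> linear_maps M N"
  by (rule linI) (simp_all add: lin_closed lin_add lin_smult vs_smult_add_right mult.commute)

lemma lin_minus_map: "\<lbrakk>vspace N; f \<in> linear_maps M N\<rbrakk> \<Longrightarrow> (\<lambda>x. \<ominus>\<^bsub>N\<^esub> f x) \<in> linear_maps M N"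
  by (rule linI) (simp_all add: lin_closed lin_add lin_smult vs_minus_add vs_smult_minus_right)

lemma lin_cong: "\<lbrakk>f \<in> linear_maps M N; vspace M; \<And>x. x \<in> carrier M \<Longrightarrow> f x = g x\<rbrakk> \<Longrightarrow> g \<in> linear_maps M N"
  by (rule linI) (metis lin_closed, metis lin_add vs_add_closed, metis lin_smult vs_smult_closed)

lemma lin_diff_map: "\<lbrakk>vspace M; vspace N; f \<in> linear_maps M N; g \<in> linear_maps M N\<rbrakk>
    \<Longrightarrow> (\<lambda>x. f x \<ominus>\<^bsub>N\<^esub> g x) \<in> linear_maps M N"
  by (rule lin_cong[OF lin_add_map[OF _ _ lin_minus_map]])
    (simp_all add: vs_diff_def lin_closed)

lemma lin_scalar_map: "\<lbrakk>vspace N; f \<in> linear_maps M ground_algebra; v \<in> carrier N\<rbrakk>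
    \<Longrightarrow> (\<lambda>x. f x \<odot>\<^bsub>N\<^esub> v) \<in> linear_maps M N"
  by (rule linI) (simp_all add: lin_add lin_smult vs_smult_add_left)

lemma lin_finsum_map:
  assumes N: "vspace N" and f: "\<And>i. i \<in> I \<Longrightarrow> f i \<in> linear_maps M N" and "vspace M"
  shows "(\<lambda>x. finsum N (\<lambda>i. f i x) I) \<in> linear_maps M N"
proof (cases "finite I")
  case True
  interpret N: abelian_monoid N using N by (rule vspace_abelian_monoid)
  show ?thesis
    using True f
  proof (induction I)
    case empty
    then show ?case using N by (simp add: lin_zero_map)
  next
    case (insert a A)
    have *: "(\<lambda>x. f a x \<oplus>\<^bsub>N\<^esub> finsum N (\<lambda>i. f i x) A) \<in> linear_maps M N"
      using insert N by (intro lin_add_map) auto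
    show ?case
    proof (rule lin_cong[OF * \<open>vspace M\<close>])
      fix x assume "x \<in> carrier M"
      then have "(\<lambda>i. f i x) \<in> A \<rightarrow> carrier N" "f a x \<in> carrier N"
        using insert.prems by (auto intro: lin_closed)
      then show "f a x \<oplus>\<^bsub>N\<^esub> finsum N (\<lambda>i. f i x) A = finsum N (\<lambda>i. f i x) (insert a A)"
        using insert by (simp add: N.finsum_insert)
    qed
  qed
next
  case False
  interpret N: abelian_monoid N using N by (rule vspace_abelian_monoid)
  show ?thesis
    using False N by (simp add: N.finsum_infinite lin_zero_map)
qed

section \<open>Quotients\<close>

definition vsubspace :: "'a set \<Rightarrow> ('k::field, 'a, 'm) module_scheme \<Rightarrow> bool" where
  "vsubspace W M \<longleftrightarrow> W \<subseteq> carrier M \<and> \<zero>\<^bsub>M\<^esub> \<in> W \<and>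
     (\<forall>x\<in>W. \<forall>y\<in>W. x \<oplus>\<^bsub>M\<^esub> y \<in> W) \<and> (\<forall>c. \<forall>x\<in>W. c \<odot>\<^bsub>M\<^esub> x \<in> W)"

lemma quot_simps:
  "carrier (quot M W) = (\<lambda>x. W +>\<^bsub>M\<^esub> x) ` carrier M"
  "zero (quot M W) = W" "add (quot M W) = set_add M"
  "one (quot M W) = W +>\<^bsub>M\<^esub> \<one>\<^bsub>M\<^esub>" "monoid.mult (quot M W) = rcoset_mult M W"
  "module.smult (quot M W) = (\<lambda>c C. W <+>\<^bsub>M\<^esub> ((\<lambda>x. c \<odot>\<^bsub>M\<^esub> x) ` C))"
  by (auto simp: quot_def ring.defs module.defs FactRing_def A_RCOSETS_def' a_r_coset_def')

lemma vsubspace_abelian_subgroup: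
  assumes M: "vspace M" and W: "vsubspace W M"
  shows "abelian_subgroup W M"
proof (rule abelian_subgroupI3)
  interpret M: abelian_group M using M by (rule vspace_abelian_group)
  have "\<ominus>\<^bsub>M\<^esub> x \<in> W" if "x \<in> W" for x
    using W that M by (auto simp: vsubspace_def vs_minus_eq_smult subset_iff)
  then have "subgroup W (add_monoid M)"
    using W by (intro M.add.subgroupI) (auto simp: vsubspace_def a_inv_def)
  then show "additive_subgroup W M"
    by (rule additive_subgroup.intro)
  show "abelian_group M" by (rule M.abelian_group_axioms)
qed

context
  fixes M :: "('k::field, 'a, 'm) module_scheme" (structure) and W :: "'a set"
  assumes M: "vspace M" and W: "vsubspace W M"
begin

lemmas sg = vsubspace_abelian_subgroup[OF M W]

lemma coset_in_quot [simp]: "x \<in> carrier M \<Longrightarrow> W +> x \<in> carrier (quot M W)"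
  by (simp add: quot_simps)

lemma quot_cases: "C \<in> carrier (quot M W) \<Longrightarrow> (\<And>x. x \<in> carrier M \<Longrightarrow> C = W +> x \<Longrightarrow> P) \<Longrightarrow> P"
  by (auto simp: quot_simps)

lemma quot_add: "\<lbrakk>x \<in> carrier M; y \<in> carrier M\<rbrakk> \<Longrightarrow> (W +> x) \<oplus>\<^bsub>quot M W\<^esub> (W +> y) = W +> (x \<oplus> y)"
  by (simp add: quot_simps abelian_subgroup.a_rcos_sum[OF sg])

lemma quot_smult:
  assumes x: "x \<in> carrier M"
  shows "c \<odot>\<^bsub>quot M W\<^esub> (W +> x) = W +> (c \<odot> x)"
proof -
  have WM: "W \<subseteq> carrier M" and W': "\<And>x y. x \<in> W \<Longrightarrow> y \<in> W \<Longrightarrow> x \<oplus> y \<in> W"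
      "\<And>c x. x \<in> W \<Longrightarrow> c \<odot> x \<in> W" "\<zero> \<in> W"
    using W by (auto simp: vsubspace_def)
  have "w \<oplus> c \<odot> (w' \<oplus> x) \<in> W +> (c \<odot> x)" if "w \<in> W" "w' \<in> W" for w w'
  proof -
    have "w \<oplus> c \<odot> (w' \<oplus> x) = (w \<oplus> c \<odot> w') \<oplus> c \<odot> x"
      using that WM x M by (auto simp: vs_smult_add_right vs_assoc subset_iff)
    then show ?thesis using that W' by (auto simp: a_r_coset_def')
  qed
  moreover have "w \<oplus> c \<odot> x \<in> W <+> ((\<lambda>x. c \<odot> x) ` (W +> x))" if "w \<in> W" for w
  proof -
    have "\<zero> \<oplus> x \<in> W +> x" using W' by (auto simp: a_r_coset_def')
    then have "x \<in> W +> x" using x M by simp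
    then show ?thesis using that by (auto simp: set_add_def')
  qed
  ultimately show ?thesis
    by (auto simp: quot_simps set_add_def' a_r_coset_def')
qed

lemma quot_zero: "\<zero>\<^bsub>quot M W\<^esub> = W +> \<zero>"
  using abelian_group.a_coset_add_zero[OF vspace_abelian_group[OF M], of W] W
  by (simp add: quot_simps vsubspace_def)

lemma quot_eq_iff: "\<lbrakk>x \<in> carrier M; y \<in> carrier M\<rbrakk> \<Longrightarrow> W +> x = W +> y \<longleftrightarrow> x \<ominus> y \<in> W"
  using abelian_subgroup.a_rcos_module[OF sg, of y x] abelian_subgroup.a_repr_independence'[OF sg, of x y]
    abelian_subgroup.a_repr_independenceD[OF sg, of x y]
  unfolding a_minus_def by metis

lemma quot_mem: "\<lbrakk>x \<in> carrier M; y \<in> W +> x\<rbrakk> \<Longrightarrow> y \<in> carrier M \<and> W +> y = W +> x"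
  using abelian_subgroup.a_repr_independence'[OF sg, of y x]
    abelian_subgroup.a_elemrcos_carrier[OF sg, of x y]
  by metis

lemma quot_self_mem: "x \<in> carrier M \<Longrightarrow> x \<in> W +> x"
  by (rule abelian_subgroup.a_rcos_self[OF sg])

lemma vspace_quot: "vspace (quot M W)"
proof (rule vspaceI)
  fix C D assume "C \<in> carrier (quot M W)" "D \<in> carrier (quot M W)"
  then show "C \<oplus>\<^bsub>quot M W\<^esub> D = D \<oplus>\<^bsub>quot M W\<^esub> C"
    by (elim quot_cases) (simp add: M quot_add vs_comm[OF M])
next
  fix C D E assume "C \<in> carrier (quot M W)" "D \<in> carrier (quot M W)" "E \<in> carrier (quot M W)"
  then show "(C \<oplus>\<^bsub>quot M W\<^esub> D) \<oplus>\<^bsub>quot M W\<^esub> E = C \<oplus>\<^bsub>quot M W\<^esub> (D \<oplus>\<^bsub>quot M W\<^esub> E)"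
    by (elim quot_cases) (simp add: M quot_add vs_assoc[OF M])
next
  show "\<zero>\<^bsub>quot M W\<^esub> \<in> carrier (quot M W)"
    using M by (simp add: quot_zero)
next
  fix C assume "C \<in> carrier (quot M W)"
  then show "\<zero>\<^bsub>quot M W\<^esub> \<oplus>\<^bsub>quot M W\<^esub> C = C" "0 \<odot>\<^bsub>quot M W\<^esub> C = \<zero>\<^bsub>quot M W\<^esub>"
      "1 \<odot>\<^bsub>quot M W\<^esub> C = C"
    by (auto elim!: quot_cases simp: M quot_add quot_smult quot_zero vs_zero_smult[OF M] vs_one_smult[OF M])
next
  fix C D and c d :: 'k assume "C \<in> carrier (quot M W)" 
  then show "c \<odot>\<^bsub>quot M W\<^esub> C \<in> carrier (quot M W)" "(c * d) \<odot>\<^bsub>quot M W\<^esub> C = c \<odot>\<^bsub>quot M W\<^esub> (d \<odot>\<^bsub>quot M W\<^esub> C)"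
      "(c + d) \<odot>\<^bsub>quot M W\<^esub> C = c \<odot>\<^bsub>quot M W\<^esub> C \<oplus>\<^bsub>quot M W\<^esub> d \<odot>\<^bsub>quot M W\<^esub> C"
    by (auto elim!: quot_cases simp: M quot_add quot_smult vs_smult_add_left[OF M] vs_smult_smult[OF M] vs_smult_closed[OF M])
  assume "D \<in> carrier (quot M W)" 
  with \<open>C \<in> carrier (quot M W)\<close> show "C \<oplus>\<^bsub>quot M W\<^esub> D \<in> carrier (quot M W)"
      "c \<odot>\<^bsub>quot M W\<^esub> (C \<oplus>\<^bsub>quot M W\<^esub> D) = c \<odot>\<^bsub>quot M W\<^esub> C \<oplus>\<^bsub>quot M W\<^esub> c \<odot>\<^bsub>quot M W\<^esub> D"
    by (auto elim!: quot_cases simp: M quot_add quot_smult vs_smult_add_right[OF M] vs_smult_closed[OF M])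
qed

lemma quot_proj_lin: "(\<lambda>x. W +> x) \<in> linear_maps M (quot M W)"
  using M by (intro linI) (simp_all add: quot_add quot_smult)

text \<open>A linear map that vanishes on \<open>W\<close> takes one value on each coset, so it may be evaluated on
  the chosen representative.\<close>

lemma quot_lift:
  assumes N: "vspace N" and h: "h \<in> linear_maps M N" and hW: "\<And>w. w \<in> W \<Longrightarrow> h w = \<zero>\<^bsub>N\<^esub>"
  shows "(\<lambda>C. h (SOME x. x \<in> C)) \<in> linear_maps (quot M W) N"
    and "x \<in> carrier M \<Longrightarrow> h (SOME y. y \<in> W +> x) = h x"
proof -
  show *: "h (SOME y. y \<in> W +> x) = h x" if x: "x \<in> carrier M" for x
  proof -
    define y where "y = (SOME y. y \<in> W +> x)"
    have y: "y \<in> W +> x"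
      unfolding y_def using quot_self_mem[OF x] by (rule someI)
    then have y': "y \<in> carrier M" "W +> y = W +> x"
      using quot_mem[OF x y] by auto
    then have "y \<ominus> x \<in> W" using quot_eq_iff x by blast
    then have "h y \<ominus>\<^bsub>N\<^esub> h x = \<zero>\<^bsub>N\<^esub>" using hW lin_diff[OF h M N y'(1) x] by auto
    then show ?thesis
      using vs_diff_zero_iff[OF N] lin_closed[OF h] y' x by (simp add: y_def)
  qed
  show "(\<lambda>C. h (SOME x. x \<in> C)) \<in> linear_maps (quot M W) N"
    by (rule linI; (elim quot_cases)?)
      (use M in \<open>simp_all add: quot_add quot_smult * lin_closed[OF h] lin_add[OF h] lin_smult[OF h]\<close>)
qed

end

section \<open>Free vector spaces\<close>

lemma lookup_fscale [simp]: "Poly_Mapping.lookup (fscale c p) x = c * Poly_Mapping.lookup p x"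
  by (simp add: fscale_def map.rep_eq when_def)

global_interpretation fscale: vector_space fscale
  by unfold_locales (auto intro!: poly_mapping_eqI simp: lookup_add algebra_simps)

lemma fscale_single [simp]: "fscale c (Poly_Mapping.single x d) = Poly_Mapping.single x (c * d)"
  by (auto intro!: poly_mapping_eqI simp: lookup_single when_def)

lemma monoid_algebra_simps [simp]:
  "carrier (monoid_algebra G) = {p. Poly_Mapping.keys p \<subseteq> carrier G}"
  "zero (monoid_algebra G) = 0" "add (monoid_algebra G) = (+)" "module.smult (monoid_algebra G) = fscale"
  "one (monoid_algebra G) = fgen \<one>\<^bsub>G\<^esub>"
  by (simp_all add: monoid_algebra_def)

lemma keys_fscale: "Poly_Mapping.keys (fscale c p) \<subseteq> Poly_Mapping.keys p"
  by (auto simp: in_keys_iff)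

lemma vspace_monoid_algebra [simp]: "vspace (monoid_algebra G)"
  by (rule vspaceI, unfold monoid_algebra_simps mem_Collect_eq)
    (rule order_trans[OF keys_add] order_trans[OF keys_fscale] add.assoc add.commute fscale.scale_left_distrib
       fscale.scale_right_distrib fscale.scale_scale[symmetric] fscale.scale_one
       fscale.scale_zero_left add_0 keys_zero[THEN equalityD1, THEN order_trans] empty_subsetI Un_least | assumption)+

lemma monoid_algebra_minus: 
  assumes "p \<in> carrier (monoid_algebra G)"
  shows "\<ominus>\<^bsub>monoid_algebra G\<^esub> p = - p"
  using assms by (subst vs_minus_eq_smult) auto

lemma monoid_algebra_diff: 
  assumes "p \<in> carrier (monoid_algebra G)" "q \<in> carrier (monoid_algebra G)"
  shows "p \<ominus>\<^bsub>monoid_algebra G\<^esub> q = p - q"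
  using assms by (subst vs_diff_def) (auto simp: monoid_algebra_minus)

text \<open>The value of \<^const>\<open>lin_ext\<close> on a chosen representative, separated from the choice.\<close>

definition free_ext :: "('k::field, 'b, 'n) module_scheme \<Rightarrow> ('x \<Rightarrow> 'b) \<Rightarrow> ('x \<Rightarrow>\<^sub>0 'k) \<Rightarrow> 'b" where
  "free_ext N F p =
     finsum N (\<lambda>x. Poly_Mapping.lookup p x \<odot>\<^bsub>N\<^esub> F x) (Poly_Mapping.keys p)"

lemma lin_ext_free_ext: "lin_ext N F C = free_ext N F (SOME p. p \<in> C)"
  by (simp add: lin_ext_def free_ext_def Let_def)

context
  fixes N :: "('k::field, 'b, 'n) module_scheme" and F :: "'x \<Rightarrow> 'b" and Y
  assumes N: "vspace N" and F: "\<And>x. x \<in> Y \<Longrightarrow> F x \<in> carrier N"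
begin

interpretation N: abelian_monoid N using N by (rule vspace_abelian_monoid)

lemma free_ext_superset:
  assumes S: "finite S" "Poly_Mapping.keys p \<subseteq> S" "S \<subseteq> Y"
  shows "free_ext N F p = finsum N (\<lambda>x. Poly_Mapping.lookup p x \<odot>\<^bsub>N\<^esub> F x) S"
  unfolding free_ext_def
proof (rule N.add.finprod_mono_neutral_cong_left[OF S(1,2)])
  fix x assume x: "x \<in> S - Poly_Mapping.keys p"
  then have "Poly_Mapping.lookup p x = 0" "F x \<in> carrier N"
    using S F by (auto simp: in_keys_iff)
  then show "Poly_Mapping.lookup p x \<odot>\<^bsub>N\<^esub> F x = \<zero>\<^bsub>N\<^esub>"
    by (simp add: vs_zero_smult[OF N])
next
  show "(\<lambda>x. Poly_Mapping.lookup p x \<odot>\<^bsub>N\<^esub> F x) \<in> S \<rightarrow> carrier N"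
    using S F vs_smult_closed[OF N] by blast
qed simp

lemma free_ext_closed: "Poly_Mapping.keys p \<subseteq> Y \<Longrightarrow> free_ext N F p \<in> carrier N"
  unfolding free_ext_def using F N by (intro N.finsum_closed) auto

lemma free_ext_add:
  assumes "Poly_Mapping.keys p \<subseteq> Y" "Poly_Mapping.keys q \<subseteq> Y"
  shows "free_ext N F (p + q) = free_ext N F p \<oplus>\<^bsub>N\<^esub> free_ext N F q"
proof -
  define S where "S = Poly_Mapping.keys p \<union> Poly_Mapping.keys q"
  have S: "finite S" "S \<subseteq> Y" "Poly_Mapping.keys p \<subseteq> S" "Poly_Mapping.keys q \<subseteq> S"
      "Poly_Mapping.keys (p + q) \<subseteq> S"
    using assms keys_add[of p q] by (auto simp: S_def)
  have cl: "(\<lambda>x. c x \<odot>\<^bsub>N\<^esub> F x) \<in> S \<rightarrow> carrier N" for c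
    using S F N by auto
  have "free_ext N F (p + q) = finsum N (\<lambda>x. Poly_Mapping.lookup (p + q) x \<odot>\<^bsub>N\<^esub> F x) S"
    using S by (intro free_ext_superset) auto
  also have "\<dots> = finsum N (\<lambda>x. Poly_Mapping.lookup p x \<odot>\<^bsub>N\<^esub> F x \<oplus>\<^bsub>N\<^esub> Poly_Mapping.lookup q x \<odot>\<^bsub>N\<^esub> F x) S"
    using S F N by (intro N.finsum_cong') (auto simp: lookup_add vs_smult_add_left subset_iff)
  also have "\<dots> = free_ext N F p \<oplus>\<^bsub>N\<^esub> free_ext N F q"
    using S cl by (simp add: N.finsum_addf free_ext_superset[of S])
  finally show ?thesis .
qed

lemma free_ext_fscale:
  assumes "Poly_Mapping.keys p \<subseteq> Y"
  shows "free_ext N F (fscale c p) = c \<odot>\<^bsub>N\<^esub> free_ext N F p"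
proof -
  have "c \<odot>\<^bsub>N\<^esub> free_ext N F p
      = finsum N (\<lambda>x. c \<odot>\<^bsub>N\<^esub> (Poly_Mapping.lookup p x \<odot>\<^bsub>N\<^esub> F x)) (Poly_Mapping.keys p)"
    unfolding free_ext_def
    using assms F N by (intro lin_finsum[of "\<lambda>v. c \<odot>\<^bsub>N\<^esub> v" N N] lin_smult_map lin_id) auto
  also have "\<dots> = free_ext N F (fscale c p)"
    using assms F N by (subst free_ext_superset[of "Poly_Mapping.keys p"])
      (use keys_fscale[of c p] in \<open>auto intro!: N.finsum_cong'\<close>)
  finally show ?thesis by simp
qed

lemma free_ext_single:
  assumes "x \<in> Y"
  shows "free_ext N F (Poly_Mapping.single x c) = c \<odot>\<^bsub>N\<^esub> F x"
  using F[OF assms] N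
  by (subst free_ext_superset[of "{x}"]) (auto simp: N.finsum_insert assms)

lemma free_ext_gen: "x \<in> Y \<Longrightarrow> free_ext N F (fgen x) = F x"
  using F N by (simp add: free_ext_single)

end

lemma free_ext_lin:
  assumes "vspace N" "\<And>x. x \<in> carrier G \<Longrightarrow> F x \<in> carrier N"
  shows "free_ext N F \<in> linear_maps (monoid_algebra G) N"
  by (rule linI) (use assms in \<open>simp_all add: free_ext_closed[OF assms] free_ext_add[OF assms] free_ext_fscale[OF assms]\<close>)

lemma free_induct [consumes 1, case_names zero add]:
  fixes p :: "'x \<Rightarrow>\<^sub>0 'k::ab_group_add"
  assumes "Poly_Mapping.keys p \<subseteq> Y"
    and "P 0"
    and "\<And>p x c. \<lbrakk>Poly_Mapping.keys p \<subseteq> Y; x \<in> Y; P p\<rbrakk> \<Longrightarrow> P (Poly_Mapping.single x c + p)"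
  shows "P p"
proof -
  have "finite S \<Longrightarrow> S \<subseteq> Y \<Longrightarrow> Poly_Mapping.keys p \<subseteq> S \<Longrightarrow> P p" for S
  proof (induction S arbitrary: p rule: finite_induct)
    case empty
    then show ?case using assms(2) by simp
  next
    case (insert a S)
    let ?q = "p - Poly_Mapping.single a (Poly_Mapping.lookup p a)"
    have q: "Poly_Mapping.keys ?q \<subseteq> S"
      using insert by (auto simp: in_keys_iff lookup_minus lookup_single when_def split: if_splits)
    then have "P (Poly_Mapping.single a (Poly_Mapping.lookup p a) + ?q)"
      using insert by (intro assms(3)) auto
    then show ?case by simp
  qed
  from this[of "Poly_Mapping.keys p"] show ?thesis using assms(1) by auto
qed

lemma free_ext_unique:
  assumes N: "vspace N" and h: "h \<in> linear_maps (monoid_algebra G) N"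
    and p: "Poly_Mapping.keys p \<subseteq> carrier G" and F: "\<And>x. x \<in> carrier G \<Longrightarrow> F x = h (fgen x)"
  shows "free_ext N F p = h p"
proof -
  have cl: "F x \<in> carrier N" if "x \<in> carrier G" for x
    using that lin_closed[OF h] F by simp
  note e = free_ext_lin[of N G F, OF N cl]
  show ?thesis
    using p
  proof (induction p rule: free_induct)
    case zero
    then show ?case using lin_zero[OF e] lin_zero[OF h] N by simp
  next
    case (add p x c)
    have s: "Poly_Mapping.single x c = fscale c (fgen x)" by simp
    have 1: "Poly_Mapping.single x c \<in> carrier (monoid_algebra G)" "p \<in> carrier (monoid_algebra G)"
        "fgen x \<in> carrier (monoid_algebra G)"
      using add by auto
    have 2: "free_ext N F (Poly_Mapping.single x c) = h (Poly_Mapping.single x c)"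
      using add(2) 1 lin_smult[OF h, of "fgen x" c] cl N F free_ext_single[of N "carrier G" F x c]
      by simp
    show ?case
      using lin_add[OF e 1(1,2)] lin_add[OF h 1(1,2)] 2 add by simp
  qed
qed

section \<open>Presented vector spaces\<close>

text \<open>Tensor products, balanced tensor products, tensor powers and tensor algebras are all of this form,
  so the rules for defining and comparing linear maps on them are proved here once.\<close>

abbreviation pres :: "('x, 'm) monoid_scheme \<Rightarrow> ('x \<Rightarrow>\<^sub>0 'k::field) set \<Rightarrow> ('k, ('x \<Rightarrow>\<^sub>0 'k) set) module" where
  "pres G R \<equiv> quot (monoid_algebra G) (fspan R)"

lemma fspan_eq: "fspan R = fscale.span R"
  by (simp add: fspan_def)

lemma fspan_vsubspace:
  assumes "R \<subseteq> carrier (monoid_algebra G)"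
  shows "vsubspace (fspan R) (monoid_algebra G)"
proof -
  have "fscale.subspace {p. Poly_Mapping.keys p \<subseteq> carrier G}"
    by (auto simp: fscale.subspace_def dest!: subsetD[OF keys_add] subsetD[OF keys_fscale])
  then have "fspan R \<subseteq> carrier (monoid_algebra G)"
    using assms by (metis fspan_eq fscale.span_minimal monoid_algebra_simps(1))
  then show ?thesis
    by (simp add: vsubspace_def fspan_eq fscale.span_add fscale.span_scale fscale.span_zero)
qed

lemma fspan_kills:
  assumes N: "vspace N" and h: "h \<in> linear_maps (monoid_algebra G) N" and R: "R \<subseteq> carrier (monoid_algebra G)"
    and k: "\<And>r. r \<in> R \<Longrightarrow> h r = \<zero>\<^bsub>N\<^esub>" and w: "w \<in> fspan R"
  shows "h w = \<zero>\<^bsub>N\<^esub>"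
proof -
  have "fscale.subspace {p \<in> carrier (monoid_algebra G). h p = \<zero>\<^bsub>N\<^esub>}"
  proof -
    note V = vspace_monoid_algebra[of G]
    show ?thesis
      unfolding fscale.subspace_def
      using lin_zero[OF h V N] lin_add[OF h] lin_smult[OF h] vs_zero_closed[OF V] vs_add_closed[OF V]
        vs_smult_closed[OF V] vs_l_zero[OF N] vs_smult_zero[OF N] vs_zero_closed[OF N]
      unfolding monoid_algebra_simps by (auto dest!: subsetD[OF keys_add] subsetD[OF keys_fscale])
  qed
  then have "fspan R \<subseteq> {p \<in> carrier (monoid_algebra G). h p = \<zero>\<^bsub>N\<^esub>}"
    using R k unfolding fspan_eq by (intro fscale.span_minimal) auto
  with w show ?thesis by auto
qed

context
  fixes G :: "('x, 'm) monoid_scheme" and R :: "('x \<Rightarrow>\<^sub>0 'k::field) set"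
  assumes R: "R \<subseteq> carrier (monoid_algebra G)"
begin

lemma vspace_pres: "vspace (pres G R)"
  using R by (intro vspace_quot fspan_vsubspace) auto

lemma cls_pres: 
  assumes "x \<in> carrier G"
  shows "cls (pres G R) x = fspan R +>\<^bsub>monoid_algebra G\<^esub> fgen x"
  unfolding cls_def
proof (rule the_equality)
  note S = vspace_monoid_algebra[of G] fspan_vsubspace[OF R]
  have x: "fgen x \<in> carrier (monoid_algebra G)" using assms by simp
  show "fspan R +>\<^bsub>monoid_algebra G\<^esub> fgen x \<in> carrier (pres G R)
      \<and> fgen x \<in> fspan R +>\<^bsub>monoid_algebra G\<^esub> fgen x"
    using coset_in_quot[OF S x] quot_self_mem[OF S x] by auto
  show "C = fspan R +>\<^bsub>monoid_algebra G\<^esub> fgen x" if "C \<in> carrier (pres G R) \<and> fgen x \<in> C" for C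
    using that quot_mem[OF S] by (metis quot_cases[OF S])
qed

lemma cls_pres_closed: "x \<in> carrier G \<Longrightarrow> cls (pres G R) x \<in> carrier (pres G R)"
  using R by (simp add: cls_pres coset_in_quot fspan_vsubspace)

lemma pres_linear_of_gen:
  assumes N: "vspace N" and h: "h \<in> linear_maps (pres G R) N" 
    and p: "Poly_Mapping.keys p \<subseteq> carrier G" and F: "\<And>x. x \<in> carrier G \<Longrightarrow> F x = h (cls (pres G R) x)"
  shows "free_ext N F p = h (fspan R +>\<^bsub>monoid_algebra G\<^esub> p)"
proof -
  note S = vspace_monoid_algebra[of G] fspan_vsubspace[OF R]
  show ?thesis
    using free_ext_unique[OF N lin_comp[OF h quot_proj_lin[OF S]] p] F by (simp add: cls_pres)
qed

lemma pres_induct [consumes 1, case_names zero add]: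
  assumes C: "C \<in> carrier (pres G R)"
    and 0: "P \<zero>\<^bsub>pres G R\<^esub>"
    and add: "\<And>x c D. \<lbrakk>x \<in> carrier G; D \<in> carrier (pres G R); P D\<rbrakk> \<Longrightarrow> 
       P (c \<odot>\<^bsub>pres G R\<^esub> cls (pres G R) x \<oplus>\<^bsub>pres G R\<^esub> D)"
  shows "P C"
proof -
  note S = vspace_monoid_algebra[of G] fspan_vsubspace[OF R]
  obtain p where p: "p \<in> carrier (monoid_algebra G)" "C = fspan R +>\<^bsub>monoid_algebra G\<^esub> p"
    using quot_cases[OF S C] by blast
  have "Poly_Mapping.keys p \<subseteq> carrier G" using p by simp
  then have "P (fspan R +>\<^bsub>monoid_algebra G\<^esub> p)"
  proof (induction p rule: free_induct)
    case zero
    then show ?case using 0 quot_zero[OF S] by simp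
  next
    case (add p x c)
    have s: "Poly_Mapping.single x c = fscale c (fgen x)" by simp
    have 1: "p \<in> carrier (monoid_algebra G)" "fgen x \<in> carrier (monoid_algebra G)"
        "fscale c (fgen x) \<in> carrier (monoid_algebra G)"
      using add by auto
    show ?case
      using assms(3)[of x "fspan R +>\<^bsub>monoid_algebra G\<^esub> p" c] add 1 quot_add[OF S 1(3,1)] quot_smult[OF S 1(2), of c]
        coset_in_quot[OF S 1(1)]
      by (simp add: cls_pres)
  qed
  then show ?thesis using p by simp
qed

lemma pres_lin_eq:
  assumes N: "vspace N" and h: "h \<in> linear_maps (pres G R) N" "h' \<in> linear_maps (pres G R) N"
    and e: "\<And>x. x \<in> carrier G \<Longrightarrow> h (cls (pres G R) x) = h' (cls (pres G R) x)"
    and C: "C \<in> carrier (pres G R)"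
  shows "h C = h' C"
  using C
proof (induction C rule: pres_induct)
  case zero
  then show ?case using h N vspace_pres by (simp add: lin_zero[of _ "pres G R" N])
next
  case (add x c D)
  then show ?case using h N vspace_pres e
    by (simp add: lin_add[of _ "pres G R" N] lin_smult[of _ "pres G R" N] cls_pres_closed)
qed

lemma pres_lin_ext:
  assumes N: "vspace N" and F: "\<And>x. x \<in> carrier G \<Longrightarrow> F x \<in> carrier N"
    and k: "\<And>r. r \<in> R \<Longrightarrow> free_ext N F r = \<zero>\<^bsub>N\<^esub>"
  shows "lin_ext N F \<in> linear_maps (pres G R) N"
    and "x \<in> carrier G \<Longrightarrow> lin_ext N F (cls (pres G R) x) = F x"
proof -
  note S = vspace_monoid_algebra[of G] fspan_vsubspace[OF R]
  note L = free_ext_lin[of N G F, OF N F]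
  note q = quot_lift[OF S N L fspan_kills[OF N L R k]]
  show "lin_ext N F \<in> linear_maps (pres G R) N"
    unfolding lin_ext_free_ext[abs_def] by (rule q(1))
  show "lin_ext N F (cls (pres G R) x) = F x" if "x \<in> carrier G"
    using q(2)[of "fgen x"] that free_ext_gen[of N "carrier G" F, OF N F] 
    by (simp add: lin_ext_free_ext cls_pres)
qed

text \<open>Even when \<open>F\<close> is not yet known to respect the relations, its extension is controlled by any
  linear map \<open>\<theta>\<close> after which it becomes well defined.\<close>

lemma lin_ext_via:
  assumes N: "vspace N" and N': "vspace N'" and \<theta>: "\<theta> \<in> linear_maps N N'" 
    and H: "H \<in> linear_maps (pres G R) N'"
    and F: "\<And>x. x \<in> carrier G \<Longrightarrow> F x \<in> carrier N" "\<And>x. x \<in> carrier G \<Longrightarrow> \<theta> (F x) = H (cls (pres G R) x)"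
    and C: "C \<in> carrier (pres G R)"
  shows "lin_ext N F C \<in> carrier N" "\<theta> (lin_ext N F C) = H C"
proof -
  note S = vspace_monoid_algebra[of G] fspan_vsubspace[OF R]
  define p where "p = (SOME p. p \<in> C)"
  obtain p0 where p0: "p0 \<in> carrier (monoid_algebra G)" "C = fspan R +>\<^bsub>monoid_algebra G\<^esub> p0"
    using quot_cases[OF S C] by blast
  have "p \<in> C" using quot_self_mem[OF S p0(1)] p0(2) by (auto simp: p_def intro: someI)
  then have p: "p \<in> carrier (monoid_algebra G)" "C = fspan R +>\<^bsub>monoid_algebra G\<^esub> p"
    using quot_mem[OF S p0(1), of p] p0(2) by auto
  show cl: "lin_ext N F C \<in> carrier N"
    using free_ext_closed[of N "carrier G" F p, OF N F(1)] p(1) by (simp add: lin_ext_free_ext p_def)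
  have "\<theta> (lin_ext N F C) = free_ext N' (\<lambda>x. \<theta> (F x)) p"
  proof -
    have "\<theta> (lin_ext N F C) = finsum N' (\<lambda>x. \<theta> (Poly_Mapping.lookup p x \<odot>\<^bsub>N\<^esub> F x)) (Poly_Mapping.keys p)"
      unfolding lin_ext_free_ext free_ext_def p_def[symmetric]
      using p(1) F(1) N by (intro lin_finsum[OF \<theta> N N']) auto
    also have "\<dots> = free_ext N' (\<lambda>x. \<theta> (F x)) p"
      unfolding free_ext_def using p(1) F(1) N' lin_closed[OF \<theta>] 
      by (intro abelian_monoid.finsum_cong'[OF vspace_abelian_monoid[OF N']]) 
        (auto simp: lin_smult[OF \<theta>] subset_iff)
    finally show ?thesis .
  qed
  also have "\<dots> = H C"
    using pres_linear_of_gen[OF N' H _ F(2)] p by simp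
  finally show "\<theta> (lin_ext N F C) = H C" .
qed

text \<open>The representative on which \<^const>\<open>lin_ext\<close> evaluates depends only on \<open>C\<close>, so linearity in a
  parameter of \<open>F\<close> holds whether or not \<open>F\<close> respects the relations.\<close>

lemma lin_ext_param:
  assumes Q: "vspace Q" and N: "vspace N" and F: "\<And>x. x \<in> carrier G \<Longrightarrow> (\<lambda>q. F q x) \<in> linear_maps Q N" 
    and C: "C \<in> carrier (pres G R)"
  shows "(\<lambda>q. lin_ext N (F q) C) \<in> linear_maps Q N"
proof -
  note S = vspace_monoid_algebra[of G] fspan_vsubspace[OF R]
  define p where "p = (SOME p. p \<in> C)"
  obtain p0 where p0: "p0 \<in> carrier (monoid_algebra G)" "C = fspan R +>\<^bsub>monoid_algebra G\<^esub> p0"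
    using quot_cases[OF S C] by blast
  have "p \<in> C" using quot_self_mem[OF S p0(1)] p0(2) by (auto simp: p_def intro: someI)
  then have p: "p \<in> carrier (monoid_algebra G)" 
    using quot_mem[OF S p0(1), of p] p0(2) by auto
  show ?thesis
    unfolding lin_ext_free_ext p_def[symmetric] free_ext_def
    using p F by (intro lin_finsum_map lin_smult_map N Q) auto
qed

end

section \<open>Tensor products\<close>

lemma keys_diff3: "Poly_Mapping.keys (fgen x - fgen y - fgen z :: 'x \<Rightarrow>\<^sub>0 'k::field) \<subseteq> {x, y, z}"
  by (auto simp: in_keys_iff lookup_minus lookup_single when_def split: if_splits)

lemma keys_diff2: "Poly_Mapping.keys (fgen x - Poly_Mapping.single y c :: 'x \<Rightarrow>\<^sub>0 'k::field) \<subseteq> {x, y}"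
  by (auto simp: in_keys_iff lookup_minus lookup_single when_def split: if_splits)

context
  fixes N :: "('k::field, 'b, 'n) module_scheme" and G :: "('x, 'm) monoid_scheme" and F :: "'x \<Rightarrow> 'b"
  assumes N: "vspace N" and F: "\<And>x. x \<in> carrier G \<Longrightarrow> F x \<in> carrier N"
begin

lemma free_ext_diff:
  assumes "Poly_Mapping.keys p \<subseteq> carrier G" "Poly_Mapping.keys q \<subseteq> carrier G"
  shows "free_ext N F (p - q) = free_ext N F p \<ominus>\<^bsub>N\<^esub> free_ext N F q"
  using lin_diff[OF free_ext_lin[of N G F, OF N F] vspace_monoid_algebra N, of p q] assms
  by (simp add: monoid_algebra_diff)

lemma free_ext_diff3:
  assumes "x \<in> carrier G" "y \<in> carrier G" "z \<in> carrier G" "F x = F y \<oplus>\<^bsub>N\<^esub> F z"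
  shows "free_ext N F (fgen x - fgen y - fgen z) = \<zero>\<^bsub>N\<^esub>"
proof -
  have "Poly_Mapping.keys (fgen x - fgen y :: 'x \<Rightarrow>\<^sub>0 'k) \<subseteq> carrier G"
    using keys_diff2[of x y 1] assms by fastforce
  then have "free_ext N F (fgen x - fgen y - fgen z) = (F x \<ominus>\<^bsub>N\<^esub> F y) \<ominus>\<^bsub>N\<^esub> F z"
    using assms by (simp add: free_ext_diff free_ext_gen[of N "carrier G" F, OF N F])
  then show ?thesis
    using assms F N by (simp add: vs_diff_eq_iff vs_comm)
qed

lemma free_ext_diff2:
  assumes "x \<in> carrier G" "y \<in> carrier G" "F x = c \<odot>\<^bsub>N\<^esub> F y"
  shows "free_ext N F (fgen x - Poly_Mapping.single y c) = \<zero>\<^bsub>N\<^esub>"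
  using assms F N
  by (simp add: free_ext_diff free_ext_gen[of N "carrier G" F, OF N F] free_ext_single[of N "carrier G" F, OF N F])

end

context
  fixes G :: "('x, 'm) monoid_scheme" and R :: "('x \<Rightarrow>\<^sub>0 'k::field) set"
  assumes R: "R \<subseteq> carrier (monoid_algebra G)"
begin

lemma pres_coset_eq:
  assumes "p - q \<in> R" "Poly_Mapping.keys p \<subseteq> carrier G" "Poly_Mapping.keys q \<subseteq> carrier G"
  shows "fspan R +>\<^bsub>monoid_algebra G\<^esub> p = fspan R +>\<^bsub>monoid_algebra G\<^esub> q"
  using assms fscale.span_base[of "p - q" R]
  by (subst quot_eq_iff[OF vspace_monoid_algebra fspan_vsubspace[OF R]]) (simp_all add: monoid_algebra_diff fspan_eq)

lemma pres_rel3: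
  assumes r: "fgen x - fgen y - fgen z \<in> R" and G: "x \<in> carrier G" "y \<in> carrier G" "z \<in> carrier G"
  shows "cls (pres G R) x = cls (pres G R) y \<oplus>\<^bsub>pres G R\<^esub> cls (pres G R) z"
proof -
  have k: "Poly_Mapping.keys (fgen y + fgen z :: 'x \<Rightarrow>\<^sub>0 'k) \<subseteq> carrier G"
    using keys_add[of "fgen y" "fgen z :: 'x \<Rightarrow>\<^sub>0 'k"] G by auto
  have "fspan R +>\<^bsub>monoid_algebra G\<^esub> fgen x = fspan R +>\<^bsub>monoid_algebra G\<^esub> (fgen y + fgen z)"
    using r G k by (intro pres_coset_eq) (auto simp: algebra_simps)
  also have "\<dots> = (fspan R +>\<^bsub>monoid_algebra G\<^esub> fgen y) \<oplus>\<^bsub>pres G R\<^esub> (fspan R +>\<^bsub>monoid_algebra G\<^esub> fgen z)"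
    using G by (subst quot_add[OF vspace_monoid_algebra fspan_vsubspace[OF R]]) auto
  finally show ?thesis using G by (simp add: cls_pres[OF R])
qed

lemma pres_rel2:
  assumes r: "fgen x - Poly_Mapping.single y c \<in> R" and G: "x \<in> carrier G" "y \<in> carrier G"
  shows "cls (pres G R) x = c \<odot>\<^bsub>pres G R\<^esub> cls (pres G R) y"
proof -
  have "fspan R +>\<^bsub>monoid_algebra G\<^esub> fgen x = fspan R +>\<^bsub>monoid_algebra G\<^esub> (fscale c (fgen y))"
    using r G by (intro pres_coset_eq) auto
  also have "\<dots> = c \<odot>\<^bsub>pres G R\<^esub> (fspan R +>\<^bsub>monoid_algebra G\<^esub> fgen y)"
    using G by (subst quot_smult[OF vspace_monoid_algebra fspan_vsubspace[OF R]]) auto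
  finally show ?thesis using G by (simp add: cls_pres[OF R])
qed

lemma pres_rel_eq:
  assumes "fgen x - fgen y \<in> R" and G: "x \<in> carrier G" "y \<in> carrier G"
  shows "cls (pres G R) x = cls (pres G R) y"
  using assms by (simp add: cls_pres[OF R] pres_coset_eq)

end

definition bilin :: "('k::field, 'a, 'm) module_scheme \<Rightarrow> ('k, 'b, 'n) module_scheme \<Rightarrow>
    ('k, 'c, 'p) module_scheme \<Rightarrow> ('a \<Rightarrow> 'b \<Rightarrow> 'c) \<Rightarrow> bool" where
  "bilin M N P F \<longleftrightarrow> (\<forall>x\<in>carrier M. (\<lambda>y. F x y) \<in> linear_maps N P) \<and>
     (\<forall>y\<in>carrier N. (\<lambda>x. F x y) \<in> linear_maps M P)"

lemma bilinI:
  "\<lbrakk>\<And>x. x \<in> carrier M \<Longrightarrow> (\<lambda>y. F x y) \<in> linear_maps N P; \<And>y. y \<in> carrier N \<Longrightarrow> (\<lambda>x. F x y) \<in> linear_maps M P\<rbrakk>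
   \<Longrightarrow> bilin M N P F"
  by (simp add: bilin_def)

lemma bilin_closed: "\<lbrakk>bilin M N P F; x \<in> carrier M; y \<in> carrier N\<rbrakk> \<Longrightarrow> F x y \<in> carrier P"
  by (auto simp: bilin_def intro: lin_closed)

lemma bilin_linD:
  "\<lbrakk>bilin M N P F; x \<in> carrier M\<rbrakk> \<Longrightarrow> (\<lambda>y. F x y) \<in> linear_maps N P"
  "\<lbrakk>bilin M N P F; y \<in> carrier N\<rbrakk> \<Longrightarrow> (\<lambda>x. F x y) \<in> linear_maps M P"
  by (auto simp: bilin_def)

lemma bilin_simps:
  "\<lbrakk>bilin M N P F; x \<in> carrier M; x' \<in> carrier M; y \<in> carrier N\<rbrakk> \<Longrightarrow> F (x \<oplus>\<^bsub>M\<^esub> x') y = F x y \<oplus>\<^bsub>P\<^esub> F x' y"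
  "\<lbrakk>bilin M N P F; x \<in> carrier M; y \<in> carrier N; y' \<in> carrier N\<rbrakk> \<Longrightarrow> F x (y \<oplus>\<^bsub>N\<^esub> y') = F x y \<oplus>\<^bsub>P\<^esub> F x y'"
  "\<lbrakk>bilin M N P F; x \<in> carrier M; y \<in> carrier N\<rbrakk> \<Longrightarrow> F (c \<odot>\<^bsub>M\<^esub> x) y = c \<odot>\<^bsub>P\<^esub> F x y"
  "\<lbrakk>bilin M N P F; x \<in> carrier M; y \<in> carrier N\<rbrakk> \<Longrightarrow> F x (c \<odot>\<^bsub>N\<^esub> y) = c \<odot>\<^bsub>P\<^esub> F x y"
  by (rule lin_add[OF bilin_linD(2)] lin_add[OF bilin_linD(1)] lin_smult[OF bilin_linD(2)] lin_smult[OF bilin_linD(1)];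
      assumption)+

lemma DirProd_carrier: "(x, y) \<in> carrier (M \<times>\<times> N) \<longleftrightarrow> x \<in> carrier M \<and> y \<in> carrier N"
  by (simp add: DirProd_def)

lemma bilinear_rels_intros:
  "\<lbrakk>x \<in> carrier M; x' \<in> carrier M; y \<in> carrier N\<rbrakk> \<Longrightarrow>
    fgen (x \<oplus>\<^bsub>M\<^esub> x', y) - fgen (x, y) - fgen (x', y) \<in> bilinear_rels M N"
  "\<lbrakk>x \<in> carrier M; y \<in> carrier N; y' \<in> carrier N\<rbrakk> \<Longrightarrow>
    fgen (x, y \<oplus>\<^bsub>N\<^esub> y') - fgen (x, y) - fgen (x, y') \<in> bilinear_rels M N"
  "\<lbrakk>x \<in> carrier M; y \<in> carrier N\<rbrakk> \<Longrightarrow> fgen (c \<odot>\<^bsub>M\<^esub> x, y) - Poly_Mapping.single (x, y) c \<in> bilinear_rels M N"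
  "\<lbrakk>x \<in> carrier M; y \<in> carrier N\<rbrakk> \<Longrightarrow> fgen (x, c \<odot>\<^bsub>N\<^esub> y) - Poly_Mapping.single (x, y) c \<in> bilinear_rels M N"
  unfolding bilinear_rels_def by fast+

lemma bilinear_rels_sub:
  assumes M: "vspace M" and N: "vspace N"
  shows "bilinear_rels M N \<subseteq> carrier (monoid_algebra (M \<times>\<times> N))"
  unfolding bilinear_rels_def monoid_algebra_simps
  by (rule subsetI, unfold mem_Collect_eq, elim UnE CollectE exE conjE; simp only:;
      (rule order_trans[OF keys_diff3] | rule order_trans[OF keys_diff2]); simp add: DirProd_carrier M N)

context
  fixes M :: "('k::field, 'a, 'm) module_scheme" and N :: "('k, 'b, 'n) module_scheme"
    and R :: "('a \<times> 'b \<Rightarrow>\<^sub>0 'k) set"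
  assumes M: "vspace M" and N: "vspace N" and R: "R \<subseteq> carrier (monoid_algebra (M \<times>\<times> N))"
begin

text \<open>With \<open>R\<close> empty this is the tensor product; a balanced tensor product has the balancing relations
  as \<open>R\<close>.\<close>

abbreviation (input) BT where "BT \<equiv> pres (M \<times>\<times> N) (bilinear_rels M N \<union> R)"

lemma bt_sub: "bilinear_rels M N \<union> R \<subseteq> carrier (monoid_algebra (M \<times>\<times> N))"
  using bilinear_rels_sub[OF M N] R by auto

lemma vspace_bt: "vspace BT"
  by (rule vspace_pres[OF bt_sub])

lemma bt_closed: "\<lbrakk>x \<in> carrier M; y \<in> carrier N\<rbrakk> \<Longrightarrow> cls BT (x, y) \<in> carrier BT"
  by (rule cls_pres_closed[OF bt_sub]) (simp add: DirProd_carrier)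

lemma bt_bilin: "bilin M N BT (\<lambda>x y. cls BT (x, y))"
proof (intro bilinI linI)
  fix x y x' y' c assume xy: "x \<in> carrier M" "y \<in> carrier N"
  show "cls BT (c \<odot>\<^bsub>M\<^esub> x, y) = c \<odot>\<^bsub>BT\<^esub> cls BT (x, y)" "cls BT (x, c \<odot>\<^bsub>N\<^esub> y) = c \<odot>\<^bsub>BT\<^esub> cls BT (x, y)"
    by (rule pres_rel2[OF bt_sub UnI1[OF bilinear_rels_intros(3)]] pres_rel2[OF bt_sub UnI1[OF bilinear_rels_intros(4)]];
        use xy M N in \<open>simp add: DirProd_carrier\<close>)+
  show "x' \<in> carrier M \<Longrightarrow> cls BT (x \<oplus>\<^bsub>M\<^esub> x', y) = cls BT (x, y) \<oplus>\<^bsub>BT\<^esub> cls BT (x', y)"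
    by (rule pres_rel3[OF bt_sub UnI1[OF bilinear_rels_intros(1)]]; use xy M N in \<open>simp add: DirProd_carrier\<close>)
  show "y' \<in> carrier N \<Longrightarrow> cls BT (x, y \<oplus>\<^bsub>N\<^esub> y') = cls BT (x, y) \<oplus>\<^bsub>BT\<^esub> cls BT (x, y')"
    by (rule pres_rel3[OF bt_sub UnI1[OF bilinear_rels_intros(2)]]; use xy M N in \<open>simp add: DirProd_carrier\<close>)
qed (simp_all add: bt_closed)

lemma bt_ext:
  assumes P: "vspace P" and F: "bilin M N P F" and r: "\<And>r. r \<in> R \<Longrightarrow> free_ext P (\<lambda>(x, y). F x y) r = \<zero>\<^bsub>P\<^esub>"
  shows "lin_ext P (\<lambda>(x, y). F x y) \<in> linear_maps BT P"
    and "\<lbrakk>x \<in> carrier M; y \<in> carrier N\<rbrakk> \<Longrightarrow> lin_ext P (\<lambda>(x, y). F x y) (cls BT (x, y)) = F x y"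
proof -
  have cl: "(\<lambda>(x, y). F x y) z \<in> carrier P" if "z \<in> carrier (M \<times>\<times> N)" for z
    using that bilin_closed[OF F] by (cases z) (auto simp: DirProd_carrier)
  have k: "free_ext P (\<lambda>(x, y). F x y) r = \<zero>\<^bsub>P\<^esub>" if "r \<in> bilinear_rels M N \<union> R" for r
  proof (cases "r \<in> R")
    case True
    then show ?thesis by (rule r)
  next
    case False
    then have "r \<in> bilinear_rels M N" using that by simp
    then show ?thesis
      unfolding bilinear_rels_def using F M N cl[of "(_, _)", simplified]
      by (auto simp: bilin_simps[OF F] DirProd_carrier bilin_closed[OF F]
          intro!: free_ext_diff3[of P "M \<times>\<times> N", OF P cl] free_ext_diff2[of P "M \<times>\<times> N", OF P cl])
  qed
  show "lin_ext P (\<lambda>(x, y). F x y) \<in> linear_maps BT P"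
    using pres_lin_ext(1)[OF bt_sub P cl k] .
  show "lin_ext P (\<lambda>(x, y). F x y) (cls BT (x, y)) = F x y" if "x \<in> carrier M" "y \<in> carrier N"
    using pres_lin_ext(2)[OF bt_sub P cl k, of "(x, y)"] that by (simp add: DirProd_carrier)
qed

lemma bt_induct [consumes 1, case_names gen add]:
  assumes t: "t \<in> carrier BT"
    and g: "\<And>x y. \<lbrakk>x \<in> carrier M; y \<in> carrier N\<rbrakk> \<Longrightarrow> Q (cls BT (x, y))"
    and a: "\<And>s t. \<lbrakk>s \<in> carrier BT; t \<in> carrier BT; Q s; Q t\<rbrakk> \<Longrightarrow> Q (s \<oplus>\<^bsub>BT\<^esub> t)"
  shows "Q t"
  using t
proof (induction t rule: pres_induct[OF bt_sub, consumes 1, case_names zero add])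
  case zero
  have "cls BT (\<zero>\<^bsub>M\<^esub>, \<zero>\<^bsub>N\<^esub>) = \<zero>\<^bsub>BT\<^esub>"
    using bt_bilin M N vspace_bt by (intro lin_zero[of _ M BT]) (auto simp: bilin_def)
  then show ?case using g[of "\<zero>\<^bsub>M\<^esub>" "\<zero>\<^bsub>N\<^esub>"] M N by simp
next
  case (add z c D)
  obtain x y where z: "z = (x, y)" "x \<in> carrier M" "y \<in> carrier N"
    using add(1) by (cases z) (auto simp: DirProd_carrier)
  have "c \<odot>\<^bsub>BT\<^esub> cls BT z = cls BT (c \<odot>\<^bsub>M\<^esub> x, y)"
    using bt_bilin z by (simp add: bilin_def lin_smult[of "\<lambda>x. cls BT (x, y)" M BT])
  then show ?case
    using add z M g[of "c \<odot>\<^bsub>M\<^esub> x" y] bt_closed[of "c \<odot>\<^bsub>M\<^esub> x" y] by (auto intro!: a)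
qed

lemma bt_lin_eq:
  assumes P: "vspace P" and "h \<in> linear_maps BT P" "h' \<in> linear_maps BT P"
    and e: "\<And>x y. \<lbrakk>x \<in> carrier M; y \<in> carrier N\<rbrakk> \<Longrightarrow> h (cls BT (x, y)) = h' (cls BT (x, y))"
    and t: "t \<in> carrier BT"
  shows "h t = h' t"
  using pres_lin_eq[OF bt_sub P assms(2,3) _ t] e by (auto simp: DirProd_def)

lemma bt_ext_param:
  assumes Q: "vspace Q" and P: "vspace P"
    and F: "\<And>x y. \<lbrakk>x \<in> carrier M; y \<in> carrier N\<rbrakk> \<Longrightarrow> (\<lambda>q. F q x y) \<in> linear_maps Q P" and t: "t \<in> carrier BT"
  shows "(\<lambda>q. lin_ext P (\<lambda>(x, y). F q x y) t) \<in> linear_maps Q P"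
  using lin_ext_param[OF bt_sub Q P _ t, of "\<lambda>q (x, y). F q x y"] F by (auto simp: DirProd_def)

lemma bt_ext_via:
  assumes P: "vspace P" "vspace P'" and \<theta>: "\<theta> \<in> linear_maps P P'" and H: "H \<in> linear_maps BT P'"
    and F: "\<And>x y. \<lbrakk>x \<in> carrier M; y \<in> carrier N\<rbrakk> \<Longrightarrow> F x y \<in> carrier P"
      "\<And>x y. \<lbrakk>x \<in> carrier M; y \<in> carrier N\<rbrakk> \<Longrightarrow> \<theta> (F x y) = H (cls BT (x, y))"
    and t: "t \<in> carrier BT"
  shows "lin_ext P (\<lambda>(x, y). F x y) t \<in> carrier P" "\<theta> (lin_ext P (\<lambda>(x, y). F x y) t) = H t"
  using lin_ext_via[OF bt_sub P \<theta> H _ _ t, of "\<lambda>(x, y). F x y"] F by (auto simp: DirProd_def)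

end

context
  fixes M :: "('k::field, 'a, 'm) module_scheme" and N :: "('k, 'b, 'n) module_scheme"
  assumes M: "vspace M" and N: "vspace N"
begin

lemma tensor_bt: "tensor M N = pres (M \<times>\<times> N) (bilinear_rels M N \<union> {})"
  by (simp add: tensor_def)

lemmas tensor_bt' = M N empty_subsetI[of "carrier (monoid_algebra (M \<times>\<times> N))"]

lemma vspace_tensor [simp]: "vspace (tensor M N)"
  unfolding tensor_bt by (rule vspace_bt[OF tensor_bt'])

lemma tens_closed [simp]: "\<lbrakk>x \<in> carrier M; y \<in> carrier N\<rbrakk> \<Longrightarrow> cls (tensor M N) (x, y) \<in> carrier (tensor M N)"
  unfolding tensor_bt by (rule bt_closed[OF tensor_bt'])

lemma tens_lin_right:
  assumes "x \<in> carrier M" and g: "g \<in> linear_maps Q N"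
  shows "(\<lambda>q. cls (tensor M N) (x, g q)) \<in> linear_maps Q (tensor M N)"
proof -
  have "(\<lambda>y. cls (tensor M N) (x, y)) \<in> linear_maps N (tensor M N)"
    using bt_bilin[OF tensor_bt'] assms(1) unfolding tensor_bt[symmetric] bilin_def by simp
  from lin_comp[OF this g] show ?thesis .
qed

lemma tens_lin_left:
  assumes "y \<in> carrier N" and g: "g \<in> linear_maps Q M"
  shows "(\<lambda>q. cls (tensor M N) (g q, y)) \<in> linear_maps Q (tensor M N)"
proof -
  have "(\<lambda>x. cls (tensor M N) (x, y)) \<in> linear_maps M (tensor M N)"
    using bt_bilin[OF tensor_bt'] assms(1) unfolding tensor_bt[symmetric] bilin_def by simp
  from lin_comp[OF this g] show ?thesis .
qed

lemma tens_add_right: 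
  "\<lbrakk>x \<in> carrier M; y \<in> carrier N; y' \<in> carrier N\<rbrakk> \<Longrightarrow> 
    cls (tensor M N) (x, y \<oplus>\<^bsub>N\<^esub> y') = cls (tensor M N) (x, y) \<oplus>\<^bsub>tensor M N\<^esub> cls (tensor M N) (x, y')"
  and tens_add_left: 
  "\<lbrakk>x \<in> carrier M; x' \<in> carrier M; y \<in> carrier N\<rbrakk> \<Longrightarrow> 
    cls (tensor M N) (x \<oplus>\<^bsub>M\<^esub> x', y) = cls (tensor M N) (x, y) \<oplus>\<^bsub>tensor M N\<^esub> cls (tensor M N) (x', y)"
  and tens_smult_right: 
  "\<lbrakk>x \<in> carrier M; y \<in> carrier N\<rbrakk> \<Longrightarrow> 
    cls (tensor M N) (x, c \<odot>\<^bsub>N\<^esub> y) = c \<odot>\<^bsub>tensor M N\<^esub> cls (tensor M N) (x, y)"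
  and tens_smult_left: 
  "\<lbrakk>x \<in> carrier M; y \<in> carrier N\<rbrakk> \<Longrightarrow> 
    cls (tensor M N) (c \<odot>\<^bsub>M\<^esub> x, y) = c \<odot>\<^bsub>tensor M N\<^esub> cls (tensor M N) (x, y)"
  and tens_minus_right: 
  "\<lbrakk>x \<in> carrier M; y \<in> carrier N\<rbrakk> \<Longrightarrow> 
    cls (tensor M N) (x, \<ominus>\<^bsub>N\<^esub> y) = \<ominus>\<^bsub>tensor M N\<^esub> cls (tensor M N) (x, y)"
  and tens_minus_left: 
  "\<lbrakk>x \<in> carrier M; y \<in> carrier N\<rbrakk> \<Longrightarrow> 
    cls (tensor M N) (\<ominus>\<^bsub>M\<^esub> x, y) = \<ominus>\<^bsub>tensor M N\<^esub> cls (tensor M N) (x, y)"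
  by (rule lin_add[OF tens_lin_right[OF _ lin_id]] lin_add[OF tens_lin_left[OF _ lin_id]]
    lin_smult[OF tens_lin_right[OF _ lin_id]] lin_smult[OF tens_lin_left[OF _ lin_id]]
    lin_minus[OF tens_lin_right[OF _ lin_id] N vspace_tensor] lin_minus[OF tens_lin_left[OF _ lin_id] M vspace_tensor]; assumption)+

lemma tensor_ext_lin:
  assumes "vspace P" and "bilin M N P F" and "g \<in> linear_maps Q (tensor M N)"
  shows "(\<lambda>q. lin_ext P (\<lambda>(x, y). F x y) (g q)) \<in> linear_maps Q P"
  using lin_comp[OF bt_ext(1)[OF tensor_bt' assms(1,2)], of g Q] assms(3) unfolding tensor_bt by simp

lemma tensor_ext_cls:
  assumes "vspace P" and "bilin M N P F" and "x \<in> carrier M" "y \<in> carrier N"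
  shows "lin_ext P (\<lambda>(x, y). F x y) (cls (tensor M N) (x, y)) = F x y"
  using bt_ext(2)[OF tensor_bt' assms(1,2) _ assms(3,4)] unfolding tensor_bt by simp

lemma tensor_ext_param:
  assumes Q: "vspace Q" and P: "vspace P"
    and F: "\<And>x y. \<lbrakk>x \<in> carrier M; y \<in> carrier N\<rbrakk> \<Longrightarrow> (\<lambda>q. F q x y) \<in> linear_maps Q P" and t: "t \<in> carrier (tensor M N)"
  shows "(\<lambda>q. lin_ext P (\<lambda>(x, y). F q x y) t) \<in> linear_maps Q P"
  using bt_ext_param[OF tensor_bt' Q P F] t unfolding tensor_bt by simp

lemma tensor_lin_eq:
  assumes P: "vspace P" and "h \<in> linear_maps (tensor M N) P" "h' \<in> linear_maps (tensor M N) P"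
    and e: "\<And>x y. \<lbrakk>x \<in> carrier M; y \<in> carrier N\<rbrakk> \<Longrightarrow> h (cls (tensor M N) (x, y)) = h' (cls (tensor M N) (x, y))"
    and t: "t \<in> carrier (tensor M N)"
  shows "h t = h' t"
  using bt_lin_eq[OF tensor_bt' P, of h h' t] assms unfolding tensor_bt by auto

end

section \<open>Tensor powers and words\<close>

text \<open>Linearity is asked one position at a time, by updating a list.\<close>

definition multilin :: "('k::field, 'v, 'm) module_scheme \<Rightarrow> nat \<Rightarrow> ('k, 'b, 'n) module_scheme \<Rightarrow>
    ('v list \<Rightarrow> 'b) \<Rightarrow> bool" where
  "multilin V n N F \<longleftrightarrow> (\<forall>xs. set xs \<subseteq> carrier V \<longrightarrow> length xs = n \<longrightarrow> F xs \<in> carrier N \<and>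
     (\<forall>i<n. (\<lambda>x. F (xs[i := x])) \<in> linear_maps V N))"

lemma multilinI:
  assumes "\<And>xs. \<lbrakk>set xs \<subseteq> carrier V; length xs = n\<rbrakk> \<Longrightarrow> F xs \<in> carrier N"
    and "\<And>xs i. \<lbrakk>set xs \<subseteq> carrier V; length xs = n; i < n\<rbrakk> \<Longrightarrow> (\<lambda>x. F (xs[i := x])) \<in> linear_maps V N"
  shows "multilin V n N F"
  using assms by (simp add: multilin_def)

lemma multilin_closed: "\<lbrakk>multilin V n N F; set xs \<subseteq> carrier V; length xs = n\<rbrakk> \<Longrightarrow> F xs \<in> carrier N"
  and multilin_lin: "\<lbrakk>multilin V n N F; set xs \<subseteq> carrier V; length xs = n; i < n\<rbrakk> \<Longrightarrow> (\<lambda>x. F (xs[i := x])) \<in> linear_maps V N"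
  by (auto simp: multilin_def)

lemma multilin_append_lin:
  assumes "multilin V n N F" "set us \<subseteq> carrier V" "set vs \<subseteq> carrier V" "length us + 1 + length vs = n" "vspace V"
  shows "(\<lambda>x. F (us @ [x] @ vs)) \<in> linear_maps V N"
  using multilin_lin[OF assms(1), of "us @ [\<zero>\<^bsub>V\<^esub>] @ vs" "length us"] assms by simp

lemma multilinear_rels_sub:
  assumes V: "vspace V"
  shows "multilinear_rels V n \<subseteq> {p. Poly_Mapping.keys p \<subseteq> {xs. set xs \<subseteq> carrier V \<and> length xs = n}}"
  unfolding multilinear_rels_def
  by (rule subsetI, unfold mem_Collect_eq, elim UnE CollectE exE conjE; simp only:;
      (rule order_trans[OF keys_diff3] | rule order_trans[OF keys_diff2]); simp add: V lists_eq_set)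

lemma multilinear_rels_intros:
  "\<lbrakk>set us \<subseteq> carrier V; set vs \<subseteq> carrier V; x \<in> carrier V; y \<in> carrier V; length us + 1 + length vs = n\<rbrakk> \<Longrightarrow>
    fgen (us @ [x \<oplus>\<^bsub>V\<^esub> y] @ vs) - fgen (us @ [x] @ vs) - fgen (us @ [y] @ vs) \<in> multilinear_rels V n"
  "\<lbrakk>set us \<subseteq> carrier V; set vs \<subseteq> carrier V; x \<in> carrier V; length us + 1 + length vs = n\<rbrakk> \<Longrightarrow>
    fgen (us @ [c \<odot>\<^bsub>V\<^esub> x] @ vs) - Poly_Mapping.single (us @ [x] @ vs) c \<in> multilinear_rels V n"
  unfolding multilinear_rels_def lists_eq_set by fast+

text \<open>Tensor powers and the tensor algebra are both spanned by words, with lengths in a set \<open>I\<close>.\<close>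

context
  fixes V :: "('k::field, 'v, 'm) module_scheme" and I :: "nat set" and G :: "('v list, 'g) monoid_scheme"
  assumes V: "vspace V" and G: "carrier G = {xs. set xs \<subseteq> carrier V \<and> length xs \<in> I}"
begin

abbreviation (input) WT where "WT \<equiv> pres G (\<Union>n\<in>I. multilinear_rels V n)"

lemma wt_sub: "(\<Union>n\<in>I. multilinear_rels V n) \<subseteq> carrier (monoid_algebra G)"
  using multilinear_rels_sub[OF V] by (fastforce simp: G)

lemma wt_cls_lin:
  assumes "set xs \<subseteq> carrier V" "length xs \<in> I" "i < length xs"
  shows "(\<lambda>x. cls WT (xs[i := x])) \<in> linear_maps V WT"
proof (rule linI)
  note u = upd_conv_take_nth_drop[OF assms(3)]
  have t: "set (take i xs) \<subseteq> carrier V" "set (drop (Suc i) xs) \<subseteq> carrier V"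
    using assms set_take_subset[of i xs] set_drop_subset[of "Suc i" xs] by auto
  have s: "set (xs[i := x]) \<subseteq> carrier V" if "x \<in> carrier V" for x
    using assms that set_update_subset_insert[of xs i x] by auto
  fix x assume x: "x \<in> carrier V"
  show "cls WT (xs[i := x]) \<in> carrier WT"
    using x assms s by (intro cls_pres_closed[OF wt_sub]) (simp add: G)
  show "cls WT (xs[i := c \<odot>\<^bsub>V\<^esub> x]) = c \<odot>\<^bsub>WT\<^esub> cls WT (xs[i := x])" for c
  proof (rule pres_rel2[OF wt_sub])
    show "fgen (xs[i := c \<odot>\<^bsub>V\<^esub> x]) - Poly_Mapping.single (xs[i := x]) c \<in> (\<Union>n\<in>I. multilinear_rels V n)"
      using x t assms multilinear_rels_intros(2)[of "take i xs" V "drop (Suc i) xs" x "length xs" c]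
      by (intro UN_I[OF assms(2)]) (simp add: u)
  qed (use x assms s V in \<open>auto simp: G\<close>)
  fix y assume y: "y \<in> carrier V"
  show "cls WT (xs[i := x \<oplus>\<^bsub>V\<^esub> y]) = cls WT (xs[i := x]) \<oplus>\<^bsub>WT\<^esub> cls WT (xs[i := y])"
  proof (rule pres_rel3[OF wt_sub])
    show "fgen (xs[i := x \<oplus>\<^bsub>V\<^esub> y]) - fgen (xs[i := x]) - fgen (xs[i := y]) \<in> (\<Union>n\<in>I. multilinear_rels V n)"
      using x y t assms multilinear_rels_intros(1)[of "take i xs" V "drop (Suc i) xs" x y "length xs"]
      by (intro UN_I[OF assms(2)]) (simp add: u)
  qed (use x y assms s V in \<open>auto simp: G\<close>)
qed

lemma wt_ext:
  assumes N: "vspace N" and F: "\<And>n. n \<in> I \<Longrightarrow> multilin V n N F"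
  shows "lin_ext N F \<in> linear_maps WT N"
    and "\<lbrakk>set xs \<subseteq> carrier V; length xs \<in> I\<rbrakk> \<Longrightarrow> lin_ext N F (cls WT xs) = F xs"
proof -
  have cl: "F xs \<in> carrier N" if "xs \<in> carrier G" for xs
    using that F multilin_closed by (fastforce simp: G)
  have k: "free_ext N F r = \<zero>\<^bsub>N\<^esub>" if "r \<in> (\<Union>n\<in>I. multilinear_rels V n)" for r
  proof -
    from that obtain n where n: "n \<in> I" "r \<in> multilinear_rels V n" by blast
    note L = multilin_append_lin[OF F[OF n(1)] _ _ _ V]
    from n(2) show ?thesis
      unfolding multilinear_rels_def
    proof (elim UnE CollectE exE conjE)
      fix us x y vs
      assume r: "r = fgen (us @ [x \<oplus>\<^bsub>V\<^esub> y] @ vs) - fgen (us @ [x] @ vs) - fgen (us @ [y] @ vs)"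
        and *: "us \<in> lists (carrier V)" "vs \<in> lists (carrier V)" "x \<in> carrier V" "y \<in> carrier V"
          "length us + 1 + length vs = n"
      show ?thesis
        unfolding r by (rule free_ext_diff3[of N G, OF N cl])
          (use * n V lin_add[OF L[of us vs], of x y] in \<open>simp_all add: G lists_eq_set\<close>)
    next
      fix us x c vs
      assume r: "r = fgen (us @ [c \<odot>\<^bsub>V\<^esub> x] @ vs) - Poly_Mapping.single (us @ [x] @ vs) c"
        and *: "us \<in> lists (carrier V)" "vs \<in> lists (carrier V)" "x \<in> carrier V" 
          "length us + 1 + length vs = n"
      show ?thesis
        unfolding r by (rule free_ext_diff2[of N G, OF N cl])
          (use * n V lin_smult[OF L[of us vs], of x c] in \<open>simp_all add: G lists_eq_set\<close>)
    qed
  qed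
  show "lin_ext N F \<in> linear_maps WT N"
    using pres_lin_ext(1)[OF wt_sub N cl k] .
  show "lin_ext N F (cls WT xs) = F xs" if "set xs \<subseteq> carrier V" "length xs \<in> I"
    using pres_lin_ext(2)[OF wt_sub N cl k, of xs] that by (simp add: G)
qed

end

section \<open>Algebras\<close>

context
  fixes A :: "('k::field, 'a, 'm) module_scheme" (structure)
  assumes A: "assoc_algebra A"
begin

interpretation assoc_algebra A by (rule A)

lemma alg_vspace [simp]: "vspace A" ..
lemma alg_ring: "ring A" ..
lemma alg_monoid: "Group.monoid A" ..

lemma alg_mult_closed [simp]: "\<lbrakk>x \<in> carrier A; y \<in> carrier A\<rbrakk> \<Longrightarrow> x \<otimes> y \<in> carrier A"
  and alg_one_closed [simp]: "\<one> \<in> carrier A"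
  and alg_assoc: "\<lbrakk>x \<in> carrier A; y \<in> carrier A; z \<in> carrier A\<rbrakk> \<Longrightarrow> (x \<otimes> y) \<otimes> z = x \<otimes> (y \<otimes> z)"
  and alg_l_one [simp]: "x \<in> carrier A \<Longrightarrow> \<one> \<otimes> x = x"
  and alg_r_one [simp]: "x \<in> carrier A \<Longrightarrow> x \<otimes> \<one> = x"
  and alg_l_distr: "\<lbrakk>x \<in> carrier A; y \<in> carrier A; z \<in> carrier A\<rbrakk> \<Longrightarrow> (x \<oplus> y) \<otimes> z = x \<otimes> z \<oplus> y \<otimes> z"
  and alg_r_distr: "\<lbrakk>x \<in> carrier A; y \<in> carrier A; z \<in> carrier A\<rbrakk> \<Longrightarrow> z \<otimes> (x \<oplus> y) = z \<otimes> x \<oplus> z \<otimes> y"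
  and alg_minus_left: "\<lbrakk>x \<in> carrier A; y \<in> carrier A\<rbrakk> \<Longrightarrow> (\<ominus> x) \<otimes> y = \<ominus> (x \<otimes> y)"
  and alg_minus_right: "\<lbrakk>x \<in> carrier A; y \<in> carrier A\<rbrakk> \<Longrightarrow> x \<otimes> (\<ominus> y) = \<ominus> (x \<otimes> y)"
  and alg_l_null [simp]: "x \<in> carrier A \<Longrightarrow> \<zero> \<otimes> x = \<zero>"
  and alg_r_null [simp]: "x \<in> carrier A \<Longrightarrow> x \<otimes> \<zero> = \<zero>"
  and alg_smult_left: "\<lbrakk>x \<in> carrier A; y \<in> carrier A\<rbrakk> \<Longrightarrow> (c \<odot> x) \<otimes> y = c \<odot> (x \<otimes> y)"
  and alg_smult_right: "\<lbrakk>x \<in> carrier A; y \<in> carrier A\<rbrakk> \<Longrightarrow> x \<otimes> (c \<odot> y) = c \<odot> (x \<otimes> y)"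
  using m_assoc[of x y z] l_distr[of x y z] r_distr[of x y z] l_minus[of x y] r_minus[of x y]
    smult_mult_left[of x y c] smult_mult_right[of x y c]
  by auto

end

lemma alg_diff_left: "\<lbrakk>assoc_algebra A; x \<in> carrier A; y \<in> carrier A; z \<in> carrier A\<rbrakk>
    \<Longrightarrow> (x \<ominus>\<^bsub>A\<^esub> y) \<otimes>\<^bsub>A\<^esub> z = x \<otimes>\<^bsub>A\<^esub> z \<ominus>\<^bsub>A\<^esub> y \<otimes>\<^bsub>A\<^esub> z"
  and alg_diff_right: "\<lbrakk>assoc_algebra A; x \<in> carrier A; y \<in> carrier A; z \<in> carrier A\<rbrakk>
    \<Longrightarrow> z \<otimes>\<^bsub>A\<^esub> (x \<ominus>\<^bsub>A\<^esub> y) = z \<otimes>\<^bsub>A\<^esub> x \<ominus>\<^bsub>A\<^esub> z \<otimes>\<^bsub>A\<^esub> y"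
  by (simp_all add: vs_diff_def alg_l_distr alg_r_distr alg_minus_left alg_minus_right)

lemma assoc_algebraI:
  assumes V: "vspace A" and B: "bilin A A A (\<lambda>x y. x \<otimes>\<^bsub>A\<^esub> y)" and "\<one>\<^bsub>A\<^esub> \<in> carrier A"
    and as: "\<And>x y z. \<lbrakk>x \<in> carrier A; y \<in> carrier A; z \<in> carrier A\<rbrakk> \<Longrightarrow> (x \<otimes>\<^bsub>A\<^esub> y) \<otimes>\<^bsub>A\<^esub> z = x \<otimes>\<^bsub>A\<^esub> (y \<otimes>\<^bsub>A\<^esub> z)"
    and un: "\<And>x. x \<in> carrier A \<Longrightarrow> \<one>\<^bsub>A\<^esub> \<otimes>\<^bsub>A\<^esub> x = x" "\<And>x. x \<in> carrier A \<Longrightarrow> x \<otimes>\<^bsub>A\<^esub> \<one>\<^bsub>A\<^esub> = x"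
  shows "assoc_algebra A"
proof -
  have "ring A"
  proof (rule ringI)
    show "abelian_group A" using V by (rule vspace_abelian_group)
    show "Group.monoid A"
      by (rule monoidI) (use assms bilin_closed[OF B] in auto)
  qed (rule bilin_simps(1,2)[OF B]; assumption)+
  then show ?thesis
    using V bilin_simps(3,4)[OF B] by (intro assoc_algebra.intro assoc_algebra_axioms.intro) auto
qed

lemma alg_lin_left: "\<lbrakk>assoc_algebra A; a \<in> carrier A; g \<in> linear_maps Q A\<rbrakk> \<Longrightarrow> (\<lambda>q. a \<otimes>\<^bsub>A\<^esub> g q) \<in> linear_maps Q A"
  by (rule linI) (simp_all add: lin_closed lin_add lin_smult alg_r_distr alg_smult_right)

lemma alg_lin_right: "\<lbrakk>assoc_algebra A; a \<in> carrier A; g \<in> linear_maps Q A\<rbrakk> \<Longrightarrow> (\<lambda>q. g q \<otimes>\<^bsub>A\<^esub> a) \<in> linear_maps Q A"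
  by (rule linI) (simp_all add: lin_closed lin_add lin_smult alg_l_distr alg_smult_left)

lemma free_lin_eq:
  assumes N: "vspace N" and h: "h \<in> linear_maps (monoid_algebra G) N" "h' \<in> linear_maps (monoid_algebra G) N"
    and e: "\<And>x. x \<in> carrier G \<Longrightarrow> h (fgen x) = h' (fgen x)" and p: "p \<in> carrier (monoid_algebra G)"
  shows "h p = h' p"
  using free_ext_unique[OF N h(1), of p "\<lambda>x. h (fgen x)"] free_ext_unique[OF N h(2), of p "\<lambda>x. h (fgen x)"] e p
  by simp

lemma finsum_monoid_algebra:
  assumes "f \<in> S \<rightarrow> carrier (monoid_algebra G)"
  shows "finsum (monoid_algebra G) f S = sum f S"
proof -
  interpret M: abelian_monoid "monoid_algebra G" by (rule vspace_abelian_monoid) simp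
  show ?thesis
  proof (cases "finite S")
    case True
    then show ?thesis using assms
    proof (induction S)
      case (insert a S)
      then have "f \<in> S \<rightarrow> carrier (monoid_algebra G)" "f a \<in> carrier (monoid_algebra G)" by auto
      then show ?case using insert by (subst M.finsum_insert) auto
    qed (simp add: M.finsum_empty)
  qed (simp add: M.finsum_infinite)
qed

lemma free_ext_monoid_algebra:
  assumes "\<And>x. x \<in> Poly_Mapping.keys p \<Longrightarrow> F x \<in> carrier (monoid_algebra G)"
  shows "free_ext (monoid_algebra G) F p = (\<Sum>x\<in>Poly_Mapping.keys p. fscale (Poly_Mapping.lookup p x) (F x))"
  unfolding free_ext_def
  by (subst finsum_monoid_algebra) (use assms in \<open>auto dest!: subsetD[OF keys_fscale]\<close>)

lemma free_ext_param:
  assumes Q: "vspace Q" and N: "vspace N" and F: "\<And>x. x \<in> carrier G \<Longrightarrow> (\<lambda>q. F q x) \<in> linear_maps Q N" 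
    and p: "Poly_Mapping.keys p \<subseteq> carrier G"
  shows "(\<lambda>q. free_ext N (F q) p) \<in> linear_maps Q N"
  unfolding free_ext_def using p F by (intro lin_finsum_map lin_smult_map N Q) auto

context
  fixes G :: "('x, 'm) monoid_scheme" (structure) and F :: "('k::field, 'x \<Rightarrow>\<^sub>0 'k) module"
  assumes G: "Group.monoid G" defines "F \<equiv> monoid_algebra G"
begin

interpretation G: Group.monoid G by (rule G)

lemma F_simps:
  "vspace F" "p \<in> carrier F \<longleftrightarrow> Poly_Mapping.keys p \<subseteq> carrier G" "zero F = 0" "add F = (+)" "module.smult F = fscale"
  "one F = fgen \<one>"
  by (simp_all add: F_def)

lemma monoid_algebra_mult:
  assumes p: "p \<in> carrier F" and q: "q \<in> carrier F"
  shows "p \<otimes>\<^bsub>F\<^esub> q = free_ext F (\<lambda>x. free_ext F (\<lambda>y. fgen (x \<otimes> y)) q) p"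
proof -
  have "free_ext F (\<lambda>y. fgen (x \<otimes> y)) q \<in> carrier (monoid_algebra G)" if "x \<in> carrier G" for x
    using free_ext_closed[of F "carrier G" "\<lambda>y. fgen (x \<otimes> y)" q] that q by (simp add: F_def)
  then have "free_ext F (\<lambda>x. free_ext F (\<lambda>y. fgen (x \<otimes> y)) q) p
     = (\<Sum>x\<in>Poly_Mapping.keys p. fscale (Poly_Mapping.lookup p x) (free_ext F (\<lambda>y. fgen (x \<otimes> y)) q))"
    unfolding F_def using p by (intro free_ext_monoid_algebra) (auto simp: F_def)
  also have "\<dots> = (\<Sum>x\<in>Poly_Mapping.keys p. fscale (Poly_Mapping.lookup p x)
      (\<Sum>y\<in>Poly_Mapping.keys q. fscale (Poly_Mapping.lookup q y) (fgen (x \<otimes> y))))"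
    unfolding F_def using p q
    by (intro sum.cong refl arg_cong[of _ _ "fscale _"] free_ext_monoid_algebra) (auto simp: F_def)
  also have "\<dots> = p \<otimes>\<^bsub>F\<^esub> q"
    by (simp add: F_def monoid_algebra_def fscale.scale_sum_right)
  finally show ?thesis by simp
qed

lemma monoid_algebra_bilin: "bilin F F F (\<lambda>p q. p \<otimes>\<^bsub>F\<^esub> q)"
proof (rule bilinI)
  have in1: "free_ext F (\<lambda>y. fgen (x \<otimes> y)) \<in> linear_maps F F" if "x \<in> carrier G" for x
    using free_ext_lin[of F G "\<lambda>y. fgen (x \<otimes> y)"] that unfolding F_def by simp
  fix p assume p: "p \<in> carrier F"
  show "(\<lambda>q. p \<otimes>\<^bsub>F\<^esub> q) \<in> linear_maps F F"
  proof (rule lin_cong[OF free_ext_param[OF F_simps(1) F_simps(1) in1]])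
    show "free_ext F (\<lambda>x. free_ext F (\<lambda>y. fgen (x \<otimes> y)) q) p = p \<otimes>\<^bsub>F\<^esub> q" if "q \<in> carrier F" for q
      using monoid_algebra_mult[OF p that] by simp
  qed (use p in \<open>simp_all add: F_simps\<close>)
  show "(\<lambda>q. q \<otimes>\<^bsub>F\<^esub> p) \<in> linear_maps F F"
  proof (rule lin_cong)
    show "free_ext F (\<lambda>x. free_ext F (\<lambda>y. fgen (x \<otimes> y)) p) \<in> linear_maps F F"
      using free_ext_lin[of F G "\<lambda>x. free_ext F (\<lambda>y. fgen (x \<otimes> y)) p"] lin_closed[OF in1 p] F_simps(1)
      unfolding F_def by simp
    show "free_ext F (\<lambda>x. free_ext F (\<lambda>y. fgen (x \<otimes> y)) p) q = q \<otimes>\<^bsub>F\<^esub> p" if "q \<in> carrier F" for q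
      using monoid_algebra_mult[OF that p] by simp
  qed (rule F_simps(1))
qed

lemma monoid_algebra_mult_gen: "\<lbrakk>x \<in> carrier G; y \<in> carrier G\<rbrakk> \<Longrightarrow> fgen x \<otimes>\<^bsub>F\<^esub> fgen y = fgen (x \<otimes> y)"
  by (simp add: F_def monoid_algebra_def)

lemma assoc_algebra_monoid_algebra: "assoc_algebra F"
proof (rule assoc_algebraI)
  note l = bilin_linD(1)[OF monoid_algebra_bilin] and r = bilin_linD(2)[OF monoid_algebra_bilin]
  note c = bilin_closed[OF monoid_algebra_bilin]
  note eq = free_lin_eq[of F _ G, folded F_def, OF F_simps(1)]
  have g: "fgen x \<in> carrier F" if "x \<in> carrier G" for x
    using that by (simp add: F_simps)
  show "vspace F" "bilin F F F (\<lambda>x y. x \<otimes>\<^bsub>F\<^esub> y)" by (rule F_simps monoid_algebra_bilin)+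
  show "\<one>\<^bsub>F\<^esub> \<in> carrier F" by (simp add: F_simps)
  show "\<one>\<^bsub>F\<^esub> \<otimes>\<^bsub>F\<^esub> p = p" if "p \<in> carrier F" for p
    by (rule eq[OF l lin_id _ that]) (simp_all add: F_simps monoid_algebra_mult_gen)
  show "p \<otimes>\<^bsub>F\<^esub> \<one>\<^bsub>F\<^esub> = p" if "p \<in> carrier F" for p
    by (rule eq[OF r lin_id _ that]) (simp_all add: F_simps monoid_algebra_mult_gen)
  fix p q s assume p: "p \<in> carrier F" and q: "q \<in> carrier F" and s: "s \<in> carrier F"
  have 1: "(fgen x \<otimes>\<^bsub>F\<^esub> fgen y) \<otimes>\<^bsub>F\<^esub> s = fgen x \<otimes>\<^bsub>F\<^esub> (fgen y \<otimes>\<^bsub>F\<^esub> s)" 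
    if "x \<in> carrier G" "y \<in> carrier G" for x y
    by (rule eq[OF l lin_comp[OF l l] _ s])
      (use that in \<open>simp_all add: g c monoid_algebra_mult_gen G.m_assoc\<close>)
  have 2: "(fgen x \<otimes>\<^bsub>F\<^esub> q) \<otimes>\<^bsub>F\<^esub> s = fgen x \<otimes>\<^bsub>F\<^esub> (q \<otimes>\<^bsub>F\<^esub> s)" if "x \<in> carrier G" for x
    by (rule eq[OF lin_comp[OF r l] lin_comp[OF l r] _ q]) (use that s in \<open>simp_all add: g 1\<close>)
  show "(p \<otimes>\<^bsub>F\<^esub> q) \<otimes>\<^bsub>F\<^esub> s = p \<otimes>\<^bsub>F\<^esub> (q \<otimes>\<^bsub>F\<^esub> s)"
    by (rule eq[OF lin_comp[OF r r] r _ p]) (use q s in \<open>simp_all add: c 2\<close>)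
qed

text \<open>It is enough to multiply the relations by basis elements: these span the monoid algebra, and
  multiplication is bilinear.\<close>

lemma fspan_ideal:
  assumes R: "R \<subseteq> carrier F"
    and l: "\<And>r x. \<lbrakk>r \<in> R; x \<in> carrier G\<rbrakk> \<Longrightarrow> fgen x \<otimes>\<^bsub>F\<^esub> r \<in> fspan R"
    and r: "\<And>r x. \<lbrakk>r \<in> R; x \<in> carrier G\<rbrakk> \<Longrightarrow> r \<otimes>\<^bsub>F\<^esub> fgen x \<in> fspan R"
  shows "ideal (fspan R) F"
proof (rule idealI)
  note A = assoc_algebra_monoid_algebra
  note V = alg_vspace[OF A]
  have W: "vsubspace (fspan R) F"
    using fspan_vsubspace R unfolding F_def by blast
  have W': "fspan R \<subseteq> carrier F" "0 \<in> fspan R" "\<And>x y. x \<in> fspan R \<Longrightarrow> y \<in> fspan R \<Longrightarrow> x + y \<in> fspan R"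
      "\<And>c x. x \<in> fspan R \<Longrightarrow> fscale c x \<in> fspan R"
    using W by (auto simp: vsubspace_def F_simps)
  show "ring F" by (rule alg_ring[OF A])
  show "subgroup (fspan R) (add_monoid F)"
    using vsubspace_abelian_subgroup[OF V W] additive_subgroup.a_subgroup abelian_subgroup_def by blast
  have step: "p \<otimes>\<^bsub>F\<^esub> s \<in> fspan R \<and> s \<otimes>\<^bsub>F\<^esub> p \<in> fspan R" if s: "s \<in> R" and p: "Poly_Mapping.keys p \<subseteq> carrier G" for s p
    using p
  proof (induction p rule: free_induct)
    case zero
    then show ?case using alg_l_null[OF A, of s] alg_r_null[OF A, of s] s R W' by (auto simp: F_simps(3))
  next
    case (add p x c)
    have *: "fscale c (fgen x) \<in> carrier F" "fgen x \<in> carrier F" "p \<in> carrier F" "s \<in> carrier F"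
      using add s subsetD[OF R s] by (auto simp: F_simps)
    have "(fscale c (fgen x) + p) \<otimes>\<^bsub>F\<^esub> s = fscale c (fgen x \<otimes>\<^bsub>F\<^esub> s) + p \<otimes>\<^bsub>F\<^esub> s"
      using alg_l_distr[OF A *(1,3,4)] alg_smult_left[OF A *(2,4), of c] unfolding F_simps by simp
    moreover have "s \<otimes>\<^bsub>F\<^esub> (fscale c (fgen x) + p) = fscale c (s \<otimes>\<^bsub>F\<^esub> fgen x) + s \<otimes>\<^bsub>F\<^esub> p"
      using alg_r_distr[OF A *(1,3,4)] alg_smult_right[OF A *(4,2), of c] unfolding F_simps by simp
    ultimately show ?case using add l[OF s] r[OF s] W' by simp
  qed
  have "fspan R \<subseteq> {w \<in> carrier F. p \<otimes>\<^bsub>F\<^esub> w \<in> fspan R \<and> w \<otimes>\<^bsub>F\<^esub> p \<in> fspan R}" if p: "p \<in> carrier F" for p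
    unfolding fspan_eq
  proof (rule fscale.span_minimal, unfold fspan_eq[symmetric])
    show "R \<subseteq> {w \<in> carrier F. p \<otimes>\<^bsub>F\<^esub> w \<in> fspan R \<and> w \<otimes>\<^bsub>F\<^esub> p \<in> fspan R}"
      using step[of _ p] subsetD[OF R] p unfolding F_simps(2)[of p] by blast
    have "x + y \<in> carrier F" "fscale c x \<in> carrier F" "(0::'x \<Rightarrow>\<^sub>0 'k) \<in> carrier F"
      if "x \<in> carrier F" "y \<in> carrier F" for x y c
      using vs_add_closed[OF V that] vs_smult_closed[OF V that(1), of c] vs_zero_closed[OF V] by (simp_all add: F_simps(3-5))
    then show "fscale.subspace {w \<in> carrier F. p \<otimes>\<^bsub>F\<^esub> w \<in> fspan R \<and> w \<otimes>\<^bsub>F\<^esub> p \<in> fspan R}"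
      using alg_r_distr[OF A _ _ p] alg_l_distr[OF A _ _ p] alg_smult_left[OF A _ p] alg_smult_right[OF A p]
        alg_l_null[OF A p] alg_r_null[OF A p] W'(2-4) p
      unfolding F_simps(3-5) fscale.subspace_def by auto
  qed
  then show "x \<otimes>\<^bsub>F\<^esub> a \<in> fspan R" "a \<otimes>\<^bsub>F\<^esub> x \<in> fspan R" if "a \<in> fspan R" "x \<in> carrier F" for a x
    using that by auto
qed

lemma monoid_algebra_mult_diff:
  assumes "g \<in> carrier G" "x \<in> carrier G" "y \<in> carrier G" "z \<in> carrier G"
  shows "fgen g \<otimes>\<^bsub>F\<^esub> (fgen x - fgen y - fgen z) = fgen (g \<otimes> x) - fgen (g \<otimes> y) - fgen (g \<otimes> z)"
    and "(fgen x - fgen y - fgen z) \<otimes>\<^bsub>F\<^esub> fgen g = fgen (x \<otimes> g) - fgen (y \<otimes> g) - fgen (z \<otimes> g)"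
    and "fgen g \<otimes>\<^bsub>F\<^esub> (fgen x - Poly_Mapping.single y c) = fgen (g \<otimes> x) - Poly_Mapping.single (g \<otimes> y) c"
    and "(fgen x - Poly_Mapping.single y c) \<otimes>\<^bsub>F\<^esub> fgen g = fgen (x \<otimes> g) - Poly_Mapping.single (y \<otimes> g) c"
proof -
  note A = assoc_algebra_monoid_algebra
  have d: "p - q = p \<ominus>\<^bsub>F\<^esub> q" if "p \<in> carrier F" "q \<in> carrier F" for p q
    using that monoid_algebra_diff[of p G q] by (simp add: F_def)
  have cl: "fgen x \<in> carrier F" "Poly_Mapping.single x c \<in> carrier F" if "x \<in> carrier G" for x c
    using that by (auto simp: F_simps)
  have s: "Poly_Mapping.single x c = c \<odot>\<^bsub>F\<^esub> fgen x" for x c by (simp add: F_simps)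
  show "fgen g \<otimes>\<^bsub>F\<^esub> (fgen x - fgen y - fgen z) = fgen (g \<otimes> x) - fgen (g \<otimes> y) - fgen (g \<otimes> z)"
    "(fgen x - fgen y - fgen z) \<otimes>\<^bsub>F\<^esub> fgen g = fgen (x \<otimes> g) - fgen (y \<otimes> g) - fgen (z \<otimes> g)"
    using assms A by (simp_all add: d cl alg_diff_right alg_diff_left monoid_algebra_mult_gen)
  show "fgen g \<otimes>\<^bsub>F\<^esub> (fgen x - Poly_Mapping.single y c) = fgen (g \<otimes> x) - Poly_Mapping.single (g \<otimes> y) c"
    "(fgen x - Poly_Mapping.single y c) \<otimes>\<^bsub>F\<^esub> fgen g = fgen (x \<otimes> g) - Poly_Mapping.single (y \<otimes> g) c"
    using assms A
    by (simp_all add: d cl alg_diff_right alg_diff_left monoid_algebra_mult_gen s[of _ c] alg_smult_left alg_smult_right)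
qed

end

lemma ideal_vsubspace:
  assumes A: "assoc_algebra A" and W: "ideal W A"
  shows "vsubspace W A"
proof -
  interpret ideal W A by (rule W)
  have "c \<odot>\<^bsub>A\<^esub> x \<in> W" if "x \<in> W" for c x
    using I_l_closed[OF that, of "c \<odot>\<^bsub>A\<^esub> \<one>\<^bsub>A\<^esub>"] that A a_subset
    by (auto simp: alg_smult_left subset_iff)
  then show ?thesis using a_subset by (auto simp: vsubspace_def)
qed

lemma quot_mult:
  assumes W: "ideal W A" and "x \<in> carrier A" "y \<in> carrier A"
  shows "(W +>\<^bsub>A\<^esub> x) \<otimes>\<^bsub>quot A W\<^esub> (W +>\<^bsub>A\<^esub> y) = W +>\<^bsub>A\<^esub> (x \<otimes>\<^bsub>A\<^esub> y)"
  using ideal.rcoset_mult_add[OF assms] by (simp add: quot_simps)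

lemma assoc_algebra_quot:
  assumes A: "assoc_algebra A" and W: "ideal W A"
  shows "assoc_algebra (quot A W)"
proof (rule assoc_algebraI)
  note V = alg_vspace[OF A] ideal_vsubspace[OF A W]
  have one: "\<one>\<^bsub>quot A W\<^esub> = W +>\<^bsub>A\<^esub> \<one>\<^bsub>A\<^esub>" by (simp add: quot_simps)
  note s = quot_mult[OF W] quot_add[OF V] quot_smult[OF V] one coset_in_quot[OF V]
  note e = quot_cases[OF V]
  show "vspace (quot A W)" by (rule vspace_quot[OF V])
  show "bilin (quot A W) (quot A W) (quot A W) (\<lambda>x y. x \<otimes>\<^bsub>quot A W\<^esub> y)"
    by (rule bilinI; rule linI)
      (auto elim!: e simp: s A alg_l_distr alg_r_distr alg_smult_left alg_smult_right)
  show "\<one>\<^bsub>quot A W\<^esub> \<in> carrier (quot A W)" using A by (simp add: s)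
  show "(x \<otimes>\<^bsub>quot A W\<^esub> y) \<otimes>\<^bsub>quot A W\<^esub> z = x \<otimes>\<^bsub>quot A W\<^esub> (y \<otimes>\<^bsub>quot A W\<^esub> z)"
    if "x \<in> carrier (quot A W)" "y \<in> carrier (quot A W)" "z \<in> carrier (quot A W)" for x y z
    using that by (auto elim!: e simp: s A alg_assoc)
  show "\<one>\<^bsub>quot A W\<^esub> \<otimes>\<^bsub>quot A W\<^esub> x = x" "x \<otimes>\<^bsub>quot A W\<^esub> \<one>\<^bsub>quot A W\<^esub> = x" if "x \<in> carrier (quot A W)" for x
    using that by (auto elim!: e simp: s A)
qed

text \<open>The reason why tensor products, tensor powers and the tensor algebra are algebras: each is a monoid
  algebra (on pairs, on words with entrywise product, on words with concatenation) modulo an ideal.\<close>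

lemma pres_algebra:
  assumes G: "Group.monoid G" and R: "R \<subseteq> carrier (monoid_algebra G)"
    and l: "\<And>r x. \<lbrakk>r \<in> R; x \<in> carrier G\<rbrakk> \<Longrightarrow> fgen x \<otimes>\<^bsub>monoid_algebra G\<^esub> r \<in> R"
    and r: "\<And>r x. \<lbrakk>r \<in> R; x \<in> carrier G\<rbrakk> \<Longrightarrow> r \<otimes>\<^bsub>monoid_algebra G\<^esub> fgen x \<in> R"
  shows "assoc_algebra (pres G R)"
    and "\<one>\<^bsub>pres G R\<^esub> = cls (pres G R) \<one>\<^bsub>G\<^esub>"
    and "\<lbrakk>x \<in> carrier G; y \<in> carrier G\<rbrakk> \<Longrightarrow> cls (pres G R) x \<otimes>\<^bsub>pres G R\<^esub> cls (pres G R) y = cls (pres G R) (x \<otimes>\<^bsub>G\<^esub> y)"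
proof -
  interpret G: Group.monoid G by (rule G)
  have I: "ideal (fspan R) (monoid_algebra G)"
    using l r by (intro fspan_ideal[OF G R]) (auto simp: fspan_eq intro: fscale.span_base)
  show "assoc_algebra (pres G R)"
    by (rule assoc_algebra_quot[OF assoc_algebra_monoid_algebra[OF G] I])
  show "\<one>\<^bsub>pres G R\<^esub> = cls (pres G R) \<one>\<^bsub>G\<^esub>"
    by (simp add: cls_pres[OF R] quot_simps)
  show "cls (pres G R) x \<otimes>\<^bsub>pres G R\<^esub> cls (pres G R) y = cls (pres G R) (x \<otimes>\<^bsub>G\<^esub> y)"
    if "x \<in> carrier G" "y \<in> carrier G"
    using that by (simp add: cls_pres[OF R] quot_mult[OF I] monoid_algebra_mult_gen[OF G])
qed

lemma DirProd_simps: "(x, y) \<otimes>\<^bsub>M \<times>\<times> N\<^esub> (x', y') = (x \<otimes>\<^bsub>M\<^esub> x', y \<otimes>\<^bsub>N\<^esub> y')" "\<one>\<^bsub>M \<times>\<times> N\<^esub> = (\<one>\<^bsub>M\<^esub>, \<one>\<^bsub>N\<^esub>)"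
  by (simp_all add: DirProd_def)

context
  fixes M :: "('k::field, 'a, 'm) module_scheme" and N :: "('k, 'b, 'n) module_scheme"
  assumes M: "assoc_algebra M" and N: "assoc_algebra N"
begin

lemma bilinear_rels_mult:
  assumes r: "r \<in> bilinear_rels M N" and x: "x \<in> carrier (M \<times>\<times> N)"
  shows "fgen x \<otimes>\<^bsub>monoid_algebra (M \<times>\<times> N)\<^esub> r \<in> bilinear_rels M N"
    and "r \<otimes>\<^bsub>monoid_algebra (M \<times>\<times> N)\<^esub> fgen x \<in> bilinear_rels M N"
proof -
  note G = DirProd_monoid[OF alg_monoid[OF M] alg_monoid[OF N]]
  obtain a b where x': "x = (a, b)" "a \<in> carrier M" "b \<in> carrier N"
    using x by (cases x) (auto simp: DirProd_carrier)
  have D: "(p, q) \<in> carrier (M \<times>\<times> N)" if "p \<in> carrier M" "q \<in> carrier N" for p q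
    using that by (simp add: DirProd_carrier)
  note m = monoid_algebra_mult_diff[OF G, of "(a, b)", OF D[OF x'(2,3)], unfolded DirProd_simps]
  note cl = alg_mult_closed[OF M] alg_mult_closed[OF N] vs_add_closed[OF alg_vspace[OF M]] vs_add_closed[OF alg_vspace[OF N]]
    vs_smult_closed[OF alg_vspace[OF M]] vs_smult_closed[OF alg_vspace[OF N]]
  have "fgen (a, b) \<otimes>\<^bsub>monoid_algebra (M \<times>\<times> N)\<^esub> r \<in> bilinear_rels M N
    \<and> r \<otimes>\<^bsub>monoid_algebra (M \<times>\<times> N)\<^esub> fgen (a, b) \<in> bilinear_rels M N"
    using r
  proof (subst (asm) bilinear_rels_def, elim UnE CollectE exE conjE)
    fix p p' q assume r: "r = fgen (p \<oplus>\<^bsub>M\<^esub> p', q) - fgen (p, q) - fgen (p', q)"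
      and *: "p \<in> carrier M" "p' \<in> carrier M" "q \<in> carrier N"
    note w = D[OF cl(3)[OF *(1,2)] *(3)] D[OF *(1,3)] D[OF *(2,3)]
    show ?thesis
      unfolding r m(1)[OF w] m(2)[OF w] DirProd_simps alg_r_distr[OF M *(1,2) x'(2)] alg_l_distr[OF M *(1,2) x'(2)]
      by (intro conjI bilinear_rels_intros(1) cl * x')
  next
    fix p q q' assume r: "r = fgen (p, q \<oplus>\<^bsub>N\<^esub> q') - fgen (p, q) - fgen (p, q')"
      and *: "p \<in> carrier M" "q \<in> carrier N" "q' \<in> carrier N"
    note w = D[OF *(1) cl(4)[OF *(2,3)]] D[OF *(1,2)] D[OF *(1,3)]
    show ?thesis
      unfolding r m(1)[OF w] m(2)[OF w] DirProd_simps alg_r_distr[OF N *(2,3) x'(3)] alg_l_distr[OF N *(2,3) x'(3)]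
      by (intro conjI bilinear_rels_intros(2) cl * x')
  next
    fix c p q assume r: "r = fgen (c \<odot>\<^bsub>M\<^esub> p, q) - Poly_Mapping.single (p, q) c"
      and *: "p \<in> carrier M" "q \<in> carrier N"
    note w = D[OF cl(5)[OF *(1)] *(2)] D[OF *] D[OF *]
    show ?thesis
      unfolding r m(3)[OF w] m(4)[OF w] DirProd_simps alg_smult_right[OF M x'(2) *(1)] alg_smult_left[OF M *(1) x'(2)]
      by (intro conjI bilinear_rels_intros(3) cl * x')
  next
    fix c p q assume r: "r = fgen (p, c \<odot>\<^bsub>N\<^esub> q) - Poly_Mapping.single (p, q) c"
      and *: "p \<in> carrier M" "q \<in> carrier N"
    note w = D[OF *(1) cl(6)[OF *(2)]] D[OF *] D[OF *]
    show ?thesis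
      unfolding r m(3)[OF w] m(4)[OF w] DirProd_simps alg_smult_right[OF N x'(3) *(2)] alg_smult_left[OF N *(2) x'(3)]
      by (intro conjI bilinear_rels_intros(4) cl * x')
  qed
  then show "fgen x \<otimes>\<^bsub>monoid_algebra (M \<times>\<times> N)\<^esub> r \<in> bilinear_rels M N"
    "r \<otimes>\<^bsub>monoid_algebra (M \<times>\<times> N)\<^esub> fgen x \<in> bilinear_rels M N"
    by (simp_all add: x')
qed

lemma assoc_algebra_tensor [simp]: "assoc_algebra (tensor M N)"
  and tens_one: "\<one>\<^bsub>tensor M N\<^esub> = cls (tensor M N) (\<one>\<^bsub>M\<^esub>, \<one>\<^bsub>N\<^esub>)"
  and tens_mult: "\<lbrakk>x \<in> carrier M; x' \<in> carrier M; y \<in> carrier N; y' \<in> carrier N\<rbrakk> \<Longrightarrow>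
     cls (tensor M N) (x, y) \<otimes>\<^bsub>tensor M N\<^esub> cls (tensor M N) (x', y') = cls (tensor M N) (x \<otimes>\<^bsub>M\<^esub> x', y \<otimes>\<^bsub>N\<^esub> y')"
  using pres_algebra[OF DirProd_monoid[OF alg_monoid[OF M] alg_monoid[OF N]] 
      bilinear_rels_sub[OF alg_vspace[OF M] alg_vspace[OF N]] bilinear_rels_mult, folded tensor_def]
  by (simp_all add: DirProd_carrier DirProd_simps)

end

section \<open>Tensor powers of an algebra and the tensor algebra\<close>

context
  fixes V :: "('k::field, 'v, 'm) module_scheme"
  assumes V: "vspace V"
begin

abbreviation (input) pw_monoid where
  "pw_monoid n \<equiv> \<lparr>carrier = {xs \<in> lists (carrier V). length xs = n},
             monoid.mult = map2 (monoid.mult V), one = replicate n (one V)\<rparr>"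

lemma tpow_wt: "tensor_power V n = pres (pw_monoid n) (\<Union>i\<in>{n}. multilinear_rels V i)"
  by (simp add: tensor_power_def)

lemma tpow_carrier: "carrier (pw_monoid n) = {xs. set xs \<subseteq> carrier V \<and> length xs \<in> {n}}"
  by (simp add: lists_eq_set)

lemma vspace_tpow [simp]: "vspace (tensor_power V n)"
  unfolding tpow_wt by (rule vspace_pres[OF wt_sub[OF V tpow_carrier]])

lemma tpow_closed: "\<lbrakk>set xs \<subseteq> carrier V; length xs = n\<rbrakk> \<Longrightarrow> cls (tensor_power V n) xs \<in> carrier (tensor_power V n)"
  unfolding tpow_wt by (rule cls_pres_closed[OF wt_sub[OF V tpow_carrier]]) (simp add: lists_eq_set)

lemma tpow_cls_lin:
  assumes "set xs \<subseteq> carrier V" "length xs = n" "i < n" and g: "g \<in> linear_maps Q V"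
  shows "(\<lambda>q. cls (tensor_power V n) (xs[i := g q])) \<in> linear_maps Q (tensor_power V n)"
  using lin_comp[OF wt_cls_lin[OF V tpow_carrier, of xs n i, folded tpow_wt] g] assms by simp

lemma tpow_ext_lin:
  assumes "vspace N" "multilin V n N F" "g \<in> linear_maps Q (tensor_power V n)"
  shows "(\<lambda>q. lin_ext N F (g q)) \<in> linear_maps Q N"
  using lin_comp[OF wt_ext(1)[OF V tpow_carrier assms(1), of n F, folded tpow_wt] assms(3)] assms(2) by simp

lemma tpow_ext_cls:
  assumes "vspace N" "multilin V n N F" "set xs \<subseteq> carrier V" "length xs = n"
  shows "lin_ext N F (cls (tensor_power V n) xs) = F xs"
  using wt_ext(2)[OF V tpow_carrier assms(1), of n F xs, folded tpow_wt] assms(2-) by simp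

lemma tpow_lin_eq:
  assumes "vspace N" "h \<in> linear_maps (tensor_power V n) N" "h' \<in> linear_maps (tensor_power V n) N"
    and e: "\<And>xs. \<lbrakk>set xs \<subseteq> carrier V; length xs = n\<rbrakk> \<Longrightarrow> h (cls (tensor_power V n) xs) = h' (cls (tensor_power V n) xs)"
    and t: "t \<in> carrier (tensor_power V n)"
  shows "h t = h' t"
  using pres_lin_eq[OF wt_sub[OF V tpow_carrier, of n], folded tpow_wt, OF assms(1-3) _ t] e
  by (auto simp: lists_eq_set)

lemma tpow_ext_param:
  assumes "vspace Q" "vspace N"
    and F: "\<And>xs. \<lbrakk>set xs \<subseteq> carrier V; length xs = n\<rbrakk> \<Longrightarrow> (\<lambda>q. F q xs) \<in> linear_maps Q N"
    and t: "t \<in> carrier (tensor_power V n)"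
  shows "(\<lambda>q. lin_ext N (F q) t) \<in> linear_maps Q N"
  using lin_ext_param[OF wt_sub[OF V tpow_carrier, of n], folded tpow_wt, OF assms(1,2) _ t, of F] F
  by (auto simp: lists_eq_set)

abbreviation (input) word_monoid where
  "word_monoid \<equiv> \<lparr>carrier = lists (carrier V), monoid.mult = (@), one = []\<rparr>"

lemma talg_wt: "tensor_algebra V = pres word_monoid (\<Union>i\<in>UNIV. multilinear_rels V i)"
  by (simp add: tensor_algebra_def)

lemma talg_carrier: "carrier word_monoid = {xs. set xs \<subseteq> carrier V \<and> length xs \<in> UNIV}"
  by (simp add: lists_eq_set)

lemma talg_closed: "set xs \<subseteq> carrier V \<Longrightarrow> cls (tensor_algebra V) xs \<in> carrier (tensor_algebra V)"
  unfolding talg_wt by (rule cls_pres_closed[OF wt_sub[OF V talg_carrier]]) (simp add: lists_eq_set)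

lemma talg_cls_lin:
  assumes "set xs \<subseteq> carrier V" "i < length xs"
  shows "(\<lambda>q. cls (tensor_algebra V) (xs[i := q])) \<in> linear_maps V (tensor_algebra V)"
  using wt_cls_lin[OF V talg_carrier, of xs i, folded talg_wt] assms by simp

lemma talg_ext:
  assumes "vspace N" "\<And>n. multilin V n N F"
  shows "lin_ext N F \<in> linear_maps (tensor_algebra V) N"
    and "set xs \<subseteq> carrier V \<Longrightarrow> lin_ext N F (cls (tensor_algebra V) xs) = F xs"
  using wt_ext[OF V talg_carrier assms, folded talg_wt] by simp_all

lemma talg_lin_eq:
  assumes "vspace N" "h \<in> linear_maps (tensor_algebra V) N" "h' \<in> linear_maps (tensor_algebra V) N"
    and e: "\<And>xs. set xs \<subseteq> carrier V \<Longrightarrow> h (cls (tensor_algebra V) xs) = h' (cls (tensor_algebra V) xs)"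
    and t: "t \<in> carrier (tensor_algebra V)"
  shows "h t = h' t"
  using pres_lin_eq[OF wt_sub[OF V talg_carrier], folded talg_wt, OF assms(1-3) _ t] e
  by (auto simp: lists_eq_set)

lemma talg_induct [consumes 1, case_names zero add]:
  assumes t: "t \<in> carrier (tensor_algebra V)"
    and 0: "P \<zero>\<^bsub>tensor_algebra V\<^esub>"
    and add: "\<And>xs c t. \<lbrakk>set xs \<subseteq> carrier V; t \<in> carrier (tensor_algebra V); P t\<rbrakk> \<Longrightarrow> 
       P (c \<odot>\<^bsub>tensor_algebra V\<^esub> cls (tensor_algebra V) xs \<oplus>\<^bsub>tensor_algebra V\<^esub> t)"
  shows "P t"
  using pres_induct[OF wt_sub[OF V talg_carrier], folded talg_wt, OF t, of P] 0 add
  by (auto simp: lists_eq_set)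

lemma word_monoid: "Group.monoid word_monoid"
  by (rule monoidI) auto

lemma talg_rels_mult:
  assumes r: "r \<in> (\<Union>i\<in>UNIV. multilinear_rels V i)" and x: "x \<in> carrier word_monoid"
  shows "fgen x \<otimes>\<^bsub>monoid_algebra word_monoid\<^esub> r \<in> (\<Union>i\<in>UNIV. multilinear_rels V i)"
    and "r \<otimes>\<^bsub>monoid_algebra word_monoid\<^esub> fgen x \<in> (\<Union>i\<in>UNIV. multilinear_rels V i)"
proof -
  have x': "set x \<subseteq> carrier V" using x by (simp add: lists_eq_set)
  from r obtain i where r: "r \<in> multilinear_rels V i" by blast
  have m: "fgen x \<otimes>\<^bsub>monoid_algebra word_monoid\<^esub> (fgen a - fgen b - fgen c) = fgen (x @ a) - fgen (x @ b) - fgen (x @ c)"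
      "(fgen a - fgen b - fgen c) \<otimes>\<^bsub>monoid_algebra word_monoid\<^esub> fgen x = fgen (a @ x) - fgen (b @ x) - fgen (c @ x)"
      "fgen x \<otimes>\<^bsub>monoid_algebra word_monoid\<^esub> (fgen a - Poly_Mapping.single b d) = fgen (x @ a) - Poly_Mapping.single (x @ b) d"
      "(fgen a - Poly_Mapping.single b d) \<otimes>\<^bsub>monoid_algebra word_monoid\<^esub> fgen x = fgen (a @ x) - Poly_Mapping.single (b @ x) d"
    if "a \<in> lists (carrier V)" "b \<in> lists (carrier V)" "c \<in> lists (carrier V)" for a b c d
    using that x monoid_algebra_mult_diff(1,2)[OF word_monoid, of x a b c] monoid_algebra_mult_diff(3,4)[OF word_monoid, of x a b c d]
    by simp_all
  have w: "us @ [a] @ vs \<in> lists (carrier V)"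
    if "us \<in> lists (carrier V)" "vs \<in> lists (carrier V)" "a \<in> carrier V" for us vs a
    using that by simp
  have "fgen x \<otimes>\<^bsub>monoid_algebra word_monoid\<^esub> r \<in> multilinear_rels V (length x + i)
    \<and> r \<otimes>\<^bsub>monoid_algebra word_monoid\<^esub> fgen x \<in> multilinear_rels V (length x + i)"
    using r
  proof (subst (asm) multilinear_rels_def, elim UnE CollectE exE conjE)
    fix us a b vs
    assume r: "r = fgen (us @ [a \<oplus>\<^bsub>V\<^esub> b] @ vs) - fgen (us @ [a] @ vs) - fgen (us @ [b] @ vs)"
      and *: "us \<in> lists (carrier V)" "vs \<in> lists (carrier V)" "a \<in> carrier V" "b \<in> carrier V"
        "length us + 1 + length vs = i"
    note w' = w[OF *(1,2)] vs_add_closed[OF V *(3,4)]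
    show ?thesis
      unfolding r m(1)[OF w'(1)[OF w'(2)] w'(1)[OF *(3)] w'(1)[OF *(4)]] 
        m(2)[OF w'(1)[OF w'(2)] w'(1)[OF *(3)] w'(1)[OF *(4)]]
      using multilinear_rels_intros(1)[of "x @ us" V vs a b "length x + i"]
        multilinear_rels_intros(1)[of us V "vs @ x" a b "length x + i"] * x'
      by (simp add: lists_eq_set)
  next
    fix us d a vs
    assume r: "r = fgen (us @ [d \<odot>\<^bsub>V\<^esub> a] @ vs) - Poly_Mapping.single (us @ [a] @ vs) d"
      and *: "us \<in> lists (carrier V)" "vs \<in> lists (carrier V)" "a \<in> carrier V"
        "length us + 1 + length vs = i"
    note w' = w[OF *(1,2)] vs_smult_closed[OF V *(3)]
    show ?thesis
      unfolding r m(3)[OF w'(1)[OF w'(2)] w'(1)[OF *(3)] w'(1)[OF *(3)]] 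
        m(4)[OF w'(1)[OF w'(2)] w'(1)[OF *(3)] w'(1)[OF *(3)]]
      using multilinear_rels_intros(2)[of "x @ us" V vs a "length x + i" d]
        multilinear_rels_intros(2)[of us V "vs @ x" a "length x + i" d] * x'
      by (simp add: lists_eq_set)
  qed
  then show "fgen x \<otimes>\<^bsub>monoid_algebra word_monoid\<^esub> r \<in> (\<Union>i\<in>UNIV. multilinear_rels V i)"
    "r \<otimes>\<^bsub>monoid_algebra word_monoid\<^esub> fgen x \<in> (\<Union>i\<in>UNIV. multilinear_rels V i)" by blast+
qed

lemma assoc_algebra_talg: "assoc_algebra (tensor_algebra V)"
  and talg_one: "\<one>\<^bsub>tensor_algebra V\<^esub> = cls (tensor_algebra V) []"
  and talg_mult: "\<lbrakk>set xs \<subseteq> carrier V; set ys \<subseteq> carrier V\<rbrakk> \<Longrightarrow>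
     cls (tensor_algebra V) xs \<otimes>\<^bsub>tensor_algebra V\<^esub> cls (tensor_algebra V) ys = cls (tensor_algebra V) (xs @ ys)"
  using pres_algebra[OF word_monoid wt_sub[OF V talg_carrier] talg_rels_mult, folded talg_wt]
  by (simp_all add: lists_eq_set)

end

context
  fixes A :: "('k::field, 'v, 'm) module_scheme"
  assumes A: "assoc_algebra A"
begin

lemma map2_append_split:
  assumes "length xs = length us + 1 + length vs"
  shows "map2 f xs (us @ [z] @ vs) = map2 f (take (length us) xs) us @ [f (xs ! length us) z] @ map2 f (drop (Suc (length us)) xs) vs"
    and "map2 f (us @ [z] @ vs) xs = map2 f us (take (length us) xs) @ [f z (xs ! length us)] @ map2 f vs (drop (Suc (length us)) xs)"
proof -
  have 1: "xs = take (length us) xs @ [xs ! length us] @ drop (Suc (length us)) xs"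
    using assms id_take_nth_drop[of "length us" xs] by simp
  have l: "length (take (length us) xs) = length us" using assms by simp
  show "map2 f xs (us @ [z] @ vs) = map2 f (take (length us) xs) us @ [f (xs ! length us) z] @ map2 f (drop (Suc (length us)) xs) vs"
    by (subst 1) (use l in simp)
  show "map2 f (us @ [z] @ vs) xs = map2 f us (take (length us) xs) @ [f z (xs ! length us)] @ map2 f vs (drop (Suc (length us)) xs)"
  proof -
    have "map2 f (us @ [z] @ vs) (take (length us) xs @ [xs ! length us] @ drop (Suc (length us)) xs)
        = map2 f us (take (length us) xs) @ [f z (xs ! length us)] @ map2 f vs (drop (Suc (length us)) xs)"
      using l by simp
    then show ?thesis unfolding 1[symmetric] .
  qed
qed

lemma map2_mult_closed: "\<lbrakk>set xs \<subseteq> carrier A; set ys \<subseteq> carrier A\<rbrakk> \<Longrightarrow> set (map2 (monoid.mult A) xs ys) \<subseteq> carrier A"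
  by (auto intro!: alg_mult_closed[OF A] dest: set_zip_leftD set_zip_rightD)

lemma tpow_monoid: "Group.monoid (pw_monoid A n)"
proof (rule monoidI, unfold monoid.simps partial_object.simps mem_Collect_eq lists_eq_set)
  fix xs ys zs assume xs: "set xs \<subseteq> carrier A \<and> length xs = n" and ys: "set ys \<subseteq> carrier A \<and> length ys = n"
    and zs: "set zs \<subseteq> carrier A \<and> length zs = n"
  show "set (map2 (monoid.mult A) xs ys) \<subseteq> carrier A \<and> length (map2 (monoid.mult A) xs ys) = n"
    using xs ys map2_mult_closed by simp
  show "map2 (monoid.mult A) (map2 (monoid.mult A) xs ys) zs = map2 (monoid.mult A) xs (map2 (monoid.mult A) ys zs)"
    using xs ys zs A by (intro nth_equalityI) (auto intro!: alg_assoc)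
next
  fix xs assume xs: "set xs \<subseteq> carrier A \<and> length xs = n"
  then have "xs ! i \<in> carrier A" if "i < n" for i using that by (auto dest: nth_mem)
  then show "map2 (monoid.mult A) (replicate n \<one>\<^bsub>A\<^esub>) xs = xs" "map2 (monoid.mult A) xs (replicate n \<one>\<^bsub>A\<^esub>) = xs"
    using xs A by (auto intro!: nth_equalityI)
qed (use A in auto)

lemma tpow_rels_mult:
  assumes r: "r \<in> (\<Union>i\<in>{n}. multilinear_rels A i)" and x: "x \<in> carrier (pw_monoid A n)"
  shows "fgen x \<otimes>\<^bsub>monoid_algebra (pw_monoid A n)\<^esub> r \<in> (\<Union>i\<in>{n}. multilinear_rels A i)"
    and "r \<otimes>\<^bsub>monoid_algebra (pw_monoid A n)\<^esub> fgen x \<in> (\<Union>i\<in>{n}. multilinear_rels A i)"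
proof -
  have x': "set x \<subseteq> carrier A" "length x = n" using x by (auto simp: lists_eq_set)
  have t: "set (take i x) \<subseteq> carrier A" "set (drop i x) \<subseteq> carrier A" "i < n \<Longrightarrow> x ! i \<in> carrier A" for i
    using x' set_take_subset[of i x] set_drop_subset[of i x] by auto
  from r have r: "r \<in> multilinear_rels A n" by simp
  note m = monoid_algebra_mult_diff[OF tpow_monoid]
  note C = map2_mult_closed
  have w: "us @ [a] @ vs \<in> carrier (pw_monoid A n)"
    if "us \<in> lists (carrier A)" "vs \<in> lists (carrier A)" "a \<in> carrier A" "length us + 1 + length vs = n" for us vs a
    using that by simp
  have g: "fgen x \<otimes>\<^bsub>monoid_algebra (pw_monoid A n)\<^esub> r \<in> multilinear_rels A n
    \<and> r \<otimes>\<^bsub>monoid_algebra (pw_monoid A n)\<^esub> fgen x \<in> multilinear_rels A n"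
    using r
  proof (subst (asm) multilinear_rels_def, elim UnE CollectE exE conjE)
    fix us a b vs
    assume r: "r = fgen (us @ [a \<oplus>\<^bsub>A\<^esub> b] @ vs) - fgen (us @ [a] @ vs) - fgen (us @ [b] @ vs)"
      and *: "us \<in> lists (carrier A)" "vs \<in> lists (carrier A)" "a \<in> carrier A" "b \<in> carrier A"
        "length us + 1 + length vs = n"
    let ?c = "x ! length us" and ?u = "take (length us) x" and ?v = "drop (Suc (length us)) x"
    have **: "length x = length us + 1 + length vs" "length us < n" "set us \<subseteq> carrier A" "set vs \<subseteq> carrier A"
      and c: "?c \<in> carrier A" using * x' t by (auto simp: lists_eq_set)
    note w' = w[OF *(1,2) _ *(5)] vs_add_closed[OF alg_vspace[OF A] *(3,4)]
    show ?thesis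
      unfolding r m(1)[OF x w'(1)[OF w'(2)] w'(1)[OF *(3)] w'(1)[OF *(4)]] 
        m(2)[OF x w'(1)[OF w'(2)] w'(1)[OF *(3)] w'(1)[OF *(4)]]
        monoid.simps map2_append_split[OF **(1)] alg_r_distr[OF A *(3,4) c] alg_l_distr[OF A *(3,4) c]
      by (intro conjI multilinear_rels_intros(1) C) (use * ** c t A x' in simp_all)
  next
    fix us d a vs
    assume r: "r = fgen (us @ [d \<odot>\<^bsub>A\<^esub> a] @ vs) - Poly_Mapping.single (us @ [a] @ vs) d"
      and *: "us \<in> lists (carrier A)" "vs \<in> lists (carrier A)" "a \<in> carrier A"
        "length us + 1 + length vs = n"
    let ?c = "x ! length us" and ?u = "take (length us) x" and ?v = "drop (Suc (length us)) x"
    have **: "length x = length us + 1 + length vs" "length us < n" "set us \<subseteq> carrier A" "set vs \<subseteq> carrier A"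
      and c: "?c \<in> carrier A" using * x' t by (auto simp: lists_eq_set)
    note w' = w[OF *(1,2) _ *(4)] vs_smult_closed[OF alg_vspace[OF A] *(3)]
    show ?thesis
      unfolding r m(3)[OF x w'(1)[OF w'(2)] w'(1)[OF *(3)] w'(1)[OF *(3)]] 
        m(4)[OF x w'(1)[OF w'(2)] w'(1)[OF *(3)] w'(1)[OF *(3)]]
        monoid.simps map2_append_split[OF **(1)] alg_smult_right[OF A c *(3)] alg_smult_left[OF A *(3) c]
      by (intro conjI multilinear_rels_intros(2) C) (use * ** c t A x' in simp_all)
  qed
  then show "fgen x \<otimes>\<^bsub>monoid_algebra (pw_monoid A n)\<^esub> r \<in> (\<Union>i\<in>{n}. multilinear_rels A i)"
    "r \<otimes>\<^bsub>monoid_algebra (pw_monoid A n)\<^esub> fgen x \<in> (\<Union>i\<in>{n}. multilinear_rels A i)"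
    by simp_all
qed

lemma assoc_algebra_tpow [simp]: "assoc_algebra (tensor_power A n)"
  and tpow_one: "\<one>\<^bsub>tensor_power A n\<^esub> = cls (tensor_power A n) (replicate n \<one>\<^bsub>A\<^esub>)"
  and tpow_mult: "\<lbrakk>set xs \<subseteq> carrier A; set ys \<subseteq> carrier A; length xs = n; length ys = n\<rbrakk> \<Longrightarrow>
     cls (tensor_power A n) xs \<otimes>\<^bsub>tensor_power A n\<^esub> cls (tensor_power A n) ys
       = cls (tensor_power A n) (map2 (monoid.mult A) xs ys)"
  using pres_algebra[OF tpow_monoid wt_sub[OF alg_vspace[OF A] tpow_carrier[OF alg_vspace[OF A]]] tpow_rels_mult,
      folded tpow_wt[OF alg_vspace[OF A]]]
  unfolding partial_object.simps monoid.simps lists_eq_set mem_Collect_eq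
  by blast+

end

section \<open>Twisted enveloping algebras and their universal property\<close>

text \<open>The operator by which an element of a twisted enveloping algebra acts once the operators \<open>D x\<close>
  by which the generators act are given. The coaction, the counit, the antipode and the adjoint
  action are all of this form.\<close>

definition eact :: "('k::field, 'v, 'n) module_scheme \<Rightarrow> ('g \<Rightarrow> 'v \<Rightarrow> 'v) \<Rightarrow>
    ('g list \<Rightarrow>\<^sub>0 'k) set set \<Rightarrow> 'v \<Rightarrow> 'v" where
  "eact N D a v = env_ext N (\<lambda>xs. foldr D xs v) a"

context lie_two_cocycle
begin

abbreviation "V \<equiv> type_space scale"
abbreviation "T \<equiv> tensor_algebra (type_space scale)"
abbreviation "A \<equiv> twisted_env scale br f"
abbreviation "\<iota> \<equiv> twisted_incl scale br f"
abbreviation "I \<equiv> twisted_ideal scale br f"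

lemma vspace_V [simp]: "vspace V"
  by (rule vspaceI) (auto simp: scale_left_distrib scale_right_distrib add.assoc add.commute)

lemma alg_T [simp]: "assoc_algebra T"
  by (rule assoc_algebra_talg[OF vspace_V])

lemma vspace_T: "vspace T"
  by (rule alg_vspace[OF alg_T])

lemma T_closed [simp]: "cls T xs \<in> carrier T"
  by (rule talg_closed[OF vspace_V]) simp

lemma T_mult [simp]: "cls T xs \<otimes>\<^bsub>T\<^esub> cls T ys = cls T (xs @ ys)"
  by (rule talg_mult[OF vspace_V]) simp_all

lemma T_one: "\<one>\<^bsub>T\<^esub> = cls T []"
  by (rule talg_one[OF vspace_V])

definition rel :: "'b \<Rightarrow> 'b \<Rightarrow> ('b list \<Rightarrow>\<^sub>0 'a) set" where
  "rel x y = cls T [x, y] \<ominus>\<^bsub>T\<^esub> cls T [y, x] \<ominus>\<^bsub>T\<^esub> cls T [br x y] \<ominus>\<^bsub>T\<^esub> f x y \<odot>\<^bsub>T\<^esub> \<one>\<^bsub>T\<^esub>"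

lemma rel_closed: "rel x y \<in> carrier T"
  unfolding rel_def by (intro vs_diff_closed[OF vspace_T] vs_smult_closed[OF vspace_T] T_closed alg_one_closed[OF alg_T])

lemma I_eq: "I = Idl\<^bsub>T\<^esub> {rel x y | x y. True}"
  by (simp add: twisted_ideal_def Let_def rel_def)

lemma I_ideal: "ideal I T"
  unfolding I_eq by (rule ring.genideal_ideal[OF alg_ring[OF alg_T]]) (auto simp: rel_closed)

lemma rel_in_I: "rel x y \<in> I"
  unfolding I_eq using ring.genideal_self[OF alg_ring[OF alg_T], of "{rel x y | x y. True}"] rel_closed by blast

lemma I_minimal:
  assumes "ideal J T" "\<And>x y. rel x y \<in> J"
  shows "I \<subseteq> J"
  unfolding I_eq by (rule ring.genideal_minimal[OF alg_ring[OF alg_T] assms(1)]) (auto simp: assms)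

lemma A_eq: "A = quot T I"
  by (simp add: twisted_env_def)

lemmas TI = vspace_T ideal_vsubspace[OF alg_T I_ideal]

lemma alg_A [simp]: "assoc_algebra A"
  unfolding A_eq by (rule assoc_algebra_quot[OF alg_T I_ideal])

lemma vspace_A [simp]: "vspace A"
  by (rule alg_vspace[OF alg_A])

lemma \<iota>_eq: "\<iota> x = I +>\<^bsub>T\<^esub> cls T [x]"
  by (simp add: twisted_incl_def Let_def)

lemma \<iota>_closed [simp]: "\<iota> x \<in> carrier A"
  unfolding \<iota>_eq A_eq by (rule coset_in_quot[OF TI T_closed])

lemma \<iota>_lin: "\<iota> \<in> linear_maps V A"
proof -
  have "(\<lambda>x. cls T ([0][0 := x])) \<in> linear_maps V T"
    by (rule talg_cls_lin[OF vspace_V]) auto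
  then have "(\<lambda>x. I +>\<^bsub>T\<^esub> cls T [x]) \<in> linear_maps V A"
    unfolding A_eq by (intro lin_comp[OF quot_proj_lin[OF TI]]) simp
  then show ?thesis by (simp add: \<iota>_eq[abs_def])
qed

lemma A_one: "\<one>\<^bsub>A\<^esub> = I +>\<^bsub>T\<^esub> cls T []"
  by (simp add: A_eq quot_simps T_one)

lemma \<iota>_rel: "\<iota> x \<otimes>\<^bsub>A\<^esub> \<iota> y = \<iota> y \<otimes>\<^bsub>A\<^esub> \<iota> x \<oplus>\<^bsub>A\<^esub> (\<iota> (br x y) \<oplus>\<^bsub>A\<^esub> f x y \<odot>\<^bsub>A\<^esub> \<one>\<^bsub>A\<^esub>)"
proof -
  define b where "b = cls T [y, x] \<oplus>\<^bsub>T\<^esub> (cls T [br x y] \<oplus>\<^bsub>T\<^esub> f x y \<odot>\<^bsub>T\<^esub> cls T [])"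
  have cl: "f x y \<odot>\<^bsub>T\<^esub> cls T [] \<in> carrier T" "cls T [br x y] \<oplus>\<^bsub>T\<^esub> f x y \<odot>\<^bsub>T\<^esub> cls T [] \<in> carrier T" "b \<in> carrier T"
    using vspace_T by (simp_all add: b_def)
  have "cls T [x, y] \<ominus>\<^bsub>T\<^esub> b = rel x y"
    using vspace_T cl by (simp add: rel_def T_one vs_diff_def vs_minus_add vs_assoc b_def)
  then have "I +>\<^bsub>T\<^esub> cls T [x, y] = I +>\<^bsub>T\<^esub> b"
    using quot_eq_iff[OF TI T_closed cl(3), of "[x, y]"] rel_in_I by simp
  also have "\<dots> = (I +>\<^bsub>T\<^esub> cls T [y, x]) \<oplus>\<^bsub>A\<^esub> ((I +>\<^bsub>T\<^esub> cls T [br x y]) \<oplus>\<^bsub>A\<^esub> f x y \<odot>\<^bsub>A\<^esub> (I +>\<^bsub>T\<^esub> cls T []))"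
    unfolding b_def A_eq
    using cl by (simp add: quot_add[OF TI] quot_smult[OF TI])
  finally show ?thesis
    unfolding \<iota>_eq A_one using quot_mult[OF I_ideal T_closed T_closed, of "[x]" "[y]"]
      quot_mult[OF I_ideal T_closed T_closed, of "[y]" "[x]"] by (simp add: A_eq)
qed

lemma A_word: "I +>\<^bsub>T\<^esub> cls T (x # xs) = \<iota> x \<otimes>\<^bsub>A\<^esub> (I +>\<^bsub>T\<^esub> cls T xs)"
  using quot_mult[OF I_ideal T_closed T_closed, of "[x]" xs] by (simp add: A_eq \<iota>_eq)

lemma A_word_snoc: "I +>\<^bsub>T\<^esub> cls T (xs @ [x]) = (I +>\<^bsub>T\<^esub> cls T xs) \<otimes>\<^bsub>A\<^esub> \<iota> x"
  using quot_mult[OF I_ideal T_closed T_closed, of xs "[x]"] by (simp add: A_eq \<iota>_eq)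

lemma A_word_closed: "I +>\<^bsub>T\<^esub> cls T xs \<in> carrier A"
  unfolding A_eq by (rule coset_in_quot[OF TI T_closed])

lemma A_word_induct [consumes 1, case_names word add smult]:
  assumes a: "a \<in> carrier A"
    and w: "\<And>xs. P (I +>\<^bsub>T\<^esub> cls T xs)"
    and add: "\<And>a b. \<lbrakk>a \<in> carrier A; b \<in> carrier A; P a; P b\<rbrakk> \<Longrightarrow> P (a \<oplus>\<^bsub>A\<^esub> b)"
    and smult: "\<And>c a. \<lbrakk>a \<in> carrier A; P a\<rbrakk> \<Longrightarrow> P (c \<odot>\<^bsub>A\<^esub> a)"
  shows "P a"
proof -
  obtain t where t: "t \<in> carrier T" "a = I +>\<^bsub>T\<^esub> t"
    using quot_cases[OF TI] a unfolding A_eq by blast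
  have "P (I +>\<^bsub>T\<^esub> t)"
    using t(1)
  proof (induction t rule: talg_induct[OF vspace_V, consumes 1, case_names zero add])
    case zero
    have "I +>\<^bsub>T\<^esub> \<zero>\<^bsub>T\<^esub> = 0 \<odot>\<^bsub>A\<^esub> (I +>\<^bsub>T\<^esub> cls T [])"
      using quot_zero[OF TI] A_word_closed[of "[]"] by (simp add: A_eq[symmetric])
    then show ?case using smult[OF A_word_closed w, of 0 "[]"] by simp
  next
    case (add xs c t)
    have "I +>\<^bsub>T\<^esub> (c \<odot>\<^bsub>T\<^esub> cls T xs \<oplus>\<^bsub>T\<^esub> t) = c \<odot>\<^bsub>A\<^esub> (I +>\<^bsub>T\<^esub> cls T xs) \<oplus>\<^bsub>A\<^esub> (I +>\<^bsub>T\<^esub> t)"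
      unfolding A_eq using add(2) vspace_T by (simp add: quot_add[OF TI] quot_smult[OF TI])
    then show ?case
      using add w[of xs] A_word_closed[of xs] coset_in_quot[OF TI add(2)] assms(3) smult
      by (simp add: A_eq[symmetric])
  qed
  then show ?thesis using t by simp
qed

lemma A_induct [consumes 1, case_names one mult add smult]:
  assumes a: "a \<in> carrier A"
    and one: "P \<one>\<^bsub>A\<^esub>" and mult: "\<And>x a. \<lbrakk>a \<in> carrier A; P a\<rbrakk> \<Longrightarrow> P (\<iota> x \<otimes>\<^bsub>A\<^esub> a)"
    and add: "\<And>a b. \<lbrakk>a \<in> carrier A; b \<in> carrier A; P a; P b\<rbrakk> \<Longrightarrow> P (a \<oplus>\<^bsub>A\<^esub> b)"
    and smult: "\<And>c a. \<lbrakk>a \<in> carrier A; P a\<rbrakk> \<Longrightarrow> P (c \<odot>\<^bsub>A\<^esub> a)"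
  shows "P a"
  using a
proof (induction a rule: A_word_induct)
  case (word xs)
  show ?case
    by (induction xs) (use one mult[OF A_word_closed] in \<open>simp_all add: A_one A_word\<close>)
qed (use add smult in auto)

lemma A_induct_right [consumes 1, case_names one mult add smult]:
  assumes a: "a \<in> carrier A"
    and one: "P \<one>\<^bsub>A\<^esub>" and mult: "\<And>x a. \<lbrakk>a \<in> carrier A; P a\<rbrakk> \<Longrightarrow> P (a \<otimes>\<^bsub>A\<^esub> \<iota> x)"
    and add: "\<And>a b. \<lbrakk>a \<in> carrier A; b \<in> carrier A; P a; P b\<rbrakk> \<Longrightarrow> P (a \<oplus>\<^bsub>A\<^esub> b)"
    and smult: "\<And>c a. \<lbrakk>a \<in> carrier A; P a\<rbrakk> \<Longrightarrow> P (c \<odot>\<^bsub>A\<^esub> a)"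
  shows "P a"
  using a
proof (induction a rule: A_word_induct)
  case (word xs)
  show ?case
    by (induction xs rule: rev_induct) (use one mult[OF A_word_closed] in \<open>simp_all add: A_one A_word_snoc\<close>)
qed (use add smult in auto)

text \<open>The form in which almost every identity below is proved: both sides are linear, agree at the unit,
  and transform in the same way when the argument is multiplied by a generator on the left.\<close>

lemma A_lin_eq:
  assumes N: "vspace N" and h: "h \<in> linear_maps A N" and h': "h' \<in> linear_maps A N"
    and one: "h \<one>\<^bsub>A\<^esub> = h' \<one>\<^bsub>A\<^esub>"
    and mult: "\<And>x a. \<lbrakk>a \<in> carrier A; h a = h' a\<rbrakk> \<Longrightarrow> h (\<iota> x \<otimes>\<^bsub>A\<^esub> a) = h' (\<iota> x \<otimes>\<^bsub>A\<^esub> a)"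
    and a: "a \<in> carrier A"
  shows "h a = h' a"
  using a
  by (induction a rule: A_induct) (simp_all add: one mult lin_add[OF h] lin_add[OF h'] lin_smult[OF h] lin_smult[OF h'])

text \<open>An operator representation of the defining relations on \<open>N\<close>; by the universal property it is
  the same as a module over the twisted enveloping algebra.\<close>

definition lierep :: "('a, 'v, 'n) module_scheme \<Rightarrow> ('b \<Rightarrow> 'v \<Rightarrow> 'v) \<Rightarrow> bool" where
  "lierep N D \<longleftrightarrow> vspace N \<and> (\<forall>x. D x \<in> linear_maps N N) \<and> (\<forall>v\<in>carrier N. (\<lambda>x. D x v) \<in> linear_maps V N) \<and>
     (\<forall>x y. \<forall>v\<in>carrier N. D x (D y v) = D y (D x v) \<oplus>\<^bsub>N\<^esub> (D (br x y) v \<oplus>\<^bsub>N\<^esub> f x y \<odot>\<^bsub>N\<^esub> v))"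

lemma lierepI:
  assumes "vspace N" "\<And>x. D x \<in> linear_maps N N" "\<And>v. v \<in> carrier N \<Longrightarrow> (\<lambda>x. D x v) \<in> linear_maps V N"
    and "\<And>x y v. v \<in> carrier N \<Longrightarrow> D x (D y v) = D y (D x v) \<oplus>\<^bsub>N\<^esub> (D (br x y) v \<oplus>\<^bsub>N\<^esub> f x y \<odot>\<^bsub>N\<^esub> v)"
  shows "lierep N D"
  unfolding lierep_def using assms by blast

context
  fixes N :: "('a, 'v, 'n) module_scheme" and D :: "'b \<Rightarrow> 'v \<Rightarrow> 'v"
  assumes D: "lierep N D"
begin

lemma rep_vspace: "vspace N" and rep_lin: "D x \<in> linear_maps N N"
  and rep_lin_left: "v \<in> carrier N \<Longrightarrow> (\<lambda>x. D x v) \<in> linear_maps V N"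
  and rep_rel: "v \<in> carrier N \<Longrightarrow> D x (D y v) = D y (D x v) \<oplus>\<^bsub>N\<^esub> (D (br x y) v \<oplus>\<^bsub>N\<^esub> f x y \<odot>\<^bsub>N\<^esub> v)"
  using D unfolding lierep_def by blast+

lemma rep_closed: "v \<in> carrier N \<Longrightarrow> D x v \<in> carrier N"
  by (rule lin_closed[OF rep_lin])

lemma foldr_lin: "foldr D xs \<in> linear_maps N N"
  by (induction xs) (use lin_comp[OF rep_lin] in \<open>auto simp: lin_id id_def comp_def\<close>)

lemma foldr_multilin:
  assumes v: "v \<in> carrier N"
  shows "multilin V n N (\<lambda>xs. foldr D xs v)"
proof (rule multilinI)
  show "foldr D xs v \<in> carrier N" for xs using lin_closed[OF foldr_lin v] .
  show "(\<lambda>x. foldr D (xs[i := x]) v) \<in> linear_maps V N" if "length xs = n" "i < n" for xs i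
    using that
  proof (induction xs arbitrary: i n)
    case (Cons y ys)
    show ?case
    proof (cases i)
      case 0
      then show ?thesis using rep_lin_left[OF lin_closed[OF foldr_lin v]] by simp
    next
      case (Suc j)
      then show ?thesis using Cons lin_comp[OF rep_lin Cons.IH[of "length ys" j]] by simp
    qed
  qed simp
qed

definition tact where "tact t v = lin_ext N (\<lambda>xs. foldr D xs v) t"

lemma tact_lin: "v \<in> carrier N \<Longrightarrow> (\<lambda>t. tact t v) \<in> linear_maps T N"
  unfolding tact_def by (rule talg_ext(1)[OF vspace_V rep_vspace foldr_multilin])

lemma tact_cls: "v \<in> carrier N \<Longrightarrow> tact (cls T xs) v = foldr D xs v"
  unfolding tact_def by (rule talg_ext(2)[OF vspace_V rep_vspace foldr_multilin]) simp_all

lemma tact_closed: "\<lbrakk>v \<in> carrier N; t \<in> carrier T\<rbrakk> \<Longrightarrow> tact t v \<in> carrier N"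
  by (rule lin_closed[OF tact_lin])

lemma tact_lin_right:
  assumes "t \<in> carrier T" shows "(\<lambda>v. tact t v) \<in> linear_maps N N"
proof -
  show ?thesis
    using assms
  proof (induction t rule: talg_induct[OF vspace_V, consumes 1, case_names zero add])
    case zero
    show ?case
      by (rule lin_cong[OF lin_zero_map[OF rep_vspace] rep_vspace])
        (use lin_zero[OF tact_lin vspace_T rep_vspace] in simp)
  next
    case (add xs c t)
    show ?case
    proof (rule lin_cong[OF lin_add_map[OF rep_vspace lin_smult_map[OF rep_vspace foldr_lin] add(3)] rep_vspace])
      fix v assume v: "v \<in> carrier N"
      show "c \<odot>\<^bsub>N\<^esub> foldr D xs v \<oplus>\<^bsub>N\<^esub> tact t v = tact (c \<odot>\<^bsub>T\<^esub> cls T xs \<oplus>\<^bsub>T\<^esub> t) v"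
        using lin_add[OF tact_lin[OF v] _ add(2), of "c \<odot>\<^bsub>T\<^esub> cls T xs"] lin_smult[OF tact_lin[OF v] T_closed, of c xs] v vspace_T
        by (simp add: tact_cls)
    qed
  qed
qed

lemma tact_mult:
  assumes s: "s \<in> carrier T" and t: "t \<in> carrier T" and v: "v \<in> carrier N"
  shows "tact (s \<otimes>\<^bsub>T\<^esub> t) v = tact s (tact t v)"
proof (rule talg_lin_eq[OF vspace_V rep_vspace _ _ _ s])
  show "(\<lambda>s. tact (s \<otimes>\<^bsub>T\<^esub> t) v) \<in> linear_maps T N"
    by (rule lin_comp[OF tact_lin[OF v] alg_lin_right[OF alg_T t lin_id]])
  show "(\<lambda>s. tact s (tact t v)) \<in> linear_maps T N"
    by (rule tact_lin[OF tact_closed[OF v t]])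
  fix xs
  show "tact (cls T xs \<otimes>\<^bsub>T\<^esub> t) v = tact (cls T xs) (tact t v)"
    unfolding tact_cls[OF tact_closed[OF v t]]
  proof (rule talg_lin_eq[OF vspace_V rep_vspace _ _ _ t])
    show "(\<lambda>t. tact (cls T xs \<otimes>\<^bsub>T\<^esub> t) v) \<in> linear_maps T N"
      by (rule lin_comp[OF tact_lin[OF v] alg_lin_left[OF alg_T T_closed lin_id]])
    show "(\<lambda>t. foldr D xs (tact t v)) \<in> linear_maps T N"
      by (rule lin_comp[OF foldr_lin tact_lin[OF v]])
  qed (simp add: tact_cls v)
qed

lemma tact_rel: "v \<in> carrier N \<Longrightarrow> tact (rel x y) v = \<zero>\<^bsub>N\<^esub>"
proof -
  assume v: "v \<in> carrier N"
  note N = rep_vspace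
  have cl: "D x v \<in> carrier N" for x using rep_closed v .
  have "tact (rel x y) v = D x (D y v) \<ominus>\<^bsub>N\<^esub> D y (D x v) \<ominus>\<^bsub>N\<^esub> D (br x y) v \<ominus>\<^bsub>N\<^esub> f x y \<odot>\<^bsub>N\<^esub> v"
    unfolding rel_def T_one
    using v vspace_T by (simp add: lin_diff[OF tact_lin[OF v] vspace_T N] lin_smult[OF tact_lin[OF v]] tact_cls)
  also have "\<dots> = \<zero>\<^bsub>N\<^esub>"
    using v N cl rep_closed by (simp add: rep_rel[OF v, of x y] vs_diff_eq_iff vs_ac)
  finally show ?thesis .
qed

text \<open>The tensors that act as zero form a two-sided ideal, which contains the defining relations.\<close>

lemma tact_I: 
  assumes "t \<in> I" "v \<in> carrier N" shows "tact t v = \<zero>\<^bsub>N\<^esub>"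
proof -
  let ?J = "{t \<in> carrier T. \<forall>v\<in>carrier N. tact t v = \<zero>\<^bsub>N\<^esub>}"
  note N = rep_vspace
  have "ideal ?J T"
  proof (rule idealI)
    show "ring T" by (rule alg_ring[OF alg_T])
    interpret T: ring T by (rule alg_ring[OF alg_T])
    show "subgroup ?J (add_monoid T)"
    proof (rule T.add.subgroupI)
      show "?J \<subseteq> carrier T" by auto
      show "?J \<noteq> {}" using lin_zero[OF tact_lin vspace_T N] by auto
      show "\<ominus>\<^bsub>T\<^esub> a \<in> ?J" if "a \<in> ?J" for a
        using that lin_minus[OF tact_lin vspace_T N] N by auto
      show "a \<oplus>\<^bsub>T\<^esub> b \<in> ?J" if "a \<in> ?J" "b \<in> ?J" for a b
        using that lin_add[OF tact_lin] N by auto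
    qed
    show "x \<otimes>\<^bsub>T\<^esub> a \<in> ?J" "a \<otimes>\<^bsub>T\<^esub> x \<in> ?J" if "a \<in> ?J" "x \<in> carrier T" for a x
      using that lin_zero[OF tact_lin_right N N] tact_closed by (auto simp: tact_mult)
  qed
  then have "I \<subseteq> ?J"
    by (rule I_minimal) (simp add: rel_closed tact_rel)
  then show ?thesis using assms by auto
qed

lemma eact_coset:
  assumes "v \<in> carrier N" "t \<in> carrier T" shows "eact N D (I +>\<^bsub>T\<^esub> t) v = tact t v"
  using quot_lift(2)[OF TI rep_vspace tact_lin[OF assms(1)] tact_I assms(2)] assms(1)
  by (simp add: eact_def env_ext_def tact_def)

lemma eact_lin: "v \<in> carrier N \<Longrightarrow> (\<lambda>a. eact N D a v) \<in> linear_maps A N"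
  using quot_lift(1)[OF TI rep_vspace tact_lin tact_I, of v] unfolding A_eq
  by (simp add: eact_def[abs_def] env_ext_def tact_def)

lemma eact_closed: "\<lbrakk>v \<in> carrier N; a \<in> carrier A\<rbrakk> \<Longrightarrow> eact N D a v \<in> carrier N"
  by (rule lin_closed[OF eact_lin])

lemma eact_lin_right: 
  assumes "a \<in> carrier A" shows "eact N D a \<in> linear_maps N N"
proof -
  obtain t where t: "t \<in> carrier T" "a = I +>\<^bsub>T\<^esub> t"
    using quot_cases[OF TI] assms unfolding A_eq by blast
  show ?thesis
    by (rule lin_cong[OF tact_lin_right[OF t(1)] rep_vspace]) (simp add: t eact_coset)
qed

lemma eact_one: "v \<in> carrier N \<Longrightarrow> eact N D \<one>\<^bsub>A\<^esub> v = v"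
  by (simp add: A_one eact_coset tact_cls)

lemma eact_mult:
  assumes "a \<in> carrier A" "b \<in> carrier A" "v \<in> carrier N"
  shows "eact N D (a \<otimes>\<^bsub>A\<^esub> b) v = eact N D a (eact N D b v)"
proof -
  obtain s t where t: "s \<in> carrier T" "a = I +>\<^bsub>T\<^esub> s" "t \<in> carrier T" "b = I +>\<^bsub>T\<^esub> t"
    using quot_cases[OF TI] assms unfolding A_eq by metis
  show ?thesis
    using t assms(3) quot_mult[OF I_ideal t(1,3)] alg_T
    by (simp add: A_eq[symmetric] eact_coset tact_mult tact_closed)
qed

lemma eact_\<iota>: "v \<in> carrier N \<Longrightarrow> eact N D (\<iota> x) v = D x v"
  by (simp add: \<iota>_eq eact_coset tact_cls)

lemma eact_\<iota>_mult: "\<lbrakk>a \<in> carrier A; v \<in> carrier N\<rbrakk> \<Longrightarrow> eact N D (\<iota> x \<otimes>\<^bsub>A\<^esub> a) v = D x (eact N D a v)"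
  by (simp add: eact_mult eact_\<iota> eact_closed)

end

text \<open>Identities between maps out of the algebra are obtained by comparing how both sides
  intertwine the generators.\<close>

lemma eact_intertwine:
  assumes D: "lierep N D" and D': "lierep N' D'" and \<theta>: "\<theta> \<in> linear_maps N N'"
    and e: "\<And>x v. v \<in> carrier N \<Longrightarrow> \<theta> (D x v) = D' x (\<theta> v)"
    and a: "a \<in> carrier A" and v: "v \<in> carrier N"
  shows "\<theta> (eact N D a v) = eact N' D' a (\<theta> v)"
proof (rule A_lin_eq[OF rep_vspace[OF D'] lin_comp[OF \<theta> eact_lin[OF D v]] eact_lin[OF D' lin_closed[OF \<theta> v]] _ _ a])
qed (use v in \<open>simp_all add: eact_one[OF D] eact_one[OF D'] lin_closed[OF \<theta>] eact_\<iota>_mult[OF D] eact_\<iota>_mult[OF D']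
       e eact_closed[OF D]\<close>)

lemma lierep_mult:
  assumes B: "assoc_algebra B" and d: "d \<in> linear_maps V B"
    and r: "\<And>x y. d x \<otimes>\<^bsub>B\<^esub> d y = d y \<otimes>\<^bsub>B\<^esub> d x \<oplus>\<^bsub>B\<^esub> (d (br x y) \<oplus>\<^bsub>B\<^esub> f x y \<odot>\<^bsub>B\<^esub> \<one>\<^bsub>B\<^esub>)"
  shows "lierep B (\<lambda>x t. d x \<otimes>\<^bsub>B\<^esub> t)"
proof (rule lierepI)
  have cl: "d x \<in> carrier B" for x using lin_closed[OF d, of x] by simp
  show "vspace B" by (rule alg_vspace[OF B])
  show "(\<lambda>t. d x \<otimes>\<^bsub>B\<^esub> t) \<in> linear_maps B B" for x by (rule alg_lin_left[OF B cl lin_id])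
  fix v assume v: "v \<in> carrier B"
  show "(\<lambda>x. d x \<otimes>\<^bsub>B\<^esub> v) \<in> linear_maps V B" by (rule alg_lin_right[OF B v d])
  fix x y
  have "d x \<otimes>\<^bsub>B\<^esub> (d y \<otimes>\<^bsub>B\<^esub> v) = (d x \<otimes>\<^bsub>B\<^esub> d y) \<otimes>\<^bsub>B\<^esub> v"
    using B cl v by (simp add: alg_assoc)
  then show "d x \<otimes>\<^bsub>B\<^esub> (d y \<otimes>\<^bsub>B\<^esub> v) = d y \<otimes>\<^bsub>B\<^esub> (d x \<otimes>\<^bsub>B\<^esub> v) \<oplus>\<^bsub>B\<^esub> (d (br x y) \<otimes>\<^bsub>B\<^esub> v \<oplus>\<^bsub>B\<^esub> f x y \<odot>\<^bsub>B\<^esub> v)"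
    using B cl v by (simp add: r[of x y] alg_l_distr alg_smult_left alg_assoc)
qed

lemma lie_two_cocycle_zero: "lie_two_cocycle scale br (\<lambda>_ _. 0)"
proof -
  have "Vector_Spaces.linear scale (*) (\<lambda>_. 0 :: 'a)"
    by unfold_locales (auto simp: algebra_simps)
  then show ?thesis
    by (intro lie_two_cocycle.intro lie_two_cocycle_axioms.intro lie_algebra_axioms) simp_all
qed

end

section \<open>The twisted enveloping algebra is not zero\<close>

context lie_two_cocycle
begin

lemma br_simps: "br x (y + z) = br x y + br x z" "br (x + y) z = br x z + br y z"
  "br x (scale c y) = scale c (br x y)" "br (scale c x) y = scale c (br x y)"
proof -
  have "module_hom scale scale (br x)" "module_hom scale scale (\<lambda>x. br x y)" for x y
    using br_linear_right[of x] br_linear_left[of y] by (simp_all add: Vector_Spaces.linear_def)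
  note m = this[THEN module_hom.add] this[THEN module_hom.scale]
  show "br x (y + z) = br x y + br x z" "br (x + y) z = br x z + br y z"
    "br x (scale c y) = scale c (br x y)" "br (scale c x) y = scale c (br x y)"
    by (rule m)+
qed

lemma f_simps: "f x (y + z) = f x y + f x z" "f (x + y) z = f x z + f y z"
  "f x (scale c y) = c * f x y" "f (scale c x) y = c * f x y"
proof -
  have "module_hom scale (*) (f x)" "module_hom scale (*) (\<lambda>x. f x y)" for x y
    using f_linear_right[of x] f_linear_left[of y] by (simp_all add: Vector_Spaces.linear_def)
  note m = this[THEN module_hom.add] this[THEN module_hom.scale]
  show "f x (y + z) = f x y + f x z" "f (x + y) z = f x z + f y z"
    "f x (scale c y) = c * f x y" "f (scale c x) y = c * f x y"
    by (rule m)+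
qed

lemma br_swap: "br y x = - br x y"
proof -
  have "br (x + y) (x + y) = (br x x + br y x) + (br x y + br y y)" by (simp only: br_simps)
  then have "br x y + br y x = 0" by (simp add: br_self add.commute)
  then show ?thesis by (simp add: add_eq_0_iff)
qed

lemma f_swap: "f y x = - f x y"
proof -
  have "f (x + y) (x + y) = (f x x + f y x) + (f x y + f y y)" by (simp only: f_simps)
  then have "f x y + f y x = 0" by (simp add: f_self add.commute)
  then show ?thesis by (simp add: add_eq_0_iff)
qed

lemma f_minus: "f (- x) y = - f x y" "f x (- y) = - f x y"
  using f_simps(4)[of "-1" x y] f_simps(3)[of x "-1" y] by simp_all

lemma br_minus: "br (- x) y = - br x y" "br x (- y) = - br x y"
  using br_simps(4)[of "-1" x y] br_simps(3)[of x "-1" y] by simp_all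

text \<open>A linear functional on the twisted enveloping algebra is the same as a multilinear function on
  words that is compatible with the defining relations.\<close>

definition word_linear :: "('b list \<Rightarrow> 'a) \<Rightarrow> bool" where
  "word_linear g \<longleftrightarrow> (\<forall>u v x y c. g (u @ (x + y) # v) = g (u @ x # v) + g (u @ y # v) \<and>
     g (u @ scale c x # v) = c * g (u @ x # v))"

definition word_rel :: "('b list \<Rightarrow> 'a) \<Rightarrow> 'b list \<Rightarrow> 'b \<Rightarrow> 'b \<Rightarrow> 'b list \<Rightarrow> bool" where
  "word_rel g u x y v \<longleftrightarrow> g (u @ x # y # v) = g (u @ y # x # v) + g (u @ br x y # v) + f x y * g (u @ v)"

lemma word_linear_closure:
  "word_linear (\<lambda>_. 0)" "\<lbrakk>word_linear g; word_linear h\<rbrakk> \<Longrightarrow> word_linear (\<lambda>w. g w + h w)"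
  "word_linear g \<Longrightarrow> word_linear (\<lambda>w. c * g w)" "word_linear g \<Longrightarrow> word_linear (\<lambda>w. g (w @ [z]))"
  by (simp_all add: word_linear_def algebra_simps)

lemma word_rel_closure:
  "word_rel (\<lambda>_. 0) u x y v" "\<lbrakk>word_rel g u x y v; word_rel h u x y v\<rbrakk> \<Longrightarrow> word_rel (\<lambda>w. g w + h w) u x y v"
  "word_rel g u x y v \<Longrightarrow> word_rel (\<lambda>w. c * g w) u x y v"
  "word_rel g u x y (v @ [z]) \<Longrightarrow> word_rel (\<lambda>w. g (w @ [z])) u x y v"
  by (simp_all add: word_rel_def algebra_simps)

text \<open>Functions of this kind form a module over the algebra, in which a letter acts by being appended.
  Evaluation of the translates at the empty word therefore turns one of them into a functional.\<close>

definition dual_words :: "('a, 'b list \<Rightarrow> 'a) module" where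
  "dual_words = \<lparr>carrier = {g. word_linear g \<and> (\<forall>u x y v. word_rel g u x y v)},
     monoid.mult = undefined, one = undefined, zero = (\<lambda>_. 0), add = (\<lambda>g h w. g w + h w),
     module.smult = (\<lambda>c g w. c * g w)\<rparr>"

lemma dual_words_simps [simp]:
  "g \<in> carrier dual_words \<longleftrightarrow> word_linear g \<and> (\<forall>u x y v. word_rel g u x y v)"
  "zero dual_words = (\<lambda>_. 0)" "add dual_words = (\<lambda>g h w. g w + h w)" "module.smult dual_words = (\<lambda>c g w. c * g w)"
  by (simp_all add: dual_words_def)

lemma vspace_dual_words: "vspace dual_words"
  by (rule vspaceI) (simp_all add: word_linear_closure word_rel_closure algebra_simps)

lemma lierep_dual_words: "lierep dual_words (\<lambda>x g w. g (w @ [x]))"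
proof (rule lierepI)
  show "vspace dual_words" by (rule vspace_dual_words)
  show "(\<lambda>g w. g (w @ [x])) \<in> linear_maps dual_words dual_words" for x
    by (rule linI) (simp_all add: word_linear_closure word_rel_closure)
  fix g assume g: "g \<in> carrier dual_words"
  then have lin: "g (w @ [x + y]) = g (w @ [x]) + g (w @ [y])" "g (w @ [scale c x]) = c * g (w @ [x])" for w x y c
    by (simp_all add: word_linear_def)
  show "(\<lambda>x w. g (w @ [x])) \<in> linear_maps V dual_words"
    using g by (intro linI) (simp_all add: word_linear_closure word_rel_closure lin)
  have r: "g (w @ [x, y]) = g (w @ [y, x]) + (g (w @ [br x y]) + f x y * g w)" for w x y
    using g unfolding dual_words_simps word_rel_def by (metis (no_types) add.assoc append_Nil2)
  show "(\<lambda>w. g ((w @ [x]) @ [y])) = (\<lambda>w. g ((w @ [y]) @ [x])) \<oplus>\<^bsub>dual_words\<^esub>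
      ((\<lambda>w. g (w @ [br x y])) \<oplus>\<^bsub>dual_words\<^esub> f x y \<odot>\<^bsub>dual_words\<^esub> g)" for x y
    unfolding dual_words_simps append_assoc append.simps by (rule ext) (rule r)
qed

lemma functional_of_words:
  assumes g: "word_linear g" "\<And>u x y v. word_rel g u x y v" "g [] = 1"
  shows "\<exists>\<phi>\<in>linear_maps A ground_algebra. \<phi> \<one>\<^bsub>A\<^esub> = 1"
proof -
  let ?D = "\<lambda>x g w. g (w @ [x])"
  have g': "g \<in> carrier dual_words" using g by simp
  have "(\<lambda>h. h []) \<in> linear_maps dual_words ground_algebra"
    by (rule linI) simp_all
  from lin_comp[OF this eact_lin[OF lierep_dual_words g']] eact_one[OF lierep_dual_words g'] g(3)
  show ?thesis by (intro bexI[of _ "\<lambda>a. eact dual_words ?D a g []"]) auto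
qed

end

locale ordered_basis = lie_two_cocycle +
  fixes B :: "'b set" and lt :: "'b \<Rightarrow> 'b \<Rightarrow> bool"
  assumes indep: "independent B" and span_B: "span B = UNIV"
    and lt_asym: "lt x y \<Longrightarrow> \<not> lt y x" and lt_trans: "lt x y \<Longrightarrow> lt y z \<Longrightarrow> lt x z"
    and lt_total: "x \<noteq> y \<Longrightarrow> lt x y \<or> lt y x"
begin

text \<open>The linear extension of a function on the basis.\<close>

definition coord_sum :: "'b \<Rightarrow> ('b \<Rightarrow> 'a) \<Rightarrow> 'a" where
  "coord_sum z h = (\<Sum>b | representation B z b \<noteq> 0. representation B z b * h b)"

lemma coord_sum_superset:
  assumes "finite S" "{b. representation B z b \<noteq> 0} \<subseteq> S"
  shows "coord_sum z h = (\<Sum>b\<in>S. representation B z b * h b)"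
  unfolding coord_sum_def by (rule sum.mono_neutral_left) (use assms in auto)

lemma coord_sum_lin:
  "coord_sum (x + y) h = coord_sum x h + coord_sum y h" "coord_sum (scale c x) h = c * coord_sum x h"
proof -
  let ?S = "{b. representation B x b \<noteq> 0} \<union> {b. representation B y b \<noteq> 0}"
  have S: "finite ?S" by (simp add: finite_representation)
  have r: "representation B (x + y) b = representation B x b + representation B y b"
    "representation B (scale c x) b = c * representation B x b" for b
    using representation_add[OF indep, of y x] representation_scale[OF indep, of x c] by (simp_all add: span_B)
  show "coord_sum (x + y) h = coord_sum x h + coord_sum y h"
    by (subst (1 2 3) coord_sum_superset[OF S]) (auto simp: r sum.distrib distrib_right)
  show "coord_sum (scale c x) h = c * coord_sum x h"
    by (subst (1 2) coord_sum_superset[OF S]) (auto simp: r sum_distrib_left mult.assoc)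
qed

lemma coord_sum_lin_right:
  "coord_sum x (\<lambda>b. h b + h' b) = coord_sum x h + coord_sum x h'" "coord_sum x (\<lambda>b. c * h b) = c * coord_sum x h"
  by (simp_all add: coord_sum_def sum.distrib distrib_left sum_distrib_left mult.left_commute)

lemma coord_sum_basis:
  assumes "b \<in> B" shows "coord_sum b h = h b"
proof -
  have "{c. representation B b c \<noteq> 0} \<subseteq> {b}"
    using representation_basis[OF indep assms] by (auto split: if_splits)
  then show ?thesis
    using representation_basis[OF indep assms] by (subst coord_sum_superset[of "{b}"]) auto
qed

text \<open>The multilinear function on all words with prescribed values on words in the basis.\<close>

primrec word_ext :: "'b list \<Rightarrow> ('b list \<Rightarrow> 'a) \<Rightarrow> 'a" where
  "word_ext [] g = g []"
| "word_ext (z # zs) g = coord_sum z (\<lambda>b. word_ext zs (\<lambda>w. g (b # w)))"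

lemma word_linear_ext: "word_linear (\<lambda>w. word_ext w g)"
proof -
  have "word_ext (u @ (x + y) # v) g = word_ext (u @ x # v) g + word_ext (u @ y # v) g
     \<and> word_ext (u @ scale c x # v) g = c * word_ext (u @ x # v) g" for u x y v c
    by (induction u arbitrary: g) (simp_all add: coord_sum_lin coord_sum_lin_right)
  then show ?thesis by (simp add: word_linear_def)
qed

lemma word_ext_basis: "set w \<subseteq> B \<Longrightarrow> word_ext w g = g w"
  by (induction w arbitrary: g) (simp_all add: coord_sum_basis)

lemma word_ext_basis1: "set u \<subseteq> B \<Longrightarrow> set v \<subseteq> B \<Longrightarrow> word_ext (u @ z # v) g = coord_sum z (\<lambda>b. g (u @ b # v))"
  by (induction u arbitrary: g) (simp_all add: coord_sum_basis word_ext_basis)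

primrec inversions :: "'b list \<Rightarrow> nat" where
  "inversions [] = 0"
| "inversions (x # xs) = length (filter (\<lambda>y. lt y x) xs) + inversions xs"

lemma inversions_swap: "lt y x \<Longrightarrow> inversions (u @ y # x # v) < inversions (u @ x # y # v)"
  by (induction u) (use lt_asym in auto)

fun descent :: "'b list \<Rightarrow> 'b list \<times> 'b \<times> 'b \<times> 'b list \<Rightarrow> bool" where
  "descent w (u, x, y, v) \<longleftrightarrow> w = u @ x # y # v \<and> lt y x"

text \<open>Straightening a word at some descent; words without a descent get the value zero, so that the
  resulting functional is the projection to the unit along the other ordered monomials.\<close>

function straight :: "'b list \<Rightarrow> 'a" where
  "straight w = (if w = [] then 1 else if \<exists>q. descent w q then
     (case (SOME q. descent w q) of (u, x, y, v) \<Rightarrow>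
        straight (u @ y # x # v) +
        (\<Sum>b | representation B (br x y) b \<noteq> 0. representation B (br x y) b * straight (u @ b # v)) +
        f x y * straight (u @ v)) else 0)"
  by pat_completeness auto
termination
proof (relation "measures [length, inversions]")
  show "wf (measures [length, inversions])" by simp
next
  fix w q u r x s y v assume "w \<noteq> []" and ex: "\<exists>q. descent w q" and "(u, r) = (SOME q. descent w q)"
    "(x, s) = r" "(y, v) = s"
  then have "descent w (u, x, y, v)" using someI_ex[OF ex] by simp
  then show "(u @ y # x # v, w) \<in> measures [length, inversions]" "(u @ b # v, w) \<in> measures [length, inversions]"
    "(u @ v, w) \<in> measures [length, inversions]" for b
    using inversions_swap by auto
qed

declare straight.simps [simp del]

definition L where "L w = word_ext w straight"

lemma L_lin: "L (u @ (x + y) # v) = L (u @ x # v) + L (u @ y # v)" "L (u @ scale c x # v) = c * L (u @ x # v)"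
  using word_linear_ext[of straight] by (auto simp: L_def word_linear_def)

lemma L_zero: "L (u @ 0 # v) = 0" and L_minus: "L (u @ (- x) # v) = - L (u @ x # v)"
  using L_lin(2)[of u 0 0 v] L_lin(2)[of u "-1" x v] by simp_all

lemma L_nil: "L [] = 1"
  by (simp add: L_def straight.simps[of "[]"])

abbreviation rhs where "rhs u x y v \<equiv> L (u @ y # x # v) + L (u @ br x y # v) + f x y * L (u @ v)"

lemma word_rel_iff: "word_rel L u x y v \<longleftrightarrow> L (u @ x # y # v) = rhs u x y v"
  by (simp add: word_rel_def)

text \<open>By definition the relation holds at the one descent that was chosen for straightening; the
  work is to show that every other descent gives the same value.\<close>

lemma L_chosen:
  assumes w: "set w \<subseteq> B" and "descent w q"
  shows "\<exists>u x y v. descent w (u, x, y, v) \<and> L w = rhs u x y v"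
proof -
  obtain u x y v where q: "(SOME q. descent w q) = (u, x, y, v)" by (metis prod_cases4)
  have d: "descent w (u, x, y, v)" using someI[of "descent w", OF assms(2)] by (simp add: q)
  then have s: "set u \<subseteq> B" "set v \<subseteq> B" "x \<in> B" "y \<in> B" using w by auto
  have ex: "w \<noteq> []" "\<exists>q. descent w q" using d by auto
  have "straight w = straight (u @ y # x # v) + coord_sum (br x y) (\<lambda>b. straight (u @ b # v)) + f x y * straight (u @ v)"
    by (subst straight.simps) (use ex in \<open>simp add: q coord_sum_def\<close>)
  then have "L w = rhs u x y v"
    using s w by (simp add: L_def word_ext_basis word_ext_basis1)
  then show ?thesis using d by blast
qed

lemma zero_of_basis:
  assumes "\<And>x y. h (x + y) = h x + h y" "\<And>c x. h (scale c x) = c * h x" "\<And>b. b \<in> B \<Longrightarrow> h b = (0 :: 'a)"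
  shows "h x = 0"
proof -
  have "h 0 = 0" using assms(2)[of 0 0] by simp
  then have "subspace {x. h x = 0}" using assms by (auto simp: subspace_def)
  then have "span B \<subseteq> {x. h x = 0}" by (intro span_minimal) (auto simp: assms)
  then show ?thesis using span_B by auto
qed

text \<open>The defect of the relation is multilinear, so it suffices to check the relation on basis words.\<close>

lemma word_rel_of_basis:
  assumes b: "\<And>u x y v. \<lbrakk>set u \<subseteq> B; set v \<subseteq> B; x \<in> B; y \<in> B; length u + length v + 2 = m\<rbrakk> \<Longrightarrow> word_rel L u x y v"
    and m: "length u + length v + 2 = m"
  shows "word_rel L u x y v"
proof -
  define R where "R u x y v = L (u @ x # y # v) - rhs u x y v" for u x y v
  have R: "R u x y v = 0 \<longleftrightarrow> word_rel L u x y v" for u x y v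
    by (simp add: R_def word_rel_iff)
  note lin = L_lin L_lin[of "_ @ [_]", simplified] L_lin[of "_ @ [_, _]", simplified] br_simps f_simps
  have Rx: "R u (x + x') y v = R u x y v + R u x' y v" "R u (scale c x) y v = c * R u x y v" for u x x' y v c
    by (simp_all add: R_def lin algebra_simps)
  have Ry: "R u x (y + y') v = R u x y v + R u x y' v" "R u x (scale c y) v = c * R u x y v" for u x y' y v c
    by (simp_all add: R_def lin algebra_simps)
  have Ru: "R (u @ (z + z') # u') x y v = R (u @ z # u') x y v + R (u @ z' # u') x y v"
    "R (u @ scale c z # u') x y v = c * R (u @ z # u') x y v" for u z z' u' x y v c
    by (simp_all add: R_def L_lin algebra_simps)
  have Rv: "R u x y (v @ (z + z') # v') = R u x y (v @ z # v') + R u x y (v @ z' # v')"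
    "R u x y (v @ scale c z # v') = c * R u x y (v @ z # v')" for u z z' v v' x y c
    using L_lin[of "u @ x # y # v"] L_lin[of "u @ y # x # v"] L_lin[of "u @ br x y # v"] L_lin[of "u @ v"]
    by (simp_all add: R_def algebra_simps)
  have 1: "R u x y v = 0" if *: "set u \<subseteq> B" "set v \<subseteq> B" "length u + length v + 2 = m" for u x y v
  proof -
    have "R u x y v = 0" if "y \<in> B" for x y
      by (rule zero_of_basis[of "\<lambda>x. R u x y v", OF Rx]) (use b * that in \<open>simp add: R\<close>)
    then show ?thesis
      by (rule zero_of_basis[of "\<lambda>y. R u x y v", OF Ry])
  qed
  have 2: "R (u @ u') x y v = 0" if "set u' \<subseteq> B" "set v \<subseteq> B" "length u + length u' + length v + 2 = m" for u u' x y v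
    using that
  proof (induction u arbitrary: u' rule: rev_induct)
    case (snoc z u)
    have "R (u @ z # u') x y v = 0"
      by (rule zero_of_basis[of "\<lambda>z. R (u @ z # u') x y v", OF Ru]) (use snoc.IH[of "_ # u'"] snoc.prems in simp)
    then show ?case by simp
  qed (simp add: 1)
  have "R u x y (v @ v') = 0" if "set v' \<subseteq> B" "length u + length v + length v' + 2 = m" for u v v' x y
    using that
  proof (induction v arbitrary: v' rule: rev_induct)
    case Nil
    then show ?case using 2[of "[]" v' u] by simp
  next
    case (snoc z v)
    have "R u x y (v @ z # v') = 0"
      by (rule zero_of_basis[of "\<lambda>z. R u x y (v @ z # v')", OF Rv]) (use snoc.IH[of "_ # v'"] snoc.prems in simp)
    then show ?case by simp
  qed
  from this[of "[]" u v x y] show ?thesis using m by (simp add: R)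
qed

lemma jacobi': "br (br x y) z + br (br y z) x - br (br x z) y = 0"
  using jacobi[of x y z] br_swap[of "br x y" z] br_swap[of "br y z" x] br_swap[of "br z x" y]  br_swap[of x z]
  by (simp add: br_minus add_eq_0_iff algebra_simps)

text \<open>Confluence: two descents that are far apart commute, and for two adjacent ones the difference is
  a Jacobi and cocycle expression.\<close>

lemma rhs_eq_apart:
  assumes H: "\<And>u x y v. length u + length v + 2 < length u1 + length w + length v1 + 4 \<Longrightarrow> word_rel L u x y v"
    and e1: "word_rel L (u1 @ y # x # w) z t v1" and e2: "word_rel L u1 x y (w @ t # z # v1)"
  shows "rhs u1 x y (w @ z # t # v1) = rhs (u1 @ x # y # w) z t v1"
proof -
  note e = e1[unfolded word_rel_iff, simplified] e2[unfolded word_rel_iff, simplified]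
    H[of u1 "w @ br z t # v1" x y, unfolded word_rel_iff, simplified]
    H[of u1 "w @ v1" x y, unfolded word_rel_iff, simplified]
    H[of "u1 @ br x y # w" v1 z t, unfolded word_rel_iff, simplified]
    H[of "u1 @ w" v1 z t, unfolded word_rel_iff, simplified]
  show ?thesis by (simp add: e algebra_simps)
qed

lemma rhs_eq_overlap:
  assumes H: "\<And>u x y v. length u + length v + 2 < length u1 + length v1 + 3 \<Longrightarrow> word_rel L u x y v"
    and e1: "word_rel L (u1 @ [y]) x z v1" "word_rel L u1 y z (x # v1)"
    and e2: "word_rel L u1 x z (y # v1)" "word_rel L (u1 @ [z]) x y v1"
  shows "rhs u1 x y (z # v1) = rhs (u1 @ [x]) y z v1"
proof -
  note e = e1[unfolded word_rel_iff, simplified] e2[unfolded word_rel_iff, simplified]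
  have h1: "L (u1 @ br x y # z # v1) = L (u1 @ z # br x y # v1) + L (u1 @ br (br x y) z # v1) + f (br x y) z * L (u1 @ v1)"
    and h2: "L (u1 @ br y z # x # v1) = L (u1 @ x # br y z # v1) + L (u1 @ br (br y z) x # v1) + f (br y z) x * L (u1 @ v1)"
    and h3: "L (u1 @ br x z # y # v1) = L (u1 @ y # br x z # v1) + L (u1 @ br (br x z) y # v1) + f (br x z) y * L (u1 @ v1)"
    using H[of u1 v1 "br x y" z] H[of u1 v1 "br y z" x] H[of u1 v1 "br x z" y] by (simp_all add: word_rel_iff)
  have j: "L (u1 @ br (br x y) z # v1) + L (u1 @ br (br y z) x # v1) - L (u1 @ br (br x z) y # v1) = 0"
  proof -
    have "br (br x y) z + br (br y z) x = br (br x z) y" using jacobi'[of x y z] by simp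
    then show ?thesis using L_lin(1)[of u1 "br (br x y) z" "br (br y z) x" v1] by simp
  qed
  have c: "f (br x y) z + f (br y z) x - f (br x z) y = 0"
    using f_cocycle[of x y z] br_swap[of x z] by (simp add: f_minus)
  then have c': "f (br x z) y = f (br x y) z + f (br y z) x" by simp
  from j have j': "L (u1 @ br (br x z) y # v1) = L (u1 @ br (br x y) z # v1) + L (u1 @ br (br y z) x # v1)" by simp
  show ?thesis by (simp add: e h1 h2 h3 j' c' algebra_simps)
qed

text \<open>The diamond lemma, by induction on the length of the word and then on its number of inversions.
  Any two descents of a word give the same value: they are equal, or overlap in one letter, or lie
  apart. So each of them agrees with the chosen one, for which the relation holds.\<close>

lemma word_rel_L: "word_rel L u x y v"
proof -
  have "\<forall>u x y v. length u + length v + 2 = m \<longrightarrow> word_rel L u x y v" for m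
  proof (induction m rule: less_induct)
    case (less m)
    then have H: "word_rel L u x y v" if "length u + length v + 2 < m" for u x y v
      using that by blast
    \<comment> \<open>The relation is read as a rewriting step at a descent; letters in ascending order are
      treated by antisymmetry at the end.\<close>
    have desc: "\<forall>u x y v. set u \<subseteq> B \<longrightarrow> set v \<subseteq> B \<longrightarrow> x \<in> B \<longrightarrow> y \<in> B \<longrightarrow> length u + length v + 2 = m \<longrightarrow>
       lt y x \<longrightarrow> inversions (u @ x # y # v) = k \<longrightarrow> word_rel L u x y v" for k
    proof (induction k rule: less_induct)
      case (less k)
      then have D: "word_rel L u x y v" if "set u \<subseteq> B" "set v \<subseteq> B" "x \<in> B" "y \<in> B" "length u + length v + 2 = m"
         "lt y x" "inversions (u @ x # y # v) < k" for u x y v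
        using that by blast
      have same: "rhs u x y v = rhs u' x' y' v'"
        if d: "descent w (u, x, y, v)" "descent w (u', x', y', v')" and w: "set w \<subseteq> B" "length w = m" "inversions w = k"
          and le: "length u \<le> length u'" for w u x y v u' x' y' v'
      proof -
        have e: "u @ x # y # v = u' @ x' # y' # v'" and lt: "lt y x" "lt y' x'" using d by auto
        then obtain us where us: "u' = u @ us" "us @ x' # y' # v' = x # y # v"
          using le by (auto simp: append_eq_append_conv2)
        show ?thesis
          \<comment> \<open>\<open>us\<close> is the part of the word from the first descent up to the second. It is empty if
            they are equal, has one letter if they overlap, and at least two if they lie apart.\<close>
        proof (cases us rule: remdups_adj.cases)
          case 1
          then show ?thesis using us by simp
        next
          case (2 a)
          then have eq: "us = [x]" "x' = y" "v = y' # v'" using us by auto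
          have W: "w = u @ x # y # y' # v'" using d eq by simp
          have B: "set u \<subseteq> B" "set v' \<subseteq> B" "x \<in> B" "y \<in> B" "y' \<in> B" using w(1) W by auto
          have ltx: "lt y' x" "lt y x" "lt y' y" using lt eq lt_trans[of y' y x] by auto
          have i1: "inversions (u @ y # x # y' # v') < k"
            using inversions_swap[OF ltx(2), of u "y' # v'"] w(3) W by simp
          have i2: "inversions (u @ y # y' # x # v') < k"
            using inversions_swap[OF ltx(1), of "u @ [y]" "v'"] i1 by simp
          have i3: "inversions (u @ x # y' # y # v') < k"
            using inversions_swap[OF ltx(3), of "u @ [x]" "v'"] w(3) W by simp
          have i4: "inversions (u @ y' # x # y # v') < k"
            using inversions_swap[OF ltx(1), of u "y # v'"] i3 by simp
          \<comment> \<open>The four words occur on the two ways of reversing \<open>x y y'\<close>, and have fewer inversions.\<close>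
          have "rhs u x y (y' # v') = rhs (u @ [x]) y y' v'"
          proof (rule rhs_eq_overlap)
            show "word_rel L p q s t" if "length p + length t + 2 < length u + length v' + 3" for p q s t
              using H[of p t q s] that w(2) W by simp
            show "word_rel L (u @ [y]) x y' v'" by (rule D) (use B ltx i1 w(2) W in simp_all)
            show "word_rel L u y y' (x # v')" by (rule D) (use B ltx i2 w(2) W in simp_all)
            show "word_rel L u x y' (y # v')" by (rule D) (use B ltx i3 w(2) W in simp_all)
            show "word_rel L (u @ [y']) x y v'" by (rule D) (use B ltx i4 w(2) W in simp_all)
          qed
          then show ?thesis using eq us by simp
        next
          case (3 a b ws)
          then have eq: "us = x # y # ws" "v = ws @ x' # y' # v'" using us by auto
          have W: "w = u @ x # y # ws @ x' # y' # v'" using d eq by simp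
          have B: "set u \<subseteq> B" "set v' \<subseteq> B" "set ws \<subseteq> B" "x \<in> B" "y \<in> B" "x' \<in> B" "y' \<in> B" using w(1) W by auto
          have i1: "inversions (u @ y # x # ws @ x' # y' # v') < k"
            using inversions_swap[OF lt(1), of u "ws @ x' # y' # v'"] w(3) W by simp
          have i2: "inversions (u @ x # y # ws @ y' # x' # v') < k"
            using inversions_swap[OF lt(2), of "u @ x # y # ws" v'] w(3) W by simp
          have "rhs u x y (ws @ x' # y' # v') = rhs (u @ x # y # ws) x' y' v'"
          proof (rule rhs_eq_apart)
            show "word_rel L p q s t" if "length p + length t + 2 < length u + length ws + length v' + 4" for p q s t
              using H[of p t q s] that w(2) W by simp
            show "word_rel L (u @ y # x # ws) x' y' v'" by (rule D) (use B lt i1 w(2) W in simp_all)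
            show "word_rel L u x y (ws @ y' # x' # v')" by (rule D) (use B lt i2 w(2) W in simp_all)
          qed
          then show ?thesis using eq us by simp
        qed
      qed
      show ?case
      proof (intro allI impI)
        fix u x y v assume *: "set u \<subseteq> B" "set v \<subseteq> B" "x \<in> B" "y \<in> B" "length u + length v + 2 = m" "lt y x"
          "inversions (u @ x # y # v) = k"
        let ?w = "u @ x # y # v"
        have d: "descent ?w (u, x, y, v)" and w: "set ?w \<subseteq> B" "length ?w = m" "inversions ?w = k" using * by auto
        obtain u' x' y' v' where d': "descent ?w (u', x', y', v')" "L ?w = rhs u' x' y' v'"
          using L_chosen[OF w(1) d] by blast
        have "rhs u x y v = rhs u' x' y' v'"
          using same[OF d d'(1) w] same[OF d'(1) d w] by (cases "length u \<le> length u'") auto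
        then show "word_rel L u x y v" using d'(2) by (simp add: word_rel_iff)
      qed
    qed
    have basis: "word_rel L u x y v" if *: "set u \<subseteq> B" "set v \<subseteq> B" "x \<in> B" "y \<in> B" "length u + length v + 2 = m" for u x y v
    proof (cases "x = y")
      case True
      then show ?thesis by (simp add: word_rel_iff br_self f_self L_zero)
    next
      case False
      then consider "lt y x" | "lt x y" using lt_total by blast
      then show ?thesis
      proof cases
        case 1
        then show ?thesis using desc * by blast
      next
        case 2
        then have "word_rel L u y x v" using desc * by blast
        then show ?thesis
          by (simp add: word_rel_iff br_swap[of y x] f_swap[of y x] L_minus)
      qed
    qed
    show ?case using word_rel_of_basis[OF basis] by blast
  qed
  then show ?thesis by blast
qed

end

context lie_two_cocycle
begin

text \<open>The functional takes the coefficient of the unit in the basis of ordered monomials.\<close>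

theorem A_functional: "\<exists>\<phi>\<in>linear_maps A ground_algebra. \<phi> \<one>\<^bsub>A\<^esub> = 1"
proof -
  obtain B where B: "independent B" "span B = UNIV"
    using maximal_independent_subset[of UNIV] by (metis UNIV_I subset_UNIV top.extremum_uniqueI)
  obtain r :: "'b rel" where r: "well_order_on UNIV r" using well_order_on by blast
  define lt where "lt x y \<longleftrightarrow> (x, y) \<in> r \<and> x \<noteq> y" for x y
  have "antisym r" "trans r" "total_on UNIV r"
    using r by (auto simp: well_order_on_def linear_order_on_def partial_order_on_def preorder_on_def)
  then interpret ordered_basis scale br f B lt
    by unfold_locales (use B in \<open>auto simp: lt_def total_on_def dest: antisymD transD\<close>)
  show ?thesis
    using functional_of_words[of L] word_rel_L L_nil L_lin by (simp add: word_linear_def)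
qed

lemma inj_scalars: "inj (\<lambda>c. c \<odot>\<^bsub>A\<^esub> \<one>\<^bsub>A\<^esub>)"
proof (rule injI)
  obtain \<phi> where \<phi>: "\<phi> \<in> linear_maps A ground_algebra" "\<phi> \<one>\<^bsub>A\<^esub> = 1" using A_functional by blast
  fix c d assume "c \<odot>\<^bsub>A\<^esub> \<one>\<^bsub>A\<^esub> = d \<odot>\<^bsub>A\<^esub> \<one>\<^bsub>A\<^esub>"
  then have "\<phi> (c \<odot>\<^bsub>A\<^esub> \<one>\<^bsub>A\<^esub>) = \<phi> (d \<odot>\<^bsub>A\<^esub> \<one>\<^bsub>A\<^esub>)" by simp
  then show "c = d" using lin_smult[OF \<phi>(1), of "\<one>\<^bsub>A\<^esub>"] \<phi>(2) by simp
qed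

end

section \<open>The Hopf algebra and its coaction\<close>

sublocale lie_two_cocycle \<subseteq> E: lie_two_cocycle scale br "\<lambda>_ _. 0"
  by (rule lie_two_cocycle_zero)

lemma vs_commutator_aux:
  assumes "vspace M" "{a, b, c, d, e, g, h} \<subseteq> carrier M"
  shows "((a \<oplus>\<^bsub>M\<^esub> (b \<oplus>\<^bsub>M\<^esub> c)) \<ominus>\<^bsub>M\<^esub> d) \<ominus>\<^bsub>M\<^esub> (e \<ominus>\<^bsub>M\<^esub> g) =
    ((a \<ominus>\<^bsub>M\<^esub> e) \<ominus>\<^bsub>M\<^esub> (d \<ominus>\<^bsub>M\<^esub> (g \<oplus>\<^bsub>M\<^esub> (h \<oplus>\<^bsub>M\<^esub> c)))) \<oplus>\<^bsub>M\<^esub> (b \<ominus>\<^bsub>M\<^esub> h)"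
proof -
  define b' where "b' = b \<ominus>\<^bsub>M\<^esub> h"
  have *: "a \<in> carrier M" "c \<in> carrier M" "d \<in> carrier M" "e \<in> carrier M" "g \<in> carrier M" "h \<in> carrier M"
    "b' \<in> carrier M" and b: "b = b' \<oplus>\<^bsub>M\<^esub> h"
    using assms vs_diff_eq_iff[of M b h b'] by (auto simp: b'_def)
  have "b \<ominus>\<^bsub>M\<^esub> h = b'" by (simp add: b'_def)
  then show ?thesis
    using * assms(1) by (simp add: b vs_diff_def vs_minus_add vs_ac)
qed

context lie_two_cocycle
begin

abbreviation "U \<equiv> env scale br"
abbreviation "j \<equiv> env_incl scale br"
abbreviation "AU \<equiv> tensor A U"
abbreviation "UU \<equiv> tensor U U"
abbreviation "\<rho> \<equiv> twisted_coaction scale br f"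
abbreviation "\<Delta> \<equiv> twisted_coaction scale br (\<lambda>_ _. 0)"
abbreviation "\<epsilon> \<equiv> env_ext ground_algebra (\<lambda>xs :: 'b list. if xs = [] then 1 else 0 :: 'a)"
abbreviation "S \<equiv> env_ext U (\<lambda>xs. foldr (\<lambda>x s. s \<otimes>\<^bsub>U\<^esub> (\<ominus>\<^bsub>U\<^esub> j x)) xs \<one>\<^bsub>U\<^esub>)"

lemma E_lierepI:
  assumes "vspace N" "\<And>x. D x \<in> linear_maps N N" "\<And>v. v \<in> carrier N \<Longrightarrow> (\<lambda>x. D x v) \<in> linear_maps V N"
    and e: "\<And>x y v. v \<in> carrier N \<Longrightarrow> D x (D y v) = D y (D x v) \<oplus>\<^bsub>N\<^esub> D (br x y) v"
  shows "E.lierep N D"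
proof (rule E.lierepI[OF assms(1-3)])
  fix x y v assume v: "v \<in> carrier N"
  show "D x (D y v) = D y (D x v) \<oplus>\<^bsub>N\<^esub> (D (br x y) v \<oplus>\<^bsub>N\<^esub> 0 \<odot>\<^bsub>N\<^esub> v)"
    using e[OF v, of x y] v assms(1) lin_closed[OF assms(2) v] by simp
qed

lemma j_rel: "j x \<otimes>\<^bsub>U\<^esub> j y = j y \<otimes>\<^bsub>U\<^esub> j x \<oplus>\<^bsub>U\<^esub> j (br x y)"
  using E.\<iota>_rel[of x y] by simp

text \<open>In the difference of left and right multiplication the two occurrences of the cocycle
  cancel. So a pair of twisted representations gives an untwisted one, and the enveloping algebra acts.\<close>

lemma lierep_ad:
  assumes B: "assoc_algebra B" and l: "l \<in> linear_maps V B" and r: "r \<in> linear_maps V B"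
    and lr: "\<And>x y. l x \<otimes>\<^bsub>B\<^esub> l y = l y \<otimes>\<^bsub>B\<^esub> l x \<oplus>\<^bsub>B\<^esub> (l (br x y) \<oplus>\<^bsub>B\<^esub> f x y \<odot>\<^bsub>B\<^esub> \<one>\<^bsub>B\<^esub>)"
      "\<And>x y. r x \<otimes>\<^bsub>B\<^esub> r y = r y \<otimes>\<^bsub>B\<^esub> r x \<oplus>\<^bsub>B\<^esub> (r (br x y) \<oplus>\<^bsub>B\<^esub> f x y \<odot>\<^bsub>B\<^esub> \<one>\<^bsub>B\<^esub>)"
  shows "E.lierep B (\<lambda>x t. l x \<otimes>\<^bsub>B\<^esub> t \<ominus>\<^bsub>B\<^esub> t \<otimes>\<^bsub>B\<^esub> r x)"
proof (rule E_lierepI)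
  note VB = alg_vspace[OF B]
  have cl: "l x \<in> carrier B" "r x \<in> carrier B" for x
    using lin_closed[OF l, of x] lin_closed[OF r, of x] by simp_all
  show "vspace B" by (rule VB)
  show "(\<lambda>t. l x \<otimes>\<^bsub>B\<^esub> t \<ominus>\<^bsub>B\<^esub> t \<otimes>\<^bsub>B\<^esub> r x) \<in> linear_maps B B" for x
    by (intro lin_diff_map alg_lin_left alg_lin_right lin_id VB B cl)
  fix v assume v: "v \<in> carrier B"
  show "(\<lambda>x. l x \<otimes>\<^bsub>B\<^esub> v \<ominus>\<^bsub>B\<^esub> v \<otimes>\<^bsub>B\<^esub> r x) \<in> linear_maps V B"
    by (intro lin_diff_map alg_lin_left alg_lin_right l r VB B v vspace_V)
  fix x y
  have 1: "l x \<otimes>\<^bsub>B\<^esub> (l y \<otimes>\<^bsub>B\<^esub> v) = l y \<otimes>\<^bsub>B\<^esub> (l x \<otimes>\<^bsub>B\<^esub> v) \<oplus>\<^bsub>B\<^esub> (l (br x y) \<otimes>\<^bsub>B\<^esub> v \<oplus>\<^bsub>B\<^esub> f x y \<odot>\<^bsub>B\<^esub> v)"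
  proof -
    have "l x \<otimes>\<^bsub>B\<^esub> (l y \<otimes>\<^bsub>B\<^esub> v) = (l x \<otimes>\<^bsub>B\<^esub> l y) \<otimes>\<^bsub>B\<^esub> v" using B cl v by (simp add: alg_assoc)
    then show ?thesis using B cl v by (simp add: lr(1)[of x y] alg_l_distr alg_smult_left alg_assoc)
  qed
  have 2: "(v \<otimes>\<^bsub>B\<^esub> r x) \<otimes>\<^bsub>B\<^esub> r y = (v \<otimes>\<^bsub>B\<^esub> r y) \<otimes>\<^bsub>B\<^esub> r x \<oplus>\<^bsub>B\<^esub> (v \<otimes>\<^bsub>B\<^esub> r (br x y) \<oplus>\<^bsub>B\<^esub> f x y \<odot>\<^bsub>B\<^esub> v)"
    using B cl v by (simp add: lr(2)[of x y] alg_r_distr alg_smult_right alg_assoc)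
  have "l x \<otimes>\<^bsub>B\<^esub> (l y \<otimes>\<^bsub>B\<^esub> v \<ominus>\<^bsub>B\<^esub> v \<otimes>\<^bsub>B\<^esub> r y) \<ominus>\<^bsub>B\<^esub> (l y \<otimes>\<^bsub>B\<^esub> v \<ominus>\<^bsub>B\<^esub> v \<otimes>\<^bsub>B\<^esub> r y) \<otimes>\<^bsub>B\<^esub> r x
    = (l x \<otimes>\<^bsub>B\<^esub> (l y \<otimes>\<^bsub>B\<^esub> v) \<ominus>\<^bsub>B\<^esub> l x \<otimes>\<^bsub>B\<^esub> (v \<otimes>\<^bsub>B\<^esub> r y)) \<ominus>\<^bsub>B\<^esub> (l y \<otimes>\<^bsub>B\<^esub> (v \<otimes>\<^bsub>B\<^esub> r x) \<ominus>\<^bsub>B\<^esub> (v \<otimes>\<^bsub>B\<^esub> r y) \<otimes>\<^bsub>B\<^esub> r x)"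
    using B cl v by (simp add: alg_diff_left alg_diff_right alg_assoc)
  also have "\<dots> = ((l y \<otimes>\<^bsub>B\<^esub> (l x \<otimes>\<^bsub>B\<^esub> v) \<ominus>\<^bsub>B\<^esub> l y \<otimes>\<^bsub>B\<^esub> (v \<otimes>\<^bsub>B\<^esub> r x)) \<ominus>\<^bsub>B\<^esub>
      (l x \<otimes>\<^bsub>B\<^esub> (v \<otimes>\<^bsub>B\<^esub> r y) \<ominus>\<^bsub>B\<^esub> (v \<otimes>\<^bsub>B\<^esub> r x) \<otimes>\<^bsub>B\<^esub> r y)) \<oplus>\<^bsub>B\<^esub> (l (br x y) \<otimes>\<^bsub>B\<^esub> v \<ominus>\<^bsub>B\<^esub> v \<otimes>\<^bsub>B\<^esub> r (br x y))"
    unfolding 1 2 by (rule vs_commutator_aux) (use B cl v in simp_all)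
  also have "\<dots> = (l y \<otimes>\<^bsub>B\<^esub> (l x \<otimes>\<^bsub>B\<^esub> v \<ominus>\<^bsub>B\<^esub> v \<otimes>\<^bsub>B\<^esub> r x) \<ominus>\<^bsub>B\<^esub> (l x \<otimes>\<^bsub>B\<^esub> v \<ominus>\<^bsub>B\<^esub> v \<otimes>\<^bsub>B\<^esub> r x) \<otimes>\<^bsub>B\<^esub> r y)
      \<oplus>\<^bsub>B\<^esub> (l (br x y) \<otimes>\<^bsub>B\<^esub> v \<ominus>\<^bsub>B\<^esub> v \<otimes>\<^bsub>B\<^esub> r (br x y))"
    using B cl v by (simp add: alg_diff_left alg_diff_right alg_assoc)
  finally show "l x \<otimes>\<^bsub>B\<^esub> (l y \<otimes>\<^bsub>B\<^esub> v \<ominus>\<^bsub>B\<^esub> v \<otimes>\<^bsub>B\<^esub> r y) \<ominus>\<^bsub>B\<^esub> (l y \<otimes>\<^bsub>B\<^esub> v \<ominus>\<^bsub>B\<^esub> v \<otimes>\<^bsub>B\<^esub> r y) \<otimes>\<^bsub>B\<^esub> r x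
    = (l y \<otimes>\<^bsub>B\<^esub> (l x \<otimes>\<^bsub>B\<^esub> v \<ominus>\<^bsub>B\<^esub> v \<otimes>\<^bsub>B\<^esub> r x) \<ominus>\<^bsub>B\<^esub> (l x \<otimes>\<^bsub>B\<^esub> v \<ominus>\<^bsub>B\<^esub> v \<otimes>\<^bsub>B\<^esub> r x) \<otimes>\<^bsub>B\<^esub> r y)
      \<oplus>\<^bsub>B\<^esub> (l (br x y) \<otimes>\<^bsub>B\<^esub> v \<ominus>\<^bsub>B\<^esub> v \<otimes>\<^bsub>B\<^esub> r (br x y))" .
qed

text \<open>The image of a generator under the coaction.\<close>

definition d :: "'b \<Rightarrow> (('b list \<Rightarrow>\<^sub>0 'a) set set \<times> ('b list \<Rightarrow>\<^sub>0 'a) set set \<Rightarrow>\<^sub>0 'a) set" where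
  "d x = cls AU (\<iota> x, \<one>\<^bsub>U\<^esub>) \<oplus>\<^bsub>AU\<^esub> cls AU (\<one>\<^bsub>A\<^esub>, j x)"

lemma d_lin: "d \<in> linear_maps V AU"
  unfolding d_def[abs_def]
  by (intro lin_add_map tens_lin_left tens_lin_right \<iota>_lin E.\<iota>_lin) simp_all

lemma d_closed [simp]: "d x \<in> carrier AU"
  using lin_closed[OF d_lin, of x] by simp

lemma d_mult_tens:
  "\<lbrakk>a \<in> carrier A; h \<in> carrier U\<rbrakk> \<Longrightarrow> d x \<otimes>\<^bsub>AU\<^esub> cls AU (a, h) = cls AU (\<iota> x \<otimes>\<^bsub>A\<^esub> a, h) \<oplus>\<^bsub>AU\<^esub> cls AU (a, j x \<otimes>\<^bsub>U\<^esub> h)"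
  by (simp add: d_def alg_l_distr tens_mult)

lemma tens_mult_d:
  "\<lbrakk>a \<in> carrier A; h \<in> carrier U\<rbrakk> \<Longrightarrow> cls AU (a, h) \<otimes>\<^bsub>AU\<^esub> d x = cls AU (a \<otimes>\<^bsub>A\<^esub> \<iota> x, h) \<oplus>\<^bsub>AU\<^esub> cls AU (a, h \<otimes>\<^bsub>U\<^esub> j x)"
  by (simp add: d_def alg_r_distr tens_mult)

lemma d_rel: "d x \<otimes>\<^bsub>AU\<^esub> d y = d y \<otimes>\<^bsub>AU\<^esub> d x \<oplus>\<^bsub>AU\<^esub> (d (br x y) \<oplus>\<^bsub>AU\<^esub> f x y \<odot>\<^bsub>AU\<^esub> \<one>\<^bsub>AU\<^esub>)"
proof -
  have e: "d x \<otimes>\<^bsub>AU\<^esub> d y = (cls AU (\<iota> x \<otimes>\<^bsub>A\<^esub> \<iota> y, \<one>\<^bsub>U\<^esub>) \<oplus>\<^bsub>AU\<^esub> cls AU (\<iota> y, j x)) \<oplus>\<^bsub>AU\<^esub>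
      (cls AU (\<iota> x, j y) \<oplus>\<^bsub>AU\<^esub> cls AU (\<one>\<^bsub>A\<^esub>, j x \<otimes>\<^bsub>U\<^esub> j y))" for x y
    unfolding d_def[of y] by (simp add: alg_r_distr d_mult_tens)
  show ?thesis
    unfolding e[of x y] e[of y x] \<iota>_rel[of x y] j_rel[of x y] d_def[of "br x y"]
    by (simp add: tens_add_left tens_add_right tens_smult_left tens_one vs_ac)
qed

lemma lierep_d: "lierep AU (\<lambda>x t. d x \<otimes>\<^bsub>AU\<^esub> t)"
  by (rule lierep_mult[OF _ d_lin d_rel]) simp

text \<open>The coaction sends a product of generators \<open>\<iota> x\<close> to the product of the elements \<open>d x\<close>; it is well
  defined because these satisfy the defining relations.\<close>

lemma \<rho>_eact: "\<rho> a = eact AU (\<lambda>x t. d x \<otimes>\<^bsub>AU\<^esub> t) a \<one>\<^bsub>AU\<^esub>"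
  by (simp add: twisted_coaction_def Let_def eact_def d_def)

lemma \<rho>_lin: "\<rho> \<in> linear_maps A AU"
  unfolding \<rho>_eact[abs_def] by (rule eact_lin[OF lierep_d]) simp

lemma \<rho>_closed [simp]: "a \<in> carrier A \<Longrightarrow> \<rho> a \<in> carrier AU"
  by (rule lin_closed[OF \<rho>_lin])

lemma \<rho>_one: "\<rho> \<one>\<^bsub>A\<^esub> = \<one>\<^bsub>AU\<^esub>"
  unfolding \<rho>_eact by (rule eact_one[OF lierep_d]) simp

lemma \<rho>_\<iota>_mult: "a \<in> carrier A \<Longrightarrow> \<rho> (\<iota> x \<otimes>\<^bsub>A\<^esub> a) = d x \<otimes>\<^bsub>AU\<^esub> \<rho> a"
  unfolding \<rho>_eact by (rule eact_\<iota>_mult[OF lierep_d]) simp_all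

lemma \<rho>_\<iota>: "\<rho> (\<iota> x) = d x"
  using \<rho>_\<iota>_mult[of "\<one>\<^bsub>A\<^esub>" x] by (simp add: \<rho>_one)

lemma \<rho>_mult:
  assumes a: "a \<in> carrier A" and b: "b \<in> carrier A"
  shows "\<rho> (a \<otimes>\<^bsub>A\<^esub> b) = \<rho> a \<otimes>\<^bsub>AU\<^esub> \<rho> b"
proof (rule A_lin_eq[OF _ _ _ _ _ a, of AU])
  show "(\<lambda>a. \<rho> (a \<otimes>\<^bsub>A\<^esub> b)) \<in> linear_maps A AU"
    by (intro lin_comp[OF \<rho>_lin] alg_lin_right b lin_id) simp
  show "(\<lambda>a. \<rho> a \<otimes>\<^bsub>AU\<^esub> \<rho> b) \<in> linear_maps A AU"
    by (intro alg_lin_right \<rho>_lin) (simp_all add: b)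
  fix x a assume "a \<in> carrier A" "\<rho> (a \<otimes>\<^bsub>A\<^esub> b) = \<rho> a \<otimes>\<^bsub>AU\<^esub> \<rho> b"
  then show "\<rho> ((\<iota> x \<otimes>\<^bsub>A\<^esub> a) \<otimes>\<^bsub>A\<^esub> b) = \<rho> (\<iota> x \<otimes>\<^bsub>A\<^esub> a) \<otimes>\<^bsub>AU\<^esub> \<rho> b"
    using b by (simp add: alg_assoc \<rho>_\<iota>_mult)
qed (simp_all add: b \<rho>_one)

lemma \<rho>_hom: "\<rho> \<in> algebra_homs A AU"
  using \<rho>_lin by (auto simp: algebra_homs_def ring_hom_def \<rho>_mult lin_add[OF \<rho>_lin] \<rho>_one)

lemma \<epsilon>_eact: "\<epsilon> h = eact ground_algebra (\<lambda>_ _. 0) h 1"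
proof -
  have "(if xs = [] then 1 else 0 :: 'a) = foldr (\<lambda>_ _. 0) xs 1" for xs :: "'b list"
    by (cases xs) auto
  then have e: "(\<lambda>xs :: 'b list. if xs = [] then 1 else 0 :: 'a) = (\<lambda>xs. foldr (\<lambda>_ _. 0) xs 1)"
    by (rule ext)
  show ?thesis unfolding eact_def e by (rule refl)
qed

lemma lierep_zero: "E.lierep ground_algebra (\<lambda>_ _. 0)"
  by (rule E_lierepI) (use lin_zero_map[OF vspace_ground_algebra] in auto)

lemma \<epsilon>_lin: "\<epsilon> \<in> linear_maps U ground_algebra"
  unfolding \<epsilon>_eact[abs_def] by (rule E.eact_lin[OF lierep_zero]) simp

lemma \<epsilon>_one: "\<epsilon> \<one>\<^bsub>U\<^esub> = 1"
  unfolding \<epsilon>_eact by (rule E.eact_one[OF lierep_zero]) simp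

lemma \<epsilon>_j_mult: "h \<in> carrier U \<Longrightarrow> \<epsilon> (j x \<otimes>\<^bsub>U\<^esub> h) = 0"
  unfolding \<epsilon>_eact by (rule E.eact_\<iota>_mult[OF lierep_zero]) simp_all

lemma \<epsilon>_mult:
  assumes a: "a \<in> carrier U" and b: "b \<in> carrier U"
  shows "\<epsilon> (a \<otimes>\<^bsub>U\<^esub> b) = \<epsilon> a * \<epsilon> b"
proof (rule E.A_lin_eq[OF _ _ _ _ _ a, of ground_algebra])
  show "(\<lambda>a. \<epsilon> (a \<otimes>\<^bsub>U\<^esub> b)) \<in> linear_maps U ground_algebra"
    by (intro lin_comp[OF \<epsilon>_lin] alg_lin_right b lin_id) simp
  show "(\<lambda>a. \<epsilon> a * \<epsilon> b) \<in> linear_maps U ground_algebra"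
    using lin_scalar_map[OF vspace_ground_algebra \<epsilon>_lin, of "\<epsilon> b"] by simp
qed (simp_all add: b \<epsilon>_one alg_assoc \<epsilon>_j_mult)

lemma \<epsilon>_hom: "\<epsilon> \<in> algebra_homs U ground_algebra"
  using \<epsilon>_lin lin_add[OF \<epsilon>_lin] by (auto simp: algebra_homs_def ring_hom_def \<epsilon>_mult \<epsilon>_one)

lemma S_eact: "S h = eact U (\<lambda>x s. s \<otimes>\<^bsub>U\<^esub> (\<ominus>\<^bsub>U\<^esub> j x)) h \<one>\<^bsub>U\<^esub>"
  by (simp add: eact_def)

lemma lierep_S: "E.lierep U (\<lambda>x s. s \<otimes>\<^bsub>U\<^esub> (\<ominus>\<^bsub>U\<^esub> j x))"
proof (rule E_lierepI)
  show "(\<lambda>s. s \<otimes>\<^bsub>U\<^esub> (\<ominus>\<^bsub>U\<^esub> j x)) \<in> linear_maps U U" for x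
    by (intro alg_lin_right lin_id) simp_all
  fix v assume v: "v \<in> carrier U"
  show "(\<lambda>x. v \<otimes>\<^bsub>U\<^esub> (\<ominus>\<^bsub>U\<^esub> j x)) \<in> linear_maps V U"
    by (intro alg_lin_left v lin_minus_map E.\<iota>_lin) simp_all
  show "(v \<otimes>\<^bsub>U\<^esub> (\<ominus>\<^bsub>U\<^esub> j y)) \<otimes>\<^bsub>U\<^esub> (\<ominus>\<^bsub>U\<^esub> j x) = (v \<otimes>\<^bsub>U\<^esub> (\<ominus>\<^bsub>U\<^esub> j x)) \<otimes>\<^bsub>U\<^esub> (\<ominus>\<^bsub>U\<^esub> j y) \<oplus>\<^bsub>U\<^esub> v \<otimes>\<^bsub>U\<^esub> (\<ominus>\<^bsub>U\<^esub> j (br x y))" for x y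
  proof -
    have "v \<otimes>\<^bsub>U\<^esub> (j x \<otimes>\<^bsub>U\<^esub> j y) = v \<otimes>\<^bsub>U\<^esub> (j y \<otimes>\<^bsub>U\<^esub> j x) \<oplus>\<^bsub>U\<^esub> v \<otimes>\<^bsub>U\<^esub> j (br x y)"
      using v by (simp add: j_rel[of x y] alg_r_distr)
    then show ?thesis using v by (simp add: alg_minus_left alg_minus_right alg_assoc vs_ac)
  qed
qed simp

lemma S_lin: "S \<in> linear_maps U U"
  unfolding S_eact[abs_def] by (rule E.eact_lin[OF lierep_S]) simp

lemma S_closed [simp]: "h \<in> carrier U \<Longrightarrow> S h \<in> carrier U"
  by (rule lin_closed[OF S_lin])

lemma S_one: "S \<one>\<^bsub>U\<^esub> = \<one>\<^bsub>U\<^esub>"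
  unfolding S_eact by (rule E.eact_one[OF lierep_S]) simp

lemma S_j_mult: "h \<in> carrier U \<Longrightarrow> S (j x \<otimes>\<^bsub>U\<^esub> h) = S h \<otimes>\<^bsub>U\<^esub> (\<ominus>\<^bsub>U\<^esub> j x)"
  unfolding S_eact by (rule E.eact_\<iota>_mult[OF lierep_S]) simp_all

end

context lie_two_cocycle
begin

subsection \<open>Coassociativity and counit\<close>

abbreviation "AUU \<equiv> tensor A UU"

text \<open>Both composites send multiplication by \<open>\<iota> x\<close> to multiplication by the element \<open>e x\<close> of
  \<open>A \<otimes> U \<otimes> U\<close>, the sum of the images of \<open>x\<close> in the three factors. In the proof, \<open>F\<close> is the summand
  on the left-hand side, and \<open>G\<close> and \<open>\<theta>1\<close> are its successive linear extensions.\<close>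

lemma \<rho>_coassoc:
  assumes m: "m \<in> carrier A"
  shows "lin_ext AUU (\<lambda>(a, h). lin_ext AUU (\<lambda>(a0, a1). cls AUU (a0, cls UU (a1, h))) (\<rho> a)) (\<rho> m)
      = lin_ext AUU (\<lambda>(a, h). cls AUU (a, \<Delta> h)) (\<rho> m)"
proof -
  define F where "F = (\<lambda>h a0 a1. cls AUU (a0, cls UU (a1, h)))"
  define G where "G = (\<lambda>a h. lin_ext AUU (\<lambda>(a0, a1). F h a0 a1) (\<rho> a))"
  define \<theta>1 where "\<theta>1 = lin_ext AUU (\<lambda>(a, h). G a h)"
  define \<theta>2 where "\<theta>2 = lin_ext AUU (\<lambda>(a, h). cls AUU (a, \<Delta> h))"
  define e where "e x = cls AUU (\<iota> x, \<one>\<^bsub>UU\<^esub>) \<oplus>\<^bsub>AUU\<^esub> cls AUU (\<one>\<^bsub>A\<^esub>, E.d x)" for x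
  have e_cl: "e x \<in> carrier AUU" for x by (simp add: e_def)
  have e_mult: "e x \<otimes>\<^bsub>AUU\<^esub> cls AUU (a, s) = cls AUU (\<iota> x \<otimes>\<^bsub>A\<^esub> a, s) \<oplus>\<^bsub>AUU\<^esub> cls AUU (a, E.d x \<otimes>\<^bsub>UU\<^esub> s)"
    if "a \<in> carrier A" "s \<in> carrier UU" for x a s
    using that by (simp add: e_def alg_l_distr tens_mult)
  have F: "bilin A U AUU (F h)" if "h \<in> carrier U" for h
    unfolding F_def by (intro bilinI tens_lin_left tens_lin_right lin_id) (simp_all add: that)
  have Flin: "(\<lambda>h. F h a0 a1) \<in> linear_maps U AUU" if "a0 \<in> carrier A" "a1 \<in> carrier U" for a0 a1
    unfolding F_def by (intro tens_lin_right lin_id) (simp_all add: that)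
  note Fl = tensor_ext_lin[of A U AUU, OF _ _ _ F] and Fc = tensor_ext_cls[of A U AUU, OF _ _ _ F]
  have G: "bilin A U AUU G"
    unfolding G_def
    by (intro bilinI Fl \<rho>_lin tensor_ext_param[of A U]) (simp_all add: Flin)
  have \<theta>1: "\<theta>1 \<in> linear_maps AU AUU"
    unfolding \<theta>1_def using tensor_ext_lin[of A U AUU, OF _ _ _ G lin_id] by simp
  have \<theta>1c: "\<theta>1 (cls AU (a, h)) = G a h" if "a \<in> carrier A" "h \<in> carrier U" for a h
    unfolding \<theta>1_def using tensor_ext_cls[of A U AUU, OF _ _ _ G that] by simp
  have b2: "bilin A U AUU (\<lambda>a h. cls AUU (a, \<Delta> h))"
    by (intro bilinI tens_lin_left tens_lin_right lin_id lin_comp[OF E.\<rho>_lin]) simp_all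
  have \<theta>2: "\<theta>2 \<in> linear_maps AU AUU"
    unfolding \<theta>2_def using tensor_ext_lin[of A U AUU, OF _ _ _ b2 lin_id] by simp
  have \<theta>2c: "\<theta>2 (cls AU (a, h)) = cls AUU (a, \<Delta> h)" if "a \<in> carrier A" "h \<in> carrier U" for a h
    unfolding \<theta>2_def using tensor_ext_cls[of A U AUU, OF _ _ _ b2 that] by simp
  have claim: "lin_ext AUU (\<lambda>(a0, a1). F h a0 a1) (d x \<otimes>\<^bsub>AU\<^esub> s) \<oplus>\<^bsub>AUU\<^esub> lin_ext AUU (\<lambda>(a0, a1). F (j x \<otimes>\<^bsub>U\<^esub> h) a0 a1) s
      = e x \<otimes>\<^bsub>AUU\<^esub> lin_ext AUU (\<lambda>(a0, a1). F h a0 a1) s" if h: "h \<in> carrier U" and s: "s \<in> carrier AU" for h x s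
  proof (rule tensor_lin_eq[of A U AUU, OF _ _ _ _ _ _ s])
    show "(\<lambda>s. lin_ext AUU (\<lambda>(a0, a1). F h a0 a1) (d x \<otimes>\<^bsub>AU\<^esub> s) \<oplus>\<^bsub>AUU\<^esub> lin_ext AUU (\<lambda>(a0, a1). F (j x \<otimes>\<^bsub>U\<^esub> h) a0 a1) s) \<in> linear_maps AU AUU"
      by (intro lin_add_map Fl alg_lin_left lin_id) (simp_all add: h)
    show "(\<lambda>s. e x \<otimes>\<^bsub>AUU\<^esub> lin_ext AUU (\<lambda>(a0, a1). F h a0 a1) s) \<in> linear_maps AU AUU"
      by (intro alg_lin_left Fl lin_id) (simp_all add: h e_cl)
    fix a0 a1 assume a: "a0 \<in> carrier A" "a1 \<in> carrier U"
    have "lin_ext AUU (\<lambda>(a0, a1). F h a0 a1) (d x \<otimes>\<^bsub>AU\<^esub> cls AU (a0, a1)) = F h (\<iota> x \<otimes>\<^bsub>A\<^esub> a0) a1 \<oplus>\<^bsub>AUU\<^esub> F h a0 (j x \<otimes>\<^bsub>U\<^esub> a1)"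
      using a h by (simp add: d_mult_tens lin_add[OF Fl[OF _ _ _ _ lin_id]] Fc)
    then show "lin_ext AUU (\<lambda>(a0, a1). F h a0 a1) (d x \<otimes>\<^bsub>AU\<^esub> cls AU (a0, a1)) \<oplus>\<^bsub>AUU\<^esub> lin_ext AUU (\<lambda>(a0, a1). F (j x \<otimes>\<^bsub>U\<^esub> h) a0 a1) (cls AU (a0, a1))
      = e x \<otimes>\<^bsub>AUU\<^esub> lin_ext AUU (\<lambda>(a0, a1). F h a0 a1) (cls AU (a0, a1))"
      using a h by (simp add: Fc) (simp add: F_def e_mult E.d_mult_tens tens_add_right vs_assoc)
  qed simp_all
  have 1: "\<theta>1 (d x \<otimes>\<^bsub>AU\<^esub> t) = e x \<otimes>\<^bsub>AUU\<^esub> \<theta>1 t" if "t \<in> carrier AU" for x t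
  proof (rule tensor_lin_eq[of A U AUU, OF _ _ _ _ _ _ that])
    show "(\<lambda>t. \<theta>1 (d x \<otimes>\<^bsub>AU\<^esub> t)) \<in> linear_maps AU AUU"
      by (intro lin_comp[OF \<theta>1] alg_lin_left lin_id) simp_all
    show "(\<lambda>t. e x \<otimes>\<^bsub>AUU\<^esub> \<theta>1 t) \<in> linear_maps AU AUU"
      by (intro alg_lin_left \<theta>1) (simp_all add: e_cl)
    fix a h assume a: "a \<in> carrier A" "h \<in> carrier U"
    then show "\<theta>1 (d x \<otimes>\<^bsub>AU\<^esub> cls AU (a, h)) = e x \<otimes>\<^bsub>AUU\<^esub> \<theta>1 (cls AU (a, h))"
      using claim[of h "\<rho> a" x] by (simp add: d_mult_tens lin_add[OF \<theta>1] \<theta>1c G_def \<rho>_\<iota>_mult)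
  qed simp_all
  have 2: "\<theta>2 (d x \<otimes>\<^bsub>AU\<^esub> t) = e x \<otimes>\<^bsub>AUU\<^esub> \<theta>2 t" if "t \<in> carrier AU" for x t
  proof (rule tensor_lin_eq[of A U AUU, OF _ _ _ _ _ _ that])
    show "(\<lambda>t. \<theta>2 (d x \<otimes>\<^bsub>AU\<^esub> t)) \<in> linear_maps AU AUU"
      by (intro lin_comp[OF \<theta>2] alg_lin_left lin_id) simp_all
    show "(\<lambda>t. e x \<otimes>\<^bsub>AUU\<^esub> \<theta>2 t) \<in> linear_maps AU AUU"
      by (intro alg_lin_left \<theta>2) (simp_all add: e_cl)
    fix a h assume a: "a \<in> carrier A" "h \<in> carrier U"
    then show "\<theta>2 (d x \<otimes>\<^bsub>AU\<^esub> cls AU (a, h)) = e x \<otimes>\<^bsub>AUU\<^esub> \<theta>2 (cls AU (a, h))"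
      by (simp add: d_mult_tens lin_add[OF \<theta>2] \<theta>2c e_mult E.\<rho>_\<iota>_mult)
  qed simp_all
  have "\<theta>1 (\<rho> m) = \<theta>2 (\<rho> m)"
  proof (rule A_lin_eq[OF _ _ _ _ _ m, of AUU])
    show "(\<lambda>m. \<theta>1 (\<rho> m)) \<in> linear_maps A AUU" "(\<lambda>m. \<theta>2 (\<rho> m)) \<in> linear_maps A AUU"
      by (intro lin_comp[OF \<theta>1] lin_comp[OF \<theta>2] \<rho>_lin)+
    show "\<theta>1 (\<rho> \<one>\<^bsub>A\<^esub>) = \<theta>2 (\<rho> \<one>\<^bsub>A\<^esub>)"
      by (simp add: \<rho>_one tens_one \<theta>1c \<theta>2c G_def Fc) (simp add: F_def E.\<rho>_one tens_one)
    show "\<theta>1 (\<rho> (\<iota> x \<otimes>\<^bsub>A\<^esub> a)) = \<theta>2 (\<rho> (\<iota> x \<otimes>\<^bsub>A\<^esub> a))" if "a \<in> carrier A" "\<theta>1 (\<rho> a) = \<theta>2 (\<rho> a)" for x a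
      using that by (simp add: \<rho>_\<iota>_mult 1 2)
  qed simp
  then show ?thesis by (simp add: \<theta>1_def \<theta>2_def G_def F_def)
qed

lemma \<rho>_counit:
  assumes m: "m \<in> carrier A"
  shows "lin_ext A (\<lambda>(a, h). \<epsilon> h \<odot>\<^bsub>A\<^esub> a) (\<rho> m) = m"
proof -
  define \<theta> where "\<theta> = lin_ext A (\<lambda>(a, h). \<epsilon> h \<odot>\<^bsub>A\<^esub> a)"
  have b: "bilin A U A (\<lambda>a h. \<epsilon> h \<odot>\<^bsub>A\<^esub> a)"
    by (intro bilinI lin_scalar_map lin_smult_map lin_id \<epsilon>_lin) simp_all
  have \<theta>: "\<theta> \<in> linear_maps AU A"
    unfolding \<theta>_def using tensor_ext_lin[of A U A, OF _ _ _ b lin_id] by simp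
  have c: "\<theta> (cls AU (a, h)) = \<epsilon> h \<odot>\<^bsub>A\<^esub> a" if "a \<in> carrier A" "h \<in> carrier U" for a h
    unfolding \<theta>_def using tensor_ext_cls[of A U A, OF _ _ _ b that] by simp
  have 1: "\<theta> (d x \<otimes>\<^bsub>AU\<^esub> t) = \<iota> x \<otimes>\<^bsub>A\<^esub> \<theta> t" if "t \<in> carrier AU" for x t
  proof (rule tensor_lin_eq[of A U A, OF _ _ _ _ _ _ that])
    show "(\<lambda>t. \<theta> (d x \<otimes>\<^bsub>AU\<^esub> t)) \<in> linear_maps AU A" "(\<lambda>t. \<iota> x \<otimes>\<^bsub>A\<^esub> \<theta> t) \<in> linear_maps AU A"
      by (intro lin_comp[OF \<theta>] alg_lin_left \<theta> lin_id; simp)+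
    show "\<theta> (d x \<otimes>\<^bsub>AU\<^esub> cls AU (a, h)) = \<iota> x \<otimes>\<^bsub>A\<^esub> \<theta> (cls AU (a, h))" if "a \<in> carrier A" "h \<in> carrier U" for a h
      using that by (simp add: d_mult_tens lin_add[OF \<theta>] c \<epsilon>_j_mult alg_smult_right)
  qed simp_all
  have "\<theta> (\<rho> m) = m"
  proof (rule A_lin_eq[OF _ _ lin_id _ _ m])
    show "(\<lambda>m. \<theta> (\<rho> m)) \<in> linear_maps A A" by (rule lin_comp[OF \<theta> \<rho>_lin])
  qed (simp_all add: \<rho>_one tens_one c \<epsilon>_one \<rho>_\<iota>_mult 1)
  then show ?thesis by (simp add: \<theta>_def)
qed

lemma counit_left_U:
  assumes m: "m \<in> carrier U"
  shows "lin_ext U (\<lambda>(a, h). \<epsilon> a \<odot>\<^bsub>U\<^esub> h) (\<Delta> m) = m"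
proof -
  define \<theta> where "\<theta> = lin_ext U (\<lambda>(a, h). \<epsilon> a \<odot>\<^bsub>U\<^esub> h)"
  have b: "bilin U U U (\<lambda>a h. \<epsilon> a \<odot>\<^bsub>U\<^esub> h)"
    by (intro bilinI lin_scalar_map lin_smult_map lin_id \<epsilon>_lin) simp_all
  have \<theta>: "\<theta> \<in> linear_maps UU U"
    unfolding \<theta>_def using tensor_ext_lin[of U U U, OF _ _ _ b lin_id] by simp
  have c: "\<theta> (cls UU (a, h)) = \<epsilon> a \<odot>\<^bsub>U\<^esub> h" if "a \<in> carrier U" "h \<in> carrier U" for a h
    unfolding \<theta>_def using tensor_ext_cls[of U U U, OF _ _ _ b that] by simp
  have 1: "\<theta> (E.d x \<otimes>\<^bsub>UU\<^esub> t) = j x \<otimes>\<^bsub>U\<^esub> \<theta> t" if "t \<in> carrier UU" for x t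
  proof (rule tensor_lin_eq[of U U U, OF _ _ _ _ _ _ that])
    show "(\<lambda>t. \<theta> (E.d x \<otimes>\<^bsub>UU\<^esub> t)) \<in> linear_maps UU U" "(\<lambda>t. j x \<otimes>\<^bsub>U\<^esub> \<theta> t) \<in> linear_maps UU U"
      by (intro lin_comp[OF \<theta>] alg_lin_left \<theta> lin_id; simp)+
    show "\<theta> (E.d x \<otimes>\<^bsub>UU\<^esub> cls UU (a, h)) = j x \<otimes>\<^bsub>U\<^esub> \<theta> (cls UU (a, h))" if "a \<in> carrier U" "h \<in> carrier U" for a h
      using that by (simp add: E.d_mult_tens lin_add[OF \<theta>] c \<epsilon>_j_mult alg_smult_right)
  qed simp_all
  have "\<theta> (\<Delta> m) = m"
  proof (rule E.A_lin_eq[OF _ _ lin_id _ _ m])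
    show "(\<lambda>m. \<theta> (\<Delta> m)) \<in> linear_maps U U" by (rule lin_comp[OF \<theta> E.\<rho>_lin])
  qed (simp_all add: E.\<rho>_one tens_one c \<epsilon>_one E.\<rho>_\<iota>_mult 1)
  then show ?thesis by (simp add: \<theta>_def)
qed

text \<open>Multiplication of the argument by \<open>x\<close> produces two terms, with \<open>S x = - x\<close> and with \<open>x\<close> between
  \<open>S a\<close> and \<open>b\<close>; they cancel.\<close>

lemma antipode_left_U:
  assumes m: "m \<in> carrier U"
  shows "lin_ext U (\<lambda>(a, b). S a \<otimes>\<^bsub>U\<^esub> b) (\<Delta> m) = \<epsilon> m \<odot>\<^bsub>U\<^esub> \<one>\<^bsub>U\<^esub>"
proof -
  define \<theta> where "\<theta> = lin_ext U (\<lambda>(a, b). S a \<otimes>\<^bsub>U\<^esub> b)"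
  have b: "bilin U U U (\<lambda>a b. S a \<otimes>\<^bsub>U\<^esub> b)"
    by (intro bilinI alg_lin_left alg_lin_right lin_id S_lin) simp_all
  have \<theta>: "\<theta> \<in> linear_maps UU U"
    unfolding \<theta>_def using tensor_ext_lin[of U U U, OF _ _ _ b lin_id] by simp
  have c: "\<theta> (cls UU (a, h)) = S a \<otimes>\<^bsub>U\<^esub> h" if "a \<in> carrier U" "h \<in> carrier U" for a h
    unfolding \<theta>_def using tensor_ext_cls[of U U U, OF _ _ _ b that] by simp
  have 1: "\<theta> (E.d x \<otimes>\<^bsub>UU\<^esub> t) = \<zero>\<^bsub>U\<^esub>" if "t \<in> carrier UU" for x t
  proof (rule tensor_lin_eq[of U U U, OF _ _ _ _ lin_zero_map _ that])
    show "(\<lambda>t. \<theta> (E.d x \<otimes>\<^bsub>UU\<^esub> t)) \<in> linear_maps UU U"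
      by (intro lin_comp[OF \<theta>] alg_lin_left lin_id) simp_all
    show "\<theta> (E.d x \<otimes>\<^bsub>UU\<^esub> cls UU (a, h)) = \<zero>\<^bsub>U\<^esub>" if "a \<in> carrier U" "h \<in> carrier U" for a h
      using that by (simp add: E.d_mult_tens lin_add[OF \<theta>] c S_j_mult alg_assoc alg_minus_left alg_minus_right)
  qed simp_all
  have "\<theta> (\<Delta> m) = \<epsilon> m \<odot>\<^bsub>U\<^esub> \<one>\<^bsub>U\<^esub>"
  proof (rule E.A_lin_eq[OF _ _ _ _ _ m, of U])
    show "(\<lambda>m. \<theta> (\<Delta> m)) \<in> linear_maps U U" by (rule lin_comp[OF \<theta> E.\<rho>_lin])
    show "(\<lambda>m. \<epsilon> m \<odot>\<^bsub>U\<^esub> \<one>\<^bsub>U\<^esub>) \<in> linear_maps U U" by (intro lin_scalar_map \<epsilon>_lin) simp_all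
  qed (simp_all add: E.\<rho>_one tens_one c \<epsilon>_one S_one E.\<rho>_\<iota>_mult 1 \<epsilon>_j_mult)
  then show ?thesis by (simp add: \<theta>_def)
qed

text \<open>Here the two terms have \<open>x\<close> on the left and \<open>- x\<close> on the right of the product of \<open>a\<close> and \<open>S b\<close>. They
  cancel because the sum of these products is a scalar by induction.\<close>

lemma antipode_right_U:
  assumes m: "m \<in> carrier U"
  shows "lin_ext U (\<lambda>(a, b). a \<otimes>\<^bsub>U\<^esub> S b) (\<Delta> m) = \<epsilon> m \<odot>\<^bsub>U\<^esub> \<one>\<^bsub>U\<^esub>"
proof -
  define \<theta> where "\<theta> = lin_ext U (\<lambda>(a, b). a \<otimes>\<^bsub>U\<^esub> S b)"
  have b: "bilin U U U (\<lambda>a b. a \<otimes>\<^bsub>U\<^esub> S b)"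
    by (intro bilinI alg_lin_left alg_lin_right lin_id S_lin) simp_all
  have \<theta>: "\<theta> \<in> linear_maps UU U"
    unfolding \<theta>_def using tensor_ext_lin[of U U U, OF _ _ _ b lin_id] by simp
  have c: "\<theta> (cls UU (a, h)) = a \<otimes>\<^bsub>U\<^esub> S h" if "a \<in> carrier U" "h \<in> carrier U" for a h
    unfolding \<theta>_def using tensor_ext_cls[of U U U, OF _ _ _ b that] by simp
  have 1: "\<theta> (E.d x \<otimes>\<^bsub>UU\<^esub> t) = j x \<otimes>\<^bsub>U\<^esub> \<theta> t \<oplus>\<^bsub>U\<^esub> \<theta> t \<otimes>\<^bsub>U\<^esub> (\<ominus>\<^bsub>U\<^esub> j x)" if "t \<in> carrier UU" for x t
  proof (rule tensor_lin_eq[of U U U, OF _ _ _ _ _ _ that])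
    show "(\<lambda>t. \<theta> (E.d x \<otimes>\<^bsub>UU\<^esub> t)) \<in> linear_maps UU U"
      by (intro lin_comp[OF \<theta>] alg_lin_left lin_id) simp_all
    show "(\<lambda>t. j x \<otimes>\<^bsub>U\<^esub> \<theta> t \<oplus>\<^bsub>U\<^esub> \<theta> t \<otimes>\<^bsub>U\<^esub> (\<ominus>\<^bsub>U\<^esub> j x)) \<in> linear_maps UU U"
      by (intro lin_add_map alg_lin_left alg_lin_right \<theta>) simp_all
    show "\<theta> (E.d x \<otimes>\<^bsub>UU\<^esub> cls UU (a, h)) = j x \<otimes>\<^bsub>U\<^esub> \<theta> (cls UU (a, h)) \<oplus>\<^bsub>U\<^esub> \<theta> (cls UU (a, h)) \<otimes>\<^bsub>U\<^esub> (\<ominus>\<^bsub>U\<^esub> j x)"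
      if "a \<in> carrier U" "h \<in> carrier U" for a h
      using that by (simp add: E.d_mult_tens lin_add[OF \<theta>] c S_j_mult alg_assoc)
  qed simp_all
  have "\<theta> (\<Delta> m) = \<epsilon> m \<odot>\<^bsub>U\<^esub> \<one>\<^bsub>U\<^esub>"
  proof (rule E.A_lin_eq[OF _ _ _ _ _ m, of U])
    show "(\<lambda>m. \<theta> (\<Delta> m)) \<in> linear_maps U U" by (rule lin_comp[OF \<theta> E.\<rho>_lin])
    show "(\<lambda>m. \<epsilon> m \<odot>\<^bsub>U\<^esub> \<one>\<^bsub>U\<^esub>) \<in> linear_maps U U" by (intro lin_scalar_map \<epsilon>_lin) simp_all
  qed (simp_all add: E.\<rho>_one tens_one c \<epsilon>_one S_one E.\<rho>_\<iota>_mult 1 \<epsilon>_j_mult alg_smult_left alg_smult_right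
      vs_smult_minus_right)
  then show ?thesis by (simp add: \<theta>_def)
qed

end

section \<open>The Galois extension\<close>

lemma vs_add_diff:
  assumes "vspace M" "a \<in> carrier M" "b \<in> carrier M"
  shows "a \<oplus>\<^bsub>M\<^esub> (b \<ominus>\<^bsub>M\<^esub> a) = b"
  using assms vs_lcomm[of M a b "\<ominus>\<^bsub>M\<^esub> a"] by (simp add: vs_diff_def)

lemma assoc_algebra_transfer:
  assumes A: "assoc_algebra A"
    and e: "carrier H = carrier A" "monoid.mult H = monoid.mult A" "one H = one A" "zero H = zero A"
      "add H = add A" "module.smult H = module.smult A"
  shows "assoc_algebra H"
proof (rule assoc_algebraI)
  note V = alg_vspace[OF A]
  have e': "linear_maps H H = linear_maps A A" by (simp add: linear_maps_def e)
  show "vspace H"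
    by (rule vspaceI; unfold e)
      (use V in \<open>simp_all add: vs_smult_add_left vs_smult_add_right vs_ac\<close>)
  show "bilin H H H (\<lambda>x y. x \<otimes>\<^bsub>H\<^esub> y)"
    unfolding bilin_def e e' using alg_lin_left[OF A _ lin_id] alg_lin_right[OF A _ lin_id] by blast
qed (unfold e, use A in \<open>simp_all add: alg_assoc\<close>)

context lie_two_cocycle
begin

abbreviation "U' \<equiv> env_hopf scale br"

lemma U'_simps [simp]:
  "carrier U' = carrier U" "monoid.mult U' = monoid.mult U" "one U' = one U" "zero U' = zero U"
  "add U' = add U" "module.smult U' = module.smult U" "comult U' = \<Delta>" "counit U' = \<epsilon>" "antipode U' = S"
  by (simp_all add: env_hopf_def Let_def module.defs hopf.defs)

lemma tensor_U' [simp]: "tensor M U' = tensor M U" "tensor U' N = tensor U N"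
  by (simp_all add: tensor_def DirProd_def bilinear_rels_def)

lemma linear_maps_U' [simp]: "linear_maps U' N = linear_maps U N" "linear_maps M U' = linear_maps M U"
  by (simp_all add: linear_maps_def)

lemma algebra_homs_U' [simp]: "algebra_homs U' N = algebra_homs U N"
  by (simp add: algebra_homs_def ring_hom_def)

lemma lin_ext_U' [simp]: "lin_ext U' F = lin_ext U F"
  by (rule ext) (simp add: lin_ext_def finsum_def finprod_def)

lemma alg_U' [simp]: "assoc_algebra U'"
  by (rule assoc_algebra_transfer[OF E.alg_A]) simp_all

lemma hopf_U': "hopf_algebra U'"
proof (intro hopf_algebra.intro hopf_algebra_axioms.intro, simp_all only: U'_simps tensor_U' linear_maps_U' algebra_homs_U' lin_ext_U')
  show "assoc_algebra U'" by simp
qed (rule E.\<rho>_hom \<epsilon>_hom E.\<rho>_coassoc counit_left_U E.\<rho>_counit S_lin antipode_left_U antipode_right_U; assumption?)+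

lemma comodule_A: "right_comodule U' A \<rho>"
proof (intro right_comodule.intro right_comodule_axioms.intro, simp_all only: U'_simps tensor_U' linear_maps_U' algebra_homs_U' lin_ext_U')
qed (rule hopf_U' vspace_A \<rho>_lin \<rho>_coassoc \<rho>_counit; assumption?)+

abbreviation "AA \<equiv> tensor A A"

definition can where
  "can = lin_ext AU (\<lambda>(x, y). lin_ext AU (\<lambda>(y0, y1). cls AU (x \<otimes>\<^bsub>A\<^esub> y0, y1)) (\<rho> y))"

text \<open>As \<open>\<rho>\<close> is multiplicative, the canonical map is left multiplication by \<open>x \<otimes> 1\<close> applied to \<open>\<rho> y\<close>.\<close>

lemma can_inner:
  assumes x: "x \<in> carrier A" and t: "t \<in> carrier AU"
  shows "lin_ext AU (\<lambda>(y0, y1). cls AU (x \<otimes>\<^bsub>A\<^esub> y0, y1)) t = cls AU (x, \<one>\<^bsub>U\<^esub>) \<otimes>\<^bsub>AU\<^esub> t"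
proof (rule tensor_lin_eq[of A U AU, OF _ _ _ _ _ _ t])
  have b: "bilin A U AU (\<lambda>y0 y1. cls AU (x \<otimes>\<^bsub>A\<^esub> y0, y1))"
    by (intro bilinI tens_lin_left tens_lin_right alg_lin_left lin_id) (simp_all add: x)
  show "(\<lambda>t. lin_ext AU (\<lambda>(y0, y1). cls AU (x \<otimes>\<^bsub>A\<^esub> y0, y1)) t) \<in> linear_maps AU AU"
    using tensor_ext_lin[of A U AU, OF _ _ _ b lin_id] by simp
  show "(\<lambda>t. cls AU (x, \<one>\<^bsub>U\<^esub>) \<otimes>\<^bsub>AU\<^esub> t) \<in> linear_maps AU AU"
    by (intro alg_lin_left lin_id) (simp_all add: x)
  show "lin_ext AU (\<lambda>(y0, y1). cls AU (x \<otimes>\<^bsub>A\<^esub> y0, y1)) (cls AU (a, h)) = cls AU (x, \<one>\<^bsub>U\<^esub>) \<otimes>\<^bsub>AU\<^esub> cls AU (a, h)"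
    if "a \<in> carrier A" "h \<in> carrier U" for a h
    using tensor_ext_cls[of A U AU, OF _ _ _ b that] x that by (simp add: tens_mult)
qed simp_all

lemma can_bilin: "bilin A A AU (\<lambda>x y. lin_ext AU (\<lambda>(y0, y1). cls AU (x \<otimes>\<^bsub>A\<^esub> y0, y1)) (\<rho> y))"
proof (rule bilinI)
  fix x assume x: "x \<in> carrier A"
  have "(\<lambda>y. cls AU (x, \<one>\<^bsub>U\<^esub>) \<otimes>\<^bsub>AU\<^esub> \<rho> y) \<in> linear_maps A AU"
    by (intro alg_lin_left \<rho>_lin) (simp_all add: x)
  then show "(\<lambda>y. lin_ext AU (\<lambda>(y0, y1). cls AU (x \<otimes>\<^bsub>A\<^esub> y0, y1)) (\<rho> y)) \<in> linear_maps A AU"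
    by (rule lin_cong) (simp_all add: x can_inner)
next
  fix y assume y: "y \<in> carrier A"
  have "(\<lambda>x. cls AU (x, \<one>\<^bsub>U\<^esub>) \<otimes>\<^bsub>AU\<^esub> \<rho> y) \<in> linear_maps A AU"
    by (intro alg_lin_right tens_lin_left lin_id) (simp_all add: y)
  then show "(\<lambda>x. lin_ext AU (\<lambda>(y0, y1). cls AU (x \<otimes>\<^bsub>A\<^esub> y0, y1)) (\<rho> y)) \<in> linear_maps A AU"
    by (rule lin_cong) (simp_all add: y can_inner)
qed

lemma can_lin: "can \<in> linear_maps AA AU"
  unfolding can_def using tensor_ext_lin[of A A AU, OF _ _ _ can_bilin lin_id] by simp

lemma can_tens: "\<lbrakk>x \<in> carrier A; y \<in> carrier A\<rbrakk> \<Longrightarrow> can (cls AA (x, y)) = cls AU (x, \<one>\<^bsub>U\<^esub>) \<otimes>\<^bsub>AU\<^esub> \<rho> y"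
  unfolding can_def using tensor_ext_cls[of A A AU, OF _ _ _ can_bilin] by (simp add: can_inner)

text \<open>The enveloping algebra acts on \<open>A \<otimes> A\<close> by moving letters across the tensor sign; this action
  is transported by the canonical map to left multiplication on the second factor.\<close>

definition across where
  "across x t = cls AA (\<one>\<^bsub>A\<^esub>, \<iota> x) \<otimes>\<^bsub>AA\<^esub> t \<ominus>\<^bsub>AA\<^esub> t \<otimes>\<^bsub>AA\<^esub> cls AA (\<iota> x, \<one>\<^bsub>A\<^esub>)"

lemma lierep_across: "E.lierep AA across"
  unfolding across_def[abs_def]
proof (rule lierep_ad)
  show "(\<lambda>x. cls AA (\<one>\<^bsub>A\<^esub>, \<iota> x)) \<in> linear_maps V AA" "(\<lambda>x. cls AA (\<iota> x, \<one>\<^bsub>A\<^esub>)) \<in> linear_maps V AA"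
    by (intro tens_lin_left tens_lin_right \<iota>_lin; simp)+
  show "cls AA (\<one>\<^bsub>A\<^esub>, \<iota> x) \<otimes>\<^bsub>AA\<^esub> cls AA (\<one>\<^bsub>A\<^esub>, \<iota> y) = cls AA (\<one>\<^bsub>A\<^esub>, \<iota> y) \<otimes>\<^bsub>AA\<^esub> cls AA (\<one>\<^bsub>A\<^esub>, \<iota> x)
      \<oplus>\<^bsub>AA\<^esub> (cls AA (\<one>\<^bsub>A\<^esub>, \<iota> (br x y)) \<oplus>\<^bsub>AA\<^esub> f x y \<odot>\<^bsub>AA\<^esub> \<one>\<^bsub>AA\<^esub>)" for x y
    by (simp add: tens_mult \<iota>_rel[of x y] tens_add_right tens_smult_right tens_one)
  show "cls AA (\<iota> x, \<one>\<^bsub>A\<^esub>) \<otimes>\<^bsub>AA\<^esub> cls AA (\<iota> y, \<one>\<^bsub>A\<^esub>) = cls AA (\<iota> y, \<one>\<^bsub>A\<^esub>) \<otimes>\<^bsub>AA\<^esub> cls AA (\<iota> x, \<one>\<^bsub>A\<^esub>)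
      \<oplus>\<^bsub>AA\<^esub> (cls AA (\<iota> (br x y), \<one>\<^bsub>A\<^esub>) \<oplus>\<^bsub>AA\<^esub> f x y \<odot>\<^bsub>AA\<^esub> \<one>\<^bsub>AA\<^esub>)" for x y
    by (simp add: tens_mult \<iota>_rel[of x y] tens_add_left tens_smult_left tens_one)
qed simp

lemma across_tens:
  "\<lbrakk>a \<in> carrier A; b \<in> carrier A\<rbrakk> \<Longrightarrow> across x (cls AA (a, b)) = cls AA (a, \<iota> x \<otimes>\<^bsub>A\<^esub> b) \<ominus>\<^bsub>AA\<^esub> cls AA (a \<otimes>\<^bsub>A\<^esub> \<iota> x, b)"
  by (simp add: across_def tens_mult)

lemma across_lin: "across x \<in> linear_maps AA AA"
  by (rule E.rep_lin[OF lierep_across])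

definition can_inv where
  "can_inv = lin_ext AA (\<lambda>(a, h). eact AA across h (cls AA (a, \<one>\<^bsub>A\<^esub>)))"

lemma can_inv_bilin: "bilin A U AA (\<lambda>a h. eact AA across h (cls AA (a, \<one>\<^bsub>A\<^esub>)))"
  by (intro bilinI E.eact_lin[OF lierep_across] lin_comp[OF E.eact_lin_right[OF lierep_across]] tens_lin_left lin_id) simp_all

lemma can_inv_lin: "can_inv \<in> linear_maps AU AA"
  unfolding can_inv_def using tensor_ext_lin[of A U AA, OF _ _ _ can_inv_bilin lin_id] by simp

lemma can_inv_tens: "\<lbrakk>a \<in> carrier A; h \<in> carrier U\<rbrakk> \<Longrightarrow> can_inv (cls AU (a, h)) = eact AA across h (cls AA (a, \<one>\<^bsub>A\<^esub>))"
  unfolding can_inv_def using tensor_ext_cls[of A U AA, OF _ _ _ can_inv_bilin] by simp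

lemma can_across:
  assumes t: "t \<in> carrier AA"
  shows "can (across x t) = cls AU (\<one>\<^bsub>A\<^esub>, j x) \<otimes>\<^bsub>AU\<^esub> can t"
proof (rule tensor_lin_eq[of A A AU, OF _ _ _ _ _ _ t])
  show "(\<lambda>t. can (across x t)) \<in> linear_maps AA AU" "(\<lambda>t. cls AU (\<one>\<^bsub>A\<^esub>, j x) \<otimes>\<^bsub>AU\<^esub> can t) \<in> linear_maps AA AU"
    by (intro lin_comp[OF can_lin] across_lin alg_lin_left can_lin; simp)+
  fix a b assume ab: "a \<in> carrier A" "b \<in> carrier A"
  have "cls AU (a, \<one>\<^bsub>U\<^esub>) \<otimes>\<^bsub>AU\<^esub> (d x \<otimes>\<^bsub>AU\<^esub> \<rho> b) = (cls AU (a, \<one>\<^bsub>U\<^esub>) \<otimes>\<^bsub>AU\<^esub> d x) \<otimes>\<^bsub>AU\<^esub> \<rho> b"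
    using ab by (simp add: alg_assoc)
  also have "\<dots> = cls AU (a, j x) \<otimes>\<^bsub>AU\<^esub> \<rho> b \<oplus>\<^bsub>AU\<^esub> cls AU (a \<otimes>\<^bsub>A\<^esub> \<iota> x, \<one>\<^bsub>U\<^esub>) \<otimes>\<^bsub>AU\<^esub> \<rho> b"
    using ab by (simp add: tens_mult_d alg_l_distr vs_comm)
  finally have "cls AU (a, \<one>\<^bsub>U\<^esub>) \<otimes>\<^bsub>AU\<^esub> (d x \<otimes>\<^bsub>AU\<^esub> \<rho> b) \<ominus>\<^bsub>AU\<^esub> cls AU (a \<otimes>\<^bsub>A\<^esub> \<iota> x, \<one>\<^bsub>U\<^esub>) \<otimes>\<^bsub>AU\<^esub> \<rho> b
      = cls AU (a, j x) \<otimes>\<^bsub>AU\<^esub> \<rho> b"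
    using ab by (simp add: vs_diff_eq_iff)
  also have "\<dots> = cls AU (\<one>\<^bsub>A\<^esub>, j x) \<otimes>\<^bsub>AU\<^esub> (cls AU (a, \<one>\<^bsub>U\<^esub>) \<otimes>\<^bsub>AU\<^esub> \<rho> b)"
    using ab alg_assoc[of AU "cls AU (\<one>\<^bsub>A\<^esub>, j x)" "cls AU (a, \<one>\<^bsub>U\<^esub>)" "\<rho> b"] by (simp add: tens_mult)
  finally show "can (across x (cls AA (a, b))) = cls AU (\<one>\<^bsub>A\<^esub>, j x) \<otimes>\<^bsub>AU\<^esub> can (cls AA (a, b))"
    using ab by (simp add: across_tens lin_diff[OF can_lin] can_tens \<rho>_\<iota>_mult)
qed simp_all

lemma can_inv_mult:
  assumes t: "t \<in> carrier AU"
  shows "can_inv (cls AU (\<one>\<^bsub>A\<^esub>, j x) \<otimes>\<^bsub>AU\<^esub> t) = across x (can_inv t)"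
proof (rule tensor_lin_eq[of A U AA, OF _ _ _ _ _ _ t])
  show "(\<lambda>t. can_inv (cls AU (\<one>\<^bsub>A\<^esub>, j x) \<otimes>\<^bsub>AU\<^esub> t)) \<in> linear_maps AU AA" "(\<lambda>t. across x (can_inv t)) \<in> linear_maps AU AA"
    by (intro lin_comp[OF can_inv_lin] lin_comp[OF across_lin] alg_lin_left can_inv_lin lin_id; simp)+
qed (simp_all add: tens_mult can_inv_tens E.eact_\<iota>_mult[OF lierep_across])

lemma can_can_inv:
  assumes t: "t \<in> carrier AU"
  shows "can (can_inv t) = t"
proof (rule tensor_lin_eq[of A U AU, OF _ _ _ lin_comp[OF can_lin can_inv_lin] lin_id _ t])
  fix a h assume a: "a \<in> carrier A" and h: "h \<in> carrier U"
  have "can (eact AA across h (cls AA (a, \<one>\<^bsub>A\<^esub>))) = cls AU (a, h)"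
  proof (rule E.A_lin_eq[OF _ _ _ _ _ h, of AU])
    show "(\<lambda>h. can (eact AA across h (cls AA (a, \<one>\<^bsub>A\<^esub>)))) \<in> linear_maps U AU"
      by (intro lin_comp[OF can_lin] E.eact_lin[OF lierep_across]) (simp add: a)
    show "(\<lambda>h. cls AU (a, h)) \<in> linear_maps U AU"
      by (intro tens_lin_right lin_id) (simp_all add: a)
    show "can (eact AA across (j x \<otimes>\<^bsub>U\<^esub> h) (cls AA (a, \<one>\<^bsub>A\<^esub>))) = cls AU (a, j x \<otimes>\<^bsub>U\<^esub> h)"
      if "h \<in> carrier U" "can (eact AA across h (cls AA (a, \<one>\<^bsub>A\<^esub>))) = cls AU (a, h)" for x h
      using that a by (simp add: E.eact_\<iota>_mult[OF lierep_across] can_across E.eact_closed[OF lierep_across] tens_mult)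
  qed (simp_all add: a E.eact_one[OF lierep_across] can_tens \<rho>_one)
  then show "can (can_inv (cls AU (a, h))) = cls AU (a, h)" by (simp add: can_inv_tens a h)
qed simp_all

text \<open>Induction on the second factor: \<open>a \<otimes> x b\<close> is \<open>a x \<otimes> b\<close> up to the result of moving \<open>x\<close> across
  \<open>a \<otimes> b\<close>, and both of these are covered by the induction hypothesis if \<open>a\<close> may vary.\<close>

lemma can_inv_can:
  assumes t: "t \<in> carrier AA"
  shows "can_inv (can t) = t"
proof (rule tensor_lin_eq[of A A AA, OF _ _ _ lin_comp[OF can_inv_lin can_lin] lin_id _ t])
  fix a b assume a: "a \<in> carrier A" and b: "b \<in> carrier A"
  show "can_inv (can (cls AA (a, b))) = cls AA (a, b)"
    using b a
  proof (induction b arbitrary: a rule: A_induct)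
    case one
    then show ?case by (simp add: can_tens \<rho>_one can_inv_tens E.eact_one[OF lierep_across])
  next
    case (mult x b)
    note 1 = tens_mult_d[OF mult.prems, of "\<one>\<^bsub>U\<^esub>" x, simplified]
    have "can (cls AA (a, \<iota> x \<otimes>\<^bsub>A\<^esub> b)) = (cls AU (a, \<one>\<^bsub>U\<^esub>) \<otimes>\<^bsub>AU\<^esub> d x) \<otimes>\<^bsub>AU\<^esub> \<rho> b"
      using mult by (simp add: can_tens \<rho>_\<iota>_mult alg_assoc)
    also have "\<dots> = can (cls AA (a \<otimes>\<^bsub>A\<^esub> \<iota> x, b)) \<oplus>\<^bsub>AU\<^esub> cls AU (a, j x) \<otimes>\<^bsub>AU\<^esub> \<rho> b"
      unfolding 1 using mult by (simp add: can_tens alg_l_distr)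
    also have "cls AU (a, j x) \<otimes>\<^bsub>AU\<^esub> \<rho> b = cls AU (\<one>\<^bsub>A\<^esub>, j x) \<otimes>\<^bsub>AU\<^esub> can (cls AA (a, b))"
      using mult alg_assoc[of AU "cls AU (\<one>\<^bsub>A\<^esub>, j x)" "cls AU (a, \<one>\<^bsub>U\<^esub>)" "\<rho> b"] by (simp add: tens_mult can_tens)
    finally have "can_inv (can (cls AA (a, \<iota> x \<otimes>\<^bsub>A\<^esub> b))) = cls AA (a \<otimes>\<^bsub>A\<^esub> \<iota> x, b) \<oplus>\<^bsub>AA\<^esub> across x (cls AA (a, b))"
      using mult by (simp add: lin_add[OF can_inv_lin] lin_closed[OF can_lin] can_inv_mult)
    also have "\<dots> = cls AA (a, \<iota> x \<otimes>\<^bsub>A\<^esub> b)"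
      using mult by (simp add: across_tens vs_diff_def vs_comm)  (simp add: vs_ac)
    finally show ?case .
  next
    case (add b b')
    then show ?case by (simp add: tens_add_right lin_add[OF can_lin] lin_add[OF can_inv_lin] lin_closed[OF can_lin])
  next
    case (smult c b)
    then show ?case by (simp add: tens_smult_right lin_smult[OF can_lin] lin_smult[OF can_inv_lin] lin_closed[OF can_lin])
  qed
qed simp_all

lemma can_bij: "bij_betw can (carrier AA) (carrier AU)"
  by (rule bij_betwI[where g = can_inv])
    (auto simp: can_can_inv can_inv_can lin_closed[OF can_lin] lin_closed[OF can_inv_lin])

abbreviation "scalars \<equiv> (\<lambda>c. c \<odot>\<^bsub>A\<^esub> \<one>\<^bsub>A\<^esub>) ` UNIV"

text \<open>Balancing over the scalars follows from bilinearity.\<close>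

lemma tensor_over_scalars: "tensor_over scalars (monoid.mult A) (monoid.mult A) A A = AA"
proof -
  let ?R = "bilinear_rels A A"
  let ?R' = "{fgen (p \<otimes>\<^bsub>A\<^esub> s, m) - fgen (p, s \<otimes>\<^bsub>A\<^esub> m) | p s m. p \<in> carrier A \<and> s \<in> scalars \<and> m \<in> carrier A} :: (_ \<Rightarrow>\<^sub>0 'a) set"
  have "?R' \<subseteq> fscale.span ?R"
  proof clarify
    fix p c m assume pm: "p \<in> carrier A" "m \<in> carrier A"
    have "fgen (c \<odot>\<^bsub>A\<^esub> p, m) - Poly_Mapping.single (p, m) c - (fgen (p, c \<odot>\<^bsub>A\<^esub> m) - Poly_Mapping.single (p, m) c) \<in> fscale.span ?R"
      by (intro fscale.span_diff fscale.span_base bilinear_rels_intros pm)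
    then show "fgen (p \<otimes>\<^bsub>A\<^esub> (c \<odot>\<^bsub>A\<^esub> \<one>\<^bsub>A\<^esub>), m) - fgen (p, c \<odot>\<^bsub>A\<^esub> \<one>\<^bsub>A\<^esub> \<otimes>\<^bsub>A\<^esub> m) \<in> fscale.span ?R"
      using pm by (simp add: alg_smult_left alg_smult_right)
  qed
  then have "fscale.span (?R \<union> ?R') \<subseteq> fscale.span ?R"
    by (intro fscale.span_minimal fscale.subspace_span) (auto intro: fscale.span_base)
  moreover have "fscale.span ?R \<subseteq> fscale.span (?R \<union> ?R')" by (intro fscale.span_mono) simp
  ultimately have "fscale.span (?R \<union> ?R') = fscale.span ?R" by (rule subset_antisym)
  then have "fspan (?R \<union> ?R') = fspan ?R" unfolding fspan_eq .
  then show ?thesis unfolding tensor_over_def tensor_def by (simp only:)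
qed

text \<open>If \<open>\<rho> a = a \<otimes> 1\<close> then the canonical map takes the same value on \<open>1 \<otimes> a\<close> and on \<open>a \<otimes> 1\<close>, so
  these are equal. A functional with value one at the unit, applied to the first factor, now shows
  that \<open>a\<close> is a scalar. This is where it matters that the algebra is not zero.\<close>

lemma coinvariants_A: "scalars = {a \<in> carrier A. \<rho> a = cls AU (a, \<one>\<^bsub>U\<^esub>)}"
proof (intro equalityI subsetI)
  fix a assume "a \<in> scalars"
  then show "a \<in> {a \<in> carrier A. \<rho> a = cls AU (a, \<one>\<^bsub>U\<^esub>)}"
    by (auto simp: lin_smult[OF \<rho>_lin] \<rho>_one tens_one tens_smult_left)
next
  fix a assume "a \<in> {a \<in> carrier A. \<rho> a = cls AU (a, \<one>\<^bsub>U\<^esub>)}"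
  then have a: "a \<in> carrier A" "\<rho> a = cls AU (a, \<one>\<^bsub>U\<^esub>)" by auto
  have "can (cls AA (\<one>\<^bsub>A\<^esub>, a)) = can (cls AA (a, \<one>\<^bsub>A\<^esub>))"
    using a by (simp add: can_tens \<rho>_one tens_mult)
  then have "can_inv (can (cls AA (\<one>\<^bsub>A\<^esub>, a))) = can_inv (can (cls AA (a, \<one>\<^bsub>A\<^esub>)))" by simp
  then have e: "cls AA (\<one>\<^bsub>A\<^esub>, a) = cls AA (a, \<one>\<^bsub>A\<^esub>)" using a by (simp add: can_inv_can)
  obtain \<phi> where \<phi>: "\<phi> \<in> linear_maps A ground_algebra" "\<phi> \<one>\<^bsub>A\<^esub> = 1" using A_functional by blast
  have b: "bilin A A A (\<lambda>x y. \<phi> x \<odot>\<^bsub>A\<^esub> y)"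
    by (intro bilinI lin_scalar_map lin_smult_map lin_id \<phi>(1)) simp_all
  have "lin_ext A (\<lambda>(x, y). \<phi> x \<odot>\<^bsub>A\<^esub> y) (cls AA (\<one>\<^bsub>A\<^esub>, a)) = lin_ext A (\<lambda>(x, y). \<phi> x \<odot>\<^bsub>A\<^esub> y) (cls AA (a, \<one>\<^bsub>A\<^esub>))"
    by (simp add: e)
  then have "a = \<phi> a \<odot>\<^bsub>A\<^esub> \<one>\<^bsub>A\<^esub>"
    using a \<phi>(2) tensor_ext_cls[of A A A, OF _ _ _ b] by simp
  then show "a \<in> scalars" by blast
qed

lemma galois: "galois_extension U' A scalars \<rho>"
proof (intro galois_extension.intro galois_extension_axioms.intro, simp_all only: U'_simps tensor_U' tensor_over_scalars)
  show "bij_betw (lin_ext AU (\<lambda>(x, y). lin_ext AU (\<lambda>(y0, y1). cls AU (x \<otimes>\<^bsub>A\<^esub> y0, y1)) (\<rho> y))) (carrier AA) (carrier AU)"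
    using can_bij by (simp add: can_def)
qed (rule comodule_A alg_A \<rho>_hom coinvariants_A)+

section \<open>The modular crossed module\<close>

abbreviation "act \<equiv> twisted_action scale br f"

definition ad where "ad x b = \<iota> x \<otimes>\<^bsub>A\<^esub> b \<ominus>\<^bsub>A\<^esub> b \<otimes>\<^bsub>A\<^esub> \<iota> x"

lemma lierep_ad_A: "E.lierep A ad"
  unfolding ad_def[abs_def] by (rule lierep_ad[OF alg_A \<iota>_lin \<iota>_lin \<iota>_rel \<iota>_rel])

lemma act_eact: "act h a = eact A ad h a"
  by (simp add: twisted_action_def Let_def eact_def ad_def[abs_def])

lemma act_lin: "a \<in> carrier A \<Longrightarrow> (\<lambda>h. act h a) \<in> linear_maps U A"
  and act_lin_right: "h \<in> carrier U \<Longrightarrow> act h \<in> linear_maps A A"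
  and act_one: "a \<in> carrier A \<Longrightarrow> act \<one>\<^bsub>U\<^esub> a = a"
  and act_mult: "\<lbrakk>h \<in> carrier U; h' \<in> carrier U; a \<in> carrier A\<rbrakk> \<Longrightarrow> act (h \<otimes>\<^bsub>U\<^esub> h') a = act h (act h' a)"
  and act_j: "a \<in> carrier A \<Longrightarrow> act (j x) a = ad x a"
  and act_j_mult: "\<lbrakk>h \<in> carrier U; a \<in> carrier A\<rbrakk> \<Longrightarrow> act (j x \<otimes>\<^bsub>U\<^esub> h) a = ad x (act h a)"
  and act_closed [simp]: "\<lbrakk>h \<in> carrier U; a \<in> carrier A\<rbrakk> \<Longrightarrow> act h a \<in> carrier A"
  unfolding act_eact[abs_def]
  by (rule E.eact_lin[OF lierep_ad_A] E.eact_lin_right[OF lierep_ad_A] E.eact_one[OF lierep_ad_A]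
      E.eact_mult[OF lierep_ad_A] E.eact_\<iota>[OF lierep_ad_A] E.eact_\<iota>_mult[OF lierep_ad_A] E.eact_closed[OF lierep_ad_A]; assumption)+

text \<open>Write the preimage of \<open>1 \<otimes> h\<close> under the canonical map as a sum of terms \<open>l h \<otimes> r h\<close>. Then \<open>h\<close>
  acts on \<open>t\<close> as the sum of the \<open>L (r h) t R (l h)\<close>, and the preimage of \<open>\<rho> m\<close>, which is \<open>1 \<otimes> m\<close>,
  is the sum of the \<open>m0 (l m1) \<otimes> r m1\<close>; hence the claim. The proof is the induction behind this
  computation: with a factor \<open>b\<close> to the left of \<open>R m0\<close> the value becomes \<open>L m\<close> times \<open>b\<close>, and it is
  this form that passes from \<open>m\<close> to \<open>x m\<close>. With \<open>L\<close> and \<open>R\<close> the identity it is modularity; for two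
  adjacent slots of a tensor power it governs the cyclic operator.\<close>

lemma coaction_conjugation:
  assumes B: "assoc_algebra B" and L: "L \<in> linear_maps A B" and R: "R \<in> linear_maps A B"
    and L1: "L \<one>\<^bsub>A\<^esub> = \<one>\<^bsub>B\<^esub>" and R1: "R \<one>\<^bsub>A\<^esub> = \<one>\<^bsub>B\<^esub>"
    and Lm: "\<And>x a. a \<in> carrier A \<Longrightarrow> L (\<iota> x \<otimes>\<^bsub>A\<^esub> a) = L (\<iota> x) \<otimes>\<^bsub>B\<^esub> L a"
    and Rm: "\<And>x a. a \<in> carrier A \<Longrightarrow> R (\<iota> x \<otimes>\<^bsub>A\<^esub> a) = R (\<iota> x) \<otimes>\<^bsub>B\<^esub> R a"
    and D: "E.lierep B D" and De: "\<And>x t. t \<in> carrier B \<Longrightarrow> D x t = L (\<iota> x) \<otimes>\<^bsub>B\<^esub> t \<ominus>\<^bsub>B\<^esub> t \<otimes>\<^bsub>B\<^esub> R (\<iota> x)"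
    and m: "m \<in> carrier A"
  shows "lin_ext B (\<lambda>(m0, m1). eact B D m1 (R m0)) (\<rho> m) = L m"
proof -
  note VB = alg_vspace[OF B] and cl [simp] = lin_closed[OF L] lin_closed[OF R]
  define \<theta> where "\<theta> b = lin_ext B (\<lambda>(m0, m1). eact B D m1 (b \<otimes>\<^bsub>B\<^esub> R m0))" for b
  have bb: "bilin A U B (\<lambda>m0 m1. eact B D m1 (b \<otimes>\<^bsub>B\<^esub> R m0))" if "b \<in> carrier B" for b
    by (intro bilinI lin_comp[OF E.eact_lin_right[OF D]] E.eact_lin[OF D] alg_lin_left B R) (simp_all add: that B)
  have \<theta>: "\<theta> b \<in> linear_maps AU B" if "b \<in> carrier B" for b
    unfolding \<theta>_def using tensor_ext_lin[of A U B, OF _ _ VB bb[OF that] lin_id] by simp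
  have t: "\<theta> b (cls AU (a, h)) = eact B D h (b \<otimes>\<^bsub>B\<^esub> R a)" if "b \<in> carrier B" "a \<in> carrier A" "h \<in> carrier U" for b a h
    unfolding \<theta>_def using tensor_ext_cls[of A U B, OF _ _ VB bb[OF that(1)] that(2,3)] by simp
  have 1: "\<theta> b (d x \<otimes>\<^bsub>AU\<^esub> s) = \<theta> (b \<otimes>\<^bsub>B\<^esub> R (\<iota> x)) s \<oplus>\<^bsub>B\<^esub> D x (\<theta> b s)" if "s \<in> carrier AU" "b \<in> carrier B" for b x s
  proof (rule tensor_lin_eq[of A U B, OF _ _ _ _ _ _ that(1)])
    show "(\<lambda>s. \<theta> b (d x \<otimes>\<^bsub>AU\<^esub> s)) \<in> linear_maps AU B"
      by (intro lin_comp[OF \<theta>] alg_lin_left lin_id) (simp_all add: that)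
    show "(\<lambda>s. \<theta> (b \<otimes>\<^bsub>B\<^esub> R (\<iota> x)) s \<oplus>\<^bsub>B\<^esub> D x (\<theta> b s)) \<in> linear_maps AU B"
      by (intro lin_add_map \<theta> lin_comp[OF E.rep_lin[OF D]] VB) (simp_all add: that B)
    show "\<theta> b (d x \<otimes>\<^bsub>AU\<^esub> cls AU (a, h)) = \<theta> (b \<otimes>\<^bsub>B\<^esub> R (\<iota> x)) (cls AU (a, h)) \<oplus>\<^bsub>B\<^esub> D x (\<theta> b (cls AU (a, h)))"
      if "a \<in> carrier A" "h \<in> carrier U" for a h
      using that \<open>b \<in> carrier B\<close> B by (simp add: d_mult_tens lin_add[OF \<theta>] t E.eact_\<iota>_mult[OF D] Rm alg_assoc)
  qed (simp_all add: VB)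
  have "\<theta> b (\<rho> m) = L m \<otimes>\<^bsub>B\<^esub> b" if "b \<in> carrier B" for b
    using m that
  proof (induction m arbitrary: b rule: A_induct)
    case one
    then show ?case using B by (simp add: \<rho>_one tens_one t E.eact_one[OF D] R1 L1)
  next
    case (mult x a)
    then show ?case using B by (simp add: \<rho>_\<iota>_mult 1 De Lm alg_assoc vs_add_diff)
  next
    case (add a a')
    then show ?case using B by (simp add: lin_add[OF \<rho>_lin] lin_add[OF \<theta>] lin_add[OF L] alg_l_distr)
  next
    case (smult k a)
    then show ?case using B by (simp add: lin_smult[OF \<rho>_lin] lin_smult[OF \<theta>] lin_smult[OF L] alg_smult_left)
  qed
  from this[of "\<one>\<^bsub>B\<^esub>"] have 2: "\<theta> \<one>\<^bsub>B\<^esub> (\<rho> m) = L m" using B m by simp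
  have b: "bilin A U B (\<lambda>m0 m1. eact B D m1 (R m0))"
    by (intro bilinI lin_comp[OF E.eact_lin_right[OF D]] E.eact_lin[OF D] R) simp_all
  have "lin_ext B (\<lambda>(m0, m1). eact B D m1 (R m0)) (\<rho> m) = \<theta> \<one>\<^bsub>B\<^esub> (\<rho> m)"
    by (rule tensor_lin_eq[of A U B, OF _ _ VB tensor_ext_lin[of A U B, OF _ _ VB b lin_id] \<theta>])
      (use m B in \<open>simp_all add: tensor_ext_cls[of A U B, OF _ _ VB b] t\<close>)
  then show ?thesis using 2 by simp
qed

text \<open>Both sides, as functions of \<open>h\<close>, turn left multiplication by \<open>x\<close> into the commutator \<open>C x\<close> with the
  element \<open>d x\<close>. In the proof, \<open>F\<close> is the summand on the right-hand side, and \<open>G\<close>, \<open>\<Phi>\<close> and \<open>\<Psi>\<close> are its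
  successive linear extensions over the three tensors. The three summands produced by the iterated
  comultiplication of \<open>x\<close> are the parts of that commutator: \<open>x\<close> acting on \<open>m0\<close>, and \<open>x\<close> multiplying the second factor
  from the left and, through the antipode, from the right.\<close>

lemma coaction_act_A:
  assumes h: "h \<in> carrier U" and m: "m \<in> carrier A"
  shows "\<rho> (act h m) = lin_ext AU (\<lambda>(h1, k). lin_ext AU (\<lambda>(h2, h3). lin_ext AU (\<lambda>(m0, m1).
      cls AU (act h2 m0, h3 \<otimes>\<^bsub>U\<^esub> m1 \<otimes>\<^bsub>U\<^esub> S h1)) (\<rho> m)) (\<Delta> k)) (\<Delta> h)"
proof -
  define F where "F = (\<lambda>h1 h2 h3 m0 m1. cls AU (act h2 m0, h3 \<otimes>\<^bsub>U\<^esub> m1 \<otimes>\<^bsub>U\<^esub> S h1))"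
  define G where "G = (\<lambda>h1 h2 h3 r. lin_ext AU (\<lambda>(m0, m1). F h1 h2 h3 m0 m1) r)"
  define \<Phi> where "\<Phi> = (\<lambda>h1 s. lin_ext AU (\<lambda>(h2, h3). G h1 h2 h3 (\<rho> m)) s)"
  define \<Psi> where "\<Psi> = lin_ext AU (\<lambda>(h1, k). \<Phi> h1 (\<Delta> k))"
  define C where "C x s = d x \<otimes>\<^bsub>AU\<^esub> s \<ominus>\<^bsub>AU\<^esub> s \<otimes>\<^bsub>AU\<^esub> d x" for x s
  have C: "C x \<in> linear_maps AU AU" for x
    unfolding C_def[abs_def] by (intro lin_diff_map alg_lin_left alg_lin_right lin_id) simp_all
  have F: "bilin A U AU (F h1 h2 h3)" if "h1 \<in> carrier U" "h2 \<in> carrier U" "h3 \<in> carrier U" for h1 h2 h3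
    unfolding F_def by (intro bilinI tens_lin_left tens_lin_right alg_lin_right alg_lin_left act_lin_right lin_id) (simp_all add: that)
  have F': "(\<lambda>h1. F h1 h2 h3 m0 m1) \<in> linear_maps U AU" "(\<lambda>h2. F h1 h2 h3 m0 m1) \<in> linear_maps U AU"
    "(\<lambda>h3. F h1 h2 h3 m0 m1) \<in> linear_maps U AU"
    if "h1 \<in> carrier U" "h2 \<in> carrier U" "h3 \<in> carrier U" "m0 \<in> carrier A" "m1 \<in> carrier U" for h1 h2 h3 m0 m1
    unfolding F_def by (intro tens_lin_left tens_lin_right alg_lin_right alg_lin_left act_lin S_lin lin_id; simp add: that)+
  have G: "G h1 h2 h3 \<in> linear_maps AU AU" if "h1 \<in> carrier U" "h2 \<in> carrier U" "h3 \<in> carrier U" for h1 h2 h3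
    unfolding G_def using tensor_ext_lin[of A U AU, OF _ _ _ F[OF that] lin_id] by simp
  have Gt: "G h1 h2 h3 (cls AU (m0, m1)) = F h1 h2 h3 m0 m1"
    if "h1 \<in> carrier U" "h2 \<in> carrier U" "h3 \<in> carrier U" "m0 \<in> carrier A" "m1 \<in> carrier U" for h1 h2 h3 m0 m1
    unfolding G_def using tensor_ext_cls[of A U AU, OF _ _ _ F[OF that(1-3)] that(4,5)] by simp
  have G': "(\<lambda>h1. G h1 h2 h3 r) \<in> linear_maps U AU" "(\<lambda>h2. G h1 h2 h3 r) \<in> linear_maps U AU"
    "(\<lambda>h3. G h1 h2 h3 r) \<in> linear_maps U AU"
    if "h1 \<in> carrier U" "h2 \<in> carrier U" "h3 \<in> carrier U" "r \<in> carrier AU" for h1 h2 h3 r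
    unfolding G_def by (rule tensor_ext_param[of A U]; use that F' in simp)+
  have bG: "bilin U U AU (\<lambda>h2 h3. G h1 h2 h3 (\<rho> m))" if "h1 \<in> carrier U" for h1
    by (intro bilinI G') (simp_all add: that m)
  have \<Phi>: "\<Phi> h1 \<in> linear_maps UU AU" if "h1 \<in> carrier U" for h1
    unfolding \<Phi>_def using tensor_ext_lin[of U U AU, OF _ _ _ bG[OF that] lin_id] by simp
  have \<Phi>t: "\<Phi> h1 (cls UU (h2, h3)) = G h1 h2 h3 (\<rho> m)" if "h1 \<in> carrier U" "h2 \<in> carrier U" "h3 \<in> carrier U" for h1 h2 h3
    unfolding \<Phi>_def using tensor_ext_cls[of U U AU, OF _ _ _ bG[OF that(1)] that(2,3)] by simp
  have \<Phi>': "(\<lambda>h1. \<Phi> h1 s) \<in> linear_maps U AU" if "s \<in> carrier UU" for s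
    unfolding \<Phi>_def by (rule tensor_ext_param[of U U]; use that G' m in simp)
  have b\<Psi>: "bilin U U AU (\<lambda>h1 k. \<Phi> h1 (\<Delta> k))"
    by (intro bilinI \<Phi>' lin_comp[OF \<Phi>] E.\<rho>_lin) simp_all
  have \<Psi>: "\<Psi> \<in> linear_maps UU AU"
    unfolding \<Psi>_def using tensor_ext_lin[of U U AU, OF _ _ _ b\<Psi> lin_id] by simp
  have \<Psi>t: "\<Psi> (cls UU (h1, k)) = \<Phi> h1 (\<Delta> k)" if "h1 \<in> carrier U" "k \<in> carrier U" for h1 k
    unfolding \<Psi>_def using tensor_ext_cls[of U U AU, OF _ _ _ b\<Psi> that] by simp
  have F1: "F (j x \<otimes>\<^bsub>U\<^esub> h1) h2 h3 m0 m1 \<oplus>\<^bsub>AU\<^esub> (F h1 (j x \<otimes>\<^bsub>U\<^esub> h2) h3 m0 m1 \<oplus>\<^bsub>AU\<^esub> F h1 h2 (j x \<otimes>\<^bsub>U\<^esub> h3) m0 m1) = C x (F h1 h2 h3 m0 m1)"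
    if "h1 \<in> carrier U" "h2 \<in> carrier U" "h3 \<in> carrier U" "m0 \<in> carrier A" "m1 \<in> carrier U" for x h1 h2 h3 m0 m1
    using that
    by (simp add: F_def C_def act_j_mult ad_def S_j_mult d_mult_tens tens_mult_d alg_assoc alg_minus_right
        tens_minus_right tens_minus_left tens_add_left vs_diff_def vs_minus_add vs_ac)
  have G1: "G (j x \<otimes>\<^bsub>U\<^esub> h1) h2 h3 r \<oplus>\<^bsub>AU\<^esub> (G h1 (j x \<otimes>\<^bsub>U\<^esub> h2) h3 r \<oplus>\<^bsub>AU\<^esub> G h1 h2 (j x \<otimes>\<^bsub>U\<^esub> h3) r) = C x (G h1 h2 h3 r)"
    if "h1 \<in> carrier U" "h2 \<in> carrier U" "h3 \<in> carrier U" "r \<in> carrier AU" for x h1 h2 h3 r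
  proof (rule tensor_lin_eq[of A U AU, OF _ _ _ _ _ _ that(4)])
    show "(\<lambda>r. G (j x \<otimes>\<^bsub>U\<^esub> h1) h2 h3 r \<oplus>\<^bsub>AU\<^esub> (G h1 (j x \<otimes>\<^bsub>U\<^esub> h2) h3 r \<oplus>\<^bsub>AU\<^esub> G h1 h2 (j x \<otimes>\<^bsub>U\<^esub> h3) r)) \<in> linear_maps AU AU"
      by (intro lin_add_map G) (simp_all add: that)
    show "(\<lambda>r. C x (G h1 h2 h3 r)) \<in> linear_maps AU AU"
      by (intro lin_comp[OF C] G that)
  qed (simp_all add: Gt F1 that)
  have P1: "\<Phi> (j x \<otimes>\<^bsub>U\<^esub> h1) s \<oplus>\<^bsub>AU\<^esub> \<Phi> h1 (E.d x \<otimes>\<^bsub>UU\<^esub> s) = C x (\<Phi> h1 s)" if "h1 \<in> carrier U" "s \<in> carrier UU" for x h1 s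
  proof (rule tensor_lin_eq[of U U AU, OF _ _ _ _ _ _ that(2)])
    show "(\<lambda>s. \<Phi> (j x \<otimes>\<^bsub>U\<^esub> h1) s \<oplus>\<^bsub>AU\<^esub> \<Phi> h1 (E.d x \<otimes>\<^bsub>UU\<^esub> s)) \<in> linear_maps UU AU"
      by (intro lin_add_map \<Phi> lin_comp[OF \<Phi>] alg_lin_left lin_id) (simp_all add: that)
    show "(\<lambda>s. C x (\<Phi> h1 s)) \<in> linear_maps UU AU"
      by (intro lin_comp[OF C] \<Phi> that)
  qed (simp_all add: E.d_mult_tens lin_add[OF \<Phi>] \<Phi>t G1 that m)
  have Q1: "\<Psi> (E.d x \<otimes>\<^bsub>UU\<^esub> t) = C x (\<Psi> t)" if "t \<in> carrier UU" for x t
  proof (rule tensor_lin_eq[of U U AU, OF _ _ _ _ _ _ that])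
    show "(\<lambda>t. \<Psi> (E.d x \<otimes>\<^bsub>UU\<^esub> t)) \<in> linear_maps UU AU"
      by (intro lin_comp[OF \<Psi>] alg_lin_left lin_id) simp_all
    show "(\<lambda>t. C x (\<Psi> t)) \<in> linear_maps UU AU"
      by (rule lin_comp[OF C \<Psi>])
  qed (simp_all add: E.d_mult_tens lin_add[OF \<Psi>] \<Psi>t P1 E.\<rho>_\<iota>_mult)
  have "\<rho> (act h m) = \<Psi> (\<Delta> h)"
  proof (rule E.A_lin_eq[OF _ _ _ _ _ h, of AU])
    show "(\<lambda>h. \<rho> (act h m)) \<in> linear_maps U AU"
      by (rule lin_comp[OF \<rho>_lin act_lin[OF m]])
    show "(\<lambda>h. \<Psi> (\<Delta> h)) \<in> linear_maps U AU"
      by (rule lin_comp[OF \<Psi> E.\<rho>_lin])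
    have "G \<one>\<^bsub>U\<^esub> \<one>\<^bsub>U\<^esub> \<one>\<^bsub>U\<^esub> r = r" if "r \<in> carrier AU" for r
      by (rule tensor_lin_eq[of A U AU, OF _ _ _ G lin_id _ that]) (simp_all add: Gt F_def S_one act_one)
    then show "\<rho> (act \<one>\<^bsub>U\<^esub> m) = \<Psi> (\<Delta> \<one>\<^bsub>U\<^esub>)"
      by (simp add: act_one m E.\<rho>_one tens_one \<Psi>t \<Phi>t)
    show "\<rho> (act (j x \<otimes>\<^bsub>U\<^esub> h) m) = \<Psi> (\<Delta> (j x \<otimes>\<^bsub>U\<^esub> h))" if "h \<in> carrier U" "\<rho> (act h m) = \<Psi> (\<Delta> h)" for x h
      using that m by (simp add: act_j_mult E.\<rho>_\<iota>_mult Q1 ad_def lin_diff[OF \<rho>_lin] \<rho>_\<iota>_mult \<rho>_mult \<rho>_\<iota> C_def)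
  qed simp
  then show ?thesis by (simp add: \<Psi>_def \<Phi>_def G_def F_def)
qed

lemma modular_crossed: "modular_crossed_module U' A act \<rho>"
proof (intro modular_crossed_module.intro modular_crossed_module_axioms.intro crossed_module.intro
    crossed_module_axioms.intro left_module.intro left_module_axioms.intro comodule_A hopf_U' vspace_A,
    simp_all only: U'_simps tensor_U' linear_maps_U')
  show "lin_ext A (\<lambda>(m0, m1). act m1 m0) (\<rho> m) = m" if "m \<in> carrier A" for m
    unfolding act_eact using coaction_conjugation[of A "\<lambda>a. a" "\<lambda>a. a", OF _ _ _ _ _ _ _ lierep_ad_A _ that]
    by (simp add: ad_def lin_id)
qed (rule act_lin_right act_lin act_one act_mult coaction_act_A; assumption)+

end

section \<open>Isomorphic cyclic objects have isomorphic cyclic homology\<close>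

text \<open>Stated for an injective map on a set that contains the space and the subspace, so that it can be
  applied to cycles and boundaries inside the total complex.\<close>

lemma quot_linear_iso:
  assumes h: "inj_on h D" and M: "carrier M \<subseteq> D" "h ` carrier M = carrier N" and W: "W \<subseteq> D" "h ` W = W'"
    and D: "\<And>x y. \<lbrakk>x \<in> D; y \<in> D\<rbrakk> \<Longrightarrow> x \<oplus>\<^bsub>M\<^esub> y \<in> D" "\<And>c x. x \<in> D \<Longrightarrow> c \<odot>\<^bsub>M\<^esub> x \<in> D"
    and add: "\<And>x y. \<lbrakk>x \<in> D; y \<in> D\<rbrakk> \<Longrightarrow> h (x \<oplus>\<^bsub>M\<^esub> y) = h x \<oplus>\<^bsub>N\<^esub> h y"
    and smult: "\<And>c x. x \<in> D \<Longrightarrow> h (c \<odot>\<^bsub>M\<^esub> x) = c \<odot>\<^bsub>N\<^esub> h x"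
  shows "linear_iso (quot M W) (quot N W')"
proof -
  have sum: "h ` (B <+>\<^bsub>M\<^esub> C) = h ` B <+>\<^bsub>N\<^esub> h ` C" if "B \<subseteq> D" "C \<subseteq> D" for B C
    using that add by (auto simp: set_add_def' image_UN subset_iff)
  have coset: "h ` (W +>\<^bsub>M\<^esub> x) = W' +>\<^bsub>N\<^esub> h x" if "x \<in> D" for x
    using that add W by (auto simp: a_r_coset_def' image_UN subset_iff)
  have sub: "C \<subseteq> D" if C: "C \<in> carrier (quot M W)" for C
    using C D(1) W(1) M(1) by (auto simp: quot_simps a_r_coset_def' subset_iff)
  have "(\<lambda>C. h ` C) \<in> linear_maps (quot M W) (quot N W')"
  proof (rule linI)
    show "h ` C \<in> carrier (quot N W')" if "C \<in> carrier (quot M W)" for C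
    proof -
      from that obtain x where x: "x \<in> carrier M" "C = W +>\<^bsub>M\<^esub> x" by (auto simp: quot_simps)
      then have "h ` C = W' +>\<^bsub>N\<^esub> h x" "h x \<in> carrier N" using coset M by auto
      then show ?thesis by (simp add: quot_simps)
    qed
    show "h ` (B \<oplus>\<^bsub>quot M W\<^esub> C) = h ` B \<oplus>\<^bsub>quot N W'\<^esub> h ` C"
      if "B \<in> carrier (quot M W)" "C \<in> carrier (quot M W)" for B C
      using sum[OF sub[OF that(1)] sub[OF that(2)]] by (simp add: quot_simps)
    show "h ` (c \<odot>\<^bsub>quot M W\<^esub> C) = c \<odot>\<^bsub>quot N W'\<^esub> h ` C" if "C \<in> carrier (quot M W)" for c C
    proof -
      have "(\<lambda>x. c \<odot>\<^bsub>M\<^esub> x) ` C \<subseteq> D" "h ` ((\<lambda>x. c \<odot>\<^bsub>M\<^esub> x) ` C) = (\<lambda>x. c \<odot>\<^bsub>N\<^esub> x) ` (h ` C)"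
        using sub[OF that] D(2) smult by (auto simp: image_image subset_iff intro!: image_cong)
      then show ?thesis using sum[OF W(1)] W(2) by (simp add: quot_simps)
    qed
  qed
  moreover have "bij_betw (\<lambda>C. h ` C) (carrier (quot M W)) (carrier (quot N W'))"
  proof (rule bij_betw_imageI)
    show "inj_on (\<lambda>C. h ` C) (carrier (quot M W))"
      by (rule inj_onI) (use inj_on_image_eq_iff[OF h] sub in blast)
    have "(\<lambda>C. h ` C) ` carrier (quot M W) = (\<lambda>x. W' +>\<^bsub>N\<^esub> h x) ` carrier M"
      unfolding quot_simps image_image using coset M(1) by (intro image_cong) auto
    then show "(\<lambda>C. h ` C) ` carrier (quot M W) = carrier (quot N W')"
      unfolding quot_simps M(2)[symmetric] by (simp add: image_image)
  qed
  ultimately show ?thesis unfolding linear_iso_def by blast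
qed

lemma tot_simps:
  "carrier (tot Z n) = (\<Pi>\<^sub>E q\<in>{..n}. carrier (obj Z q))" "zero (tot Z n) = (\<lambda>q\<in>{..n}. \<zero>\<^bsub>obj Z q\<^esub>)"
  "add (tot Z n) = (\<lambda>x y. \<lambda>q\<in>{..n}. x q \<oplus>\<^bsub>obj Z q\<^esub> y q)"
  "module.smult (tot Z n) = (\<lambda>c x. \<lambda>q\<in>{..n}. c \<odot>\<^bsub>obj Z q\<^esub> x q)"
  by (simp_all add: tot_def)

text \<open>What corresponds under the maps \<open>\<phi> n\<close> is what enters the Tsygan double complex, the faces and the
  cyclic operators. Those of \<open>Z'\<close> map into the right spaces because those of \<open>Z\<close> do.\<close>

locale cyclic_iso =
  fixes Z :: "('k::field, 'z) cyclic_object" and Z' :: "('k, 'y) cyclic_object" and \<phi> :: "nat \<Rightarrow> 'z \<Rightarrow> 'y"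
  assumes vspace_obj [simp]: "vspace (obj Z n)" "vspace (obj Z' n)"
    and \<phi>_lin: "\<phi> n \<in> linear_maps (obj Z n) (obj Z' n)"
    and \<phi>_bij: "bij_betw (\<phi> n) (carrier (obj Z n)) (carrier (obj Z' n))"
    and face_closed: "\<lbrakk>0 < n; i \<le> n; z \<in> carrier (obj Z n)\<rbrakk> \<Longrightarrow> face Z n i z \<in> carrier (obj Z (n - 1))"
    and \<phi>_face: "\<lbrakk>0 < n; i \<le> n; z \<in> carrier (obj Z n)\<rbrakk> \<Longrightarrow> \<phi> (n - 1) (face Z n i z) = face Z' n i (\<phi> n z)"
    and cyc_closed: "z \<in> carrier (obj Z n) \<Longrightarrow> cyc Z n z \<in> carrier (obj Z n)"
    and \<phi>_cyc: "z \<in> carrier (obj Z n) \<Longrightarrow> \<phi> n (cyc Z n z) = cyc Z' n (\<phi> n z)"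
begin

lemma \<phi>_closed [simp]: "z \<in> carrier (obj Z n) \<Longrightarrow> \<phi> n z \<in> carrier (obj Z' n)"
  by (rule lin_closed[OF \<phi>_lin])

lemma alternating_face_sum:
  assumes "0 < n" "z \<in> carrier (obj Z n)" "J \<subseteq> {..n}"
  shows "finsum (obj Z (n - 1)) (\<lambda>i. (-1) ^ i \<odot>\<^bsub>obj Z (n - 1)\<^esub> face Z n i z) J \<in> carrier (obj Z (n - 1))"
    and "\<phi> (n - 1) (finsum (obj Z (n - 1)) (\<lambda>i. (-1) ^ i \<odot>\<^bsub>obj Z (n - 1)\<^esub> face Z n i z) J)
      = finsum (obj Z' (n - 1)) (\<lambda>i. (-1) ^ i \<odot>\<^bsub>obj Z' (n - 1)\<^esub> face Z' n i (\<phi> n z)) J"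
proof -
  have cl: "(\<lambda>i. (-1) ^ i \<odot>\<^bsub>obj Z (n - 1)\<^esub> face Z n i z) \<in> J \<rightarrow> carrier (obj Z (n - 1))"
    using assms face_closed by (auto simp: subset_iff)
  show "finsum (obj Z (n - 1)) (\<lambda>i. (-1) ^ i \<odot>\<^bsub>obj Z (n - 1)\<^esub> face Z n i z) J \<in> carrier (obj Z (n - 1))"
    using cl by (rule vs_finsum_closed[OF vspace_obj(1)])
  have "\<phi> (n - 1) (finsum (obj Z (n - 1)) (\<lambda>i. (-1) ^ i \<odot>\<^bsub>obj Z (n - 1)\<^esub> face Z n i z) J)
    = finsum (obj Z' (n - 1)) (\<lambda>i. \<phi> (n - 1) ((-1) ^ i \<odot>\<^bsub>obj Z (n - 1)\<^esub> face Z n i z)) J"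
    by (rule lin_finsum[OF \<phi>_lin vspace_obj cl])
  also have "\<dots> = finsum (obj Z' (n - 1)) (\<lambda>i. (-1) ^ i \<odot>\<^bsub>obj Z' (n - 1)\<^esub> face Z' n i (\<phi> n z)) J"
  proof (rule abelian_monoid.finsum_cong'[OF vspace_abelian_monoid[OF vspace_obj(2)] refl])
    have e: "\<phi> (n - 1) ((-1) ^ i \<odot>\<^bsub>obj Z (n - 1)\<^esub> face Z n i z) = (-1) ^ i \<odot>\<^bsub>obj Z' (n - 1)\<^esub> face Z' n i (\<phi> n z)"
      and c: "face Z' n i (\<phi> n z) \<in> carrier (obj Z' (n - 1))" if "i \<in> J" for i
      using that assms \<phi>_face[of n i z] face_closed[of n i z] lin_smult[OF \<phi>_lin, of "face Z n i z" "n - 1"]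
        \<phi>_closed[of "face Z n i z" "n - 1"]
      by (auto simp: subset_iff)
    show "\<phi> (n - 1) ((-1) ^ i \<odot>\<^bsub>obj Z (n - 1)\<^esub> face Z n i z) = (-1) ^ i \<odot>\<^bsub>obj Z' (n - 1)\<^esub> face Z' n i (\<phi> n z)"
      if "i \<in> J" for i using e[OF that] .
    show "(\<lambda>i. (-1) ^ i \<odot>\<^bsub>obj Z' (n - 1)\<^esub> face Z' n i (\<phi> n z)) \<in> J \<rightarrow> carrier (obj Z' (n - 1))"
      using c by auto
  qed
  finally show "\<phi> (n - 1) (finsum (obj Z (n - 1)) (\<lambda>i. (-1) ^ i \<odot>\<^bsub>obj Z (n - 1)\<^esub> face Z n i z) J)
      = finsum (obj Z' (n - 1)) (\<lambda>i. (-1) ^ i \<odot>\<^bsub>obj Z' (n - 1)\<^esub> face Z' n i (\<phi> n z)) J" .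
qed

lemma hoch_b: 
  assumes "0 < n" "z \<in> carrier (obj Z n)"
  shows "hoch_b Z n z \<in> carrier (obj Z (n - 1))" "\<phi> (n - 1) (hoch_b Z n z) = hoch_b Z' n (\<phi> n z)"
    "hoch_b' Z n z \<in> carrier (obj Z (n - 1))" "\<phi> (n - 1) (hoch_b' Z n z) = hoch_b' Z' n (\<phi> n z)"
  unfolding hoch_b_def hoch_b'_def by (rule alternating_face_sum[OF assms]; auto)+

lemma signed_cyc:
  assumes "z \<in> carrier (obj Z n)"
  shows "signed_cyc Z n z \<in> carrier (obj Z n)" "\<phi> n (signed_cyc Z n z) = signed_cyc Z' n (\<phi> n z)"
  using assms cyc_closed \<phi>_cyc by (simp_all add: signed_cyc_def lin_smult[OF \<phi>_lin])

lemma signed_cyc_funpow: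
  assumes "z \<in> carrier (obj Z n)"
  shows "(signed_cyc Z n ^^ i) z \<in> carrier (obj Z n) \<and> \<phi> n ((signed_cyc Z n ^^ i) z) = (signed_cyc Z' n ^^ i) (\<phi> n z)"
  by (induction i) (simp_all add: assms signed_cyc)

lemma cyc_norm:
  assumes "z \<in> carrier (obj Z n)"
  shows "cyc_norm Z n z \<in> carrier (obj Z n)" "\<phi> n (cyc_norm Z n z) = cyc_norm Z' n (\<phi> n z)"
proof -
  have cl: "(\<lambda>i. (signed_cyc Z n ^^ i) z) \<in> {..n} \<rightarrow> carrier (obj Z n)"
    using signed_cyc_funpow[OF assms] by blast
  show "cyc_norm Z n z \<in> carrier (obj Z n)"
    unfolding cyc_norm_def by (rule vs_finsum_closed[OF vspace_obj(1) cl])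
  show "\<phi> n (cyc_norm Z n z) = cyc_norm Z' n (\<phi> n z)"
    unfolding cyc_norm_def lin_finsum[OF \<phi>_lin vspace_obj cl]
  proof (rule abelian_monoid.finsum_cong'[OF vspace_abelian_monoid[OF vspace_obj(2)] refl])
    show "(\<lambda>i. (signed_cyc Z' n ^^ i) (\<phi> n z)) \<in> {..n} \<rightarrow> carrier (obj Z' n)"
      using signed_cyc_funpow[OF assms] \<phi>_closed by (metis Pi_I')
  qed (use signed_cyc_funpow[OF assms] in blast)
qed

definition \<Phi> :: "nat \<Rightarrow> (nat \<Rightarrow> 'z) \<Rightarrow> nat \<Rightarrow> 'y" where
  "\<Phi> n x = (\<lambda>q\<in>{..n}. \<phi> q (x q))"

lemma \<Phi>_lin: "\<Phi> n \<in> linear_maps (tot Z n) (tot Z' n)"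
proof (rule linI)
  show "\<Phi> n x \<in> carrier (tot Z' n)" if "x \<in> carrier (tot Z n)" for x
    using that by (auto simp: tot_simps \<Phi>_def PiE_iff)
  show "\<Phi> n (x \<oplus>\<^bsub>tot Z n\<^esub> y) = \<Phi> n x \<oplus>\<^bsub>tot Z' n\<^esub> \<Phi> n y"
    if "x \<in> carrier (tot Z n)" "y \<in> carrier (tot Z n)" for x y
    using that by (intro ext) (auto simp: tot_simps \<Phi>_def PiE_iff lin_add[OF \<phi>_lin])
  show "\<Phi> n (c \<odot>\<^bsub>tot Z n\<^esub> x) = c \<odot>\<^bsub>tot Z' n\<^esub> \<Phi> n x" if "x \<in> carrier (tot Z n)" for c x
    using that by (intro ext) (auto simp: tot_simps \<Phi>_def PiE_iff lin_smult[OF \<phi>_lin])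
qed

lemma \<Phi>_inj: "inj_on (\<Phi> n) (carrier (tot Z n))"
proof (rule inj_onI)
  fix x y assume xy: "x \<in> carrier (tot Z n)" "y \<in> carrier (tot Z n)" "\<Phi> n x = \<Phi> n y"
  show "x = y"
  proof (rule PiE_ext[of x "{..n}" "\<lambda>q. carrier (obj Z q)" y])
    fix q assume q: "q \<in> {..n}"
    have "\<phi> q (x q) = \<phi> q (y q)" using xy(3) q by (auto simp: \<Phi>_def fun_eq_iff restrict_def split: if_splits)
    then show "x q = y q"
      using bij_betw_imp_inj_on[OF \<phi>_bij, of q] xy q by (auto simp: tot_simps PiE_iff inj_on_def)
  qed (use xy in \<open>auto simp: tot_simps\<close>)
qed

lemma \<Phi>_surj: "\<Phi> n ` carrier (tot Z n) = carrier (tot Z' n)"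
proof
  show "\<Phi> n ` carrier (tot Z n) \<subseteq> carrier (tot Z' n)" using lin_closed[OF \<Phi>_lin] by blast
  show "carrier (tot Z' n) \<subseteq> \<Phi> n ` carrier (tot Z n)"
  proof
    fix y assume y: "y \<in> carrier (tot Z' n)"
    define x where "x = (\<lambda>q\<in>{..n}. inv_into (carrier (obj Z q)) (\<phi> q) (y q))"
    have im: "\<phi> q ` carrier (obj Z q) = carrier (obj Z' q)" for q
      using bij_betw_imp_surj_on[OF \<phi>_bij] .
    have yq: "y q \<in> \<phi> q ` carrier (obj Z q)" if "q \<le> n" for q
      unfolding im using y that by (auto simp: tot_simps PiE_iff)
    have "x \<in> carrier (tot Z n)"
      using inv_into_into[OF yq] by (auto simp: tot_simps x_def)
    moreover have "\<Phi> n x = y"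
      using y f_inv_into_f[OF yq] by (auto simp: \<Phi>_def x_def fun_eq_iff tot_simps PiE_iff extensional_def)
    ultimately show "y \<in> \<Phi> n ` carrier (tot Z n)" by blast
  qed
qed

lemma tot_d:
  assumes x: "x \<in> carrier (tot Z n)" and n: "0 < n"
  shows "tot_d Z n x \<in> carrier (tot Z (n - 1))" "\<Phi> (n - 1) (tot_d Z n x) = tot_d Z' n (\<Phi> n x)"
proof -
  have q: "x q \<in> carrier (obj Z q)" if "q \<le> n" for q
    using x that by (auto simp: tot_simps PiE_iff)
  have s: "{..n - 1} = {..<n}" using n by auto
  define v where "v q = (if even (n - 1 - q) then hoch_b Z (q + 1) (x (q + 1))
      else \<ominus>\<^bsub>obj Z q\<^esub> hoch_b' Z (q + 1) (x (q + 1)))" for q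
  define w where "w q = (if odd (n - q) then x q \<ominus>\<^bsub>obj Z q\<^esub> signed_cyc Z q (x q) else cyc_norm Z q (x q))" for q
  have d: "tot_d Z n x = (\<lambda>q\<in>{..<n}. v q \<oplus>\<^bsub>obj Z q\<^esub> w q)"
    by (simp add: tot_d_def v_def w_def)
  have v: "v q \<in> carrier (obj Z q)" "\<phi> q (v q) = (if even (n - 1 - q) then hoch_b Z' (q + 1) (\<phi> (q + 1) (x (q + 1)))
      else \<ominus>\<^bsub>obj Z' q\<^esub> hoch_b' Z' (q + 1) (\<phi> (q + 1) (x (q + 1))))" if "q < n" for q
    using hoch_b[of "q + 1" "x (q + 1)"] q[of "q + 1"] that
    by (auto simp: v_def lin_minus[OF \<phi>_lin vspace_obj])
  have w: "w q \<in> carrier (obj Z q)" "\<phi> q (w q) = (if odd (n - q) then \<phi> q (x q) \<ominus>\<^bsub>obj Z' q\<^esub> signed_cyc Z' q (\<phi> q (x q))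
      else cyc_norm Z' q (\<phi> q (x q)))" if "q < n" for q
    using signed_cyc[of "x q" q] cyc_norm[of "x q" q] q[of q] that
    by (auto simp: w_def lin_diff[OF \<phi>_lin vspace_obj])
  show "tot_d Z n x \<in> carrier (tot Z (n - 1))"
    unfolding d tot_simps s using v(1) w(1) by (simp add: restrict_PiE_iff)
  show "\<Phi> (n - 1) (tot_d Z n x) = tot_d Z' n (\<Phi> n x)"
    unfolding d
    by (rule ext) (auto simp: \<Phi>_def s tot_d_def v w lin_add[OF \<phi>_lin] simp del: One_nat_def)
qed

lemma \<Phi>_boundaries: "\<Phi> n ` boundaries Z n = boundaries Z' n"
proof -
  have "\<Phi> n ` boundaries Z n = (\<lambda>x. \<Phi> n (tot_d Z (n + 1) x)) ` carrier (tot Z (n + 1))"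
    by (simp add: boundaries_def image_image)
  also have "\<dots> = (\<lambda>x. tot_d Z' (n + 1) (\<Phi> (n + 1) x)) ` carrier (tot Z (n + 1))"
    using tot_d(2)[of _ "n + 1"] by (intro image_cong) auto
  also have "\<dots> = tot_d Z' (n + 1) ` (\<Phi> (n + 1) ` carrier (tot Z (n + 1)))" by (simp add: image_image)
  finally show ?thesis by (simp only: \<Phi>_surj boundaries_def)
qed

lemma \<Phi>_zero: "\<Phi> n \<zero>\<^bsub>tot Z n\<^esub> = \<zero>\<^bsub>tot Z' n\<^esub>"
  by (rule ext) (simp add: tot_simps \<Phi>_def lin_zero[OF \<phi>_lin])

lemma \<Phi>_cycles: "\<Phi> n ` cycles Z n = cycles Z' n"
proof -
  have zc: "\<zero>\<^bsub>tot Z m\<^esub> \<in> carrier (tot Z m)" for m by (auto simp: tot_simps)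
  have "x \<in> cycles Z n \<longleftrightarrow> \<Phi> n x \<in> cycles Z' n" if x: "x \<in> carrier (tot Z n)" for x
  proof (cases "n = 0")
    case True
    then show ?thesis using x lin_closed[OF \<Phi>_lin x] by (simp add: cycles_def)
  next
    case False
    have "tot_d Z n x = \<zero>\<^bsub>tot Z (n - 1)\<^esub> \<longleftrightarrow> \<Phi> (n - 1) (tot_d Z n x) = \<Phi> (n - 1) \<zero>\<^bsub>tot Z (n - 1)\<^esub>"
      using inj_on_eq_iff[OF \<Phi>_inj tot_d(1)[OF x] zc] False by auto
    then show ?thesis
      using x lin_closed[OF \<Phi>_lin x] False tot_d(2)[OF x] by (simp add: cycles_def \<Phi>_zero)
  qed
  moreover have "cycles Z n \<subseteq> carrier (tot Z n)" "cycles Z' n \<subseteq> \<Phi> n ` carrier (tot Z n)"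
    by (auto simp: cycles_def \<Phi>_surj)
  ultimately show ?thesis by (auto simp: subset_iff)
qed

theorem cyclic_homology_iso: "linear_iso (cyclic_homology Z n) (cyclic_homology Z' n)"
  unfolding cyclic_homology_def
proof (rule quot_linear_iso[OF \<Phi>_inj])
  show "boundaries Z n \<subseteq> carrier (tot Z n)"
    using tot_d(1)[of _ "n + 1"] by (auto simp: boundaries_def)
  show "carrier (tot Z n\<lparr>carrier := cycles Z n\<rparr>) \<subseteq> carrier (tot Z n)"
    by (auto simp: cycles_def)
  show "\<Phi> n ` carrier (tot Z n\<lparr>carrier := cycles Z n\<rparr>) = carrier (tot Z' n\<lparr>carrier := cycles Z' n\<rparr>)"
    by (simp add: \<Phi>_cycles)
  show "\<Phi> n ` boundaries Z n = boundaries Z' n" by (rule \<Phi>_boundaries)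
  fix x y assume xy: "x \<in> carrier (tot Z n)" "y \<in> carrier (tot Z n)"
  have eq: "add (tot Z n\<lparr>carrier := cycles Z n\<rparr>) = add (tot Z n)" "add (tot Z' n\<lparr>carrier := cycles Z' n\<rparr>) = add (tot Z' n)"
    by simp_all
  show "x \<oplus>\<^bsub>tot Z n\<lparr>carrier := cycles Z n\<rparr>\<^esub> y \<in> carrier (tot Z n)"
    unfolding eq tot_simps using xy by (intro restrict_PiE_iff[THEN iffD2] ballI vs_add_closed) (auto simp: tot_simps PiE_iff)
  show "\<Phi> n (x \<oplus>\<^bsub>tot Z n\<lparr>carrier := cycles Z n\<rparr>\<^esub> y) = \<Phi> n x \<oplus>\<^bsub>tot Z' n\<lparr>carrier := cycles Z' n\<rparr>\<^esub> \<Phi> n y"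
    unfolding eq by (rule lin_add[OF \<Phi>_lin xy])
next
  fix c x assume x: "x \<in> carrier (tot Z n)"
  have eq: "module.smult (tot Z n\<lparr>carrier := cycles Z n\<rparr>) = module.smult (tot Z n)"
    "module.smult (tot Z' n\<lparr>carrier := cycles Z' n\<rparr>) = module.smult (tot Z' n)"
    by simp_all
  show "c \<odot>\<^bsub>tot Z n\<lparr>carrier := cycles Z n\<rparr>\<^esub> x \<in> carrier (tot Z n)"
    unfolding eq tot_simps using x by (intro restrict_PiE_iff[THEN iffD2] ballI vs_smult_closed) (auto simp: tot_simps PiE_iff)
  show "\<Phi> n (c \<odot>\<^bsub>tot Z n\<lparr>carrier := cycles Z n\<rparr>\<^esub> x) = c \<odot>\<^bsub>tot Z' n\<lparr>carrier := cycles Z' n\<rparr>\<^esub> \<Phi> n x"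
    unfolding eq by (rule lin_smult[OF \<Phi>_lin x])
qed

end

lemma inv_into_linear:
  assumes h: "h \<in> linear_maps M N" and b: "bij_betw h (carrier M) (carrier N)" and M: "vspace M"
  shows "inv_into (carrier M) h \<in> linear_maps N M"
proof (rule linI)
  note i = bij_betw_inv_into[OF b, unfolded bij_betw_def, THEN conjunct2] bij_betw_inv_into_right[OF b] bij_betw_inv_into_left[OF b]
  show c: "inv_into (carrier M) h x \<in> carrier M" if "x \<in> carrier N" for x using i(1) that by auto
  fix x y c assume x: "x \<in> carrier N"
  show "inv_into (carrier M) h (c \<odot>\<^bsub>N\<^esub> x) = c \<odot>\<^bsub>M\<^esub> inv_into (carrier M) h x"
    using i(3)[of "c \<odot>\<^bsub>M\<^esub> inv_into (carrier M) h x"] c[OF x] M by (simp add: lin_smult[OF h] i(2) x)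
  assume y: "y \<in> carrier N"
  show "inv_into (carrier M) h (x \<oplus>\<^bsub>N\<^esub> y) = inv_into (carrier M) h x \<oplus>\<^bsub>M\<^esub> inv_into (carrier M) h y"
    using i(3)[of "inv_into (carrier M) h x \<oplus>\<^bsub>M\<^esub> inv_into (carrier M) h y"] c[OF x] c[OF y] M by (simp add: lin_add[OF h] i(2) x y)
qed

lemma (in cyclic_iso) cyclic_iso_inverse: "cyclic_iso Z' Z (\<lambda>n. inv_into (carrier (obj Z n)) (\<phi> n))"
proof -
  define \<eta> where "\<eta> n = inv_into (carrier (obj Z n)) (\<phi> n)" for n
  have \<eta>: "\<eta> n \<in> linear_maps (obj Z' n) (obj Z n)" for n
    unfolding \<eta>_def by (rule inv_into_linear[OF \<phi>_lin \<phi>_bij]) simp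
  have r: "\<phi> n (\<eta> n y) = y" if "y \<in> carrier (obj Z' n)" for n y
    unfolding \<eta>_def by (rule bij_betw_inv_into_right[OF \<phi>_bij that])
  have l: "\<eta> n (\<phi> n z) = z" if "z \<in> carrier (obj Z n)" for n z
    unfolding \<eta>_def by (rule bij_betw_inv_into_left[OF \<phi>_bij that])
  have c: "\<eta> n y \<in> carrier (obj Z n)" if "y \<in> carrier (obj Z' n)" for n y by (rule lin_closed[OF \<eta> that])
  have f: "face Z' n i y = \<phi> (n - 1) (face Z n i (\<eta> n y))" if "0 < n" "i \<le> n" "y \<in> carrier (obj Z' n)" for n i y
    using \<phi>_face[OF that(1,2) c[OF that(3)]] r[OF that(3)] by simp
  have t: "cyc Z' n y = \<phi> n (cyc Z n (\<eta> n y))" if "y \<in> carrier (obj Z' n)" for n y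
    using \<phi>_cyc[OF c[OF that]] r[OF that] by simp
  have "cyclic_iso Z' Z \<eta>"
  proof (rule cyclic_iso.intro, goal_cases)
    case (4 n)
    then show ?case unfolding \<eta>_def by (rule bij_betw_inv_into[OF \<phi>_bij])
  next
    case (5 n i y)
    then show ?case by (simp add: f lin_closed[OF \<phi>_lin] face_closed c del: One_nat_def)
  next
    case (6 n i y)
    then show ?case by (simp add: f l face_closed c del: One_nat_def)
  next
    case (7 y n)
    then show ?case by (simp add: t lin_closed[OF \<phi>_lin] cyc_closed c)
  next
    case (8 y n)
    then show ?case by (simp add: t l cyc_closed c)
  qed (simp_all add: \<eta>)
  then show ?thesis by (simp add: \<eta>_def[abs_def])
qed

section \<open>The slots of a tensor power\<close>

text \<open>The image of \<open>a\<close> under the inclusion of the algebra as the factor \<open>i\<close> of its tensor power. The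
  cyclic structure maps are computed on products of such elements rather than on lists.\<close>

definition slot :: "('k::field, 'a, 'm) module_scheme \<Rightarrow> nat \<Rightarrow> nat \<Rightarrow> 'a \<Rightarrow> ('a list \<Rightarrow>\<^sub>0 'k) set" where
  "slot A n i a = cls (tensor_power A n) ((replicate n \<one>\<^bsub>A\<^esub>)[i := a])"

lemma set_list_update_subset: "\<lbrakk>set xs \<subseteq> D; x \<in> D\<rbrakk> \<Longrightarrow> set (xs[i := x]) \<subseteq> D"
  using set_update_subset_insert[of xs i x] by auto

text \<open>The index of the slot into which the face \<open>i\<close> merges slot \<open>j\<close> of a tensor of length \<open>n + 1\<close>.\<close>

definition merge :: "nat \<Rightarrow> nat \<Rightarrow> nat \<Rightarrow> nat" where
  "merge n i j = (if i < n then (if j \<le> i then j else j - 1) else (if j = n then 0 else j))"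

definition face_list :: "('k::field, 'a, 'm) module_scheme \<Rightarrow> nat \<Rightarrow> nat \<Rightarrow> 'a list \<Rightarrow> 'a list" where
  "face_list A n i as = (if i < n then take i as @ [as ! i \<otimes>\<^bsub>A\<^esub> as ! (i + 1)] @ drop (i + 2) as
     else (last as \<otimes>\<^bsub>A\<^esub> hd as) # tl (butlast as))"

lemma face_list_length: "\<lbrakk>length as = Suc n; 0 < n; i \<le> n\<rbrakk> \<Longrightarrow> length (face_list A n i as) = n"
  by (auto simp: face_list_def)

lemma face_list_nth:
  assumes "length as = Suc n" "0 < n" "i \<le> n" "k < n"
  shows "face_list A n i as ! k = (if i < n then (if k < i then as ! k else if k = i then as ! i \<otimes>\<^bsub>A\<^esub> as ! (Suc i) else as ! (Suc k))
    else if k = 0 then as ! n \<otimes>\<^bsub>A\<^esub> as ! 0 else as ! k)"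
proof (cases "i < n")
  case True
  show ?thesis
  proof (cases "i < k")
    case ik: True
    then obtain m where m: "k = Suc (i + m)" using less_imp_Suc_add by blast
    show ?thesis using assms True by (simp add: face_list_def nth_append m)
  next
    case False
    then show ?thesis using assms True by (auto simp: face_list_def nth_append)
  qed
next
  case False
  have "as \<noteq> []" using assms by auto
  then have "last as = as ! n" "hd as = as ! 0" using assms by (simp_all add: last_conv_nth hd_conv_nth)
  moreover have "tl (butlast as) ! (k - 1) = as ! k" if "k > 0"
    using that assms by (simp add: nth_tl nth_butlast)
  ultimately show ?thesis using assms False by (auto simp: face_list_def nth_Cons split: nat.splits)
qed

lemma merge_less: "\<lbrakk>0 < n; i \<le> n; j \<le> n\<rbrakk> \<Longrightarrow> merge n i j < n"
  by (auto simp: merge_def)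

lemma next_slot: "Suc i mod Suc n = (if i = n then 0 else Suc i)" if "i \<le> (n::nat)"
  using that by auto

text \<open>Slots \<open>i\<close> and \<open>i + 1\<close>, taken cyclically, are merged into one and their entries multiplied in
  this order; every other slot is only renumbered.\<close>

lemma face_list_merge:
  assumes "length as = Suc n" "0 < n" "i \<le> n" "j \<le> n"
  shows "face_list A n i as ! merge n i j = (if j = i \<or> j = Suc i mod Suc n then as ! i \<otimes>\<^bsub>A\<^esub> as ! (Suc i mod Suc n) else as ! j)"
  using assms merge_less[OF assms(2-4)] unfolding next_slot[OF assms(3)]
  by (subst face_list_nth) (auto simp: merge_def split: if_splits)

lemma face_list_update:
  assumes "length as = Suc n" "0 < n" "i \<le> n" "j \<le> n"
  shows "face_list A n i (as[j := x]) = (face_list A n i as)[merge n i j :=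
     (if j = i then x \<otimes>\<^bsub>A\<^esub> as ! (Suc i mod Suc n) else if j = Suc i mod Suc n then as ! i \<otimes>\<^bsub>A\<^esub> x else x)]"
    (is "?l = ?r")
proof (rule nth_equalityI)
  show "length ?l = length ?r" using assms by (simp add: face_list_length)
  fix k assume "k < length ?l"
  then have k: "k < n" using assms by (simp add: face_list_length)
  have c: "as[j := x] ! m = (if m = j then x else as ! m)" if "m \<le> n" for m
    using that assms by (auto simp: nth_list_update)
  have l: "length (as[j := x]) = Suc n" using assms by simp
  note L = face_list_nth[OF l assms(2,3) k] and R = face_list_nth[OF assms(1-3) k]
  have r: "?r ! k = (if k = merge n i j then (if j = i then x \<otimes>\<^bsub>A\<^esub> as ! (Suc i mod Suc n)
      else if j = Suc i mod Suc n then as ! i \<otimes>\<^bsub>A\<^esub> x else x) else face_list A n i as ! k)"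
    using k face_list_length[OF assms(1-3), of A] merge_less[OF assms(2-4)] by (simp add: nth_list_update eq_commute)
  consider "i < n" "k < i" | "i < n" "k = i" | "i < n" "i < k" | "i = n" "k = 0" | "i = n" "0 < k"
    using assms(3) by linarith
  then show "?l ! k = ?r ! k"
  proof cases
    case 1
    then show ?thesis unfolding r L R using k c[of k] by (auto simp: merge_def)
  next
    case 2
    then show ?thesis unfolding r L R using k c[of i] c[of "Suc i"] by (auto simp: merge_def)
  next
    case 3
    then show ?thesis unfolding r L R using k c[of "Suc k"] by (auto simp: merge_def)
  next
    case 4
    then show ?thesis unfolding r L R using k c[of n] c[of 0] assms(2,4) by (auto simp: merge_def)
  next
    case 5
    then show ?thesis unfolding r L R using k c[of k] assms(4) by (auto simp: merge_def)
  qed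
qed

definition rot :: "'a list \<Rightarrow> 'a list" where
  "rot as = last as # butlast as"

lemma length_rot [simp]: "as \<noteq> [] \<Longrightarrow> length (rot as) = length as"
  by (simp add: rot_def)

lemma rotate_nth: "\<lbrakk>length as = Suc n; k \<le> n\<rbrakk> \<Longrightarrow> (rot as) ! k = (if k = 0 then as ! n else as ! (k - 1))"
  by (cases k; cases "as = []") (auto simp: rot_def last_conv_nth nth_butlast)

lemma rotate_update:
  assumes "length as = Suc n" "j \<le> n"
  shows "rot (as[j := x]) = (rot as)[Suc j mod Suc n := x]"
    "(rot as) ! (Suc j mod Suc n) = as ! j"
proof -
  show "rot (as[j := x]) = (rot as)[Suc j mod Suc n := x]" (is "?l = ?r")
  proof (rule nth_equalityI)
    show "length ?l = length ?r" using assms by (cases "as = []") simp_all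
    fix k assume "k < length ?l"
    then have k: "k \<le> n" using assms by (cases "as = []") simp_all
    then have "?l ! k = (if k = 0 then as[j := x] ! n else as[j := x] ! (k - 1))"
      by (intro rotate_nth) (simp_all add: assms)
    also have "\<dots> = ?r ! k"
      using assms k rotate_nth[OF assms(1) k] length_rot[of as] unfolding next_slot[OF assms(2)]
      by (cases "as = []") (auto simp: nth_list_update)
    finally show "?l ! k = ?r ! k" .
  qed
  show "(rot as) ! (Suc j mod Suc n) = as ! j"
    using assms unfolding next_slot[OF assms(2)] by (subst rotate_nth[OF assms(1)]) auto
qed

context
  fixes A :: "('k::field, 'a, 'm) module_scheme"
  assumes A: "assoc_algebra A"
begin

lemmas VA = alg_vspace[OF A]

lemma ones_sub: "set (replicate n \<one>\<^bsub>A\<^esub>) \<subseteq> carrier A"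
  using A by auto

lemma slot_lin: "\<lbrakk>i < n; g \<in> linear_maps Q A\<rbrakk> \<Longrightarrow> (\<lambda>q. slot A n i (g q)) \<in> linear_maps Q (tensor_power A n)"
  unfolding slot_def using tpow_cls_lin[OF VA ones_sub, of n n i] by simp

lemma slot_closed: "a \<in> carrier A \<Longrightarrow> slot A n i a \<in> carrier (tensor_power A n)"
  unfolding slot_def by (intro tpow_closed[OF VA] set_list_update_subset ones_sub) simp_all

lemma slot_one: "slot A n i \<one>\<^bsub>A\<^esub> = \<one>\<^bsub>tensor_power A n\<^esub>"
proof -
  have "(replicate n \<one>\<^bsub>A\<^esub>)[i := \<one>\<^bsub>A\<^esub>] = replicate n \<one>\<^bsub>A\<^esub>"
    by (cases "i < n"; intro nth_equalityI) (simp_all add: nth_list_update)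
  then show ?thesis by (simp add: slot_def tpow_one[OF A])
qed

lemma slot_mult_cls:
  assumes "a \<in> carrier A" "set as \<subseteq> carrier A" "length as = n" "i < n"
  shows "slot A n i a \<otimes>\<^bsub>tensor_power A n\<^esub> cls (tensor_power A n) as = cls (tensor_power A n) (as[i := a \<otimes>\<^bsub>A\<^esub> as ! i])"
    and "cls (tensor_power A n) as \<otimes>\<^bsub>tensor_power A n\<^esub> slot A n i a = cls (tensor_power A n) (as[i := as ! i \<otimes>\<^bsub>A\<^esub> a])"
proof -
  have c: "as ! k \<in> carrier A" if "k < n" for k using assms that by (auto simp: subset_iff)
  have "map2 (monoid.mult A) ((replicate n \<one>\<^bsub>A\<^esub>)[i := a]) as = as[i := a \<otimes>\<^bsub>A\<^esub> as ! i]"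
    "map2 (monoid.mult A) as ((replicate n \<one>\<^bsub>A\<^esub>)[i := a]) = as[i := as ! i \<otimes>\<^bsub>A\<^esub> a]"
    using assms c A by (auto intro!: nth_equalityI simp: nth_list_update)
  then show "slot A n i a \<otimes>\<^bsub>tensor_power A n\<^esub> cls (tensor_power A n) as = cls (tensor_power A n) (as[i := a \<otimes>\<^bsub>A\<^esub> as ! i])"
    "cls (tensor_power A n) as \<otimes>\<^bsub>tensor_power A n\<^esub> slot A n i a = cls (tensor_power A n) (as[i := as ! i \<otimes>\<^bsub>A\<^esub> a])"
    using assms tpow_mult[OF A set_list_update_subset[OF ones_sub assms(1)] assms(2), of n i n]
      tpow_mult[OF A assms(2) set_list_update_subset[OF ones_sub assms(1)], of n n i]
    by (simp_all add: slot_def)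
qed

lemma slot_mult_slot:
  assumes "a \<in> carrier A" "b \<in> carrier A" "i < n"
  shows "slot A n i a \<otimes>\<^bsub>tensor_power A n\<^esub> slot A n i b = slot A n i (a \<otimes>\<^bsub>A\<^esub> b)"
proof -
  have u: "set ((replicate n \<one>\<^bsub>A\<^esub>)[i := b]) \<subseteq> carrier A"
    by (rule set_list_update_subset[OF ones_sub assms(2)])
  show ?thesis using slot_mult_cls(1)[OF assms(1) u _ assms(3)] assms(3) by (simp add: slot_def)
qed

lemma slot_comm:
  assumes "a \<in> carrier A" "b \<in> carrier A" "i < n" "k < n" "i \<noteq> k"
  shows "slot A n i a \<otimes>\<^bsub>tensor_power A n\<^esub> slot A n k b = slot A n k b \<otimes>\<^bsub>tensor_power A n\<^esub> slot A n i a"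
proof -
  have u: "set ((replicate n \<one>\<^bsub>A\<^esub>)[k := b]) \<subseteq> carrier A" "set ((replicate n \<one>\<^bsub>A\<^esub>)[i := a]) \<subseteq> carrier A"
    using assms by (intro set_list_update_subset ones_sub; simp)+
  show ?thesis
    using slot_mult_cls(1)[OF assms(1) u(1), of n i] slot_mult_cls(1)[OF assms(2) u(2), of n k] assms A
    by (simp add: slot_def list_update_swap)
qed

lemma face_list_closed:
  assumes "set as \<subseteq> carrier A" "length as = Suc n" "0 < n" "i \<le> n"
  shows "set (face_list A n i as) \<subseteq> carrier A"
proof -
  have c: "as ! k \<in> carrier A" if "k < Suc n" for k using assms that by (auto simp: subset_iff)
  have "face_list A n i as ! k \<in> carrier A" if "k < n" for k
    using that c assms A by (simp add: face_list_nth)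
  then show ?thesis using assms by (auto simp: in_set_conv_nth face_list_length)
qed

definition aface where
  "aface n i = lin_ext (tensor_power A n) (\<lambda>as. cls (tensor_power A n) (face_list A n i as))"

context
  fixes n i :: nat assumes n: "0 < n" and i: "i \<le> n"
begin

lemma face_multilin: "multilin A (Suc n) (tensor_power A n) (\<lambda>as. cls (tensor_power A n) (face_list A n i as))"
proof (rule multilinI)
  show "cls (tensor_power A n) (face_list A n i as) \<in> carrier (tensor_power A n)"
    if "set as \<subseteq> carrier A" "length as = Suc n" for as
    using that n i by (intro tpow_closed[OF VA] face_list_closed face_list_length)
  fix as j assume as: "set as \<subseteq> carrier A" "length as = Suc n" and j: "j < Suc n"
  have c: "as ! k \<in> carrier A" if "k \<le> n" for k using as that by (auto simp: subset_iff)
  have nx: "Suc i mod Suc n \<le> n" by simp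
  have j': "j \<le> n" using j by simp
  show "(\<lambda>x. cls (tensor_power A n) (face_list A n i (as[j := x]))) \<in> linear_maps A (tensor_power A n)"
    unfolding face_list_update[OF as(2) n i j']
  proof (rule tpow_cls_lin[OF VA face_list_closed[OF as n i] face_list_length[OF as(2) n i] merge_less[OF n i j']])
    have lin_if: "(\<lambda>x. if P then g x else h x) \<in> linear_maps A A"
      if "g \<in> linear_maps A A" "h \<in> linear_maps A A" for P g h
      using that by (cases P) simp_all
    show "(\<lambda>x. if j = i then x \<otimes>\<^bsub>A\<^esub> as ! (Suc i mod Suc n) else if j = Suc i mod Suc n then as ! i \<otimes>\<^bsub>A\<^esub> x else x) \<in> linear_maps A A"
      by (intro lin_if alg_lin_left[OF A c[OF i] lin_id] alg_lin_right[OF A c[OF nx] lin_id] lin_id)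
  qed
qed

lemma aface_lin: "aface n i \<in> linear_maps (tensor_power A (Suc n)) (tensor_power A n)"
  unfolding aface_def using tpow_ext_lin[OF VA vspace_tpow[OF VA] face_multilin lin_id] by simp

lemma aface_cls: "\<lbrakk>set as \<subseteq> carrier A; length as = Suc n\<rbrakk> \<Longrightarrow> aface n i (cls (tensor_power A (Suc n)) as) = cls (tensor_power A n) (face_list A n i as)"
  unfolding aface_def by (rule tpow_ext_cls[OF VA vspace_tpow[OF VA] face_multilin])

text \<open>A face is compatible with left multiplication in every slot but the right one of the two that are
  merged, and with right multiplication in every slot but the left one; where these two meet, a factor
  may be passed from one to the other.\<close>

lemma aface_slot:
  assumes a: "a \<in> carrier A" and t: "t \<in> carrier (tensor_power A (Suc n))"
  shows "\<lbrakk>j \<le> n; j \<noteq> Suc i mod Suc n\<rbrakk> \<Longrightarrow> aface n i (slot A (Suc n) j a \<otimes>\<^bsub>tensor_power A (Suc n)\<^esub> t) = slot A n (merge n i j) a \<otimes>\<^bsub>tensor_power A n\<^esub> aface n i t"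
    and "\<lbrakk>j \<le> n; j \<noteq> i\<rbrakk> \<Longrightarrow> aface n i (t \<otimes>\<^bsub>tensor_power A (Suc n)\<^esub> slot A (Suc n) j a) = aface n i t \<otimes>\<^bsub>tensor_power A n\<^esub> slot A n (merge n i j) a"
    and "aface n i (slot A (Suc n) (Suc i mod Suc n) a \<otimes>\<^bsub>tensor_power A (Suc n)\<^esub> t) = aface n i (t \<otimes>\<^bsub>tensor_power A (Suc n)\<^esub> slot A (Suc n) i a)"
proof -
  note algs = assoc_algebra_tpow[OF A] and vs = vspace_tpow[OF VA, of n]
  note lins = lin_comp[OF aface_lin] alg_lin_left[OF algs] alg_lin_right[OF algs] aface_lin lin_id slot_closed[OF a]
  have nx: "Suc i mod Suc n \<le> n" by simp
  have c: "as ! k \<in> carrier A" if "set as \<subseteq> carrier A" "length as = Suc n" "k \<le> n" for as k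
    using that by (auto simp: subset_iff)
  note s = slot_mult_cls[OF a] aface_cls set_list_update_subset A a alg_mult_closed[OF A a] alg_mult_closed[OF A _ a] c
    face_list_closed face_list_length n i face_list_merge merge_less face_list_update
  { fix j assume j: "j \<le> n" "j \<noteq> Suc i mod Suc n"
    show "aface n i (slot A (Suc n) j a \<otimes>\<^bsub>tensor_power A (Suc n)\<^esub> t) = slot A n (merge n i j) a \<otimes>\<^bsub>tensor_power A n\<^esub> aface n i t"
    proof (rule tpow_lin_eq[OF VA vs _ _ _ t])
      fix as assume as: "set as \<subseteq> carrier A" "length as = Suc n"
      show "aface n i (slot A (Suc n) j a \<otimes>\<^bsub>tensor_power A (Suc n)\<^esub> cls (tensor_power A (Suc n)) as) =
          slot A n (merge n i j) a \<otimes>\<^bsub>tensor_power A n\<^esub> aface n i (cls (tensor_power A (Suc n)) as)"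
        using as j nx by (simp add: s alg_assoc)
    qed (intro lins)+
  }
  { fix j assume j: "j \<le> n" "j \<noteq> i"
    show "aface n i (t \<otimes>\<^bsub>tensor_power A (Suc n)\<^esub> slot A (Suc n) j a) = aface n i t \<otimes>\<^bsub>tensor_power A n\<^esub> slot A n (merge n i j) a"
    proof (rule tpow_lin_eq[OF VA vs _ _ _ t])
      fix as assume as: "set as \<subseteq> carrier A" "length as = Suc n"
      show "aface n i (cls (tensor_power A (Suc n)) as \<otimes>\<^bsub>tensor_power A (Suc n)\<^esub> slot A (Suc n) j a) =
          aface n i (cls (tensor_power A (Suc n)) as) \<otimes>\<^bsub>tensor_power A n\<^esub> slot A n (merge n i j) a"
        using as j nx by (simp add: s alg_assoc)
    qed (intro lins)+
  }
  show "aface n i (slot A (Suc n) (Suc i mod Suc n) a \<otimes>\<^bsub>tensor_power A (Suc n)\<^esub> t) = aface n i (t \<otimes>\<^bsub>tensor_power A (Suc n)\<^esub> slot A (Suc n) i a)"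
  proof (rule tpow_lin_eq[OF VA vs _ _ _ t])
    fix as assume as: "set as \<subseteq> carrier A" "length as = Suc n"
    have m: "merge n i (Suc i mod Suc n) = merge n i i"
      using n i unfolding next_slot[OF i] by (auto simp: merge_def)
    have ne: "Suc i mod Suc n \<noteq> i" using n i unfolding next_slot[OF i] by auto
    have nx': "Suc i mod Suc n < Suc n" and i': "i < Suc n" using i by auto
    note cs = c[OF as i] c[OF as nx[unfolded One_nat_def]]
    have L: "slot A (Suc n) (Suc i mod Suc n) a \<otimes>\<^bsub>tensor_power A (Suc n)\<^esub> cls (tensor_power A (Suc n)) as
        = cls (tensor_power A (Suc n)) (as[Suc i mod Suc n := a \<otimes>\<^bsub>A\<^esub> as ! (Suc i mod Suc n)])"
      by (rule slot_mult_cls(1)[OF a as nx'])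
    have R: "cls (tensor_power A (Suc n)) as \<otimes>\<^bsub>tensor_power A (Suc n)\<^esub> slot A (Suc n) i a
        = cls (tensor_power A (Suc n)) (as[i := as ! i \<otimes>\<^bsub>A\<^esub> a])"
      by (rule slot_mult_cls(2)[OF a as i'])
    show "aface n i (slot A (Suc n) (Suc i mod Suc n) a \<otimes>\<^bsub>tensor_power A (Suc n)\<^esub> cls (tensor_power A (Suc n)) as) =
        aface n i (cls (tensor_power A (Suc n)) as \<otimes>\<^bsub>tensor_power A (Suc n)\<^esub> slot A (Suc n) i a)"
      unfolding L R using as ne cs a A n i
      by (simp add: aface_cls set_list_update_subset face_list_update m alg_assoc)
  qed (intro lins)+
qed

end

definition acyc where
  "acyc n = lin_ext (tensor_power A (Suc n)) (\<lambda>as. cls (tensor_power A (Suc n)) (rot as))"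

lemma rotate_closed: "\<lbrakk>set as \<subseteq> carrier A; length as = Suc n\<rbrakk> \<Longrightarrow> set (rot as) \<subseteq> carrier A"
  using last_in_set[of as] by (cases "as = []") (auto simp: rot_def dest: in_set_butlastD)

lemma rotate_multilin: "multilin A (Suc n) (tensor_power A (Suc n)) (\<lambda>as. cls (tensor_power A (Suc n)) (rot as))"
proof (rule multilinI)
  fix as assume as: "set as \<subseteq> carrier A" "length as = Suc n"
  show "cls (tensor_power A (Suc n)) (rot as) \<in> carrier (tensor_power A (Suc n))"
    using as by (intro tpow_closed[OF VA] rotate_closed[OF as]) (cases "as = []"; simp)
  fix j assume j: "j < Suc n"
  then have j': "j \<le> n" by simp
  show "(\<lambda>x. cls (tensor_power A (Suc n)) (rot (as[j := x]))) \<in> linear_maps A (tensor_power A (Suc n))"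
    unfolding rotate_update(1)[OF as(2) j']
    using as by (intro tpow_cls_lin[OF VA rotate_closed[OF as] _ _ lin_id]) (cases "as = []"; simp)+
qed

lemma acyc_lin: "acyc n \<in> linear_maps (tensor_power A (Suc n)) (tensor_power A (Suc n))"
  unfolding acyc_def using tpow_ext_lin[OF VA vspace_tpow[OF VA] rotate_multilin lin_id] by simp

lemma acyc_cls: "\<lbrakk>set as \<subseteq> carrier A; length as = Suc n\<rbrakk> \<Longrightarrow>
    acyc n (cls (tensor_power A (Suc n)) as) = cls (tensor_power A (Suc n)) (rot as)"
  unfolding acyc_def by (rule tpow_ext_cls[OF VA vspace_tpow[OF VA] rotate_multilin])

lemma acyc_slot:
  assumes a: "a \<in> carrier A" and t: "t \<in> carrier (tensor_power A (Suc n))" and j: "j \<le> n"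
  shows "acyc n (slot A (Suc n) j a \<otimes>\<^bsub>tensor_power A (Suc n)\<^esub> t) = slot A (Suc n) (Suc j mod Suc n) a \<otimes>\<^bsub>tensor_power A (Suc n)\<^esub> acyc n t"
    and "acyc n (t \<otimes>\<^bsub>tensor_power A (Suc n)\<^esub> slot A (Suc n) j a) = acyc n t \<otimes>\<^bsub>tensor_power A (Suc n)\<^esub> slot A (Suc n) (Suc j mod Suc n) a"
proof -
  note algs = assoc_algebra_tpow[OF A] and vs = vspace_tpow[OF VA, of "Suc n"]
  note lins = lin_comp[OF acyc_lin] alg_lin_left[OF algs] alg_lin_right[OF algs] acyc_lin lin_id slot_closed[OF a]
  have c: "as ! k \<in> carrier A" if "set as \<subseteq> carrier A" "length as = Suc n" "k \<le> n" for as k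
    using that by (auto simp: subset_iff)
  { fix as assume as: "set as \<subseteq> carrier A" "length as = Suc n"
    have l: "length (rot as) = Suc n" using as by (cases "as = []") simp_all
    have "acyc n (slot A (Suc n) j a \<otimes>\<^bsub>tensor_power A (Suc n)\<^esub> cls (tensor_power A (Suc n)) as) =
        cls (tensor_power A (Suc n)) ((rot as)[Suc j mod Suc n := a \<otimes>\<^bsub>A\<^esub> as ! j])"
      using as j a c[OF as j] A
      by (simp add: slot_mult_cls acyc_cls set_list_update_subset rotate_update(1)[OF as(2) j, symmetric])
    also have "\<dots> = slot A (Suc n) (Suc j mod Suc n) a \<otimes>\<^bsub>tensor_power A (Suc n)\<^esub> acyc n (cls (tensor_power A (Suc n)) as)"
      unfolding acyc_cls[OF as] using slot_mult_cls(1)[OF a rotate_closed[OF as] l, of "Suc j mod Suc n"] rotate_update(2)[OF as(2) j]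
      by simp
    finally have "acyc n (slot A (Suc n) j a \<otimes>\<^bsub>tensor_power A (Suc n)\<^esub> cls (tensor_power A (Suc n)) as)
       = slot A (Suc n) (Suc j mod Suc n) a \<otimes>\<^bsub>tensor_power A (Suc n)\<^esub> acyc n (cls (tensor_power A (Suc n)) as)" .
  } note 1 = this
  { fix as assume as: "set as \<subseteq> carrier A" "length as = Suc n"
    have l: "length (rot as) = Suc n" using as by (cases "as = []") simp_all
    have "acyc n (cls (tensor_power A (Suc n)) as \<otimes>\<^bsub>tensor_power A (Suc n)\<^esub> slot A (Suc n) j a) =
        cls (tensor_power A (Suc n)) ((rot as)[Suc j mod Suc n := as ! j \<otimes>\<^bsub>A\<^esub> a])"
      using as j a c[OF as j] A
      by (simp add: slot_mult_cls acyc_cls set_list_update_subset rotate_update(1)[OF as(2) j, symmetric])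
    also have "\<dots> = acyc n (cls (tensor_power A (Suc n)) as) \<otimes>\<^bsub>tensor_power A (Suc n)\<^esub> slot A (Suc n) (Suc j mod Suc n) a"
      unfolding acyc_cls[OF as] using slot_mult_cls(2)[OF a rotate_closed[OF as] l, of "Suc j mod Suc n"] rotate_update(2)[OF as(2) j]
      by simp
    finally have "acyc n (cls (tensor_power A (Suc n)) as \<otimes>\<^bsub>tensor_power A (Suc n)\<^esub> slot A (Suc n) j a)
       = acyc n (cls (tensor_power A (Suc n)) as) \<otimes>\<^bsub>tensor_power A (Suc n)\<^esub> slot A (Suc n) (Suc j mod Suc n) a" .
  } note 2 = this
  show "acyc n (slot A (Suc n) j a \<otimes>\<^bsub>tensor_power A (Suc n)\<^esub> t) = slot A (Suc n) (Suc j mod Suc n) a \<otimes>\<^bsub>tensor_power A (Suc n)\<^esub> acyc n t"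
    by (rule tpow_lin_eq[OF VA vs _ _ _ t], (intro lins)+, rule 1)
  show "acyc n (t \<otimes>\<^bsub>tensor_power A (Suc n)\<^esub> slot A (Suc n) j a) = acyc n t \<otimes>\<^bsub>tensor_power A (Suc n)\<^esub> slot A (Suc n) (Suc j mod Suc n) a"
    by (rule tpow_lin_eq[OF VA vs _ _ _ t], (intro lins)+, rule 2)
qed

lemma algebra_cyclic_object_eq:
  "obj (algebra_cyclic_object A) n = tensor_power A (Suc n)" "face (algebra_cyclic_object A) n i = aface n i"
  "cyc (algebra_cyclic_object A) n = acyc n"
  by (simp_all add: algebra_cyclic_object_def aface_def face_list_def acyc_def rot_def)

end

section \<open>The comparison map\<close>

lemma vs_diff_diff_swap:
  assumes "vspace M" "a \<in> carrier M" "b \<in> carrier M" "c \<in> carrier M" "d \<in> carrier M"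
  shows "(a \<ominus>\<^bsub>M\<^esub> b) \<ominus>\<^bsub>M\<^esub> (c \<ominus>\<^bsub>M\<^esub> d) = (a \<ominus>\<^bsub>M\<^esub> c) \<ominus>\<^bsub>M\<^esub> (b \<ominus>\<^bsub>M\<^esub> d)"
  using assms by (simp add: vs_diff_def vs_minus_add vs_ac)

context lie_two_cocycle
begin

abbreviation "PA n \<equiv> tensor_power A (Suc n)"
abbreviation "PU n \<equiv> tensor_power U (Suc n)"
abbreviation "sl n i a \<equiv> slot A (Suc n) i a"

lemma slot_\<iota>_lin: "i < n \<Longrightarrow> (\<lambda>x. slot A n i (\<iota> x)) \<in> linear_maps V (tensor_power A n)"
  by (rule slot_lin[OF alg_A _ \<iota>_lin])

lemma slot_\<iota>_rel:
  assumes "i < n"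
  shows "slot A n i (\<iota> x) \<otimes>\<^bsub>tensor_power A n\<^esub> slot A n i (\<iota> y) = slot A n i (\<iota> y) \<otimes>\<^bsub>tensor_power A n\<^esub> slot A n i (\<iota> x)
    \<oplus>\<^bsub>tensor_power A n\<^esub> (slot A n i (\<iota> (br x y)) \<oplus>\<^bsub>tensor_power A n\<^esub> f x y \<odot>\<^bsub>tensor_power A n\<^esub> \<one>\<^bsub>tensor_power A n\<^esub>)"
proof -
  note L = slot_lin[OF alg_A assms lin_id]
  show ?thesis
    using assms by (simp add: slot_mult_slot[OF alg_A] \<iota>_rel[of x y] lin_add[OF L] lin_smult[OF L] slot_one[OF alg_A])
qed

lemma slot_closed_A [simp]: "a \<in> carrier A \<Longrightarrow> slot A n i a \<in> carrier (tensor_power A n)"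
  by (rule slot_closed[OF alg_A])

text \<open>A letter is moved between two cyclically adjacent slots: the result is the difference of putting
  \<open>x\<close> at the left end of slot \<open>i + 1\<close> and at the right end of slot \<open>i\<close>. In the product
  \<open>a\<^sub>0 \<otimes> \<dots> \<otimes> a\<^sub>n\<close> these are the two places on either side of the tensor sign after \<open>a\<^sub>i\<close>.\<close>

definition slide :: "nat \<Rightarrow> nat \<Rightarrow> 'b \<Rightarrow> (('b list \<Rightarrow>\<^sub>0 'a) set set list \<Rightarrow>\<^sub>0 'a) set \<Rightarrow> (('b list \<Rightarrow>\<^sub>0 'a) set set list \<Rightarrow>\<^sub>0 'a) set" where
  "slide n i x t = sl n (Suc i mod Suc n) (\<iota> x) \<otimes>\<^bsub>PA n\<^esub> t \<ominus>\<^bsub>PA n\<^esub> t \<otimes>\<^bsub>PA n\<^esub> sl n i (\<iota> x)"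

lemma lierep_slide: "i \<le> n \<Longrightarrow> E.lierep (PA n) (slide n i)"
  unfolding slide_def[abs_def]
  by (rule lierep_ad; (rule slot_\<iota>_lin slot_\<iota>_rel)?; simp)

lemma slide_lin: "i \<le> n \<Longrightarrow> slide n i x \<in> linear_maps (PA n) (PA n)"
  by (rule E.rep_lin[OF lierep_slide])

lemma next_slot_neq: "\<lbrakk>i \<le> n; k \<le> n; i \<noteq> k\<rbrakk> \<Longrightarrow> Suc i mod Suc n \<noteq> Suc k mod Suc n"
  by (auto simp: mod_Suc)

text \<open>Different tensor signs involve different ends of slots. A slot may be shared, but then one of the two
  operators multiplies it from the left and the other from the right.\<close>

lemma slide_commute:
  assumes "i \<le> n" "k \<le> n" "i \<noteq> k" and t: "t \<in> carrier (PA n)"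
  shows "slide n i x (slide n k y t) = slide n k y (slide n i x t)"
proof -
  let ?l = "sl n (Suc i mod Suc n) (\<iota> x)" and ?r = "sl n i (\<iota> x)"
  let ?l' = "sl n (Suc k mod Suc n) (\<iota> y)" and ?r' = "sl n k (\<iota> y)"
  have cl: "?l \<in> carrier (PA n)" "?r \<in> carrier (PA n)" "?l' \<in> carrier (PA n)" "?r' \<in> carrier (PA n)" by simp_all
  have "?l \<otimes>\<^bsub>PA n\<^esub> ?l' = ?l' \<otimes>\<^bsub>PA n\<^esub> ?l" "?r' \<otimes>\<^bsub>PA n\<^esub> ?r = ?r \<otimes>\<^bsub>PA n\<^esub> ?r'"
    using assms next_slot_neq[OF assms(1-3)] by (intro slot_comm[OF alg_A]; simp)+
  then have 1: "?l \<otimes>\<^bsub>PA n\<^esub> (?l' \<otimes>\<^bsub>PA n\<^esub> t) = ?l' \<otimes>\<^bsub>PA n\<^esub> (?l \<otimes>\<^bsub>PA n\<^esub> t)" "(t \<otimes>\<^bsub>PA n\<^esub> ?r') \<otimes>\<^bsub>PA n\<^esub> ?r = (t \<otimes>\<^bsub>PA n\<^esub> ?r) \<otimes>\<^bsub>PA n\<^esub> ?r'"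
    using cl t alg_assoc[of "PA n" ?l ?l' t] alg_assoc[of "PA n" ?l' ?l t] by (simp_all add: alg_assoc)
  show ?thesis
    unfolding slide_def using cl t 1
    by (simp add: alg_diff_left alg_diff_right alg_assoc) (rule vs_diff_diff_swap; simp)
qed

definition slact where "slact n i h t = eact (PA n) (slide n i) h t"

context
  fixes n i :: nat assumes i: "i \<le> n"
begin

lemma slact_lin: "t \<in> carrier (PA n) \<Longrightarrow> (\<lambda>h. slact n i h t) \<in> linear_maps U (PA n)"
  and slact_lin_right: "h \<in> carrier U \<Longrightarrow> slact n i h \<in> linear_maps (PA n) (PA n)"
  and slact_one: "t \<in> carrier (PA n) \<Longrightarrow> slact n i \<one>\<^bsub>U\<^esub> t = t"
  and slact_mult: "\<lbrakk>h \<in> carrier U; h' \<in> carrier U; t \<in> carrier (PA n)\<rbrakk> \<Longrightarrow> slact n i (h \<otimes>\<^bsub>U\<^esub> h') t = slact n i h (slact n i h' t)"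
  and slact_j: "t \<in> carrier (PA n) \<Longrightarrow> slact n i (j x) t = slide n i x t"
  and slact_j_mult: "\<lbrakk>h \<in> carrier U; t \<in> carrier (PA n)\<rbrakk> \<Longrightarrow> slact n i (j x \<otimes>\<^bsub>U\<^esub> h) t = slide n i x (slact n i h t)"
  and slact_closed [simp]: "\<lbrakk>h \<in> carrier U; t \<in> carrier (PA n)\<rbrakk> \<Longrightarrow> slact n i h t \<in> carrier (PA n)"
  unfolding slact_def[abs_def]
  by (rule E.eact_lin[OF lierep_slide[OF i]] E.eact_lin_right[OF lierep_slide[OF i]] E.eact_one[OF lierep_slide[OF i]] E.eact_mult[OF lierep_slide[OF i]] E.eact_\<iota>[OF lierep_slide[OF i]] E.eact_\<iota>_mult[OF lierep_slide[OF i]] E.eact_closed[OF lierep_slide[OF i]]; assumption)+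

end

lemma slact_slide_commute:
  assumes "i \<le> n" "k \<le> n" "i \<noteq> k" "h \<in> carrier U" "t \<in> carrier (PA n)"
  shows "slide n i x (slact n k h t) = slact n k h (slide n i x t)"
  unfolding slact_def
  by (rule E.eact_intertwine[OF lierep_slide lierep_slide slide_lin]) (use assms slide_commute in simp_all)

lemma slact_commute:
  assumes "i \<le> n" "k \<le> n" "i \<noteq> k" "h \<in> carrier U" "h' \<in> carrier U" "t \<in> carrier (PA n)"
  shows "slact n k h' (slact n i h t) = slact n i h (slact n k h' t)"
  unfolding slact_def[of n i]
  by (rule E.eact_intertwine[OF lierep_slide lierep_slide slact_lin_right])
    (use assms slact_slide_commute[of i n k h'] in simp_all)

primrec actl where
  "actl n k [] t = t"
| "actl n k (h # hs) t = slact n k h (actl n (Suc k) hs t)"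

lemma actl_closed [simp]: "\<lbrakk>set hs \<subseteq> carrier U; k + length hs \<le> Suc n; t \<in> carrier (PA n)\<rbrakk> \<Longrightarrow> actl n k hs t \<in> carrier (PA n)"
  by (induction hs arbitrary: k) simp_all

lemma actl_lin: "\<lbrakk>set hs \<subseteq> carrier U; k + length hs \<le> Suc n\<rbrakk> \<Longrightarrow> actl n k hs \<in> linear_maps (PA n) (PA n)"
proof (induction hs arbitrary: k)
  case Nil
  have "actl n k [] = (\<lambda>t. t)" by (rule ext) simp
  then show ?case by (simp add: lin_id)
next
  case (Cons h hs)
  have "actl n k (h # hs) = (\<lambda>t. slact n k h (actl n (Suc k) hs t))" by (rule ext) simp
  then show ?case using Cons by (auto intro!: lin_comp[OF slact_lin_right])
qed

lemma actl_append: "actl n k (hs @ hs') t = actl n k hs (actl n (k + length hs) hs' t)"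
  by (induction hs arbitrary: k) simp_all

lemma actl_ones: "\<lbrakk>k + m \<le> Suc n; t \<in> carrier (PA n)\<rbrakk> \<Longrightarrow> actl n k (replicate m \<one>\<^bsub>U\<^esub>) t = t"
  by (induction m arbitrary: k) (simp_all add: slact_one)

lemma actl_slact_commute:
  assumes "set hs \<subseteq> carrier U" "k + length hs \<le> Suc n" "i < k \<or> k + length hs \<le> i" "i \<le> n" "h \<in> carrier U" "t \<in> carrier (PA n)"
  shows "actl n k hs (slact n i h t) = slact n i h (actl n k hs t)"
  using assms(1-3)
proof (induction hs arbitrary: k)
  case (Cons g hs)
  then have "actl n (Suc k) hs (slact n i h t) = slact n i h (actl n (Suc k) hs t)" by auto
  moreover have "slact n k g (slact n i h (actl n (Suc k) hs t)) = slact n i h (slact n k g (actl n (Suc k) hs t))"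
    using Cons.prems assms(4-) by (intro slact_commute) auto
  ultimately show ?case by simp
qed simp

lemma actl_multilin_aux:
  "\<lbrakk>set hs \<subseteq> carrier U; k + length hs \<le> Suc n; t \<in> carrier (PA n); i < length hs\<rbrakk> \<Longrightarrow>
    (\<lambda>h. actl n k (hs[i := h]) t) \<in> linear_maps U (PA n)"
proof (induction hs arbitrary: k i)
  case (Cons g hs)
  show ?case
  proof (cases i)
    case 0
    then show ?thesis using Cons.prems slact_lin[of k n "actl n (Suc k) hs t"] by simp
  next
    case (Suc i')
    then show ?thesis using Cons.prems Cons.IH[of "Suc k" i'] by (auto intro!: lin_comp[OF slact_lin_right])
  qed
qed simp

lemma actl_multilin: "t \<in> carrier (PA n) \<Longrightarrow> multilin U (Suc n) (PA n) (\<lambda>hs. actl n 0 hs t)"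
  by (rule multilinI) (simp_all add: actl_multilin_aux)

text \<open>The joint action of the tensor power of the enveloping algebra: the factor \<open>i\<close> acts by sliding
  letters from slot \<open>i\<close> to slot \<open>i + 1\<close>.\<close>

definition uact where "uact n u t = lin_ext (PA n) (\<lambda>hs. actl n 0 hs t) u"

lemma uact_lin: "t \<in> carrier (PA n) \<Longrightarrow> (\<lambda>u. uact n u t) \<in> linear_maps (PU n) (PA n)"
  unfolding uact_def using tpow_ext_lin[OF E.vspace_A _ actl_multilin lin_id] by simp

lemma uact_cls: "\<lbrakk>t \<in> carrier (PA n); set hs \<subseteq> carrier U; length hs = Suc n\<rbrakk> \<Longrightarrow> uact n (cls (PU n) hs) t = actl n 0 hs t"
  unfolding uact_def by (rule tpow_ext_cls[OF E.vspace_A _ actl_multilin]) simp_all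

lemma uact_lin_right: "u \<in> carrier (PU n) \<Longrightarrow> (\<lambda>t. uact n u t) \<in> linear_maps (PA n) (PA n)"
  unfolding uact_def by (rule tpow_ext_param[OF E.vspace_A]) (simp_all add: actl_lin)

lemma uact_closed [simp]: "\<lbrakk>u \<in> carrier (PU n); t \<in> carrier (PA n)\<rbrakk> \<Longrightarrow> uact n u t \<in> carrier (PA n)"
  by (rule lin_closed[OF uact_lin])

lemma slot_closed_U [simp]: "a \<in> carrier U \<Longrightarrow> slot U n i a \<in> carrier (tensor_power U n)"
  by (rule slot_closed[OF E.alg_A])

lemma actl_update:
  "\<lbrakk>set hs \<subseteq> carrier U; k + length hs \<le> Suc n; t \<in> carrier (PA n); i < length hs; h \<in> carrier U\<rbrakk> \<Longrightarrow>
    actl n k (hs[i := h \<otimes>\<^bsub>U\<^esub> hs ! i]) t = slact n (k + i) h (actl n k hs t)"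
proof (induction hs arbitrary: k i)
  case (Cons g hs)
  show ?case
  proof (cases i)
    case 0
    then show ?thesis using Cons.prems by (simp add: slact_mult)
  next
    case (Suc i')
    have "slact n k g (slact n (k + i) h (actl n (Suc k) hs t)) = slact n (k + i) h (slact n k g (actl n (Suc k) hs t))"
      using Cons.prems Suc by (intro slact_commute) auto
    then show ?thesis using Cons.prems Cons.IH[of "Suc k" i'] Suc by simp
  qed
qed simp

text \<open>Because the actions commute, the factor \<open>i\<close> may be taken to act last.\<close>

lemma uact_slot:
  assumes h: "h \<in> carrier U" and i: "i \<le> n" and u: "u \<in> carrier (PU n)" and t: "t \<in> carrier (PA n)"
  shows "uact n (slot U (Suc n) i h \<otimes>\<^bsub>PU n\<^esub> u) t = slact n i h (uact n u t)"
proof (rule tpow_lin_eq[OF E.vspace_A, of "PA n", OF _ _ _ _ u])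
  show "(\<lambda>u. uact n (slot U (Suc n) i h \<otimes>\<^bsub>PU n\<^esub> u) t) \<in> linear_maps (PU n) (PA n)"
    by (intro lin_comp[OF uact_lin] alg_lin_left lin_id) (simp_all add: h t)
  show "(\<lambda>u. slact n i h (uact n u t)) \<in> linear_maps (PU n) (PA n)"
    by (intro lin_comp[OF slact_lin_right] uact_lin i h t)
  fix hs assume hs: "set hs \<subseteq> carrier U" "length hs = Suc n"
  have "hs ! i \<in> carrier U" using hs i by (auto simp: subset_iff)
  then have "set (hs[i := h \<otimes>\<^bsub>U\<^esub> hs ! i]) \<subseteq> carrier U" using hs h by (intro set_list_update_subset) simp_all
  then show "uact n (slot U (Suc n) i h \<otimes>\<^bsub>PU n\<^esub> cls (PU n) hs) t = slact n i h (uact n (cls (PU n) hs) t)"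
    using hs h i t actl_update[OF hs(1), of 0 n t i h] by (simp add: slot_mult_cls[OF E.alg_A] uact_cls)
qed simp

lemma uact_one: "t \<in> carrier (PA n) \<Longrightarrow> uact n \<one>\<^bsub>PU n\<^esub> t = t"
  unfolding tpow_one[OF E.alg_A] by (subst uact_cls) (simp_all add: actl_ones slact_one del: replicate_Suc)

lemma cls_as_slot:
  assumes "h \<in> carrier U" "set hs \<subseteq> carrier U" "k + Suc (length hs) = N"
  shows "cls (tensor_power U N) (replicate k \<one>\<^bsub>U\<^esub> @ h # hs)
    = slot U N k h \<otimes>\<^bsub>tensor_power U N\<^esub> cls (tensor_power U N) (replicate (Suc k) \<one>\<^bsub>U\<^esub> @ hs)"
proof -
  have s: "set (replicate (Suc k) \<one>\<^bsub>U\<^esub> @ hs) \<subseteq> carrier U" using assms by auto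
  have e: "replicate (Suc k) \<one>\<^bsub>U\<^esub> @ hs = replicate k \<one>\<^bsub>U\<^esub> @ \<one>\<^bsub>U\<^esub> # hs"
    by (simp add: replicate_app_Cons_same)
  show ?thesis
    using slot_mult_cls(1)[OF E.alg_A assms(1) s, of N k] assms
    by (simp add: e list_update_append nth_append del: replicate_Suc)
qed

lemma uact_mult:
  assumes u: "u \<in> carrier (PU n)" and v: "v \<in> carrier (PU n)" and t: "t \<in> carrier (PA n)"
  shows "uact n (u \<otimes>\<^bsub>PU n\<^esub> v) t = uact n u (uact n v t)"
proof (rule tpow_lin_eq[OF E.vspace_A, of "PA n", OF _ _ _ _ u])
  show "(\<lambda>u. uact n (u \<otimes>\<^bsub>PU n\<^esub> v) t) \<in> linear_maps (PU n) (PA n)"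
    by (intro lin_comp[OF uact_lin] alg_lin_right lin_id) (simp_all add: v t)
  show "(\<lambda>u. uact n u (uact n v t)) \<in> linear_maps (PU n) (PA n)"
    by (intro uact_lin) (simp add: v t)
  have claim: "uact n (cls (PU n) (replicate k \<one>\<^bsub>U\<^esub> @ hs) \<otimes>\<^bsub>PU n\<^esub> v) t = actl n k hs (uact n v t)"
    if "set hs \<subseteq> carrier U" "k + length hs = Suc n" for k hs
    using that
  proof (induction hs arbitrary: k)
    case Nil
    then show ?case using v by (simp flip: tpow_one[OF E.alg_A] del: replicate_Suc)
  next
    case (Cons h hs)
    have cl: "cls (PU n) (replicate (Suc k) \<one>\<^bsub>U\<^esub> @ hs) \<in> carrier (PU n)"
      using Cons.prems by (intro tpow_closed[OF E.vspace_A]) auto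
    have "uact n (cls (PU n) (replicate k \<one>\<^bsub>U\<^esub> @ h # hs) \<otimes>\<^bsub>PU n\<^esub> v) t
        = uact n (slot U (Suc n) k h \<otimes>\<^bsub>PU n\<^esub> (cls (PU n) (replicate (Suc k) \<one>\<^bsub>U\<^esub> @ hs) \<otimes>\<^bsub>PU n\<^esub> v)) t"
      using Cons.prems cl v by (simp add: cls_as_slot alg_assoc del: replicate_Suc)
    also have "\<dots> = slact n k h (uact n (cls (PU n) (replicate (Suc k) \<one>\<^bsub>U\<^esub> @ hs) \<otimes>\<^bsub>PU n\<^esub> v) t)"
      using Cons.prems cl v t by (intro uact_slot) (simp_all del: replicate_Suc)
    finally show ?case using Cons by (simp del: replicate_Suc)
  qed
  fix hs assume hs: "set hs \<subseteq> carrier U" "length hs = Suc n"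
  then show "uact n (cls (PU n) hs \<otimes>\<^bsub>PU n\<^esub> v) t = uact n (cls (PU n) hs) (uact n v t)"
    using claim[of hs 0] v t by (simp add: uact_cls)
qed simp

subsection \<open>The iterated comultiplication\<close>

text \<open>The sum of the images of \<open>x\<close> in the first \<open>k\<close> slots; for \<open>k = N\<close> it is the iterated
  comultiplication of \<open>x\<close>.\<close>

primrec diag_sum where
  "diag_sum N 0 x = \<zero>\<^bsub>tensor_power U N\<^esub>"
| "diag_sum N (Suc k) x = diag_sum N k x \<oplus>\<^bsub>tensor_power U N\<^esub> slot U N k (j x)"

lemma diag_sum_closed [simp]: "diag_sum N k x \<in> carrier (tensor_power U N)"
  by (induction k) simp_all

lemma diag_sum_lin: "k \<le> N \<Longrightarrow> diag_sum N k \<in> linear_maps V (tensor_power U N)"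
proof (induction k)
  case 0
  have "diag_sum N 0 = (\<lambda>_. \<zero>\<^bsub>tensor_power U N\<^esub>)" by (rule ext) simp
  then show ?case by (simp add: lin_zero_map)
next
  case (Suc k)
  have "diag_sum N (Suc k) = (\<lambda>x. diag_sum N k x \<oplus>\<^bsub>tensor_power U N\<^esub> slot U N k (j x))" by (rule ext) simp
  then show ?case using Suc by (auto intro!: lin_add_map slot_lin[OF E.alg_A] E.\<iota>_lin)
qed

lemma diag_sum_slot_commute:
  "\<lbrakk>k \<le> i; i < N; h \<in> carrier U\<rbrakk> \<Longrightarrow> diag_sum N k x \<otimes>\<^bsub>tensor_power U N\<^esub> slot U N i h = slot U N i h \<otimes>\<^bsub>tensor_power U N\<^esub> diag_sum N k x"
  by (induction k) (simp_all add: alg_l_distr alg_r_distr slot_comm[OF E.alg_A])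

lemma diag_sum_rel:
  "k \<le> N \<Longrightarrow> diag_sum N k x \<otimes>\<^bsub>tensor_power U N\<^esub> diag_sum N k y = diag_sum N k y \<otimes>\<^bsub>tensor_power U N\<^esub> diag_sum N k x \<oplus>\<^bsub>tensor_power U N\<^esub> diag_sum N k (br x y)"
proof (induction k)
  case (Suc k)
  have s: "slot U N k (j x) \<otimes>\<^bsub>tensor_power U N\<^esub> slot U N k (j y) = slot U N k (j y) \<otimes>\<^bsub>tensor_power U N\<^esub> slot U N k (j x)
      \<oplus>\<^bsub>tensor_power U N\<^esub> slot U N k (j (br x y))"
    using Suc.prems lin_add[OF slot_lin[OF E.alg_A _ lin_id, of k N]]
    by (simp add: slot_mult_slot[OF E.alg_A] j_rel[of x y])
  have IH: "diag_sum N k x \<otimes>\<^bsub>tensor_power U N\<^esub> diag_sum N k y = diag_sum N k y \<otimes>\<^bsub>tensor_power U N\<^esub> diag_sum N k x \<oplus>\<^bsub>tensor_power U N\<^esub> diag_sum N k (br x y)"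
    using Suc by simp
  have c: "diag_sum N k z \<otimes>\<^bsub>tensor_power U N\<^esub> slot U N k (j w) = slot U N k (j w) \<otimes>\<^bsub>tensor_power U N\<^esub> diag_sum N k z" for z w
    using Suc.prems by (intro diag_sum_slot_commute) auto
  show ?case by (simp add: alg_l_distr alg_r_distr IH s c vs_ac)
qed simp

lemma tensor_power_U' [simp]: "tensor_power U' n = tensor_power U n"
  by (simp add: tensor_power_def multilinear_rels_def)

definition cons_map where
  "cons_map n a v = lin_ext (tensor_power U (Suc n)) (\<lambda>bs. cls (tensor_power U (Suc n)) (a # bs)) v"

lemma cons_multilin: "a \<in> carrier U \<Longrightarrow> multilin U n (tensor_power U (Suc n)) (\<lambda>bs. cls (tensor_power U (Suc n)) (a # bs))"
proof (rule multilinI)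
  fix xs i assume *: "a \<in> carrier U" "set xs \<subseteq> carrier U" "length xs = n" "i < n"
  show "(\<lambda>x. cls (tensor_power U (Suc n)) (a # xs[i := x])) \<in> linear_maps U (tensor_power U (Suc n))"
    using tpow_cls_lin[OF E.vspace_A _ _ _ lin_id, of "a # xs" "Suc n" "Suc i"] * by simp
qed (simp add: tpow_closed)

lemma cons_map_lin: "a \<in> carrier U \<Longrightarrow> cons_map n a \<in> linear_maps (tensor_power U n) (tensor_power U (Suc n))"
  unfolding cons_map_def[abs_def] using tpow_ext_lin[OF E.vspace_A _ cons_multilin lin_id] by simp

lemma cons_map_cls: "\<lbrakk>a \<in> carrier U; set bs \<subseteq> carrier U; length bs = n\<rbrakk> \<Longrightarrow> cons_map n a (cls (tensor_power U n) bs) = cls (tensor_power U (Suc n)) (a # bs)"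
  unfolding cons_map_def by (rule tpow_ext_cls[OF E.vspace_A _ cons_multilin]) simp_all

lemma cons_map_closed [simp]: "\<lbrakk>a \<in> carrier U; v \<in> carrier (tensor_power U n)\<rbrakk> \<Longrightarrow> cons_map n a v \<in> carrier (tensor_power U (Suc n))"
  by (rule lin_closed[OF cons_map_lin])

lemma cons_map_lin_left: "v \<in> carrier (tensor_power U n) \<Longrightarrow> (\<lambda>a. cons_map n a v) \<in> linear_maps U (tensor_power U (Suc n))"
  unfolding cons_map_def
proof (rule tpow_ext_param[OF E.vspace_A])
  show "(\<lambda>q. cls (tensor_power U (Suc n)) (q # xs)) \<in> linear_maps U (tensor_power U (Suc n))" if "set xs \<subseteq> carrier U" "length xs = n" for xs
    using tpow_cls_lin[OF E.vspace_A _ _ _ lin_id, of "\<one>\<^bsub>U\<^esub> # xs" "Suc n" 0] that by simp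
qed simp_all

lemma cons_map_slot:
  assumes a: "a \<in> carrier U" and b: "b \<in> carrier U" and v: "v \<in> carrier (tensor_power U n)"
  shows "cons_map n (b \<otimes>\<^bsub>U\<^esub> a) v = slot U (Suc n) 0 b \<otimes>\<^bsub>tensor_power U (Suc n)\<^esub> cons_map n a v"
    and "i < n \<Longrightarrow> cons_map n a (slot U n i b \<otimes>\<^bsub>tensor_power U n\<^esub> v) = slot U (Suc n) (Suc i) b \<otimes>\<^bsub>tensor_power U (Suc n)\<^esub> cons_map n a v"
proof -
  show "cons_map n (b \<otimes>\<^bsub>U\<^esub> a) v = slot U (Suc n) 0 b \<otimes>\<^bsub>tensor_power U (Suc n)\<^esub> cons_map n a v"
  proof (rule tpow_lin_eq[OF E.vspace_A, of "tensor_power U (Suc n)", OF _ _ _ _ v])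
    show "cons_map n (b \<otimes>\<^bsub>U\<^esub> a) \<in> linear_maps (tensor_power U n) (tensor_power U (Suc n))"
      by (intro cons_map_lin) (simp add: a b)
    show "(\<lambda>v. slot U (Suc n) 0 b \<otimes>\<^bsub>tensor_power U (Suc n)\<^esub> cons_map n a v) \<in> linear_maps (tensor_power U n) (tensor_power U (Suc n))"
      by (intro alg_lin_left cons_map_lin) (simp_all add: a b)
  qed (simp_all add: a b cons_map_cls slot_mult_cls[OF E.alg_A])
  assume i: "i < n"
  show "cons_map n a (slot U n i b \<otimes>\<^bsub>tensor_power U n\<^esub> v) = slot U (Suc n) (Suc i) b \<otimes>\<^bsub>tensor_power U (Suc n)\<^esub> cons_map n a v"
  proof (rule tpow_lin_eq[OF E.vspace_A, of "tensor_power U (Suc n)", OF _ _ _ _ v])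
    show "(\<lambda>v. cons_map n a (slot U n i b \<otimes>\<^bsub>tensor_power U n\<^esub> v)) \<in> linear_maps (tensor_power U n) (tensor_power U (Suc n))"
      by (intro lin_comp[OF cons_map_lin] alg_lin_left lin_id) (simp_all add: a b)
    show "(\<lambda>v. slot U (Suc n) (Suc i) b \<otimes>\<^bsub>tensor_power U (Suc n)\<^esub> cons_map n a v) \<in> linear_maps (tensor_power U n) (tensor_power U (Suc n))"
      by (intro alg_lin_left cons_map_lin) (simp_all add: a b)
    fix xs assume xs: "set xs \<subseteq> carrier U" "length xs = n"
    then have "xs ! i \<in> carrier U" using i by (auto simp: subset_iff)
    then have "set (xs[i := b \<otimes>\<^bsub>U\<^esub> xs ! i]) \<subseteq> carrier U" using b xs by (intro set_list_update_subset) simp_all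
    then show "cons_map n a (slot U n i b \<otimes>\<^bsub>tensor_power U n\<^esub> cls (tensor_power U n) xs)
       = slot U (Suc n) (Suc i) b \<otimes>\<^bsub>tensor_power U (Suc n)\<^esub> cons_map n a (cls (tensor_power U n) xs)"
      using xs i a b by (simp add: slot_mult_cls[OF E.alg_A] cons_map_cls)
  qed simp
qed

lemma cons_map_diag_sum:
  assumes a: "a \<in> carrier U" and v: "v \<in> carrier (tensor_power U n)"
  shows "k \<le> n \<Longrightarrow> cons_map n (j x \<otimes>\<^bsub>U\<^esub> a) v \<oplus>\<^bsub>tensor_power U (Suc n)\<^esub> cons_map n a (diag_sum n k x \<otimes>\<^bsub>tensor_power U n\<^esub> v)
     = diag_sum (Suc n) (Suc k) x \<otimes>\<^bsub>tensor_power U (Suc n)\<^esub> cons_map n a v"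
proof (induction k)
  case 0
  then show ?case using a v lin_zero[OF cons_map_lin[OF a], of n] by (simp add: cons_map_slot)
next
  case (Suc k)
  have e: "diag_sum n (Suc k) x \<otimes>\<^bsub>tensor_power U n\<^esub> v = diag_sum n k x \<otimes>\<^bsub>tensor_power U n\<^esub> v \<oplus>\<^bsub>tensor_power U n\<^esub> slot U n k (j x) \<otimes>\<^bsub>tensor_power U n\<^esub> v"
    using v by (simp add: alg_l_distr)
  have "cons_map n (j x \<otimes>\<^bsub>U\<^esub> a) v \<oplus>\<^bsub>tensor_power U (Suc n)\<^esub> cons_map n a (diag_sum n (Suc k) x \<otimes>\<^bsub>tensor_power U n\<^esub> v)
    = (cons_map n (j x \<otimes>\<^bsub>U\<^esub> a) v \<oplus>\<^bsub>tensor_power U (Suc n)\<^esub> cons_map n a (diag_sum n k x \<otimes>\<^bsub>tensor_power U n\<^esub> v))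
       \<oplus>\<^bsub>tensor_power U (Suc n)\<^esub> slot U (Suc n) (Suc k) (j x) \<otimes>\<^bsub>tensor_power U (Suc n)\<^esub> cons_map n a v"
    unfolding e using a v Suc.prems lin_add[OF cons_map_lin[OF a], of _ n] by (simp add: cons_map_slot(2) vs_assoc)
  also have "\<dots> = diag_sum (Suc n) (Suc (Suc k)) x \<otimes>\<^bsub>tensor_power U (Suc n)\<^esub> cons_map n a v"
    using Suc a v by (simp add: alg_l_distr del: diag_sum.simps(2)) (simp add: alg_l_distr)
  finally show ?case .
qed

abbreviation "icm n \<equiv> iter_comult U' n"

lemma icm_Suc: "icm (Suc n) h = lin_ext (PU (Suc n)) (\<lambda>(a, b). cons_map (Suc n) a (icm n b)) (\<Delta> h)"
  by (simp add: cons_map_def)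

text \<open>The three statements support each other in the induction over \<open>n\<close>.\<close>

lemma icm_props:
  "icm n \<in> linear_maps U (PU n) \<and> icm n \<one>\<^bsub>U\<^esub> = \<one>\<^bsub>PU n\<^esub> \<and>
   (\<forall>x. \<forall>h\<in>carrier U. icm n (j x \<otimes>\<^bsub>U\<^esub> h) = diag_sum (Suc n) (Suc n) x \<otimes>\<^bsub>PU n\<^esub> icm n h)"
proof (induction n)
  case 0
  have "icm 0 = (\<lambda>h. cls (PU 0) ([\<one>\<^bsub>U\<^esub>][0 := h]))" by (rule ext) simp
  then have 1: "icm 0 \<in> linear_maps U (PU 0)"
    using tpow_cls_lin[OF E.vspace_A _ _ _ lin_id, of "[\<one>\<^bsub>U\<^esub>]" 1 0] by simp
  have 2: "icm 0 (j x \<otimes>\<^bsub>U\<^esub> h) = diag_sum (Suc 0) (Suc 0) x \<otimes>\<^bsub>PU 0\<^esub> icm 0 h" if "h \<in> carrier U" for x h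
    using that by (simp add: slot_mult_cls[OF E.alg_A])
  have "icm 0 \<one>\<^bsub>U\<^esub> = \<one>\<^bsub>PU 0\<^esub>" by (simp add: tpow_one[OF E.alg_A])
  with 1 2 show ?case by blast
next
  case (Suc n)
  then have L: "icm n \<in> linear_maps U (PU n)" and o: "icm n \<one>\<^bsub>U\<^esub> = \<one>\<^bsub>PU n\<^esub>"
    and m: "\<And>x h. h \<in> carrier U \<Longrightarrow> icm n (j x \<otimes>\<^bsub>U\<^esub> h) = diag_sum (Suc n) (Suc n) x \<otimes>\<^bsub>PU n\<^esub> icm n h" by auto
  have cl: "icm n h \<in> carrier (PU n)" if "h \<in> carrier U" for h using lin_closed[OF L that] .
  define \<theta> where "\<theta> = lin_ext (PU (Suc n)) (\<lambda>(a, b). cons_map (Suc n) a (icm n b))"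
  have b: "bilin U U (PU (Suc n)) (\<lambda>a b. cons_map (Suc n) a (icm n b))"
    by (intro bilinI lin_comp[OF cons_map_lin] L cons_map_lin_left cl)
  have \<theta>: "\<theta> \<in> linear_maps UU (PU (Suc n))"
    unfolding \<theta>_def using tensor_ext_lin[of U U "PU (Suc n)", OF _ _ _ b lin_id] by simp
  have \<theta>t: "\<theta> (cls UU (a, b)) = cons_map (Suc n) a (icm n b)" if "a \<in> carrier U" "b \<in> carrier U" for a b
    unfolding \<theta>_def using tensor_ext_cls[of U U "PU (Suc n)", OF _ _ _ b that] by simp
  have e: "icm (Suc n) h = \<theta> (\<Delta> h)" for h unfolding \<theta>_def by (rule icm_Suc)
  have 1: "\<theta> (E.d x \<otimes>\<^bsub>UU\<^esub> t) = diag_sum (Suc (Suc n)) (Suc (Suc n)) x \<otimes>\<^bsub>PU (Suc n)\<^esub> \<theta> t" if "t \<in> carrier UU" for x t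
  proof (rule tensor_lin_eq[of U U "PU (Suc n)", OF _ _ _ _ _ _ that])
    show "(\<lambda>t. \<theta> (E.d x \<otimes>\<^bsub>UU\<^esub> t)) \<in> linear_maps UU (PU (Suc n))"
      by (intro lin_comp[OF \<theta>] alg_lin_left lin_id) simp_all
    show "(\<lambda>t. diag_sum (Suc (Suc n)) (Suc (Suc n)) x \<otimes>\<^bsub>PU (Suc n)\<^esub> \<theta> t) \<in> linear_maps UU (PU (Suc n))"
      by (intro alg_lin_left \<theta> diag_sum_closed) simp
    fix a b assume ab: "a \<in> carrier U" "b \<in> carrier U"
    then show "\<theta> (E.d x \<otimes>\<^bsub>UU\<^esub> cls UU (a, b)) = diag_sum (Suc (Suc n)) (Suc (Suc n)) x \<otimes>\<^bsub>PU (Suc n)\<^esub> \<theta> (cls UU (a, b))"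
      using cons_map_diag_sum[OF ab(1) cl[OF ab(2)], of "Suc n" x] by (simp add: E.d_mult_tens lin_add[OF \<theta>] \<theta>t m del: diag_sum.simps)
  qed simp_all
  have lin: "icm (Suc n) \<in> linear_maps U (PU (Suc n))"
    unfolding e[abs_def] by (rule lin_comp[OF \<theta> E.\<rho>_lin])
  have "icm (Suc n) \<one>\<^bsub>U\<^esub> = \<one>\<^bsub>PU (Suc n)\<^esub>"
    unfolding e by (simp add: E.\<rho>_one tens_one \<theta>t o)
      (simp add: tpow_one[OF E.alg_A] cons_map_cls replicate_Suc[of "Suc n"] set_replicate_conv_if del: replicate_Suc)
  then show ?case using lin 1 unfolding e by (simp add: E.\<rho>_\<iota>_mult del: diag_sum.simps)
qed

lemma icm_lin: "icm n \<in> linear_maps U (PU n)"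
  and icm_one: "icm n \<one>\<^bsub>U\<^esub> = \<one>\<^bsub>PU n\<^esub>"
  and icm_j_mult: "h \<in> carrier U \<Longrightarrow> icm n (j x \<otimes>\<^bsub>U\<^esub> h) = diag_sum (Suc n) (Suc n) x \<otimes>\<^bsub>PU n\<^esub> icm n h"
  using icm_props[of n] by auto

lemma icm_closed [simp]: "h \<in> carrier U \<Longrightarrow> icm n h \<in> carrier (PU n)"
  by (rule lin_closed[OF icm_lin])

text \<open>On \<open>m \<otimes> 1 \<otimes> \<dots> \<otimes> 1\<close> the diagonal action telescopes to the adjoint action on \<open>m\<close>.\<close>

lemma uact_diag_sum:
  assumes u: "u \<in> carrier (PU n)" and m: "m \<in> carrier A"
  shows "k \<le> n \<Longrightarrow> uact n (diag_sum (Suc n) k x) (sl n 0 m) = sl n 0 m \<otimes>\<^bsub>PA n\<^esub> sl n k (\<iota> x) \<ominus>\<^bsub>PA n\<^esub> sl n 0 m \<otimes>\<^bsub>PA n\<^esub> sl n 0 (\<iota> x)"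
    and "uact n (diag_sum (Suc n) (Suc n) x) (sl n 0 m) = sl n 0 (ad x m)"
proof -
  have slide: "uact n (slot U (Suc n) k (j x)) (sl n 0 m) = slide n k x (sl n 0 m)" if "k \<le> n" for k
    using uact_slot[of "j x" k n "\<one>\<^bsub>PU n\<^esub>" "sl n 0 m"] that m by (simp add: uact_one slact_j)
  have cl: "sl n 0 m \<in> carrier (PA n)" "sl n k (\<iota> x) \<in> carrier (PA n)" for k using m by simp_all
  show *: "uact n (diag_sum (Suc n) k x) (sl n 0 m) = sl n 0 m \<otimes>\<^bsub>PA n\<^esub> sl n k (\<iota> x) \<ominus>\<^bsub>PA n\<^esub> sl n 0 m \<otimes>\<^bsub>PA n\<^esub> sl n 0 (\<iota> x)" if "k \<le> n" for k
    using that
  proof (induction k)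
    case 0
    then show ?case using cl lin_zero[OF uact_lin[OF cl(1)]] by simp
  next
    case (Suc k)
    have c: "sl n (Suc k) (\<iota> x) \<otimes>\<^bsub>PA n\<^esub> sl n 0 m = sl n 0 m \<otimes>\<^bsub>PA n\<^esub> sl n (Suc k) (\<iota> x)"
      using Suc.prems m by (intro slot_comm[OF alg_A]) auto
    have "uact n (diag_sum (Suc n) (Suc k) x) (sl n 0 m) =
        (sl n 0 m \<otimes>\<^bsub>PA n\<^esub> sl n k (\<iota> x) \<ominus>\<^bsub>PA n\<^esub> sl n 0 m \<otimes>\<^bsub>PA n\<^esub> sl n 0 (\<iota> x)) \<oplus>\<^bsub>PA n\<^esub>
        (sl n 0 m \<otimes>\<^bsub>PA n\<^esub> sl n (Suc k) (\<iota> x) \<ominus>\<^bsub>PA n\<^esub> sl n 0 m \<otimes>\<^bsub>PA n\<^esub> sl n k (\<iota> x))"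
      using Suc m cl by (simp add: lin_add[OF uact_lin[OF cl(1)]] slide) (simp add: slide_def c)
    then show ?case
      using cl vs_lcomm[of "PA n" "\<ominus>\<^bsub>PA n\<^esub> (sl n 0 m \<otimes>\<^bsub>PA n\<^esub> sl n 0 (\<iota> x))" "sl n 0 m \<otimes>\<^bsub>PA n\<^esub> sl n (Suc k) (\<iota> x)" "\<ominus>\<^bsub>PA n\<^esub> (sl n 0 m \<otimes>\<^bsub>PA n\<^esub> sl n k (\<iota> x))"]
        vs_lcomm[of "PA n" "sl n 0 m \<otimes>\<^bsub>PA n\<^esub> sl n k (\<iota> x)" "sl n 0 m \<otimes>\<^bsub>PA n\<^esub> sl n (Suc k) (\<iota> x)"]
        vs_comm[of "PA n" "\<ominus>\<^bsub>PA n\<^esub> (sl n 0 m \<otimes>\<^bsub>PA n\<^esub> sl n 0 (\<iota> x))" "\<ominus>\<^bsub>PA n\<^esub> (sl n 0 m \<otimes>\<^bsub>PA n\<^esub> sl n k (\<iota> x))"]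
      by (simp add: vs_diff_def vs_assoc del: diag_sum.simps)
  qed
  have L: "(\<lambda>a. sl n 0 a) \<in> linear_maps A (PA n)" by (rule slot_lin[OF alg_A _ lin_id]) simp
  have "uact n (diag_sum (Suc n) (Suc n) x) (sl n 0 m) =
      (sl n 0 m \<otimes>\<^bsub>PA n\<^esub> sl n n (\<iota> x) \<ominus>\<^bsub>PA n\<^esub> sl n 0 m \<otimes>\<^bsub>PA n\<^esub> sl n 0 (\<iota> x)) \<oplus>\<^bsub>PA n\<^esub>
      (sl n 0 (\<iota> x) \<otimes>\<^bsub>PA n\<^esub> sl n 0 m \<ominus>\<^bsub>PA n\<^esub> sl n 0 m \<otimes>\<^bsub>PA n\<^esub> sl n n (\<iota> x))"
    using m cl by (simp add: lin_add[OF uact_lin[OF cl(1)]] slide *) (simp add: slide_def)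
  also have "\<dots> = sl n 0 (\<iota> x) \<otimes>\<^bsub>PA n\<^esub> sl n 0 m \<ominus>\<^bsub>PA n\<^esub> sl n 0 m \<otimes>\<^bsub>PA n\<^esub> sl n 0 (\<iota> x)"
    using cl vs_add_diff[of "PA n" "sl n 0 m \<otimes>\<^bsub>PA n\<^esub> sl n n (\<iota> x)" "sl n 0 (\<iota> x) \<otimes>\<^bsub>PA n\<^esub> sl n 0 m \<ominus>\<^bsub>PA n\<^esub> sl n 0 m \<otimes>\<^bsub>PA n\<^esub> sl n 0 (\<iota> x)"]
    by (simp add: vs_diff_def vs_ac)
  also have "\<dots> = sl n 0 (ad x m)"
    using m by (simp add: ad_def lin_diff[OF L] slot_mult_slot[OF alg_A])
  finally show "uact n (diag_sum (Suc n) (Suc n) x) (sl n 0 m) = sl n 0 (ad x m)" .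
qed

lemma uact_icm:
  assumes h: "h \<in> carrier U" and m: "m \<in> carrier A"
  shows "uact n (icm n h) (sl n 0 m) = sl n 0 (act h m)"
proof -
  have L: "(\<lambda>a. sl n 0 a) \<in> linear_maps A (PA n)" by (rule slot_lin[OF alg_A _ lin_id]) simp
  show ?thesis
  proof (rule E.A_lin_eq[OF _ _ _ _ _ h, of "PA n"])
    show "(\<lambda>h. uact n (icm n h) (sl n 0 m)) \<in> linear_maps U (PA n)"
      by (rule lin_comp[OF uact_lin icm_lin]) (simp add: m)
    show "(\<lambda>h. sl n 0 (act h m)) \<in> linear_maps U (PA n)"
      by (rule lin_comp[OF L act_lin[OF m]])
    show "uact n (icm n (j x \<otimes>\<^bsub>U\<^esub> h)) (sl n 0 m) = sl n 0 (act (j x \<otimes>\<^bsub>U\<^esub> h) m)"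
      if "h \<in> carrier U" "uact n (icm n h) (sl n 0 m) = sl n 0 (act h m)" for x h
      using that m by (simp add: icm_j_mult uact_mult act_j_mult uact_diag_sum[of "\<one>\<^bsub>PU n\<^esub>"] del: diag_sum.simps)
  qed (simp_all add: m icm_one uact_one act_one)
qed

end

section \<open>Bijectivity of the comparison map\<close>

lemma lin_image_closed:
  assumes h: "h \<in> linear_maps M N" and M: "vspace M" and N: "vspace N"
  shows "\<zero>\<^bsub>N\<^esub> \<in> h ` carrier M"
    and "\<lbrakk>a \<in> h ` carrier M; b \<in> h ` carrier M\<rbrakk> \<Longrightarrow> a \<oplus>\<^bsub>N\<^esub> b \<in> h ` carrier M"
    and "\<lbrakk>a \<in> h ` carrier M; b \<in> h ` carrier M\<rbrakk> \<Longrightarrow> a \<ominus>\<^bsub>N\<^esub> b \<in> h ` carrier M"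
    and "a \<in> h ` carrier M \<Longrightarrow> c \<odot>\<^bsub>N\<^esub> a \<in> h ` carrier M"
proof -
  show "\<zero>\<^bsub>N\<^esub> \<in> h ` carrier M" using lin_zero[OF h M N] M by (metis image_eqI vs_zero_closed)
  show "a \<oplus>\<^bsub>N\<^esub> b \<in> h ` carrier M" if "a \<in> h ` carrier M" "b \<in> h ` carrier M"
  proof -
    obtain x y where "x \<in> carrier M" "y \<in> carrier M" "a = h x" "b = h y" using \<open>a \<in> h ` carrier M\<close> \<open>b \<in> h ` carrier M\<close> by blast
    then show ?thesis using lin_add[OF h, of x y] M by (intro image_eqI[of _ _ "x \<oplus>\<^bsub>M\<^esub> y"]) simp_all
  qed
  show "a \<ominus>\<^bsub>N\<^esub> b \<in> h ` carrier M" if "a \<in> h ` carrier M" "b \<in> h ` carrier M"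
  proof -
    obtain x y where "x \<in> carrier M" "y \<in> carrier M" "a = h x" "b = h y" using \<open>a \<in> h ` carrier M\<close> \<open>b \<in> h ` carrier M\<close> by blast
    then show ?thesis using lin_diff[OF h M N, of x y] M by (intro image_eqI[of _ _ "x \<ominus>\<^bsub>M\<^esub> y"]) simp_all
  qed
  show "c \<odot>\<^bsub>N\<^esub> a \<in> h ` carrier M" if "a \<in> h ` carrier M"
  proof -
    obtain x where "x \<in> carrier M" "a = h x" using \<open>a \<in> h ` carrier M\<close> by blast
    then show ?thesis using lin_smult[OF h, of x c] M by (intro image_eqI[of _ _ "c \<odot>\<^bsub>M\<^esub> x"]) simp_all
  qed
qed

lemma tpow_induct [consumes 2, case_names zero gen add smult]:
  assumes V: "vspace V" and t: "t \<in> carrier (tensor_power V n)"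
    and zero: "P \<zero>\<^bsub>tensor_power V n\<^esub>"
    and gen: "\<And>xs. \<lbrakk>set xs \<subseteq> carrier V; length xs = n\<rbrakk> \<Longrightarrow> P (cls (tensor_power V n) xs)"
    and add: "\<And>a b. \<lbrakk>a \<in> carrier (tensor_power V n); b \<in> carrier (tensor_power V n); P a; P b\<rbrakk> \<Longrightarrow> P (a \<oplus>\<^bsub>tensor_power V n\<^esub> b)"
    and smult: "\<And>c a. \<lbrakk>a \<in> carrier (tensor_power V n); P a\<rbrakk> \<Longrightarrow> P (c \<odot>\<^bsub>tensor_power V n\<^esub> a)"
  shows "P t"
proof (rule pres_induct[OF wt_sub[OF V tpow_carrier[OF V], of n], folded tpow_wt[OF V], of t P])
  fix x c D assume x: "x \<in> carrier \<lparr>carrier = {xs \<in> lists (carrier V). length xs = n}, monoid.mult = map2 (monoid.mult V), one = replicate n \<one>\<^bsub>V\<^esub>\<rparr>"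
    and D: "D \<in> carrier (tensor_power V n)" "P D"
  then have "set x \<subseteq> carrier V" "length x = n" by (auto simp: lists_eq_set)
  then show "P (c \<odot>\<^bsub>tensor_power V n\<^esub> cls (tensor_power V n) x \<oplus>\<^bsub>tensor_power V n\<^esub> D)"
    using D V by (intro add smult gen) (simp_all add: tpow_closed)
qed (use t zero in simp_all)

context lie_two_cocycle
begin

abbreviation "W n \<equiv> crossed_obj U' A act n"

definition balancing_rels where
  "balancing_rels n = {fgen (u \<otimes>\<^bsub>PU n\<^esub> icm n h, m) - fgen (u, act h m) | u h m.
     u \<in> carrier (PU n) \<and> h \<in> carrier U \<and> m \<in> carrier A}"

lemma W_eq: "W n = pres (PU n \<times>\<times> A) (bilinear_rels (PU n) A \<union> balancing_rels n)"
  by (simp add: crossed_obj_def tensor_over_def balancing_rels_def)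

lemma vspace_PU [simp]: "vspace (tensor_power U n)"
  and vspace_PA [simp]: "vspace (tensor_power A n)"
  by (simp_all add: vspace_tpow)

lemma balancing_rels_sub: "balancing_rels n \<subseteq> carrier (monoid_algebra (PU n \<times>\<times> A))"
proof
  fix r assume "r \<in> balancing_rels n"
  then obtain u h m where r: "r = fgen (u \<otimes>\<^bsub>PU n\<^esub> icm n h, m) - fgen (u, act h m)"
    and *: "u \<in> carrier (PU n)" "h \<in> carrier U" "m \<in> carrier A" unfolding balancing_rels_def by blast
  show "r \<in> carrier (monoid_algebra (PU n \<times>\<times> A))"
    unfolding r monoid_algebra_simps mem_Collect_eq
    by (rule order_trans[OF keys_diff2]) (use * in \<open>simp add: DirProd_carrier\<close>)
qed

lemmas W_args = vspace_PU[of "Suc n" for n] vspace_A balancing_rels_sub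

lemma vspace_W [simp]: "vspace (W n)"
  unfolding W_eq by (rule vspace_bt[OF W_args])

lemma W_closed [simp]: "\<lbrakk>u \<in> carrier (PU n); m \<in> carrier A\<rbrakk> \<Longrightarrow> cls (W n) (u, m) \<in> carrier (W n)"
  unfolding W_eq by (rule bt_closed[OF W_args])

lemma W_bilin: "bilin (PU n) A (W n) (\<lambda>u m. cls (W n) (u, m))"
  unfolding W_eq by (rule bt_bilin[OF W_args])

lemma W_lin_left: "\<lbrakk>m \<in> carrier A; g \<in> linear_maps Q (PU n)\<rbrakk> \<Longrightarrow> (\<lambda>q. cls (W n) (g q, m)) \<in> linear_maps Q (W n)"
  by (rule lin_comp[OF bilin_linD(2)[OF W_bilin]])

lemma W_lin_right: "\<lbrakk>u \<in> carrier (PU n); g \<in> linear_maps Q A\<rbrakk> \<Longrightarrow> (\<lambda>q. cls (W n) (u, g q)) \<in> linear_maps Q (W n)"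
  by (rule lin_comp[OF bilin_linD(1)[OF W_bilin]])

lemma W_balanced:
  assumes "u \<in> carrier (PU n)" "h \<in> carrier U" "m \<in> carrier A"
  shows "cls (W n) (u \<otimes>\<^bsub>PU n\<^esub> icm n h, m) = cls (W n) (u, act h m)"
  unfolding W_eq
proof (rule pres_rel_eq[OF bt_sub[OF W_args]])
  show "fgen (u \<otimes>\<^bsub>PU n\<^esub> icm n h, m) - fgen (u, act h m) \<in> bilinear_rels (PU n) A \<union> balancing_rels n"
    using assms unfolding balancing_rels_def by blast
qed (use assms in \<open>simp_all add: DirProd_carrier\<close>)

lemmas W_induct [consumes 1, case_names gen add] = bt_induct[OF W_args, folded W_eq]

text \<open>The comparison map lets \<open>(h\<^sup>0, \<dots>, h\<^sup>n)\<close> act on \<open>m \<otimes> 1 \<otimes> \<dots> \<otimes> 1\<close>. It respects the balancing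
  relations because \<open>uact\<close> is multiplicative and, by telescoping, the diagonal action on
  \<open>m \<otimes> 1 \<otimes> \<dots> \<otimes> 1\<close> is the adjoint action on \<open>m\<close>.\<close>

definition \<psi> where "\<psi> n = lin_ext (PA n) (\<lambda>(u, m). uact n u (sl n 0 m))"

lemma sl_lin: "i \<le> n \<Longrightarrow> (\<lambda>a. sl n i a) \<in> linear_maps A (PA n)"
  by (rule slot_lin[OF alg_A _ lin_id]) simp

lemma uact_bilin: "bilin (PU n) A (PA n) (\<lambda>u m. uact n u (sl n 0 m))"
  by (intro bilinI uact_lin lin_comp[OF uact_lin_right sl_lin]) simp_all

lemma uact_balanced:
  assumes "r \<in> balancing_rels n"
  shows "free_ext (PA n) (\<lambda>(u, m). uact n u (sl n 0 m)) r = \<zero>\<^bsub>PA n\<^esub>"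
proof -
  obtain u h m where r: "r = fgen (u \<otimes>\<^bsub>PU n\<^esub> icm n h, m) - fgen (u, act h m)"
    and *: "u \<in> carrier (PU n)" "h \<in> carrier U" "m \<in> carrier A" using assms unfolding balancing_rels_def by blast
  show ?thesis unfolding r
    by (rule free_ext_diff2[of "PA n" "PU n \<times>\<times> A"]) (use * in \<open>auto simp: DirProd_carrier DirProd_def uact_mult uact_icm\<close>)
qed

lemma \<psi>_lin: "\<psi> n \<in> linear_maps (W n) (PA n)"
  unfolding \<psi>_def W_eq by (rule bt_ext(1)[OF W_args vspace_PA uact_bilin uact_balanced])

lemma \<psi>_cls: "\<lbrakk>u \<in> carrier (PU n); m \<in> carrier A\<rbrakk> \<Longrightarrow> \<psi> n (cls (W n) (u, m)) = uact n u (sl n 0 m)"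
  unfolding \<psi>_def W_eq by (rule bt_ext(2)[OF W_args vspace_PA uact_bilin uact_balanced])

text \<open>The range is a module under all slides, since \<open>slide n k x\<close> corresponds to multiplication by
  \<open>x\<close> in slot \<open>k\<close> of the tensor power of the enveloping algebra.\<close>

lemma \<psi>_range_slide:
  assumes "t \<in> \<psi> n ` carrier (W n)" "k \<le> n"
  shows "slide n k x t \<in> \<psi> n ` carrier (W n)"
proof -
  note ran = lin_image_closed[OF \<psi>_lin[of n] vspace_W vspace_PA]
  obtain w where w: "w \<in> carrier (W n)" "t = \<psi> n w" using assms by blast
  from w(1) have "slide n k x (\<psi> n w) \<in> \<psi> n ` carrier (W n)"
  proof (induction w rule: W_induct)
    case (gen u m)
    have "slide n k x (\<psi> n (cls (W n) (u, m))) = \<psi> n (cls (W n) (slot U (Suc n) k (j x) \<otimes>\<^bsub>PU n\<^esub> u, m))"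
      using gen assms(2) by (simp add: \<psi>_cls uact_slot slact_j)
    then show ?case using gen by simp
  next
    case (add s t)
    then show ?case using assms(2) ran(2) by (simp add: lin_add[OF \<psi>_lin] lin_add[OF slide_lin] lin_closed[OF \<psi>_lin])
  qed
  then show ?thesis using w by simp
qed

text \<open>Tensors whose factors after the one in slot \<open>k\<close> are units are reached by induction on \<open>k\<close>. The last
  proper factor \<open>b\<close> is dismantled from the left: modulo the slide of \<open>x\<close> from slot \<open>k\<close> to slot
  \<open>k + 1\<close>, a first letter \<open>x\<close> of \<open>b\<close> may be moved to the end of the preceding factor.\<close>

lemma \<psi>_surj_aux:
  assumes "set as \<subseteq> carrier A" "length as = Suc k" "k \<le> n"
  shows "cls (PA n) (as @ replicate (n - k) \<one>\<^bsub>A\<^esub>) \<in> \<psi> n ` carrier (W n)"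
  using assms
proof (induction k arbitrary: as)
  case 0
  then obtain a where a: "as = [a]" "a \<in> carrier A" by (cases as) auto
  have "cls (PA n) (a # replicate n \<one>\<^bsub>A\<^esub>) = \<psi> n (cls (W n) (\<one>\<^bsub>PU n\<^esub>, a))"
    using a by (simp add: \<psi>_cls uact_one) (simp add: slot_def)
  then show ?case using a by simp
next
  case (Suc k)
  note ran = lin_image_closed[OF \<psi>_lin[of n] vspace_W vspace_PA]
  define R where "R = replicate (n - Suc k) \<one>\<^bsub>A\<^esub>"
  have R: "set R \<subseteq> carrier A" "length R = n - Suc k" by (auto simp: R_def)
  have kR: "replicate (n - k) \<one>\<^bsub>A\<^esub> = \<one>\<^bsub>A\<^esub> # R"
    using Suc.prems by (simp add: R_def Suc_diff_Suc flip: replicate_Suc)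
  have L: "(\<lambda>b. cls (PA n) (bs @ b # R)) \<in> linear_maps A (PA n)"
    if "set bs \<subseteq> carrier A" "length bs = Suc k" for bs
    using tpow_cls_lin[OF vspace_A _ _ _ lin_id, of "bs @ \<one>\<^bsub>A\<^esub> # R" "Suc n" "Suc k"] that R Suc.prems
    by (simp add: list_update_append)
  have *: "cls (PA n) (bs @ b # R) \<in> \<psi> n ` carrier (W n)"
    if b: "b \<in> carrier A" and bs: "set bs \<subseteq> carrier A" "length bs = Suc k" for b bs
    using b bs
  proof (induction b arbitrary: bs rule: A_induct)
    case one
    then show ?case using Suc.IH[of bs] Suc.prems by (simp add: kR)
  next
    case (mult x b)
    have bk: "bs ! k \<in> carrier A" using mult.prems by (auto simp: subset_iff)
    define bs' where "bs' = bs[k := bs ! k \<otimes>\<^bsub>A\<^esub> \<iota> x]"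
    have bs': "set bs' \<subseteq> carrier A" "length bs' = Suc k"
      using set_list_update_subset[of bs "carrier A"] mult.prems bk unfolding bs'_def by simp_all
    have cl: "set (bs @ b # R) \<subseteq> carrier A" "length (bs @ b # R) = Suc n"
      using mult R Suc.prems by auto
    have 1: "sl n (Suc k) (\<iota> x) \<otimes>\<^bsub>PA n\<^esub> cls (PA n) (bs @ b # R) = cls (PA n) (bs @ (\<iota> x \<otimes>\<^bsub>A\<^esub> b) # R)"
      using slot_mult_cls(1)[OF alg_A _ cl, of "\<iota> x" "Suc k"] mult.prems Suc.prems by (simp add: list_update_append nth_append)
    have 2: "cls (PA n) (bs @ b # R) \<otimes>\<^bsub>PA n\<^esub> sl n k (\<iota> x) = cls (PA n) (bs' @ b # R)"
      using slot_mult_cls(2)[OF alg_A _ cl, of "\<iota> x" k] mult.prems Suc.prems by (simp add: list_update_append nth_append bs'_def)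
    have c3: "cls (PA n) (bs' @ b # R) \<in> carrier (PA n)" "cls (PA n) (bs @ (\<iota> x \<otimes>\<^bsub>A\<^esub> b) # R) \<in> carrier (PA n)"
      using lin_closed[OF L] bs' mult by simp_all
    have e: "slide n k x (cls (PA n) (bs @ b # R)) = cls (PA n) (bs @ (\<iota> x \<otimes>\<^bsub>A\<^esub> b) # R) \<ominus>\<^bsub>PA n\<^esub> cls (PA n) (bs' @ b # R)"
      using Suc.prems by (simp add: slide_def 1 2)
    have "cls (PA n) (bs @ (\<iota> x \<otimes>\<^bsub>A\<^esub> b) # R) = cls (PA n) (bs' @ b # R) \<oplus>\<^bsub>PA n\<^esub> slide n k x (cls (PA n) (bs @ b # R))"
      unfolding e using c3 by (simp add: vs_add_diff)
    then show ?case
      using ran(2)[OF mult.IH[OF bs'] \<psi>_range_slide[OF mult.IH[OF mult.prems], of k x]] Suc.prems by simp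
  next
    case (add a b)
    then show ?case using ran(2) by (simp add: lin_add[OF L])
  next
    case (smult c a)
    then show ?case using ran(4) by (simp add: lin_smult[OF L])
  qed
  obtain bs b where as: "as = bs @ [b]" "length bs = Suc k"
    using Suc.prems(2) by (metis length_Suc_conv_rev)
  then show ?case using *[of b bs] Suc.prems by (simp add: R_def)
qed

lemma \<psi>_surj: "\<psi> n ` carrier (W n) = carrier (PA n)"
proof
  show "\<psi> n ` carrier (W n) \<subseteq> carrier (PA n)" using lin_closed[OF \<psi>_lin] by auto
  note ran = lin_image_closed[OF \<psi>_lin[of n] vspace_W vspace_PA]
  show "carrier (PA n) \<subseteq> \<psi> n ` carrier (W n)"
  proof
    fix t assume t: "t \<in> carrier (PA n)"
    show "t \<in> \<psi> n ` carrier (W n)"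
      using vspace_A t
      by (induction t rule: tpow_induct) (use ran \<psi>_surj_aux[of _ n n] in simp_all)
  qed
qed

end

context lie_two_cocycle
begin

subsection \<open>Normal forms in the balanced tensor product\<close>

abbreviation "VU n \<equiv> tensor (tensor_power U n) A"

text \<open>In the balanced tensor product every element can be brought into a form with last entry one, so
  that it comes from \<open>U\<^sup>\<otimes>\<^sup>n \<otimes> A\<close>.\<close>

definition append_one where
  "append_one n v = lin_ext (PU n) (\<lambda>hs. cls (PU n) (hs @ [\<one>\<^bsub>U\<^esub>])) v"

lemma append_one_multilin: "multilin U n (PU n) (\<lambda>hs. cls (PU n) (hs @ [\<one>\<^bsub>U\<^esub>]))"
proof (rule multilinI)
  fix hs i assume *: "set hs \<subseteq> carrier U" "length hs = n" "i < n"
  show "(\<lambda>h. cls (PU n) (hs[i := h] @ [\<one>\<^bsub>U\<^esub>])) \<in> linear_maps U (PU n)"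
    using tpow_cls_lin[OF E.vspace_A _ _ _ lin_id, of "hs @ [\<one>\<^bsub>U\<^esub>]" "Suc n" i] * by (simp add: list_update_append)
qed (simp add: tpow_closed)

lemma append_one_lin: "append_one n \<in> linear_maps (tensor_power U n) (PU n)"
  unfolding append_one_def[abs_def] using tpow_ext_lin[OF E.vspace_A _ append_one_multilin lin_id] by simp

lemma append_one_cls: "\<lbrakk>set hs \<subseteq> carrier U; length hs = n\<rbrakk> \<Longrightarrow> append_one n (cls (tensor_power U n) hs) = cls (PU n) (hs @ [\<one>\<^bsub>U\<^esub>])"
  unfolding append_one_def by (rule tpow_ext_cls[OF E.vspace_A _ append_one_multilin]) simp_all

lemma append_one_closed [simp]: "v \<in> carrier (tensor_power U n) \<Longrightarrow> append_one n v \<in> carrier (PU n)"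
  by (rule lin_closed[OF append_one_lin])

definition normal_form where "normal_form n = lin_ext (W n) (\<lambda>(v, m). cls (W n) (append_one n v, m))"

lemma normal_form_bilin: "bilin (tensor_power U n) A (W n) (\<lambda>v m. cls (W n) (append_one n v, m))"
  by (intro bilinI W_lin_left W_lin_right append_one_lin lin_id append_one_closed)

lemma normal_form_lin: "normal_form n \<in> linear_maps (VU n) (W n)"
  unfolding normal_form_def using tensor_ext_lin[of "tensor_power U n" A "W n", OF _ _ _ normal_form_bilin lin_id] by simp

lemma normal_form_cls: "\<lbrakk>v \<in> carrier (tensor_power U n); m \<in> carrier A\<rbrakk> \<Longrightarrow> normal_form n (cls (VU n) (v, m)) = cls (W n) (append_one n v, m)"
  unfolding normal_form_def using tensor_ext_cls[of "tensor_power U n" A "W n", OF _ _ _ normal_form_bilin] by simp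

text \<open>Induction on the last entry, from the right. By the balancing relation, multiplying
  \<open>(h\<^sup>0, \<dots>, h\<^sup>n)\<close> on the right by \<open>x\<close> in every slot amounts to the action of \<open>x\<close> on \<open>m\<close>; hence a factor
  \<open>x\<close> in the last slot can be traded for factors in the other slots and for a change of \<open>m\<close>.\<close>

lemma normal_form_surj_aux:
  assumes "h \<in> carrier U" "set hs \<subseteq> carrier U" "length hs = n" "m \<in> carrier A"
  shows "cls (W n) (cls (PU n) (hs @ [h]), m) \<in> normal_form n ` carrier (VU n)"
proof -
  have VU: "vspace (VU n)" by simp
  note ran = lin_image_closed[OF normal_form_lin[of n] VU vspace_W]
  have L: "(\<lambda>h. cls (PU n) (hs @ [h])) \<in> linear_maps U (PU n)"
    if "set hs \<subseteq> carrier U" "length hs = n" for hs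
    using tpow_cls_lin[OF E.vspace_A _ _ _ lin_id, of "hs @ [\<one>\<^bsub>U\<^esub>]" "Suc n" n] that
    by (simp add: list_update_append)
  show ?thesis
    using assms
  proof (induction h arbitrary: hs m rule: E.A_induct_right)
    case one
    then have "cls (W n) (cls (PU n) (hs @ [\<one>\<^bsub>U\<^esub>]), m) = normal_form n (cls (VU n) (cls (tensor_power U n) hs, m))"
      by (simp add: normal_form_cls tpow_closed append_one_cls)
    then show ?case using one by (simp add: tpow_closed)
  next
    case (mult x h)
    define u where "u = cls (PU n) (hs @ [h])"
    have cl: "set (hs @ [h]) \<subseteq> carrier U" "length (hs @ [h]) = Suc n" using mult by auto
    then have u: "u \<in> carrier (PU n)" unfolding u_def by (intro tpow_closed) simp_all
    have d: "cls (W n) (u \<otimes>\<^bsub>PU n\<^esub> diag_sum (Suc n) k x, m) \<in> normal_form n ` carrier (VU n)" if "k \<le> n" for k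
      using that
    proof (induction k)
      case 0
      then show ?case
        using ran(1) lin_zero[OF W_lin_left[OF mult.prems(3) lin_id], of n] u by simp
    next
      case (Suc k)
      have hk: "hs ! k \<in> carrier U" using Suc.prems mult.prems by (auto simp: subset_iff)
      have e: "u \<otimes>\<^bsub>PU n\<^esub> slot U (Suc n) k (j x) = cls (PU n) (hs[k := hs ! k \<otimes>\<^bsub>U\<^esub> j x] @ [h])"
        using slot_mult_cls(2)[OF E.alg_A _ cl, of "j x" k] Suc.prems mult.prems
        by (simp add: u_def list_update_append nth_append)
      have "cls (W n) (u \<otimes>\<^bsub>PU n\<^esub> slot U (Suc n) k (j x), m) \<in> normal_form n ` carrier (VU n)"
        unfolding e using hk mult.prems set_list_update_subset[of hs "carrier U"] by (intro mult.IH) simp_all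
      then show ?case
        using Suc u mult.prems ran(2)
        by (simp add: alg_r_distr lin_add[OF W_lin_left[OF mult.prems(3) lin_id]])
    qed
    have s: "u \<otimes>\<^bsub>PU n\<^esub> slot U (Suc n) n (j x) = cls (PU n) (hs @ [h \<otimes>\<^bsub>U\<^esub> j x])"
      using slot_mult_cls(2)[OF E.alg_A _ cl, of "j x" n] mult.prems
      by (simp add: u_def list_update_append nth_append)
    have "icm n (j x) = diag_sum (Suc n) (Suc n) x"
      using icm_j_mult[of "\<one>\<^bsub>U\<^esub>" n x] by (simp add: icm_one del: diag_sum.simps)
    then have "cls (W n) (u \<otimes>\<^bsub>PU n\<^esub> diag_sum (Suc n) (Suc n) x, m) = cls (W n) (u, act (j x) m)"
      using W_balanced[of u n "j x" m] u mult.prems by (simp del: diag_sum.simps)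
    then have e: "cls (W n) (u \<otimes>\<^bsub>PU n\<^esub> diag_sum (Suc n) n x, m) \<oplus>\<^bsub>W n\<^esub> cls (W n) (cls (PU n) (hs @ [h \<otimes>\<^bsub>U\<^esub> j x]), m)
        = cls (W n) (u, act (j x) m)"
      using u mult.prems s[symmetric] by (simp add: alg_r_distr lin_add[OF W_lin_left[OF mult.prems(3) lin_id]])
    have "cls (W n) (u, act (j x) m) \<in> normal_form n ` carrier (VU n)"
      unfolding u_def using mult.prems by (intro mult.IH) simp_all
    moreover have "a = (b \<oplus>\<^bsub>W n\<^esub> a) \<ominus>\<^bsub>W n\<^esub> b" if "a \<in> carrier (W n)" "b \<in> carrier (W n)" for a b
      using that by (simp add: vs_diff_def vs_ac)
    moreover have "cls (W n) (u \<otimes>\<^bsub>PU n\<^esub> diag_sum (Suc n) n x, m) \<in> carrier (W n)"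
      "cls (W n) (cls (PU n) (hs @ [h \<otimes>\<^bsub>U\<^esub> j x]), m) \<in> carrier (W n)"
      using u mult.prems s[symmetric] by simp_all
    ultimately show ?case using ran(3)[OF _ d[of n]] e by (metis order_refl)
  next
    case (add a b)
    then show ?case using ran(2) lin_closed[OF L]
      by (simp add: lin_add[OF L] lin_add[OF W_lin_left[OF _ lin_id]])
  next
    case (smult c a)
    then show ?case using ran(4) lin_closed[OF L]
      by (simp add: lin_smult[OF L] lin_smult[OF W_lin_left[OF _ lin_id]])
  qed
qed

lemma normal_form_surj:
  assumes "w \<in> carrier (W n)"
  shows "w \<in> normal_form n ` carrier (VU n)"
proof -
  have VU: "vspace (VU n)" by simp
  note ran = lin_image_closed[OF normal_form_lin[of n] VU vspace_W]
  show ?thesis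
    using assms
  proof (induction w rule: W_induct)
    case (gen u m)
    note L = W_lin_left[OF gen(2) lin_id, of n]
    show ?case
      using E.vspace_A gen(1)
    proof (induction u rule: tpow_induct)
      case zero
      then show ?case using ran(1) lin_zero[OF L] by simp
    next
      case (gen hs)
      obtain gs h where hs: "hs = gs @ [h]" "length gs = n" using gen by (metis length_Suc_conv_rev)
      then show ?case using normal_form_surj_aux[of h gs n m] gen(1) \<open>m \<in> carrier A\<close> by simp
    qed (use ran(2,4) in \<open>simp_all add: lin_add[OF L] lin_smult[OF L]\<close>)
  qed (use ran(2) in simp_all)
qed

subsection \<open>The inverse\<close>

text \<open>For each slot \<open>k\<close> the generators satisfy the relations of \<open>A\<close> inside the algebra \<open>U\<^sup>\<otimes>\<^sup>n \<otimes> A\<close> if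
  \<open>x\<close> is sent to its image in \<open>A\<close> plus its images in the slots before \<open>k\<close>. The choice is forced by the
  requirement that sliding \<open>x\<close> from slot \<open>k\<close> to slot \<open>k + 1\<close> should become multiplication by \<open>x\<close> in
  slot \<open>k\<close> of \<open>U\<^sup>\<otimes>\<^sup>n\<close>: it must be the difference of the two images.\<close>

definition gen_hom where
  "gen_hom n k x = cls (VU n) (diag_sum n k x, \<one>\<^bsub>A\<^esub>) \<oplus>\<^bsub>VU n\<^esub> cls (VU n) (\<one>\<^bsub>tensor_power U n\<^esub>, \<iota> x)"

lemma gen_hom_closed [simp]: "gen_hom n k x \<in> carrier (VU n)"
  by (simp add: gen_hom_def)

lemma gen_hom_lin: "k \<le> n \<Longrightarrow> gen_hom n k \<in> linear_maps V (VU n)"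
  unfolding gen_hom_def[abs_def] by (intro lin_add_map tens_lin_left tens_lin_right diag_sum_lin \<iota>_lin) simp_all

lemma gen_hom_rel:
  assumes "k \<le> n"
  shows "gen_hom n k x \<otimes>\<^bsub>VU n\<^esub> gen_hom n k y = gen_hom n k y \<otimes>\<^bsub>VU n\<^esub> gen_hom n k x \<oplus>\<^bsub>VU n\<^esub> (gen_hom n k (br x y) \<oplus>\<^bsub>VU n\<^esub> f x y \<odot>\<^bsub>VU n\<^esub> \<one>\<^bsub>VU n\<^esub>)"
proof -
  have e: "gen_hom n k x \<otimes>\<^bsub>VU n\<^esub> gen_hom n k y = (cls (VU n) (diag_sum n k x \<otimes>\<^bsub>tensor_power U n\<^esub> diag_sum n k y, \<one>\<^bsub>A\<^esub>) \<oplus>\<^bsub>VU n\<^esub> cls (VU n) (diag_sum n k y, \<iota> x)) \<oplus>\<^bsub>VU n\<^esub>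
      (cls (VU n) (diag_sum n k x, \<iota> y) \<oplus>\<^bsub>VU n\<^esub> cls (VU n) (\<one>\<^bsub>tensor_power U n\<^esub>, \<iota> x \<otimes>\<^bsub>A\<^esub> \<iota> y))" for x y
    by (simp add: gen_hom_def alg_r_distr alg_l_distr tens_mult vs_ac)
  show ?thesis
    unfolding e[of x y] e[of y x] \<iota>_rel[of x y] diag_sum_rel[OF assms, of x y] gen_hom_def[of n k "br x y"]
    by (simp add: tens_add_left tens_add_right tens_smult_right tens_one vs_ac)
qed

definition slot_hom where "slot_hom n k a = eact (VU n) (\<lambda>x t. gen_hom n k x \<otimes>\<^bsub>VU n\<^esub> t) a \<one>\<^bsub>VU n\<^esub>"

lemma lierep_gen_hom: "k \<le> n \<Longrightarrow> lierep (VU n) (\<lambda>x t. gen_hom n k x \<otimes>\<^bsub>VU n\<^esub> t)"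
  by (rule lierep_mult[OF _ gen_hom_lin gen_hom_rel]) simp_all

context
  fixes n k :: nat assumes k: "k \<le> n"
begin

lemma slot_hom_lin: "slot_hom n k \<in> linear_maps A (VU n)"
  unfolding slot_hom_def[abs_def] by (rule eact_lin[OF lierep_gen_hom[OF k]]) simp

lemma slot_hom_closed [simp]: "a \<in> carrier A \<Longrightarrow> slot_hom n k a \<in> carrier (VU n)"
  by (rule lin_closed[OF slot_hom_lin])

lemma slot_hom_one: "slot_hom n k \<one>\<^bsub>A\<^esub> = \<one>\<^bsub>VU n\<^esub>"
  unfolding slot_hom_def by (rule eact_one[OF lierep_gen_hom[OF k]]) simp

lemma slot_hom_\<iota>_mult: "a \<in> carrier A \<Longrightarrow> slot_hom n k (\<iota> x \<otimes>\<^bsub>A\<^esub> a) = gen_hom n k x \<otimes>\<^bsub>VU n\<^esub> slot_hom n k a"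
  unfolding slot_hom_def by (rule eact_\<iota>_mult[OF lierep_gen_hom[OF k]]) simp_all

lemma slot_hom_mult_\<iota>: 
  assumes a: "a \<in> carrier A"
  shows "slot_hom n k (a \<otimes>\<^bsub>A\<^esub> \<iota> x) = slot_hom n k a \<otimes>\<^bsub>VU n\<^esub> gen_hom n k x"
proof (rule A_lin_eq[OF _ _ _ _ _ a, of "VU n"])
  show "(\<lambda>a. slot_hom n k (a \<otimes>\<^bsub>A\<^esub> \<iota> x)) \<in> linear_maps A (VU n)"
    by (intro lin_comp[OF slot_hom_lin] alg_lin_right lin_id) simp_all
  show "(\<lambda>a. slot_hom n k a \<otimes>\<^bsub>VU n\<^esub> gen_hom n k x) \<in> linear_maps A (VU n)"
    by (intro alg_lin_right slot_hom_lin) simp_all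
  show "slot_hom n k (\<one>\<^bsub>A\<^esub> \<otimes>\<^bsub>A\<^esub> \<iota> x) = slot_hom n k \<one>\<^bsub>A\<^esub> \<otimes>\<^bsub>VU n\<^esub> gen_hom n k x"
    using slot_hom_\<iota>_mult[of "\<one>\<^bsub>A\<^esub>" x] by (simp add: slot_hom_one)
qed (simp_all add: alg_assoc slot_hom_\<iota>_mult)

text \<open>The image of \<open>A\<close> for slot \<open>k\<close> involves only the slots of \<open>U\<^sup>\<otimes>\<^sup>n\<close> before \<open>k\<close>.\<close>

lemma slot_hom_commute:
  assumes i: "k \<le> i" "i < n" and h: "h \<in> carrier U" and a: "a \<in> carrier A"
  shows "cls (VU n) (slot U n i h, \<one>\<^bsub>A\<^esub>) \<otimes>\<^bsub>VU n\<^esub> slot_hom n k a = slot_hom n k a \<otimes>\<^bsub>VU n\<^esub> cls (VU n) (slot U n i h, \<one>\<^bsub>A\<^esub>)" (is "?s \<otimes>\<^bsub>VU n\<^esub> _ = _")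
proof (rule A_lin_eq[OF _ _ _ _ _ a, of "VU n"])
  have s: "?s \<in> carrier (VU n)" using h by simp
  show "(\<lambda>a. ?s \<otimes>\<^bsub>VU n\<^esub> slot_hom n k a) \<in> linear_maps A (VU n)" "(\<lambda>a. slot_hom n k a \<otimes>\<^bsub>VU n\<^esub> ?s) \<in> linear_maps A (VU n)"
    by (intro alg_lin_left alg_lin_right slot_hom_lin s; simp)+
  show "?s \<otimes>\<^bsub>VU n\<^esub> slot_hom n k \<one>\<^bsub>A\<^esub> = slot_hom n k \<one>\<^bsub>A\<^esub> \<otimes>\<^bsub>VU n\<^esub> ?s" using s by (simp add: slot_hom_one)
  fix x a assume a: "a \<in> carrier A" and IH: "?s \<otimes>\<^bsub>VU n\<^esub> slot_hom n k a = slot_hom n k a \<otimes>\<^bsub>VU n\<^esub> ?s"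
  have "?s \<otimes>\<^bsub>VU n\<^esub> gen_hom n k x = gen_hom n k x \<otimes>\<^bsub>VU n\<^esub> ?s"
    using h diag_sum_slot_commute[OF i h, of x] by (simp add: gen_hom_def alg_l_distr alg_r_distr tens_mult)
  then have "?s \<otimes>\<^bsub>VU n\<^esub> (gen_hom n k x \<otimes>\<^bsub>VU n\<^esub> slot_hom n k a) = gen_hom n k x \<otimes>\<^bsub>VU n\<^esub> (?s \<otimes>\<^bsub>VU n\<^esub> slot_hom n k a)"
    using s a by (simp flip: alg_assoc)
  then show "?s \<otimes>\<^bsub>VU n\<^esub> slot_hom n k (\<iota> x \<otimes>\<^bsub>A\<^esub> a) = slot_hom n k (\<iota> x \<otimes>\<^bsub>A\<^esub> a) \<otimes>\<^bsub>VU n\<^esub> ?s"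
    using s a IH by (simp add: slot_hom_\<iota>_mult alg_assoc)
qed simp

end

lemma slot_hom_0: "a \<in> carrier A \<Longrightarrow> slot_hom n 0 a = cls (VU n) (\<one>\<^bsub>tensor_power U n\<^esub>, a)"
proof (rule A_lin_eq[OF _ slot_hom_lin[OF le0] tens_lin_right[OF _ _ _ lin_id]])
  fix x a assume "a \<in> carrier A" "slot_hom n 0 a = cls (VU n) (\<one>\<^bsub>tensor_power U n\<^esub>, a)"
  then show "slot_hom n 0 (\<iota> x \<otimes>\<^bsub>A\<^esub> a) = cls (VU n) (\<one>\<^bsub>tensor_power U n\<^esub>, \<iota> x \<otimes>\<^bsub>A\<^esub> a)"
    using lin_zero[OF tens_lin_left[of "tensor_power U n" A a, OF _ _ _ lin_id]]
    by (simp add: slot_hom_\<iota>_mult gen_hom_def alg_l_distr tens_mult)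
qed (simp_all add: slot_hom_one tens_one)

primrec word_hom where
  "word_hom n k [] = \<one>\<^bsub>VU n\<^esub>"
| "word_hom n k (a # as) = slot_hom n k a \<otimes>\<^bsub>VU n\<^esub> word_hom n (Suc k) as"

lemma word_hom_closed [simp]: "\<lbrakk>set as \<subseteq> carrier A; k + length as \<le> Suc n\<rbrakk> \<Longrightarrow> word_hom n k as \<in> carrier (VU n)"
  by (induction as arbitrary: k) simp_all

lemma word_hom_append: "\<lbrakk>set as \<subseteq> carrier A; set bs \<subseteq> carrier A; k + length as + length bs \<le> Suc n\<rbrakk> \<Longrightarrow>
    word_hom n k (as @ bs) = word_hom n k as \<otimes>\<^bsub>VU n\<^esub> word_hom n (k + length as) bs"
  by (induction as arbitrary: k) (simp_all add: alg_assoc)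

lemma word_hom_multilin_aux:
  "\<lbrakk>set as \<subseteq> carrier A; k + length as \<le> Suc n; i < length as\<rbrakk> \<Longrightarrow> (\<lambda>a. word_hom n k (as[i := a])) \<in> linear_maps A (VU n)"
proof (induction as arbitrary: k i)
  case (Cons b as)
  show ?case
  proof (cases i)
    case 0
    then show ?thesis using Cons.prems alg_lin_right[OF _ _ slot_hom_lin[of k n], of "word_hom n (Suc k) as"] by simp
  next
    case (Suc i')
    then show ?thesis using Cons.prems Cons.IH[of "Suc k" i'] by (auto intro!: alg_lin_left)
  qed
qed simp

lemma word_hom_multilin: "multilin A (Suc n) (VU n) (word_hom n 0)"
  by (rule multilinI) (simp_all add: word_hom_multilin_aux)

lemma word_hom_commute:
  assumes "i < n" "h \<in> carrier U" "set as \<subseteq> carrier A" "k + length as \<le> Suc i"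
  shows "cls (VU n) (slot U n i h, \<one>\<^bsub>A\<^esub>) \<otimes>\<^bsub>VU n\<^esub> word_hom n k as = word_hom n k as \<otimes>\<^bsub>VU n\<^esub> cls (VU n) (slot U n i h, \<one>\<^bsub>A\<^esub>)"
  using assms(3,4)
proof (induction as arbitrary: k)
  case Nil
  then show ?case using assms(2) by simp
next
  case (Cons a as)
  let ?s = "cls (VU n) (slot U n i h, \<one>\<^bsub>A\<^esub>)"
  have s: "?s \<in> carrier (VU n)" using assms(2) by simp
  have c: "slot_hom n k a \<in> carrier (VU n)" "word_hom n (Suc k) as \<in> carrier (VU n)" using Cons.prems assms by simp_all
  have "?s \<otimes>\<^bsub>VU n\<^esub> (slot_hom n k a \<otimes>\<^bsub>VU n\<^esub> word_hom n (Suc k) as) = slot_hom n k a \<otimes>\<^bsub>VU n\<^esub> (?s \<otimes>\<^bsub>VU n\<^esub> word_hom n (Suc k) as)"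
    using slot_hom_commute[of k n i h a] s c Cons.prems assms by (simp flip: alg_assoc)
  then show ?case using Cons s c by (simp add: alg_assoc)
qed

text \<open>A left inverse of the comparison map on normal forms: \<open>a\<^sub>0 \<otimes> \<dots> \<otimes> a\<^sub>n\<close> is sent to the product of the
  images of its factors for the successive slots.\<close>

definition unwind where "unwind n = lin_ext (VU n) (word_hom n 0)"

lemma unwind_lin: "unwind n \<in> linear_maps (PA n) (VU n)"
  unfolding unwind_def using tpow_ext_lin[OF vspace_A _ word_hom_multilin lin_id] by simp

lemma unwind_cls: "\<lbrakk>set as \<subseteq> carrier A; length as = Suc n\<rbrakk> \<Longrightarrow> unwind n (cls (PA n) as) = word_hom n 0 as"
  unfolding unwind_def by (rule tpow_ext_cls[OF vspace_A _ word_hom_multilin]) simp_all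

lemma unwind_closed [simp]: "t \<in> carrier (PA n) \<Longrightarrow> unwind n t \<in> carrier (VU n)"
  by (rule lin_closed[OF unwind_lin])

lemma word_hom_ones: "k + m \<le> Suc n \<Longrightarrow> word_hom n k (replicate m \<one>\<^bsub>A\<^esub>) = \<one>\<^bsub>VU n\<^esub>"
  by (induction m arbitrary: k) (simp_all add: slot_hom_one)

lemma unwind_slot0: "m \<in> carrier A \<Longrightarrow> unwind n (sl n 0 m) = cls (VU n) (\<one>\<^bsub>tensor_power U n\<^esub>, m)"
  unfolding slot_def by (subst unwind_cls) (auto simp: word_hom_ones slot_hom_0)

text \<open>The letter \<open>x\<close> appears between the images of \<open>a\<^sub>i\<close> and \<open>a\<^sub>i\<^sub>+\<^sub>1\<close> in both terms of the slide, once as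
  \<open>gen_hom n (Suc i) x\<close> and once as \<open>gen_hom n i x\<close>; their difference lies in slot \<open>i\<close> and commutes with
  everything to its left.\<close>

lemma unwind_slide:
  assumes i: "i < n" and t: "t \<in> carrier (PA n)"
  shows "unwind n (slide n i x t) = cls (VU n) (slot U n i (j x), \<one>\<^bsub>A\<^esub>) \<otimes>\<^bsub>VU n\<^esub> unwind n t" (is "_ = ?s \<otimes>\<^bsub>VU n\<^esub> _")
proof (rule tpow_lin_eq[OF vspace_A, of "VU n", OF _ _ _ _ t])
  show "(\<lambda>t. unwind n (slide n i x t)) \<in> linear_maps (PA n) (VU n)"
    using i by (intro lin_comp[OF unwind_lin] slide_lin) simp
  show "(\<lambda>t. ?s \<otimes>\<^bsub>VU n\<^esub> unwind n t) \<in> linear_maps (PA n) (VU n)"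
    by (intro alg_lin_left unwind_lin) simp_all
  fix as assume as: "set as \<subseteq> carrier A" "length as = Suc n"
  define us a b vs where "us = take i as" and "a = as ! i" and "b = as ! Suc i" and "vs = drop (Suc (Suc i)) as"
  have e: "as = us @ a # b # vs"
    using as i by (simp add: us_def a_def b_def vs_def Cons_nth_drop_Suc id_take_nth_drop)
  have l: "length us = i" "Suc (Suc i) + length vs = Suc n" using as i by (simp_all add: us_def vs_def)
  have cl: "set us \<subseteq> carrier A" "a \<in> carrier A" "b \<in> carrier A" "set vs \<subseteq> carrier A" using as(1) unfolding e by auto
  define p q where "p = word_hom n 0 us" and "q = slot_hom n (Suc i) b \<otimes>\<^bsub>VU n\<^esub> word_hom n (Suc (Suc i)) vs"
  have pq: "p \<in> carrier (VU n)" "q \<in> carrier (VU n)" "slot_hom n i a \<in> carrier (VU n)" "gen_hom n i x \<in> carrier (VU n)" "?s \<in> carrier (VU n)"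
    using cl l i by (simp_all add: p_def q_def)
  have P: "word_hom n 0 (us @ a # b # vs) = p \<otimes>\<^bsub>VU n\<^esub> (slot_hom n i a \<otimes>\<^bsub>VU n\<^esub> q)"
    using cl l by (simp add: word_hom_append p_def q_def)
  have "sl n (Suc i) (\<iota> x) \<otimes>\<^bsub>PA n\<^esub> cls (PA n) as = cls (PA n) (us @ a # (\<iota> x \<otimes>\<^bsub>A\<^esub> b) # vs)"
    using slot_mult_cls(1)[OF alg_A _ as, of "\<iota> x" "Suc i"] i l unfolding e by (simp add: list_update_append nth_append)
  moreover have "word_hom n 0 (us @ a # (\<iota> x \<otimes>\<^bsub>A\<^esub> b) # vs) = p \<otimes>\<^bsub>VU n\<^esub> (slot_hom n i a \<otimes>\<^bsub>VU n\<^esub> (gen_hom n (Suc i) x \<otimes>\<^bsub>VU n\<^esub> q))"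
    using cl l i by (simp add: word_hom_append p_def q_def slot_hom_\<iota>_mult alg_assoc)
  ultimately have 1: "unwind n (sl n (Suc i) (\<iota> x) \<otimes>\<^bsub>PA n\<^esub> cls (PA n) as) = p \<otimes>\<^bsub>VU n\<^esub> (slot_hom n i a \<otimes>\<^bsub>VU n\<^esub> (gen_hom n (Suc i) x \<otimes>\<^bsub>VU n\<^esub> q))"
    using cl l by (simp add: unwind_cls)
  have "cls (PA n) as \<otimes>\<^bsub>PA n\<^esub> sl n i (\<iota> x) = cls (PA n) (us @ (a \<otimes>\<^bsub>A\<^esub> \<iota> x) # b # vs)"
    using slot_mult_cls(2)[OF alg_A _ as, of "\<iota> x" i] i l unfolding e by (simp add: list_update_append nth_append)
  moreover have "word_hom n 0 (us @ (a \<otimes>\<^bsub>A\<^esub> \<iota> x) # b # vs) = p \<otimes>\<^bsub>VU n\<^esub> (slot_hom n i a \<otimes>\<^bsub>VU n\<^esub> (gen_hom n i x \<otimes>\<^bsub>VU n\<^esub> q))"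
    using cl l i pq by (simp add: word_hom_append p_def[symmetric] q_def[symmetric] slot_hom_mult_\<iota> alg_assoc)
  ultimately have 2: "unwind n (cls (PA n) as \<otimes>\<^bsub>PA n\<^esub> sl n i (\<iota> x)) = p \<otimes>\<^bsub>VU n\<^esub> (slot_hom n i a \<otimes>\<^bsub>VU n\<^esub> (gen_hom n i x \<otimes>\<^bsub>VU n\<^esub> q))"
    using cl l by (simp add: unwind_cls)
  have gen_hom: "gen_hom n (Suc i) x = ?s \<oplus>\<^bsub>VU n\<^esub> gen_hom n i x"
    by (simp add: gen_hom_def tens_add_left vs_ac)
  have t: "cls (PA n) as \<in> carrier (PA n)" using as by (simp add: tpow_closed)
  have "unwind n (slide n i x (cls (PA n) as)) = p \<otimes>\<^bsub>VU n\<^esub> (slot_hom n i a \<otimes>\<^bsub>VU n\<^esub> (?s \<otimes>\<^bsub>VU n\<^esub> q))"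
    using t i pq lin_diff[OF unwind_lin, of n] by (simp add: slide_def 1 2) (simp add: gen_hom alg_l_distr alg_r_distr vs_diff_def vs_ac)
  also have "\<dots> = p \<otimes>\<^bsub>VU n\<^esub> (?s \<otimes>\<^bsub>VU n\<^esub> (slot_hom n i a \<otimes>\<^bsub>VU n\<^esub> q))"
    using slot_hom_commute[of i n i "j x" a] pq cl i by (simp flip: alg_assoc)
  also have "\<dots> = ?s \<otimes>\<^bsub>VU n\<^esub> (p \<otimes>\<^bsub>VU n\<^esub> (slot_hom n i a \<otimes>\<^bsub>VU n\<^esub> q))"
    using word_hom_commute[of i n "j x" us 0] pq cl l i by (simp add: p_def[symmetric] flip: alg_assoc)
  finally show "unwind n (slide n i x (cls (PA n) as)) = ?s \<otimes>\<^bsub>VU n\<^esub> unwind n (cls (PA n) as)"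
    using as by (simp add: unwind_cls P[folded e])
qed simp

lemma unwind_slact:
  assumes i: "i < n" and t: "t \<in> carrier (PA n)" and h: "h \<in> carrier U"
  shows "unwind n (slact n i h t) = cls (VU n) (slot U n i h, \<one>\<^bsub>A\<^esub>) \<otimes>\<^bsub>VU n\<^esub> unwind n t"
proof (rule E.A_lin_eq[OF _ _ _ _ _ h, of "VU n"])
  show "(\<lambda>h. unwind n (slact n i h t)) \<in> linear_maps U (VU n)"
    using i t by (intro lin_comp[OF unwind_lin] slact_lin) simp_all
  show "(\<lambda>h. cls (VU n) (slot U n i h, \<one>\<^bsub>A\<^esub>) \<otimes>\<^bsub>VU n\<^esub> unwind n t) \<in> linear_maps U (VU n)"
    using i t by (intro alg_lin_right tens_lin_left slot_lin[OF E.alg_A _ lin_id]) simp_all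
  show "unwind n (slact n i \<one>\<^bsub>U\<^esub> t) = cls (VU n) (slot U n i \<one>\<^bsub>U\<^esub>, \<one>\<^bsub>A\<^esub>) \<otimes>\<^bsub>VU n\<^esub> unwind n t"
    using i t tens_one[of "tensor_power U n" A, symmetric] by (simp add: slact_one slot_one[OF E.alg_A])
  fix x h assume h: "h \<in> carrier U"
    and IH: "unwind n (slact n i h t) = cls (VU n) (slot U n i h, \<one>\<^bsub>A\<^esub>) \<otimes>\<^bsub>VU n\<^esub> unwind n t"
  have "cls (VU n) (slot U n i (j x \<otimes>\<^bsub>U\<^esub> h), \<one>\<^bsub>A\<^esub>) = cls (VU n) (slot U n i (j x), \<one>\<^bsub>A\<^esub>) \<otimes>\<^bsub>VU n\<^esub> cls (VU n) (slot U n i h, \<one>\<^bsub>A\<^esub>)"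
    using i h by (simp add: tens_mult slot_mult_slot[OF E.alg_A])
  then show "unwind n (slact n i (j x \<otimes>\<^bsub>U\<^esub> h) t) = cls (VU n) (slot U n i (j x \<otimes>\<^bsub>U\<^esub> h), \<one>\<^bsub>A\<^esub>) \<otimes>\<^bsub>VU n\<^esub> unwind n t"
    using i t h IH by (simp add: slact_j_mult unwind_slide alg_assoc)
qed simp

lemma unwind_actl:
  assumes t: "t \<in> carrier (PA n)"
  shows "\<lbrakk>set hs \<subseteq> carrier U; k + length hs = n\<rbrakk> \<Longrightarrow> unwind n (actl n k hs t)
    = cls (VU n) (cls (tensor_power U n) (replicate k \<one>\<^bsub>U\<^esub> @ hs), \<one>\<^bsub>A\<^esub>) \<otimes>\<^bsub>VU n\<^esub> unwind n t"
proof (induction hs arbitrary: k)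
  case Nil
  have "cls (tensor_power U n) (replicate n \<one>\<^bsub>U\<^esub>) = \<one>\<^bsub>tensor_power U n\<^esub>" by (simp add: tpow_one[OF E.alg_A])
  moreover have "cls (VU n) (\<one>\<^bsub>tensor_power U n\<^esub>, \<one>\<^bsub>A\<^esub>) = \<one>\<^bsub>VU n\<^esub>" by (simp add: tens_one)
  ultimately show ?case using Nil t by simp
next
  case (Cons h hs)
  have c: "cls (tensor_power U n) (replicate (Suc k) \<one>\<^bsub>U\<^esub> @ hs) \<in> carrier (tensor_power U n)"
    using Cons.prems by (intro tpow_closed) auto
  have "cls (VU n) (cls (tensor_power U n) (replicate k \<one>\<^bsub>U\<^esub> @ h # hs), \<one>\<^bsub>A\<^esub>)
     = cls (VU n) (slot U n k h, \<one>\<^bsub>A\<^esub>) \<otimes>\<^bsub>VU n\<^esub> cls (VU n) (cls (tensor_power U n) (replicate (Suc k) \<one>\<^bsub>U\<^esub> @ hs), \<one>\<^bsub>A\<^esub>)"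
    using Cons.prems c by (simp add: cls_as_slot tens_mult del: replicate_Suc)
  then show ?case using Cons t c by (simp add: unwind_slact alg_assoc del: replicate_Suc)
qed

lemma unwind_\<psi>_normal_form:
  assumes v: "v \<in> carrier (VU n)"
  shows "unwind n (\<psi> n (normal_form n v)) = v"
proof (rule tensor_lin_eq[of "tensor_power U n" A "VU n", OF _ _ _ _ _ _ v])
  show "(\<lambda>v. unwind n (\<psi> n (normal_form n v))) \<in> linear_maps (VU n) (VU n)"
    by (intro lin_comp[OF unwind_lin] lin_comp[OF \<psi>_lin] normal_form_lin)
  fix v m assume v: "v \<in> carrier (tensor_power U n)" and m: "m \<in> carrier A"
  show "unwind n (\<psi> n (normal_form n (cls (VU n) (v, m)))) = cls (VU n) (v, m)"
  proof (rule tpow_lin_eq[OF E.vspace_A, of "VU n", OF _ _ _ _ v])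
    show "(\<lambda>v. unwind n (\<psi> n (normal_form n (cls (VU n) (v, m))))) \<in> linear_maps (tensor_power U n) (VU n)"
      using m by (intro lin_comp[OF unwind_lin] lin_comp[OF \<psi>_lin] lin_comp[OF normal_form_lin] tens_lin_left lin_id) simp_all
    show "(\<lambda>v. cls (VU n) (v, m)) \<in> linear_maps (tensor_power U n) (VU n)"
      using m by (intro tens_lin_left lin_id) simp_all
    fix hs assume hs: "set hs \<subseteq> carrier U" "length hs = n"
    have "\<psi> n (normal_form n (cls (VU n) (cls (tensor_power U n) hs, m))) = actl n 0 hs (sl n 0 m)"
      using hs m by (simp add: normal_form_cls tpow_closed append_one_cls \<psi>_cls uact_cls actl_append slact_one)
    then show "unwind n (\<psi> n (normal_form n (cls (VU n) (cls (tensor_power U n) hs, m)))) = cls (VU n) (cls (tensor_power U n) hs, m)"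
      using hs m by (simp add: unwind_actl unwind_slot0 tens_mult tpow_closed)
  qed simp
qed (simp_all add: lin_id)

lemma \<psi>_bij: "bij_betw (\<psi> n) (carrier (W n)) (carrier (PA n))"
proof -
  have "inj_on (\<psi> n) (carrier (W n))"
  proof (rule inj_onI)
    fix w w' assume "w \<in> carrier (W n)" "w' \<in> carrier (W n)" and e: "\<psi> n w = \<psi> n w'"
    then obtain v v' where v: "v \<in> carrier (VU n)" "v' \<in> carrier (VU n)" and w: "w = normal_form n v" "w' = normal_form n v'"
      using normal_form_surj by blast
    have "v = unwind n (\<psi> n w)" "v' = unwind n (\<psi> n w')" unfolding w by (simp_all only: unwind_\<psi>_normal_form v)
    then have "v = v'" using e by (simp only:)
    then show "w = w'" using w by (simp only:)
  qed
  then show ?thesis using \<psi>_surj by (simp add: bij_betw_def)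
qed

end

section \<open>The comparison map is cyclic\<close>

lemma tpow_ext_via:
  assumes V: "vspace V" and P: "vspace P" "vspace P'" and \<theta>: "\<theta> \<in> linear_maps P P'" and H: "H \<in> linear_maps (tensor_power V n) P'"
    and F: "\<And>xs. \<lbrakk>set xs \<subseteq> carrier V; length xs = n\<rbrakk> \<Longrightarrow> F xs \<in> carrier P"
      "\<And>xs. \<lbrakk>set xs \<subseteq> carrier V; length xs = n\<rbrakk> \<Longrightarrow> \<theta> (F xs) = H (cls (tensor_power V n) xs)"
    and t: "t \<in> carrier (tensor_power V n)"
  shows "lin_ext P F t \<in> carrier P" "\<theta> (lin_ext P F t) = H t"
  using lin_ext_via[OF wt_sub[OF V tpow_carrier[OF V], of n] P \<theta>, folded tpow_wt[OF V], OF H _ _ t, of F] F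
  by (simp_all add: lists_eq_set)

context lie_two_cocycle
begin

text \<open>The structure maps of the cyclic object with coefficients are given on tensors
  \<open>(h\<^sup>0, \<dots>, h\<^sup>n) \<otimes> m\<close> and evaluated on representatives. Here they are identified, through the
  comparison map, with maps \<open>\<theta>\<close> of tensor powers; since the comparison map is injective, this also
  shows that they respect the balancing relations.\<close>

lemma crossed_ext_via:
  assumes F: "\<And>hs m. \<lbrakk>set hs \<subseteq> carrier U; length hs = Suc n; m \<in> carrier A\<rbrakk> \<Longrightarrow> F hs m \<in> carrier (W p)"
    and e: "\<And>hs m. \<lbrakk>set hs \<subseteq> carrier U; length hs = Suc n; m \<in> carrier A\<rbrakk> \<Longrightarrow> \<psi> p (F hs m) = \<theta> (actl n 0 hs (sl n 0 m))"
    and \<theta>: "\<theta> \<in> linear_maps (PA n) (PA p)" and w: "w \<in> carrier (W n)"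
  shows "crossed_ext (W p) F w \<in> carrier (W p)" "\<psi> p (crossed_ext (W p) F w) = \<theta> (\<psi> n w)"
proof -
  have u: "lin_ext (W p) (\<lambda>hs. F hs m) u \<in> carrier (W p)" "\<psi> p (lin_ext (W p) (\<lambda>hs. F hs m) u) = \<theta> (\<psi> n (cls (W n) (u, m)))"
    if u: "u \<in> carrier (PU n)" and m: "m \<in> carrier A" for u m
  proof -
    have H: "(\<lambda>u. \<theta> (uact n u (sl n 0 m))) \<in> linear_maps (PU n) (PA p)"
      using m by (intro lin_comp[OF \<theta>] uact_lin) simp
    have F2: "\<psi> p (F hs m) = \<theta> (uact n (cls (PU n) hs) (sl n 0 m))" if "set hs \<subseteq> carrier U" "length hs = Suc n" for hs
      using that m by (simp add: e uact_cls)
    show "lin_ext (W p) (\<lambda>hs. F hs m) u \<in> carrier (W p)"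
      by (rule tpow_ext_via(1)[OF E.vspace_A vspace_W vspace_PA \<psi>_lin H _ _ u]) (use F F2 m in simp_all)
    have "\<psi> p (lin_ext (W p) (\<lambda>hs. F hs m) u) = \<theta> (uact n u (sl n 0 m))"
      by (rule tpow_ext_via(2)[OF E.vspace_A vspace_W vspace_PA \<psi>_lin H _ _ u]) (use F F2 m in simp_all)
    then show "\<psi> p (lin_ext (W p) (\<lambda>hs. F hs m) u) = \<theta> (\<psi> n (cls (W n) (u, m)))" using u m by (simp add: \<psi>_cls)
  qed
  note H = lin_comp[OF \<theta> \<psi>_lin]
  show "crossed_ext (W p) F w \<in> carrier (W p)" unfolding crossed_ext_def
    by (rule bt_ext_via(1)[OF W_args, folded W_eq, OF vspace_W vspace_PA \<psi>_lin H _ _ w]) (rule u; assumption)+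
  show "\<psi> p (crossed_ext (W p) F w) = \<theta> (\<psi> n w)" unfolding crossed_ext_def
    by (rule bt_ext_via(2)[OF W_args, folded W_eq, OF vspace_W vspace_PA \<psi>_lin H _ _ w]) (rule u; assumption)+
qed

subsection \<open>Faces\<close>

abbreviation "fc p i \<equiv> aface A (Suc p) i"

context
  fixes p i :: nat assumes i: "i \<le> Suc p"
begin

lemma fc_lin: "fc p i \<in> linear_maps (PA (Suc p)) (PA p)"
  by (rule aface_lin[OF alg_A _ i]) simp

lemma fc_closed [simp]: "t \<in> carrier (PA (Suc p)) \<Longrightarrow> fc p i t \<in> carrier (PA p)"
  by (rule lin_closed[OF fc_lin])

text \<open>Merging two slots puts the two ends between which the letter slides at the same place.\<close>

lemma fc_slide_eq:
  assumes t: "t \<in> carrier (PA (Suc p))"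
  shows "fc p i (slide (Suc p) i x t) = \<zero>\<^bsub>PA p\<^esub>"
  using t aface_slot(3)[OF alg_A _ i, of "\<iota> x" t]
  by (simp add: slide_def lin_diff[OF fc_lin])

lemma fc_slide_neq:
  assumes k: "k \<le> Suc p" "k \<noteq> i" and t: "t \<in> carrier (PA (Suc p))"
  shows "fc p i (slide (Suc p) k x t) = slide p (if k < i then k else k - 1) x (fc p i t)"
proof -
  have 1: "merge (Suc p) i k = (if k < i then k else k - 1)"
    "merge (Suc p) i (Suc k mod Suc (Suc p)) = Suc (if k < i then k else k - 1) mod Suc p"
    using k i by (auto simp: merge_def mod_Suc)
  have ne: "Suc k mod Suc (Suc p) \<noteq> Suc i mod Suc (Suc p)" using next_slot_neq[of k "Suc p" i] k i by simp
  have le: "Suc k mod Suc (Suc p) \<le> Suc p" using mod_less_divisor[of "Suc (Suc p)" "Suc k"] by linarith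
  show ?thesis
    unfolding slide_def
    using aface_slot(1)[OF alg_A _ i _ t le ne, of "\<iota> x"] aface_slot(2)[OF alg_A _ i _ t k, of "\<iota> x"] t
    by (simp add: lin_diff[OF fc_lin] 1)
qed

lemma fc_slact_eq:
  assumes t: "t \<in> carrier (PA (Suc p))" and h: "h \<in> carrier U"
  shows "fc p i (slact (Suc p) i h t) = \<epsilon> h \<odot>\<^bsub>PA p\<^esub> fc p i t"
proof (rule E.A_lin_eq[OF _ _ _ _ _ h, of "PA p"])
  show "(\<lambda>h. fc p i (slact (Suc p) i h t)) \<in> linear_maps U (PA p)"
    by (intro lin_comp[OF fc_lin] slact_lin i t)
  show "(\<lambda>h. \<epsilon> h \<odot>\<^bsub>PA p\<^esub> fc p i t) \<in> linear_maps U (PA p)"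
    using t by (intro lin_scalar_map \<epsilon>_lin) simp_all
qed (use t i in \<open>simp_all add: slact_one \<epsilon>_one slact_j_mult \<epsilon>_j_mult fc_slide_eq\<close>)

lemma fc_slact_neq:
  assumes k: "k \<le> Suc p" "k \<noteq> i" and t: "t \<in> carrier (PA (Suc p))" and h: "h \<in> carrier U"
  shows "fc p i (slact (Suc p) k h t) = slact p (if k < i then k else k - 1) h (fc p i t)"
proof -
  have k': "(if k < i then k else k - 1) \<le> p" using k i by auto
  show ?thesis
    unfolding slact_def
    by (rule E.eact_intertwine[OF lierep_slide[OF k(1)] lierep_slide[OF k'] fc_lin _ h t]) (rule fc_slide_neq[OF k])
qed

lemma fc_actl_low:
  "\<lbrakk>set us \<subseteq> carrier U; k + length us \<le> i; t \<in> carrier (PA (Suc p))\<rbrakk> \<Longrightarrow> fc p i (actl (Suc p) k us t) = actl p k us (fc p i t)"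
  using i by (induction us arbitrary: k) (simp_all add: fc_slact_neq)

lemma fc_actl_high:
  "\<lbrakk>set us \<subseteq> carrier U; i \<le> k; k + length us \<le> Suc p; t \<in> carrier (PA (Suc p))\<rbrakk> \<Longrightarrow>
    fc p i (actl (Suc p) (Suc k) us t) = actl p k us (fc p i t)"
  using i by (induction us arbitrary: k) (simp_all add: fc_slact_neq)

lemma fc_slot0:
  assumes m: "m \<in> carrier A"
  shows "fc p i (sl (Suc p) 0 m) = sl p 0 m"
proof -
  have "face_list A (Suc p) i (replicate (Suc (Suc p)) \<one>\<^bsub>A\<^esub>) = replicate (Suc p) \<one>\<^bsub>A\<^esub>"
  proof (rule nth_equalityI)
    fix k assume "k < length (face_list A (Suc p) i (replicate (Suc (Suc p)) \<one>\<^bsub>A\<^esub>))"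
    then have k: "k < Suc p" using i by (simp add: face_list_length del: replicate_Suc)
    show "face_list A (Suc p) i (replicate (Suc (Suc p)) \<one>\<^bsub>A\<^esub>) ! k = replicate (Suc p) \<one>\<^bsub>A\<^esub> ! k"
      using k i by (subst face_list_nth) (simp_all del: replicate_Suc)
  qed (use i in \<open>simp add: face_list_length del: replicate_Suc\<close>)
  then have one: "fc p i \<one>\<^bsub>PA (Suc p)\<^esub> = \<one>\<^bsub>PA p\<^esub>"
    unfolding tpow_one[OF alg_A] using i by (subst aface_cls[OF alg_A]) (simp_all add: set_replicate_conv_if del: replicate_Suc)
  have m0: "merge (Suc p) i 0 = 0" by (simp add: merge_def)
  show ?thesis
  proof (cases "i = 0")
    case True
    then show ?thesis
      using aface_slot(1)[OF alg_A _ i m, of "\<one>\<^bsub>PA (Suc p)\<^esub>" 0] m True by (simp add: m0[unfolded True] one[unfolded True])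
  next
    case False
    then show ?thesis
      using aface_slot(2)[OF alg_A _ i m, of "\<one>\<^bsub>PA (Suc p)\<^esub>" 0] m by (simp add: m0 one)
  qed
qed

text \<open>The face with index \<open>i\<close> turns the factor \<open>i\<close>, which acts by slides between the merged slots, into
  its counit. The other factors act as before, after renumbering.\<close>

lemma fc_actl:
  assumes hs: "set hs \<subseteq> carrier U" "length hs = Suc (Suc p)" and m: "m \<in> carrier A"
  shows "fc p i (actl (Suc p) 0 hs (sl (Suc p) 0 m)) = \<epsilon> (hs ! i) \<odot>\<^bsub>PA p\<^esub> actl p 0 (take i hs @ drop (Suc i) hs) (sl p 0 m)"
proof -
  define us h vs where "us = take i hs" and "h = hs ! i" and "vs = drop (Suc i) hs"
  have e: "hs = us @ h # vs" using hs i by (simp add: us_def h_def vs_def id_take_nth_drop)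
  have l: "length us = i" "i + length vs = Suc p" using hs i by (simp_all add: us_def vs_def)
  have cl: "set us \<subseteq> carrier U" "h \<in> carrier U" "set vs \<subseteq> carrier U" using hs(1) unfolding e by auto
  have "fc p i (actl (Suc p) 0 (us @ h # vs) (sl (Suc p) 0 m)) = actl p 0 us (\<epsilon> h \<odot>\<^bsub>PA p\<^esub> actl p i vs (sl p 0 m))"
    using l cl m i by (simp add: actl_append fc_actl_low fc_slact_eq fc_actl_high fc_slot0)
  also have "\<dots> = \<epsilon> h \<odot>\<^bsub>PA p\<^esub> actl p 0 (us @ vs) (sl p 0 m)"
    using l cl m by (simp add: actl_append lin_smult[OF actl_lin])
  finally show ?thesis unfolding e[symmetric] unfolding us_def h_def vs_def .
qed

end

subsection \<open>The cyclic operator\<close>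

abbreviation "cyA n \<equiv> acyc A n"

lemma cyA_lin: "cyA n \<in> linear_maps (PA n) (PA n)"
  by (rule acyc_lin[OF alg_A])

lemma next_le: "Suc k mod Suc n \<le> n"
  using mod_less_divisor[of "Suc n" "Suc k"] by linarith

lemma cyA_slact:
  assumes k: "k \<le> n" and t: "t \<in> carrier (PA n)" and h: "h \<in> carrier U"
  shows "cyA n (slact n k h t) = slact n (Suc k mod Suc n) h (cyA n t)"
  unfolding slact_def
proof (rule E.eact_intertwine[OF lierep_slide[OF k] lierep_slide[OF next_le] cyA_lin _ h t])
  fix x t assume t: "t \<in> carrier (PA n)"
  show "cyA n (slide n k x t) = slide n (Suc k mod Suc n) x (cyA n t)"
    unfolding slide_def
    using acyc_slot(1)[OF alg_A _ t next_le, of "\<iota> x" k] acyc_slot(2)[OF alg_A _ t k, of "\<iota> x"] t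
    by (simp add: lin_diff[OF cyA_lin])
qed

lemma cyA_actl:
  "\<lbrakk>set hs \<subseteq> carrier U; k + length hs \<le> n; t \<in> carrier (PA n)\<rbrakk> \<Longrightarrow> cyA n (actl n k hs t) = actl n (Suc k) hs (cyA n t)"
  by (induction hs arbitrary: k) (simp_all add: cyA_slact)

lemma cyA_slot0:
  assumes m: "m \<in> carrier A"
  shows "cyA n (sl n 0 m) = sl n (Suc 0 mod Suc n) m"
proof -
  have "rot (replicate (Suc n) \<one>\<^bsub>A\<^esub>) = replicate (Suc n) \<one>\<^bsub>A\<^esub>"
    by (simp add: rot_def last_replicate butlast_conv_take del: replicate_Suc) simp
  then have "cyA n \<one>\<^bsub>PA n\<^esub> = \<one>\<^bsub>PA n\<^esub>"
    unfolding tpow_one[OF alg_A] by (subst acyc_cls[OF alg_A]) (simp_all add: set_replicate_conv_if del: replicate_Suc)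
  then show ?thesis using acyc_slot(1)[OF alg_A m, of "\<one>\<^bsub>PA n\<^esub>" n 0] m by simp
qed

text \<open>An element in slot \<open>1\<close> (or in the only slot, if \<open>n = 0\<close>) is obtained from elements in slot \<open>0\<close> by
  slides. This is what brings the coaction into the formula for the cyclic operator.\<close>

lemma slot_coaction:
  assumes m: "m \<in> carrier A"
  shows "lin_ext (PA n) (\<lambda>(m0, m1). slact n 0 m1 (sl n 0 m0)) (\<rho> m) = sl n (Suc 0 mod Suc n) m"
  unfolding slact_def
proof (rule coaction_conjugation[where R = "\<lambda>a. sl n 0 a", OF _ _ _ _ _ _ _ lierep_slide _ m])
  show "sl n (Suc 0 mod Suc n) (\<iota> x \<otimes>\<^bsub>A\<^esub> a) = sl n (Suc 0 mod Suc n) (\<iota> x) \<otimes>\<^bsub>PA n\<^esub> sl n (Suc 0 mod Suc n) a"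
    "sl n 0 (\<iota> x \<otimes>\<^bsub>A\<^esub> a) = sl n 0 (\<iota> x) \<otimes>\<^bsub>PA n\<^esub> sl n 0 a" if "a \<in> carrier A" for x a
    using that by (simp_all add: slot_mult_slot[OF alg_A])
qed (simp_all add: sl_lin next_le slot_one[OF alg_A] slide_def)

text \<open>Rotation turns slides at one tensor sign into slides at the next and moves \<open>m\<close> from slot \<open>0\<close> to the
  next one, from where \<open>slot_coaction\<close> brings it back at the cost of a factor \<open>m1\<close> in the first entry.\<close>

lemma \<psi>_cyc:
  assumes w: "w \<in> carrier (W n)"
  defines "F \<equiv> \<lambda>hs m. lin_ext (W n) (\<lambda>(m0, m1). cls (W n) (cls (PU n) ((last hs \<otimes>\<^bsub>U\<^esub> m1) # butlast hs), m0)) (\<rho> m)"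
  shows "crossed_ext (W n) F w \<in> carrier (W n)" "\<psi> n (crossed_ext (W n) F w) = cyA n (\<psi> n w)"
proof -
  have F: "F hs m \<in> carrier (W n)" "\<psi> n (F hs m) = cyA n (actl n 0 hs (sl n 0 m))"
    if hs: "set hs \<subseteq> carrier U" "length hs = Suc n" and m: "m \<in> carrier A" for hs m
  proof -
    obtain bs h where e: "hs = bs @ [h]" "length bs = n" using hs(2) by (metis length_Suc_conv_rev)
    have cl: "set bs \<subseteq> carrier U" "h \<in> carrier U" using hs(1) unfolding e by auto
    have "(\<lambda>q. cls (PU n) ((\<one>\<^bsub>U\<^esub> # bs)[0 := h \<otimes>\<^bsub>U\<^esub> q])) \<in> linear_maps U (PU n)"
      using cl e by (intro tpow_cls_lin alg_lin_left lin_id) simp_all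
    then have L: "(\<lambda>q. cls (PU n) ((h \<otimes>\<^bsub>U\<^esub> q) # bs)) \<in> linear_maps U (PU n)" by simp
    have b: "bilin A U (W n) (\<lambda>m0 m1. cls (W n) (cls (PU n) ((h \<otimes>\<^bsub>U\<^esub> m1) # bs), m0))"
      by (intro bilinI W_lin_left W_lin_right L lin_id lin_closed[OF L])
    have b': "bilin A U (PA n) (\<lambda>m0 m1. slact n 0 m1 (sl n 0 m0))"
      by (intro bilinI slact_lin lin_comp[OF slact_lin_right] sl_lin) simp_all
    define G where "G = lin_ext (W n) (\<lambda>(m0, m1). cls (W n) (cls (PU n) ((h \<otimes>\<^bsub>U\<^esub> m1) # bs), m0))"
    have G: "G \<in> linear_maps AU (W n)"
      unfolding G_def using tensor_ext_lin[of A U "W n", OF _ _ _ b lin_id] by simp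
    have Gt: "G (cls AU (m0, m1)) = cls (W n) (cls (PU n) ((h \<otimes>\<^bsub>U\<^esub> m1) # bs), m0)" if "m0 \<in> carrier A" "m1 \<in> carrier U" for m0 m1
      unfolding G_def using tensor_ext_cls[of A U "W n", OF _ _ _ b that] by simp
    define Q where "Q = lin_ext (PA n) (\<lambda>(m0, m1). slact n 0 m1 (sl n 0 m0))"
    have Q: "Q \<in> linear_maps AU (PA n)"
      unfolding Q_def using tensor_ext_lin[of A U "PA n", OF _ _ _ b' lin_id] by simp
    have Qt: "Q (cls AU (m0, m1)) = slact n 0 m1 (sl n 0 m0)" if "m0 \<in> carrier A" "m1 \<in> carrier U" for m0 m1
      unfolding Q_def using tensor_ext_cls[of A U "PA n", OF _ _ _ b' that] by simp
    have "\<psi> n (G r) = slact n 0 h (actl n (Suc 0) bs (Q r))" if r: "r \<in> carrier AU" for r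
    proof (rule tensor_lin_eq[of A U "PA n", OF _ _ _ _ _ _ r])
      show "(\<lambda>r. \<psi> n (G r)) \<in> linear_maps AU (PA n)" by (rule lin_comp[OF \<psi>_lin G])
      show "(\<lambda>r. slact n 0 h (actl n (Suc 0) bs (Q r))) \<in> linear_maps AU (PA n)"
        using cl e by (intro lin_comp[OF slact_lin_right] lin_comp[OF actl_lin] Q) simp_all
      fix m0 m1 assume m: "m0 \<in> carrier A" "m1 \<in> carrier U"
      have "cls (PU n) ((h \<otimes>\<^bsub>U\<^esub> m1) # bs) \<in> carrier (PU n)" using lin_closed[OF L m(2)] .
      then have "\<psi> n (G (cls AU (m0, m1))) = actl n 0 ((h \<otimes>\<^bsub>U\<^esub> m1) # bs) (sl n 0 m0)"
        using m cl e by (simp add: Gt \<psi>_cls uact_cls del: actl.simps)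
      then show "\<psi> n (G (cls AU (m0, m1))) = slact n 0 h (actl n (Suc 0) bs (Q (cls AU (m0, m1))))"
        using m cl e actl_slact_commute[of bs "Suc 0" n 0 m1 "sl n 0 m0"] by (simp add: slact_mult Qt)
    qed simp_all
    then have 1: "\<psi> n (G (\<rho> m)) = slact n 0 h (actl n (Suc 0) bs (sl n (Suc 0 mod Suc n) m))"
      using m slot_coaction[OF m, of n] by (simp add: Q_def)
    have "cyA n (actl n 0 hs (sl n 0 m)) = actl n (Suc 0) bs (slact n 0 h (sl n (Suc 0 mod Suc n) m))"
      using cl m e by (simp add: actl_append cyA_actl cyA_slact cyA_slot0)
    also have "\<dots> = slact n 0 h (actl n (Suc 0) bs (sl n (Suc 0 mod Suc n) m))"
      using cl m e by (intro actl_slact_commute) simp_all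
    finally have 2: "\<psi> n (G (\<rho> m)) = cyA n (actl n 0 hs (sl n 0 m))" using 1 by simp
    have "F hs m = G (\<rho> m)" by (simp add: F_def G_def e)
    then show "F hs m \<in> carrier (W n)" "\<psi> n (F hs m) = cyA n (actl n 0 hs (sl n 0 m))"
      using 2 lin_closed[OF G] m by simp_all
  qed
  show "crossed_ext (W n) F w \<in> carrier (W n)"
    by (rule crossed_ext_via(1)[OF _ _ cyA_lin w]) (rule F; assumption)+
  show "\<psi> n (crossed_ext (W n) F w) = cyA n (\<psi> n w)"
    by (rule crossed_ext_via(2)[OF _ _ cyA_lin w]) (rule F; assumption)+
qed

lemma \<psi>_face:
  assumes i: "i \<le> Suc p" and w: "w \<in> carrier (W (Suc p))"
  defines "F \<equiv> \<lambda>hs m. \<epsilon> (hs ! i) \<odot>\<^bsub>W p\<^esub> cls (W p) (cls (PU p) (take i hs @ drop (Suc i) hs), m)"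
  shows "crossed_ext (W p) F w \<in> carrier (W p)" "\<psi> p (crossed_ext (W p) F w) = fc p i (\<psi> (Suc p) w)"
proof -
  have F: "F hs m \<in> carrier (W p)" "\<psi> p (F hs m) = fc p i (actl (Suc p) 0 hs (sl (Suc p) 0 m))"
    if hs: "set hs \<subseteq> carrier U" "length hs = Suc (Suc p)" and m: "m \<in> carrier A" for hs m
  proof -
    have s: "set (take i hs @ drop (Suc i) hs) \<subseteq> carrier U" "length (take i hs @ drop (Suc i) hs) = Suc p"
      using hs i set_take_subset[of i hs] set_drop_subset[of "Suc i" hs] by auto
    then have c: "cls (PU p) (take i hs @ drop (Suc i) hs) \<in> carrier (PU p)" by (intro tpow_closed) simp_all
    then show "F hs m \<in> carrier (W p)" using m by (simp add: F_def)
    show "\<psi> p (F hs m) = fc p i (actl (Suc p) 0 hs (sl (Suc p) 0 m))"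
      using c m by (simp add: F_def lin_smult[OF \<psi>_lin] \<psi>_cls uact_cls[OF _ s] fc_actl[OF i hs m])
  qed
  show "crossed_ext (W p) F w \<in> carrier (W p)"
    by (rule crossed_ext_via(1)[OF _ _ fc_lin[OF i] w]) (rule F; assumption)+
  show "\<psi> p (crossed_ext (W p) F w) = fc p i (\<psi> (Suc p) w)"
    by (rule crossed_ext_via(2)[OF _ _ fc_lin[OF i] w]) (rule F; assumption)+
qed

abbreviation "Zc \<equiv> crossed_cyclic_object U' A act \<rho>"

lemma Zc_simps:
  "obj Zc n = W n"
  "face Zc (Suc p) i = crossed_ext (W p) (\<lambda>hs m. \<epsilon> (hs ! i) \<odot>\<^bsub>W p\<^esub> cls (W p) (cls (PU p) (take i hs @ drop (Suc i) hs), m))"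
  "cyc Zc n = crossed_ext (W n) (\<lambda>hs m. lin_ext (W n) (\<lambda>(m0, m1). cls (W n) (cls (PU n) ((last hs \<otimes>\<^bsub>U\<^esub> m1) # butlast hs), m0)) (\<rho> m))"
  by (simp_all add: crossed_cyclic_object_def crossed_gen_def)

lemma cyclic_iso_crossed: "cyclic_iso Zc (algebra_cyclic_object A) \<psi>"
proof (rule cyclic_iso.intro, goal_cases)
  case (5 n i z)
  then obtain p where "n = Suc p" by (cases n) auto
  then show ?case using 5 \<psi>_face[of i p z] by (simp add: Zc_simps)
next
  case (6 n i z)
  then obtain p where "n = Suc p" by (cases n) auto
  then show ?case using 6 \<psi>_face[of i p z] by (simp add: Zc_simps algebra_cyclic_object_eq[OF alg_A])
qed (simp_all add: Zc_simps algebra_cyclic_object_eq[OF alg_A] \<psi>_lin \<psi>_bij \<psi>_cyc)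

end

section \<open>Cyclic homology of twisted enveloping algebras\<close>

theorem proposition6p5:
  fixes scale :: "'k::field \<Rightarrow> 'g::ab_group_add \<Rightarrow> 'g"
    and br :: "'g \<Rightarrow> 'g \<Rightarrow> 'g"
    and f :: "'g \<Rightarrow> 'g \<Rightarrow> 'k"
  assumes "lie_two_cocycle scale br f"
  shows "let A = twisted_env scale br f; \<iota> = twisted_incl scale br f;
             U = env_hopf scale br; j = env_incl scale br;
             \<rho> = twisted_coaction scale br f; act = twisted_action scale br f
         in galois_extension U A ((\<lambda>c. c \<odot>\<^bsub>A\<^esub> \<one>\<^bsub>A\<^esub>) ` UNIV) \<rho> \<and> inj (\<lambda>c. c \<odot>\<^bsub>A\<^esub> \<one>\<^bsub>A\<^esub>) \<and>
            (\<forall>x. \<forall>a\<in>carrier A. act (j x) a = (\<iota> x \<otimes>\<^bsub>A\<^esub> a) \<ominus>\<^bsub>A\<^esub> (a \<otimes>\<^bsub>A\<^esub> \<iota> x)) \<and>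
            (\<forall>x. \<rho> (\<iota> x) = cls (tensor A U) (\<iota> x, \<one>\<^bsub>U\<^esub>) \<oplus>\<^bsub>tensor A U\<^esub> cls (tensor A U) (\<one>\<^bsub>A\<^esub>, j x)) \<and>
            modular_crossed_module U A act \<rho> \<and>
            (\<forall>n. linear_iso (cyclic_homology (algebra_cyclic_object A) n)
                             (cyclic_homology (crossed_cyclic_object U A act \<rho>) n))"
proof -
  interpret lie_two_cocycle scale br f by (rule assms)
  have "linear_iso (cyclic_homology (algebra_cyclic_object A) n) (cyclic_homology Zc n)" for n
    by (rule cyclic_iso.cyclic_homology_iso[OF cyclic_iso.cyclic_iso_inverse[OF cyclic_iso_crossed]])
  then show ?thesis
    using galois inj_scalars modular_crossed
    unfolding Let_def by (simp add: act_j ad_def \<rho>_\<iota> d_def)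
qed

end
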